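(* Let $(\boldsymbol{u},p,p_\Gamma)\in Q\times U\times V_\Gamma$ be the weak solution of the coupled bulk-fracture problem (W), let $(\boldsymbol{u}_h,p_h,p_{\Gamma,h})\in \boldsymbol{V}_h\times S_h\times W_h$ be the solution of the staggered DG scheme (D), let $f_h$ be the piecewise polynomial approximation of $f$ and $f_{\Gamma,h}$ the piecewise polynomial approximation of $f_\Gamma$, and let $\eta$ be the error estimator defined in the context. Then, with a positive constant $C$ independent of the mesh size, $$\eta\le C\,\|(\boldsymbol{u}-\boldsymbol{u}_h,\;p-p_h,\;p_\Gamma-p_{\Gamma,h})\|_{sdg}+\mathrm{osc}(f,f_\Gamma),$$ where $\mathrm{osc}(f,f_\Gamma)$ is the data oscillation, defined by $$\mathrm{osc}(f,f_\Gamma)^2=\sum_{e\in\mathcal{F}_h^\Gamma}h_e^2\|\ell_\Gamma(f_{\Gamma,h}-f_\Gamma)\|_{0,e}^2+\sum_{\tau\in\mathcal{T}_h}h_\tau^2\|f-f_h\|_{0,\tau}^2 .$$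
   Context: **Model.** $\Omega\subset\mathbb{R}^2$ is crossed by a single fracture $\Gamma$ with boundary $\partial\Gamma$; $\Omega_B=\Omega\setminus\bar\Gamma=\Omega_{B,1}\cup\Omega_{B,2}$ (disjoint), $\partial\Omega_B=\bigcup_{i=1}^2\partial\Omega_{B,i}\setminus\bar\Gamma$. $\boldsymbol{n}_\Gamma$ is the unit normal on $\Gamma$ outward to $\Omega_{B,1}$. $K$ is a symmetric, isotropic, positive definite, piecewise constant $2\times2$ permeability tensor on $\Omega_B$. On $\Gamma$: the tangential permeability $\kappa_\Gamma^*$, the normal permeability $\kappa_\Gamma^n$ and the fracture thickness $\ell_\Gamma$ are piecewise constant, with positive constants such that $\kappa_1^*\le\kappa_\Gamma^*\le\kappa_2^*$, $\kappa_1^n\le\kappa_\Gamma^n\le\kappa_2^n$ a.e.; $K_\Gamma=\kappa_\Gamma^*\ell_\Gamma$, $\eta_\Gamma=\ell_\Gamma/\kappa_\Gamma^n$, $\alpha_\Gamma=\eta_\Gamma(\xi/2-1/4)$ with $\xi\in(1/2,1]$. Data: $f\in L^2(\Omega_B)$, $f_\Gamma\in L^2(\Gamma)$. $\nabla_t$, $\nabla_t\cdot$ are the tangential gradient and divergence on $\Gamma$. $(\cdot,\cdot)_D$, $\langle\cdot,\cdot\rangle_D$ are $L^2$ inner products on two- and one-dimensional sets, $\|\cdot\|_{0,D}$ is the $L^2(D)$ norm. The strong problem is $\boldsymbol{u}+K\nabla p=0$, $\nabla\cdot\boldsymbol{u}=f$ in $\Omega_B$, $p=0$ on $\partial\Omega_B$;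 $-\nabla_t\cdot(K_\Gamma\nabla_tp_\Gamma)=\ell_\Gamma f_\Gamma+[\boldsymbol{u}\cdot\boldsymbol{n}_\Gamma]$ in $\Gamma$, $p_\Gamma=0$ on $\partial\Gamma$; $\eta_\Gamma\{\boldsymbol{u}\cdot\boldsymbol{n}_\Gamma\}=[p]$ and $\alpha_\Gamma[\boldsymbol{u}\cdot\boldsymbol{n}_\Gamma]=\{p\}-p_\Gamma$ on $\Gamma$. **Spaces and weak form (W).** $Q=[L^2(\Omega_B)]^2$, $U=\{\psi\in H^1(\Omega_{B,1})\cap H^1(\Omega_{B,2}):\psi|_{\partial\Omega_B}=0\}$, $V_\Gamma=H^1_0(\Gamma)$, $V=U\times V_\Gamma$. Find $(\boldsymbol{u},p,p_\Gamma)\in Q\times U\times V_\Gamma$ with $(K^{-1}\boldsymbol{u},\boldsymbol{v})_{\Omega_B}+(\boldsymbol{v},\nabla p)_{\Omega_B}=0$ for all $\boldsymbol{v}\in Q$; $\sum_{e\in\mathcal{F}_h^\Gamma}\langle\frac1{\alpha_\Gamma}(\{p\}-p_\Gamma),\{q\}\rangle_e+\sum_{e\in\mathcal{F}_h^\Gamma}\langle\frac1{\eta_\Gamma}[p],[q]\rangle_e-(\boldsymbol{u},\nabla q)_{\Omega_B}=(f,q)_{\Omega_B}$ for all $q\in U$; $\langle K_\Gamma\nabla_tp_\Gamma,\nabla_tq_\Gamma\rangle_\Gamma-\sum_{e\in\mathcal{F}_h^\Gamma}\langle\frac1{\alpha_\Gamma}(\{p\}-p_\Gamma),q_\Gamma\rangle_e=\langle\ell_\Gamma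 f_\Gamma,q_\Gamma\rangle_\Gamma$ for all $q_\Gamma\in V_\Gamma$. **Meshes.** $\mathcal{T}_u$ is a mesh of polygons aligned with $\Gamma$ (no element is cut by $\Gamma$). $\mathcal{F}_u$: edges of $\mathcal{T}_u$ not on $\Gamma$; $\mathcal{F}_u^0$: those in $\mathcal{F}_u$ not on $\partial\Omega_B$; $\mathcal{F}_h^\Gamma$: the one-dimensional mesh of $\Gamma$; $\mathcal{N}_h^0(\Gamma)$: the set of interior vertices of $\mathcal{F}_h^\Gamma$. Each polygon is split into triangles by joining its center point $\nu$ to all its vertices (the polygon is denoted $S(\nu)$); $\mathcal{T}_h$ is the resulting triangulation and $\mathcal{F}_p$ the set of new edges; $\mathcal{F}=\mathcal{F}_u\cup\mathcal{F}_p$, $\mathcal{F}^0=\mathcal{F}_u^0\cup\mathcal{F}_p$. $h_\tau$, $h_e$ are the diameter of $\tau$ and the length of $e$; the mesh size is $h=\max_{\tau\in\mathcal{T}_h}h_\tau$. Mesh regularity: each $S(\nu)$ is star-shaped with respect to a ball of radius $\ge\rho_Sh_{S(\nu)}$, and each edge $e\subset\partial S(\nu)$ satisfies $h_e\ge\rho_Eh_{S(\nu)}$, where $h_{S(\nu)}$ is the diameter of $S(\nu)$ and $\rho_S,\rho_E$ are positive constants. A unit normal $\boldsymbol{n}$ is fixed on each edge (outward to $\Omega$ on $\partial\Omega_B$, $\boldsymbol{n}=\boldsymbol{n}_\Gamma$ on $\Gamma$). For $e\in\mathcal{F}^0\cup\mathcal{F}_h^\Gamma$ shared by $\tau_1,\tau_2\in\mathcal{T}_h$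 with $\boldsymbol{n}$ pointing from $\tau_1$ to $\tau_2$, and with subscripts $i$ denoting restrictions to $\tau_i$: $[q]=q_1-q_2$, $[\boldsymbol{v}\cdot\boldsymbol{n}]=\boldsymbol{v}_1\cdot\boldsymbol{n}-\boldsymbol{v}_2\cdot\boldsymbol{n}$, $\{q\}=(q_1+q_2)/2$, $\{\boldsymbol{v}\cdot\boldsymbol{n}\}=(\boldsymbol{v}_1\cdot\boldsymbol{n}+\boldsymbol{v}_2\cdot\boldsymbol{n})/2$; for $e\in\mathcal{F}\setminus\mathcal{F}^0$, $[q]=q_1$. **Discrete spaces and scheme (D).** With polynomial order $k\ge0$: $S_h=\{q:q|_\tau\in P^k(\tau)\ \forall\tau\in\mathcal{T}_h,\ [q]|_e=0\ \forall e\in\mathcal{F}_u^0,\ q|_{\partial\Omega_B}=0\}$; $\boldsymbol{V}_h=\{\boldsymbol{v}:\boldsymbol{v}|_\tau\in P^k(\tau)^2\ \forall\tau\in\mathcal{T}_h,\ [\boldsymbol{v}\cdot\boldsymbol{n}]|_e=0\ \forall e\in\mathcal{F}_p\}$; $W_h=\{q_\Gamma\in H^1_0(\Gamma):q_\Gamma|_e\in P^k(e)\ \forall e\in\mathcal{F}_h^\Gamma\}$, where $P^k$ denotes polynomials of degree at most $k$. Find $(\boldsymbol{u}_h,p_h,p_{\Gamma,h})\in\boldsymbol{V}_h\times S_h\times W_h$ with $(K^{-1}\boldsymbol{u}_h,\boldsymbol{v})_{\Omega_B}+b_h^*(p_h,\boldsymbol{v})=0$ for all $\boldsymbol{v}\in\boldsymbol{V}_h$;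 $-b_h(\boldsymbol{u}_h,q)+\sum_{e\in\mathcal{F}_h^\Gamma}\langle\frac1{\alpha_\Gamma}(\{p_h\}-p_{\Gamma,h}),\{q\}\rangle_e+\sum_{e\in\mathcal{F}_h^\Gamma}\langle\frac1{\eta_\Gamma}[p_h],[q]\rangle_e=(f,q)_{\Omega_B}$ for all $q\in S_h$; $\langle K_\Gamma\nabla_tp_{\Gamma,h},\nabla_tq_\Gamma\rangle_\Gamma-\sum_{e\in\mathcal{F}_h^\Gamma}\langle\frac1{\alpha_\Gamma}(\{p_h\}-p_{\Gamma,h}),q_\Gamma\rangle_e=\langle\ell_\Gamma f_\Gamma,q_\Gamma\rangle_\Gamma$ for all $q_\Gamma\in W_h$, where $b_h(\boldsymbol{v},q)=-\sum_{e\in\mathcal{F}_p}\langle\boldsymbol{v}\cdot\boldsymbol{n},[q]\rangle_e+\sum_{\tau\in\mathcal{T}_h}(\boldsymbol{v},\nabla q)_\tau$ and $b_h^*(q,\boldsymbol{v})=\sum_{e\in\mathcal{F}_u^0}\langle q,[\boldsymbol{v}\cdot\boldsymbol{n}]\rangle_e-\sum_{\tau\in\mathcal{T}_h}(q,\nabla\cdot\boldsymbol{v})_\tau+\sum_{e\in\mathcal{F}_h^\Gamma}\langle[q],\{\boldsymbol{v}\cdot\boldsymbol{n}\}\rangle_e+\sum_{e\in\mathcal{F}_h^\Gamma}\langle\{q\},[\boldsymbol{v}\cdot\boldsymbol{n}]\rangle_e$. **Norms** (gradients of piecewise functions are taken elementwise). $\|(q,q_\Gamma)\|_V^2=\sum_{e\in\mathcal{F}_h^\Gamma}\|\alpha_\Gamma^{-1/2}(\{q\}-q_\Gamma)\|_{0,e}^2+\sum_{e\in\mathcal{F}_h^\Gamma}\|\eta_\Gamma^{-1/2}[q]\|_{0,e}^2+\|K^{1/2}\nabla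 q\|_{0,\Omega_B}^2+\|K_\Gamma^{1/2}\nabla_tq_\Gamma\|_{0,\Gamma}^2$; $\|\boldsymbol{v}\|_Q=\|K^{-1/2}\boldsymbol{v}\|_{0,\Omega_B}$; $\|(\boldsymbol{v},q,q_\Gamma)\|_{sdg}^2=\|\boldsymbol{v}\|_Q^2+\|(q,q_\Gamma)\|_V^2+\|[\boldsymbol{v}\cdot\boldsymbol{n}_\Gamma]\|_{0,\Gamma}^2+\|\{\boldsymbol{v}\cdot\boldsymbol{n}_\Gamma\}\|_{0,\Gamma}^2$. **Estimator.** $$\begin{aligned}\eta={}&\Big(\sum_{\tau\in\mathcal{T}_h}\|K^{-1/2}\boldsymbol{u}_h+K^{1/2}\nabla p_h\|_{0,\tau}^2\Big)^{1/2}+\Big(\sum_{\tau\in\mathcal{T}_h}h_\tau^2\|f-\nabla\cdot\boldsymbol{u}_h\|_{0,\tau}^2\Big)^{1/2}+\Big(\sum_{e\in\mathcal{F}_p}h_e^{-1}\|[p_h]\|_{0,e}^2\Big)^{1/2}\\&+\Big(\sum_{e\in\mathcal{F}_u^0}h_e\|[\boldsymbol{u}_h\cdot\boldsymbol{n}]\|_{0,e}^2\Big)^{1/2}+\Big(\sum_{e\in\mathcal{F}_h^\Gamma}h_e^2\|\ell_\Gamma f_\Gamma+\nabla_t\cdot(K_\Gamma\nabla_tp_{\Gamma,h})+[\boldsymbol{u}_h\cdot\boldsymbol{n}_\Gamma]\|_{0,e}^2\Big)^{1/2}\\&+\Big(\sum_{z\in\mathcal{N}_h^0(\Gamma)}h_z[K_\Gamma^{1/2}\nabla_tp_{\Gamma,h}]_z^2\Big)^{1/2}+\Big(\sum_{e\in\mathcal{F}_h^\Gamma}h_e\|\tfrac1{\alpha_\Gamma}(\{p_h\}-p_{\Gamma,h})-[\boldsymbol{u}_h\cdot\boldsymbol{n}_\Gamma]\|_{0,e}^2\Big)^{1/2}\\&+\Big(\sum_{e\in\mathcal{F}_h^\Gamma}h_e\|\{\boldsymbol{u}_h\cdot\boldsymbol{n}_\Gamma\}-\tfrac1{\eta_\Gamma}[p_h]\|_{0,e}^2\Big)^{1/2},\end{aligned}$$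 where $h_z=\max\{h_e:z\in\partial e,\ e\in\mathcal{F}_h^\Gamma\}$ and $[\cdot]_z$ is the jump at $z$, e.g. $[\nabla_tp_{\Gamma,h}]_z=\nabla_tp_{\Gamma,h}|_e(z)-\nabla_tp_{\Gamma,h}|_{e'}(z)$ for the two fracture edges $e,e'$ with $\partial e\cap\partial e'=z$.
   Formalization: C also multiplies osc(f,f_Γ) (with factor 1 the bound fails for rapidly oscillating f, f_Γ); K_Γ is assumed constant on Γ, as the vertex term with K_Γ^{1/2} is otherwise uncontrolled; the coefficients on Γ are taken constant on each fracture edge. *)

theory Defs
  imports "HOL-Analysis.Analysis" "HOL-Computational_Algebra.Polynomial"
begin

type_synonym pt = "real^2"

(* A triangle of T_h is a triple (nu, a, b): nu is the centre of a polygon S(nu), and a, b are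
   consecutive vertices of S(nu) in counterclockwise order. *)
type_synonym elem = "pt \<times> pt \<times> pt"

(* Piecewise functions on T_h (q|_tau in P^k for every tau) are families elem => pt => _:
   the restriction to tau, and its one-sided trace on the edges of tau, is q tau. *)


section \<open>Function spaces\<close>

definition L2 :: "'a::euclidean_space set \<Rightarrow> ('a \<Rightarrow> 'b::euclidean_space) \<Rightarrow> bool" where
  "L2 D f \<longleftrightarrow> set_borel_measurable lebesgue D f \<and>
            set_integrable lebesgue D (\<lambda>x. (norm (f x))^2)"

definition L2norm :: "'a::euclidean_space set \<Rightarrow> ('a \<Rightarrow> 'b::euclidean_space) \<Rightarrow> real" where
  "L2norm D f = sqrt (LINT x:D|lebesgue. (norm (f x))^2)"

definition C1 :: "('a::euclidean_space \<Rightarrow> real) \<Rightarrow> ('a \<Rightarrow> 'a) \<Rightarrow> bool" where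
  "C1 \<phi> d\<phi> \<longleftrightarrow> (\<forall>x. (\<phi> has_derivative (\<lambda>h. d\<phi> x \<bullet> h)) (at x)) \<and> continuous_on UNIV d\<phi>"

definition supp :: "('a::euclidean_space \<Rightarrow> real) \<Rightarrow> 'a set" where
  "supp \<phi> = closure {x. \<phi> x \<noteq> 0}"

(* q is in H^1(D) with weak gradient G; C^1 test functions with compact support in the open set D
   give the same space as smooth ones. *)
definition H1 :: "'a::euclidean_space set \<Rightarrow> ('a \<Rightarrow> real) \<Rightarrow> ('a \<Rightarrow> 'a) \<Rightarrow> bool" where
  "H1 D q G \<longleftrightarrow> L2 D q \<and> L2 D G \<and>
     (\<forall>\<phi> d\<phi>. C1 \<phi> d\<phi> \<and> compact (supp \<phi>) \<and> supp \<phi> \<subseteq> D \<longrightarrow>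
        (LINT x:D|lebesgue. q x *\<^sub>R d\<phi> x) = - (LINT x:D|lebesgue. \<phi> x *\<^sub>R G x))"

(* q is in H^1_0(D), the closure of C^1_c(D) in H^1(D), with gradient G. *)
definition H10 :: "'a::euclidean_space set \<Rightarrow> ('a \<Rightarrow> real) \<Rightarrow> ('a \<Rightarrow> 'a) \<Rightarrow> bool" where
  "H10 D q G \<longleftrightarrow> L2 D q \<and> L2 D G \<and>
     (\<exists>\<phi> d\<phi>. (\<forall>n::nat. C1 (\<phi> n) (d\<phi> n) \<and> compact (supp (\<phi> n)) \<and> supp (\<phi> n) \<subseteq> D) \<and>
        (\<lambda>n. L2norm D (\<lambda>x. \<phi> n x - q x)) \<longlonglongrightarrow> 0 \<and>
        (\<lambda>n. L2norm D (\<lambda>x. d\<phi> n x - G x)) \<longlonglongrightarrow> 0)"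

(* g, as a function of the parameter in (0,l), is the trace of q in H^1(D) on the curve c in the
   closure of D: the continuous extension of the restriction map of C^1 functions. *)
definition has_trace ::
  "pt set \<Rightarrow> (pt \<Rightarrow> real) \<Rightarrow> (pt \<Rightarrow> pt) \<Rightarrow> (real \<Rightarrow> pt) \<Rightarrow> real \<Rightarrow> (real \<Rightarrow> real) \<Rightarrow> bool" where
  "has_trace D q G c l g \<longleftrightarrow> L2 {0<..<l} g \<and>
     (\<exists>\<phi> d\<phi>. (\<forall>n::nat. C1 (\<phi> n) (d\<phi> n)) \<and>
        (\<lambda>n. L2norm D (\<lambda>x. \<phi> n x - q x)) \<longlonglongrightarrow> 0 \<and>
        (\<lambda>n. L2norm D (\<lambda>x. d\<phi> n x - G x)) \<longlonglongrightarrow> 0 \<and>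
        (\<lambda>n. L2norm {0<..<l} (\<lambda>s. \<phi> n (c s) - g s)) \<longlonglongrightarrow> 0)"

(* Polynomials of total degree at most k in two variables. *)
definition poly2 :: "nat \<Rightarrow> (pt \<Rightarrow> real) \<Rightarrow> bool" where
  "poly2 k q \<longleftrightarrow> (\<exists>c. \<forall>x. q x = (\<Sum>i\<le>k. \<Sum>j\<le>k - i. c i j * (x$1)^i * (x$2)^j))"

definition grad :: "(pt \<Rightarrow> real) \<Rightarrow> pt \<Rightarrow> pt" where
  "grad q x = (\<chi> i. deriv (\<lambda>t. q (x + t *\<^sub>R axis i 1)) 0)"

definition dvg :: "(pt \<Rightarrow> pt) \<Rightarrow> pt \<Rightarrow> real" where
  "dvg v x = (\<Sum>i\<in>UNIV. grad (\<lambda>y. v y $ i) x $ i)"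


section \<open>The bulk--fracture model\<close>

(* The square root of a symmetric positive semidefinite matrix. *)
definition mat_sqrt :: "real^2^2 \<Rightarrow> real^2^2" where
  "mat_sqrt A = (THE B. transpose B = B \<and> (\<forall>v. 0 \<le> v \<bullet> (B *v v)) \<and> B ** B = A)"

(* Clockwise rotation by a right angle: the normal pointing to the right of a tangent. *)
definition rot :: "pt \<Rightarrow> pt" where
  "rot v = vector [v$2, - v$1]"

(* The fracture is an arc-length parametrised polygonal arc gam on [0, len]; Gamma is identified
   with the interval (0, len), so functions on Gamma are functions of the arc length s, the
   tangential gradient and divergence are d/ds, and integrals over Gamma are integrals over s. *)
record problem =
  Om  :: "pt set"
  Om1 :: "pt set"
  Om2 :: "pt set"
  gam :: "real \<Rightarrow> pt"
  len :: real
  Kb  :: "pt \<Rightarrow> real^2^2"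
  kapt :: "real \<Rightarrow> real"     (* tangential permeability *)
  kapn :: "real \<Rightarrow> real"     (* normal permeability *)
  ell :: "real \<Rightarrow> real"      (* thickness *)
  xi  :: real

definition OmB :: "problem \<Rightarrow> pt set" where
  "OmB P = Om P - gam P ` {0..len P}"

definition bdOmB :: "problem \<Rightarrow> pt set" where
  "bdOmB P = (frontier (Om1 P) \<union> frontier (Om2 P)) - gam P ` {0..len P}"

definition Gam :: "problem \<Rightarrow> real set" where
  "Gam P = {0<..<len P}"

definition KG :: "problem \<Rightarrow> real \<Rightarrow> real" where
  "KG P s = kapt P s * ell P s"

definition etaG :: "problem \<Rightarrow> real \<Rightarrow> real" where
  "etaG P s = ell P s / kapn P s"

definition alphaG :: "problem \<Rightarrow> real \<Rightarrow> real" where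
  "alphaG P s = etaG P s * (xi P / 2 - 1 / 4)"

definition nG :: "problem \<Rightarrow> real \<Rightarrow> pt" where
  "nG P s = rot (vector_derivative (gam P) (at s))"

definition polygonal_arc :: "(real \<Rightarrow> pt) \<Rightarrow> real \<Rightarrow> bool" where
  "polygonal_arc c l \<longleftrightarrow> 0 < l \<and> inj_on c {0..l} \<and>
     (\<exists>B. finite B \<and> (\<forall>s t. 0 \<le> s \<and> s < t \<and> t \<le> l \<and> {s<..<t} \<inter> B = {} \<longrightarrow>
        (\<exists>d. norm d = 1 \<and> (\<forall>x\<in>{s..t}. c x = c s + (x - s) *\<^sub>R d))))"

definition piecewise_const :: "pt set \<Rightarrow> (pt \<Rightarrow> real^2^2) \<Rightarrow> bool" where
  "piecewise_const D A \<longleftrightarrow> (\<exists>\<D>. finite \<D> \<and> disjoint \<D> \<and> (\<forall>X\<in>\<D>. open X \<and> X \<subseteq> D \<and> A constant_on X) \<and>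
      negligible (D - \<Union>\<D>))"

definition piecewise_const1 :: "real set \<Rightarrow> (real \<Rightarrow> real) \<Rightarrow> bool" where
  "piecewise_const1 D c \<longleftrightarrow>
     (\<exists>B. finite B \<and> (\<forall>I. connected I \<and> I \<subseteq> D - B \<longrightarrow> c constant_on I))"

definition fracture_problem :: "problem \<Rightarrow> bool" where
  "fracture_problem P \<longleftrightarrow>
     open (Om P) \<and> bounded (Om P) \<and>
     polygonal_arc (gam P) (len P) \<and> gam P ` Gam P \<subseteq> Om P \<and>
     gam P 0 \<in> frontier (Om P) \<and> gam P (len P) \<in> frontier (Om P) \<and>
     open (Om1 P) \<and> open (Om2 P) \<and> Om1 P \<inter> Om2 P = {} \<and> OmB P = Om1 P \<union> Om2 P \<and>
     (\<forall>s\<in>Gam P. gam P differentiable (at s) \<longrightarrow>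
        (\<exists>\<delta>>0. \<forall>t\<in>{0<..<\<delta>}. gam P s - t *\<^sub>R nG P s \<in> Om1 P \<and> gam P s + t *\<^sub>R nG P s \<in> Om2 P)) \<and>
     (\<forall>x\<in>OmB P. transpose (Kb P x) = Kb P x \<and> (\<exists>c. Kb P x = mat c) \<and>
        (\<forall>v. v \<noteq> 0 \<longrightarrow> 0 < v \<bullet> (Kb P x *v v))) \<and>
     piecewise_const (OmB P) (Kb P) \<and>
     piecewise_const1 (Gam P) (kapt P) \<and> piecewise_const1 (Gam P) (kapn P) \<and>
     piecewise_const1 (Gam P) (ell P) \<and>
     (\<exists>a>0. \<exists>b>0. AE s in lebesgue_on (Gam P). a \<le> kapt P s \<and> kapt P s \<le> b) \<and>
     (\<exists>a>0. \<exists>b>0. AE s in lebesgue_on (Gam P). a \<le> kapn P s \<and> kapn P s \<le> b) \<and>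
     (AE s in lebesgue_on (Gam P). 0 < ell P s) \<and>
     1 / 2 < xi P \<and> xi P \<le> 1"

(* q is in U, with elementwise gradient G and traces q1, q2 on Gamma from Om1 and Om2. The
   boundary condition is imposed on every segment of the (polygonal) outer boundary. *)
definition inU ::
  "problem \<Rightarrow> (pt \<Rightarrow> real) \<Rightarrow> (pt \<Rightarrow> pt) \<Rightarrow> (real \<Rightarrow> real) \<Rightarrow> (real \<Rightarrow> real) \<Rightarrow> bool" where
  "inU P q G q1 q2 \<longleftrightarrow>
     H1 (Om1 P) q G \<and> H1 (Om2 P) q G \<and>
     (\<forall>D\<in>{Om1 P, Om2 P}. \<forall>a b. a \<noteq> b \<and> closed_segment a b \<subseteq> frontier D - gam P ` {0..len P} \<longrightarrow>
        has_trace D q G (\<lambda>s. a + s *\<^sub>R (b - a)) 1 (\<lambda>_. 0)) \<and>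
     has_trace (Om1 P) q G (gam P) (len P) q1 \<and>
     has_trace (Om2 P) q G (gam P) (len P) q2"

(* The weak form (W). The sum over e in F_h^Gamma of integrals over e is the integral over
   Gamma, which keeps (W) independent of the mesh. *)
definition weak_solution ::
  "problem \<Rightarrow> (pt \<Rightarrow> real) \<Rightarrow> (real \<Rightarrow> real) \<Rightarrow> (pt \<Rightarrow> pt) \<Rightarrow>
   (pt \<Rightarrow> real) \<Rightarrow> (pt \<Rightarrow> pt) \<Rightarrow> (real \<Rightarrow> real) \<Rightarrow> (real \<Rightarrow> real) \<Rightarrow>
   (real \<Rightarrow> real) \<Rightarrow> (real \<Rightarrow> real) \<Rightarrow> bool" where
  "weak_solution P f fG u p Gp p1 p2 pG dpG \<longleftrightarrow>
     L2 (OmB P) u \<and> inU P p Gp p1 p2 \<and> H10 (Gam P) pG dpG \<and>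
     (\<forall>v. L2 (OmB P) v \<longrightarrow>
        (LINT x:OmB P|lebesgue. (matrix_inv (Kb P x) *v u x) \<bullet> v x)
        + (LINT x:OmB P|lebesgue. v x \<bullet> Gp x) = 0) \<and>
     (\<forall>q Gq q1 q2. inU P q Gq q1 q2 \<longrightarrow>
        (LINT s:Gam P|lebesgue. (1 / alphaG P s) * ((p1 s + p2 s) / 2 - pG s) * ((q1 s + q2 s) / 2))
        + (LINT s:Gam P|lebesgue. (1 / etaG P s) * (p1 s - p2 s) * (q1 s - q2 s))
        - (LINT x:OmB P|lebesgue. u x \<bullet> Gq x)
        = (LINT x:OmB P|lebesgue. f x * q x)) \<and>
     (\<forall>qG dqG. H10 (Gam P) qG dqG \<longrightarrow>
        (LINT s:Gam P|lebesgue. KG P s * dpG s * dqG s)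
        - (LINT s:Gam P|lebesgue. (1 / alphaG P s) * ((p1 s + p2 s) / 2 - pG s) * qG s)
        = (LINT s:Gam P|lebesgue. ell P s * fG s * qG s))"

(* g is the normal trace on Gamma of the field u in H(div, D), by Green's formula with test
   functions vanishing near the rest of the boundary of D; d is the divergence of u. The sign sg
   is +1 if n_Gamma is outward to D and -1 if it is inward. *)
definition has_normal_trace ::
  "problem \<Rightarrow> pt set \<Rightarrow> real \<Rightarrow> (pt \<Rightarrow> pt) \<Rightarrow> (real \<Rightarrow> real) \<Rightarrow> bool" where
  "has_normal_trace P D sg u g \<longleftrightarrow> L2 (Gam P) g \<and>
     (\<exists>d. L2 D d \<and>
       (\<forall>\<phi> d\<phi>. C1 \<phi> d\<phi> \<and> compact (supp \<phi>) \<and> supp \<phi> \<inter> (frontier D - gam P ` Gam P) = {} \<longrightarrow>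
          (LINT x:D|lebesgue. u x \<bullet> d\<phi> x) + (LINT x:D|lebesgue. d x * \<phi> x)
          = sg * (LINT s:Gam P|lebesgue. g s * \<phi> (gam P s))))"


section \<open>Meshes\<close>

(* A polygon S(nu) is (nu, [v_0,...,v_{n-1}]). The set ori holds one orientation (a,b) of every
   edge and thereby fixes its unit normal, which points to the right of b - a. *)
record mesh =
  Tu  :: "(pt \<times> pt list) set"
  ori :: "(pt \<times> pt) set"

definition tris_of :: "pt \<times> pt list \<Rightarrow> elem set" where
  "tris_of S = {(fst S, snd S ! i, snd S ! (Suc i mod length (snd S))) | i. i < length (snd S)}"

definition Th :: "mesh \<Rightarrow> elem set" where
  "Th M = (\<Union>S\<in>Tu M. tris_of S)"

definition verts :: "elem \<Rightarrow> pt set" where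
  "verts \<tau> = (case \<tau> of (\<nu>, a, b) \<Rightarrow> {\<nu>, a, b})"

definition tri :: "elem \<Rightarrow> pt set" where
  "tri \<tau> = convex hull (verts \<tau>)"

definition cell :: "pt \<times> pt list \<Rightarrow> pt set" where
  "cell S = (\<Union>\<tau>\<in>tris_of S. tri \<tau>)"

definition ccw :: "elem \<Rightarrow> bool" where
  "ccw \<tau> = (case \<tau> of (\<nu>, a, b) \<Rightarrow>
      0 < (a - \<nu>)$1 * (b - \<nu>)$2 - (a - \<nu>)$2 * (b - \<nu>)$1)"

(* Edges of a triangle, oriented counterclockwise (the triangle lies on their left). *)
definition dedges :: "elem \<Rightarrow> (pt \<times> pt) set" where
  "dedges \<tau> = (case \<tau> of (\<nu>, a, b) \<Rightarrow> {(\<nu>, a), (a, b), (b, \<nu>)})"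

(* For an oriented edge e with normal n, tau_1 = Lft M e and tau_2 = Rgt M e. *)
definition Lft :: "mesh \<Rightarrow> pt \<times> pt \<Rightarrow> elem" where
  "Lft M e = (THE \<tau>. \<tau> \<in> Th M \<and> e \<in> dedges \<tau>)"

definition Rgt :: "mesh \<Rightarrow> pt \<times> pt \<Rightarrow> elem" where
  "Rgt M e = Lft M (prod.swap e)"

definition elen :: "pt \<times> pt \<Rightarrow> real" where
  "elen e = dist (fst e) (snd e)"

definition nrm :: "pt \<times> pt \<Rightarrow> pt" where
  "nrm e = (1 / elen e) *\<^sub>R rot (snd e - fst e)"

definition eint :: "pt \<times> pt \<Rightarrow> (pt \<Rightarrow> real) \<Rightarrow> real" where
  "eint e g = (LINT s:{0<..<elen e}|lebesgue. g (fst e + (s / elen e) *\<^sub>R (snd e - fst e)))"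

(* Counterclockwise oriented edges of the polygons. *)
definition pedges :: "mesh \<Rightarrow> (pt \<times> pt) set" where
  "pedges M = {(a, b). \<exists>\<nu>. (\<nu>, a, b) \<in> Th M}"

definition on_frac :: "problem \<Rightarrow> pt \<times> pt \<Rightarrow> bool" where
  "on_frac P e \<longleftrightarrow> closed_segment (fst e) (snd e) \<subseteq> gam P ` {0..len P}"

definition on_bd :: "problem \<Rightarrow> pt \<times> pt \<Rightarrow> bool" where
  "on_bd P e \<longleftrightarrow> open_segment (fst e) (snd e) \<subseteq> bdOmB P"

definition Fu :: "problem \<Rightarrow> mesh \<Rightarrow> (pt \<times> pt) set" where
  "Fu P M = {e \<in> ori M. (e \<in> pedges M \<or> prod.swap e \<in> pedges M) \<and> \<not> on_frac P e}"

definition Fu0 :: "problem \<Rightarrow> mesh \<Rightarrow> (pt \<times> pt) set" where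
  "Fu0 P M = {e \<in> Fu P M. \<not> on_bd P e}"

definition Fp :: "mesh \<Rightarrow> (pt \<times> pt) set" where
  "Fp M = {e \<in> ori M. \<exists>\<nu> a b. (\<nu>, a, b) \<in> Th M \<and> (e = (\<nu>, a) \<or> e = (a, \<nu>))}"

(* Edges of F_h^Gamma, as arc-length intervals (s,t): the polygon edges lying on Gamma. *)
definition FG :: "problem \<Rightarrow> mesh \<Rightarrow> (real \<times> real) set" where
  "FG P M = {(s, t). 0 \<le> s \<and> s < t \<and> t \<le> len P \<and> (gam P s, gam P t) \<in> pedges M \<and>
      gam P ` {s..t} = closed_segment (gam P s) (gam P t)}"

definition NG :: "problem \<Rightarrow> mesh \<Rightarrow> real set" where
  "NG P M = {z \<in> Gam P. \<exists>r t. (r, z) \<in> FG P M \<and> (z, t) \<in> FG P M}"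

definition hz :: "problem \<Rightarrow> mesh \<Rightarrow> real \<Rightarrow> real" where
  "hz P M z = Max {t - s | s t. (s, t) \<in> FG P M \<and> (z = s \<or> z = t)}"

(* The last four conjuncts are the mesh regularity; the centre nu of the splitting is the centre
   of the ball with respect to which S(nu) is star-shaped, since otherwise the triangles of T_h
   may degenerate. The coefficients on Gamma are constant on each fracture edge, as the
   elementwise divergence and the vertex jumps in the estimator presuppose; Kb is not required
   to be aligned with the mesh. *)
definition regular_mesh :: "problem \<Rightarrow> real \<Rightarrow> real \<Rightarrow> mesh \<Rightarrow> bool" where
  "regular_mesh P \<rho>S \<rho>E M \<longleftrightarrow>
     finite (Tu M) \<and>
     (\<forall>S\<in>Tu M. 3 \<le> length (snd S) \<and> distinct (snd S)) \<and>
     (\<forall>\<tau>\<in>Th M. ccw \<tau>) \<and>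
     (\<Union>S\<in>Tu M. cell S) = closure (Om P) \<and>
     (\<forall>S\<in>Tu M. \<forall>S'\<in>Tu M. S \<noteq> S' \<longrightarrow> interior (cell S) \<inter> interior (cell S') = {}) \<and>
     (\<forall>\<tau>\<in>Th M. \<forall>\<tau>'\<in>Th M. tri \<tau> \<inter> tri \<tau>' = convex hull (verts \<tau> \<inter> verts \<tau>')) \<and>
     (\<forall>S\<in>Tu M. interior (cell S) \<subseteq> Om1 P \<or> interior (cell S) \<subseteq> Om2 P) \<and>
     (\<forall>e\<in>pedges M. on_bd P e \<or> open_segment (fst e) (snd e) \<subseteq> Om P) \<and>
     (\<Union>(s, t)\<in>FG P M. {s..t}) = {0..len P} \<and>
     (\<forall>(s, t)\<in>FG P M. kapt P constant_on {s<..<t} \<and> kapn P constant_on {s<..<t} \<and>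
        ell P constant_on {s<..<t}) \<and>
     (\<forall>e\<in>ori M. \<exists>\<tau>\<in>Th M. e \<in> dedges \<tau> \<or> prod.swap e \<in> dedges \<tau>) \<and>
     (\<forall>\<tau>\<in>Th M. \<forall>e\<in>dedges \<tau>. e \<in> ori M \<longleftrightarrow> prod.swap e \<notin> ori M) \<and>
     (\<forall>e\<in>pedges M. on_bd P e \<and> prod.swap e \<notin> pedges M \<longrightarrow> e \<in> ori M) \<and>
     (\<forall>(s, t)\<in>FG P M. (gam P s, gam P t) \<in> ori M) \<and>
     0 < \<rho>S \<and> 0 < \<rho>E \<and>
     (\<forall>S\<in>Tu M. \<exists>r \<ge> \<rho>S * diameter (cell S). ball (fst S) r \<subseteq> cell S \<and>
        (\<forall>y\<in>cell S. convex hull (insert y (ball (fst S) r)) \<subseteq> cell S)) \<and>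
     (\<forall>S\<in>Tu M. \<forall>(\<nu>, a, b)\<in>tris_of S. elen (a, b) \<ge> \<rho>E * diameter (cell S))"


section \<open>The staggered DG scheme\<close>

(* Values on Gamma, as functions of the arc length, from the Om1-side and the Om2-side. *)
definition fedge :: "problem \<Rightarrow> mesh \<Rightarrow> real \<Rightarrow> real \<times> real" where
  "fedge P M x = (THE e. e \<in> FG P M \<and> fst e < x \<and> x < snd e)"

definition side1 :: "problem \<Rightarrow> mesh \<Rightarrow> (elem \<Rightarrow> pt \<Rightarrow> 'b) \<Rightarrow> real \<Rightarrow> 'b" where
  "side1 P M q x = q (Lft M (map_prod (gam P) (gam P) (fedge P M x))) (gam P x)"

definition side2 :: "problem \<Rightarrow> mesh \<Rightarrow> (elem \<Rightarrow> pt \<Rightarrow> 'b) \<Rightarrow> real \<Rightarrow> 'b" where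
  "side2 P M q x = q (Rgt M (map_prod (gam P) (gam P) (fedge P M x))) (gam P x)"

definition njumpG :: "problem \<Rightarrow> mesh \<Rightarrow> (elem \<Rightarrow> pt \<Rightarrow> pt) \<Rightarrow> real \<Rightarrow> real" where
  "njumpG P M v x = side1 P M v x \<bullet> nG P x - side2 P M v x \<bullet> nG P x"

definition navgG :: "problem \<Rightarrow> mesh \<Rightarrow> (elem \<Rightarrow> pt \<Rightarrow> pt) \<Rightarrow> real \<Rightarrow> real" where
  "navgG P M v x = (side1 P M v x \<bullet> nG P x + side2 P M v x \<bullet> nG P x) / 2"

definition jumpG :: "problem \<Rightarrow> mesh \<Rightarrow> (elem \<Rightarrow> pt \<Rightarrow> real) \<Rightarrow> real \<Rightarrow> real" where
  "jumpG P M q x = side1 P M q x - side2 P M q x"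

definition avgG :: "problem \<Rightarrow> mesh \<Rightarrow> (elem \<Rightarrow> pt \<Rightarrow> real) \<Rightarrow> real \<Rightarrow> real" where
  "avgG P M q x = (side1 P M q x + side2 P M q x) / 2"

definition jump :: "mesh \<Rightarrow> pt \<times> pt \<Rightarrow> (elem \<Rightarrow> pt \<Rightarrow> real) \<Rightarrow> pt \<Rightarrow> real" where
  "jump M e q x = q (Lft M e) x - q (Rgt M e) x"

definition njump :: "mesh \<Rightarrow> pt \<times> pt \<Rightarrow> (elem \<Rightarrow> pt \<Rightarrow> pt) \<Rightarrow> pt \<Rightarrow> real" where
  "njump M e v x = v (Lft M e) x \<bullet> nrm e - v (Rgt M e) x \<bullet> nrm e"

definition Sh :: "problem \<Rightarrow> mesh \<Rightarrow> nat \<Rightarrow> (elem \<Rightarrow> pt \<Rightarrow> real) set" where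
  "Sh P M k = {q. (\<forall>\<tau>\<in>Th M. poly2 k (q \<tau>)) \<and>
     (\<forall>e\<in>Fu0 P M. \<forall>x\<in>closed_segment (fst e) (snd e). jump M e q x = 0) \<and>
     (\<forall>(\<nu>, a, b)\<in>Th M. on_bd P (a, b) \<longrightarrow> (\<forall>x\<in>closed_segment a b. q (\<nu>, a, b) x = 0))}"

definition Vh :: "mesh \<Rightarrow> nat \<Rightarrow> (elem \<Rightarrow> pt \<Rightarrow> pt) set" where
  "Vh M k = {v. (\<forall>\<tau>\<in>Th M. \<forall>i. poly2 k (\<lambda>x. v \<tau> x $ i)) \<and>
     (\<forall>e\<in>Fp M. \<forall>x\<in>closed_segment (fst e) (snd e). njump M e v x = 0)}"

definition Wh :: "problem \<Rightarrow> mesh \<Rightarrow> nat \<Rightarrow> (real \<Rightarrow> real) set" where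
  "Wh P M k = {q. H10 (Gam P) q (deriv q) \<and>
     (\<forall>(s, t)\<in>FG P M. \<exists>r. degree r \<le> k \<and> (\<forall>x\<in>{s..t}. q x = poly r x))}"

definition bh :: "mesh \<Rightarrow> (elem \<Rightarrow> pt \<Rightarrow> pt) \<Rightarrow> (elem \<Rightarrow> pt \<Rightarrow> real) \<Rightarrow> real" where
  "bh M v q = - (\<Sum>e\<in>Fp M. eint e (\<lambda>x. (v (Lft M e) x \<bullet> nrm e) * jump M e q x))
     + (\<Sum>\<tau>\<in>Th M. LINT x:tri \<tau>|lebesgue. v \<tau> x \<bullet> grad (q \<tau>) x)"

definition bh_star ::
  "problem \<Rightarrow> mesh \<Rightarrow> (elem \<Rightarrow> pt \<Rightarrow> real) \<Rightarrow> (elem \<Rightarrow> pt \<Rightarrow> pt) \<Rightarrow> real" where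
  "bh_star P M q v = (\<Sum>e\<in>Fu0 P M. eint e (\<lambda>x. q (Lft M e) x * njump M e v x))
     - (\<Sum>\<tau>\<in>Th M. LINT x:tri \<tau>|lebesgue. q \<tau> x * dvg (v \<tau>) x)
     + (\<Sum>(s, t)\<in>FG P M. LINT x:{s<..<t}|lebesgue. jumpG P M q x * navgG P M v x)
     + (\<Sum>(s, t)\<in>FG P M. LINT x:{s<..<t}|lebesgue. avgG P M q x * njumpG P M v x)"

definition sdg_solution ::
  "problem \<Rightarrow> mesh \<Rightarrow> nat \<Rightarrow> (pt \<Rightarrow> real) \<Rightarrow> (real \<Rightarrow> real) \<Rightarrow>
   (elem \<Rightarrow> pt \<Rightarrow> pt) \<Rightarrow> (elem \<Rightarrow> pt \<Rightarrow> real) \<Rightarrow> (real \<Rightarrow> real) \<Rightarrow> bool" where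
  "sdg_solution P M k f fG uh ph pGh \<longleftrightarrow>
     uh \<in> Vh M k \<and> ph \<in> Sh P M k \<and> pGh \<in> Wh P M k \<and>
     (\<forall>v\<in>Vh M k.
        (\<Sum>\<tau>\<in>Th M. LINT x:tri \<tau>|lebesgue. (matrix_inv (Kb P x) *v uh \<tau> x) \<bullet> v \<tau> x)
        + bh_star P M ph v = 0) \<and>
     (\<forall>q\<in>Sh P M k.
        - bh M uh q
        + (\<Sum>(s, t)\<in>FG P M. LINT x:{s<..<t}|lebesgue.
             (1 / alphaG P x) * (avgG P M ph x - pGh x) * avgG P M q x)
        + (\<Sum>(s, t)\<in>FG P M. LINT x:{s<..<t}|lebesgue.
             (1 / etaG P x) * jumpG P M ph x * jumpG P M q x)
        = (\<Sum>\<tau>\<in>Th M. LINT x:tri \<tau>|lebesgue. f x * q \<tau> x)) \<and>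
     (\<forall>qG\<in>Wh P M k.
        (LINT x:Gam P|lebesgue. KG P x * deriv pGh x * deriv qG x)
        - (\<Sum>(s, t)\<in>FG P M. LINT x:{s<..<t}|lebesgue.
             (1 / alphaG P x) * (avgG P M ph x - pGh x) * qG x)
        = (LINT x:Gam P|lebesgue. ell P x * fG x * qG x))"


section \<open>Norm, estimator and data oscillation\<close>

(* The sdg norm of a triple (v, q, q_Gamma), where v and the gradient Gq of q are given
   elementwise, q1, q2 and vn1, vn2 are the traces of q and of v . n_Gamma on Gamma from the two
   sides, and dqG is the tangential gradient of qG. *)
definition sdg_norm ::
  "problem \<Rightarrow> mesh \<Rightarrow> (elem \<Rightarrow> pt \<Rightarrow> pt) \<Rightarrow> (elem \<Rightarrow> pt \<Rightarrow> pt) \<Rightarrow> (real \<Rightarrow> real) \<Rightarrow> (real \<Rightarrow> real) \<Rightarrow>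
   (real \<Rightarrow> real) \<Rightarrow> (real \<Rightarrow> real) \<Rightarrow> (real \<Rightarrow> real) \<Rightarrow> (real \<Rightarrow> real) \<Rightarrow> real" where
  "sdg_norm P M v Gq q1 q2 qG dqG vn1 vn2 = sqrt (
     (\<Sum>\<tau>\<in>Th M. (L2norm (tri \<tau>) (\<lambda>x. matrix_inv (mat_sqrt (Kb P x)) *v v \<tau> x))^2)
     + (\<Sum>(s, t)\<in>FG P M.
          (L2norm {s<..<t} (\<lambda>x. ((q1 x + q2 x) / 2 - qG x) / sqrt (alphaG P x)))^2)
     + (\<Sum>(s, t)\<in>FG P M. (L2norm {s<..<t} (\<lambda>x. (q1 x - q2 x) / sqrt (etaG P x)))^2)
     + (\<Sum>\<tau>\<in>Th M. (L2norm (tri \<tau>) (\<lambda>x. mat_sqrt (Kb P x) *v Gq \<tau> x))^2)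
     + (L2norm (Gam P) (\<lambda>x. sqrt (KG P x) * dqG x))^2
     + (L2norm (Gam P) (\<lambda>x. vn1 x - vn2 x))^2
     + (L2norm (Gam P) (\<lambda>x. (vn1 x + vn2 x) / 2))^2)"

definition estimator ::
  "problem \<Rightarrow> mesh \<Rightarrow> (pt \<Rightarrow> real) \<Rightarrow> (real \<Rightarrow> real) \<Rightarrow>
   (elem \<Rightarrow> pt \<Rightarrow> pt) \<Rightarrow> (elem \<Rightarrow> pt \<Rightarrow> real) \<Rightarrow> (real \<Rightarrow> real) \<Rightarrow> real" where
  "estimator P M f fG uh ph pGh =
     sqrt (\<Sum>\<tau>\<in>Th M. (L2norm (tri \<tau>) (\<lambda>x. matrix_inv (mat_sqrt (Kb P x)) *v uh \<tau> x
                                         + mat_sqrt (Kb P x) *v grad (ph \<tau>) x))^2)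
   + sqrt (\<Sum>\<tau>\<in>Th M. (diameter (tri \<tau>))^2 * (L2norm (tri \<tau>) (\<lambda>x. f x - dvg (uh \<tau>) x))^2)
   + sqrt (\<Sum>e\<in>Fp M. (1 / elen e) * eint e (\<lambda>x. (jump M e ph x)^2))
   + sqrt (\<Sum>e\<in>Fu0 P M. elen e * eint e (\<lambda>x. (njump M e uh x)^2))
   + sqrt (\<Sum>(s, t)\<in>FG P M. (t - s)^2 *
       (L2norm {s<..<t} (\<lambda>x. ell P x * fG x + deriv (\<lambda>y. KG P y * deriv pGh y) x
                              + njumpG P M uh x))^2)
   + sqrt (\<Sum>z\<in>NG P M. hz P M z *
       (Lim (at_left z) (\<lambda>x. sqrt (KG P x) * deriv pGh x)
        - Lim (at_right z) (\<lambda>x. sqrt (KG P x) * deriv pGh x))^2)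
   + sqrt (\<Sum>(s, t)\<in>FG P M. (t - s) *
       (L2norm {s<..<t} (\<lambda>x. (1 / alphaG P x) * (avgG P M ph x - pGh x) - njumpG P M uh x))^2)
   + sqrt (\<Sum>(s, t)\<in>FG P M. (t - s) *
       (L2norm {s<..<t} (\<lambda>x. navgG P M uh x - (1 / etaG P x) * jumpG P M ph x))^2)"

definition pw_poly :: "mesh \<Rightarrow> nat \<Rightarrow> (elem \<Rightarrow> pt \<Rightarrow> real) \<Rightarrow> bool" where
  "pw_poly M m fh \<longleftrightarrow> (\<forall>\<tau>\<in>Th M. poly2 m (fh \<tau>))"

definition pw_polyG :: "problem \<Rightarrow> mesh \<Rightarrow> nat \<Rightarrow> (real \<Rightarrow> real) \<Rightarrow> bool" where
  "pw_polyG P M m g \<longleftrightarrow> (\<forall>(s, t)\<in>FG P M. \<exists>r. degree r \<le> m \<and> (\<forall>x\<in>{s<..<t}. g x = poly r x))"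

definition osc ::
  "problem \<Rightarrow> mesh \<Rightarrow> (pt \<Rightarrow> real) \<Rightarrow> (real \<Rightarrow> real) \<Rightarrow>
   (elem \<Rightarrow> pt \<Rightarrow> real) \<Rightarrow> (real \<Rightarrow> real) \<Rightarrow> real" where
  "osc P M f fG fh fGh = sqrt (
     (\<Sum>(s, t)\<in>FG P M. (t - s)^2 * (L2norm {s<..<t} (\<lambda>x. ell P x * (fGh x - fG x)))^2)
     + (\<Sum>\<tau>\<in>Th M. (diameter (tri \<tau>))^2 * (L2norm (tri \<tau>) (\<lambda>x. f x - fh \<tau> x))^2))"

(* The vertex term of the estimator measures the jump of sqrt K_Gamma times the gradient, whereas
   the flux K_Gamma times the gradient is what the weak form keeps continuous. Across a vertex
   where K_Gamma jumps the term need not vanish even if the discrete and the weak solution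
   coincide and f, f_Gamma are piecewise polynomial, so an efficiency bound needs this. *)
definition no_jump_KG :: "problem \<Rightarrow> bool" where
  "no_jump_KG P \<longleftrightarrow> (\<exists>c. AE s in lebesgue_on (Gam P). KG P s = c)"

(* In the efficiency estimate the mesh-independent constant also multiplies the oscillation; with
   the factor 1 there the estimate fails: on a fixed mesh, for f and f_Gamma oscillating faster
   and faster the error tends to 0, while the estimator tends to a + b and osc (for the
   L^2-projections) to sqrt (a^2 + b^2), with a, b > 0. *)

end

theory Submission
  imports Defs
begin

text \<open>
  Every term of the estimator is a residual of the discrete solution that vanishes for the exact one,
  so it can be expressed by the errors. Tested with a function of small support, a residual is
  bounded by the errors on that support, and an inverse inequality for polynomials recovers the
  norm of the residual from the test.

  The exact solution enters through consequences of the weak form: Darcy's law almost everywhere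
  (\<open>flux_eq\<close>), the balance law tested with \<open>C\<^sup>1\<close> functions supported off the fracture (\<open>weak_div\<close>), the
  interface conditions almost everywhere on the fracture (\<open>interface\<close>) and the tangential equation
  (\<open>weak_tangential\<close>). The test functions are bumps times polynomials (\<open>bump_test\<close>): in a ball inside
  a triangle for the divergence residual, in a ball around the midpoint of a polygon edge for the flux
  jump, in an interval inside a fracture edge for the tangential residual, and around a fracture
  vertex for the jump of the tangential flux. The inverse inequalities express compactness in a
  finite-dimensional space and scale with the triangle, so their constants depend on the degree and on
  the shape regularity only.

  The pressure jump across an edge inside a polygon has no counterpart in the weak form. It is balanced
  by the first discrete equation: after integration by parts (\<open>bh_star_eq\<close>) this equation, tested with
  a field whose flux is the jump, bounds the jump by the defect in Darcy's law, which the errors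
  control. That defect and the two coupling terms are plain combinations of errors.

  From the mesh one needs that areas and edge lengths are comparable with diameters (\<open>shape_regular\<close>,
  \<open>elen_ge\<close>), that a ball around the midpoint of an edge meets only its two triangles
  (\<open>midpoint_ball\<close>), and that neighbouring fracture edges have comparable lengths (\<open>FG_neighbours\<close>).
\<close>

text \<open>A set integral without an explicit measure is with respect to Lebesgue measure.\<close>
syntax
 "_LINT_lebesgue" :: "pttrn => 'a set => 'b => 'b" ("(3LINT _:_./ _)" [0,60,61] 60)
translations
 "LINT x:A. f" => "CONST set_lebesgue_integral (CONST completion (CONST lborel)) A (%x. f)"

notation scaleR (infixr "*R" 75)

section \<open>Square-integrable functions\<close>

lemma borel_measurable_lebesgue_cong_AE:
 fixes f g :: "'a::euclidean_space => 'b::euclidean_space" assumes f: "f \<in> borel_measurable lebesgue" and eq: "AE x in lebesgue. f x = g x"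
 shows "g \<in> borel_measurable lebesgue" proof (rule measurableI)
 fix S :: "'b set" assume S: "S \<in> sets borel"
 have "f -` S \<inter> space lebesgue \<in> sets lebesgue" using f S by (rule measurable_sets)
 then show "g -` S \<inter> space lebesgue \<in> sets lebesgue" by (rule completion.in_sets_AE[rotated]) (use eq in auto)
qed auto

lemma integral_lebesgue_cong_AE:
 fixes f g :: "'a::euclidean_space => 'b::euclidean_space" assumes "AE x in lebesgue. f x = g x"
 shows "integral\<^sup>L lebesgue f = integral\<^sup>L lebesgue g" proof (cases "f \<in> borel_measurable lebesgue")
 case True
 then show ?thesis using borel_measurable_lebesgue_cong_AE[OF True assms] assms by (intro integral_cong_AE) auto
next
 case False
 have "AE x in lebesgue. g x = f x" using assms by auto
 then have "g \<notin> borel_measurable lebesgue" using borel_measurable_lebesgue_cong_AE False by blast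
 then have "\<not> integrable lebesgue f" "\<not> integrable lebesgue g" using False by (auto simp: integrable_iff_bounded)
 then show ?thesis by (simp add: not_integrable_integral_eq)
qed

lemma integrable_lebesgue_cong_AE:
 fixes f g :: "'a::euclidean_space => 'b::euclidean_space" assumes "integrable lebesgue f" "AE x in lebesgue. f x = g x" shows "integrable lebesgue g"
proof -
 have "g \<in> borel_measurable lebesgue" using borel_measurable_lebesgue_cong_AE[OF _ assms(2)] assms(1) by auto
 then show ?thesis by (rule integrable_cong_AE_imp[OF assms(1) _ assms(2)])
qed

lemma set_integral_lebesgue_cong_AE:
 fixes f g :: "'a::euclidean_space => 'b::euclidean_space" assumes "AE x in lebesgue. x \<in> D --> f x = g x"
 shows "(LINT x:D. f x) = (LINT x:D. g x)" unfolding set_lebesgue_integral_def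
 by (rule integral_lebesgue_cong_AE) (use assms in \<open>auto simp: indicator_def\<close>)

lemma set_integral_lebesgue_cong_set_AE:
 fixes f :: "'a::euclidean_space => 'b::euclidean_space" assumes "AE x in lebesgue. x \<in> D \<longleftrightarrow> x \<in> E"
 shows "(LINT x:D. f x) = (LINT x:E. f x)" unfolding set_lebesgue_integral_def
 by (rule integral_lebesgue_cong_AE) (use assms in \<open>auto simp: indicator_def\<close>)

lemma set_integrable_lebesgue_cong_AE:
 fixes f g :: "'a::euclidean_space => 'b::euclidean_space" assumes "set_integrable lebesgue D f" "AE x in lebesgue. x \<in> D --> f x = g x"
 shows "set_integrable lebesgue D g" using assms(1) unfolding set_integrable_def
 by (rule integrable_lebesgue_cong_AE) (use assms(2) in \<open>auto simp: indicator_def\<close>)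

lemma set_integrable_lebesgue_cong_set_AE:
 fixes f :: "'a::euclidean_space => 'b::euclidean_space"
 assumes "set_integrable lebesgue D f" "AE x in lebesgue. x \<in> D \<longleftrightarrow> x \<in> E" shows "set_integrable lebesgue E f"
 using assms(1) unfolding set_integrable_def by (rule integrable_lebesgue_cong_AE) (use assms(2) in \<open>auto simp: indicator_def\<close>)

lemma set_borel_measurable_lebesgue_cong_AE:
 fixes f g :: "'a::euclidean_space => 'b::euclidean_space" assumes "set_borel_measurable lebesgue D f" "AE x in lebesgue. x \<in> D --> f x = g x"
 shows "set_borel_measurable lebesgue D g" using assms(1) unfolding set_borel_measurable_def
 by (rule borel_measurable_lebesgue_cong_AE) (use assms(2) in \<open>auto simp: indicator_def\<close>)

lemma L2_iff:
 "L2 D f \<longleftrightarrow> (%x. indicator D x *R f x) \<in> borel_measurable lebesgue &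
   integrable lebesgue (%x. (norm (indicator D x *R f x))^2)" proof -
 have "(%x. indicator D x *R (norm (f x))^2) = (%x. (norm (indicator D x *R f x))^2)" by (auto simp: indicator_def)
 then show ?thesis by (simp add: L2_def set_borel_measurable_def set_integrable_def)
qed

lemma L2norm_sq_eq: "(L2norm D f)^2 = (LINT x:D. (norm (f x))^2)" proof -
 have "0 \<le> (LINT x:D. (norm (f x))^2)" unfolding set_lebesgue_integral_def by (rule integral_nonneg_AE) auto
 then show ?thesis by (simp add: L2norm_def)
qed

lemma L2norm_nonneg [simp]: "0 \<le> L2norm D f" unfolding L2norm_def set_lebesgue_integral_def by (simp add: integral_nonneg_AE)

lemma L2norm_zero: "(!!x. x \<in> D ==> f x = 0) ==> L2norm D f = 0" unfolding L2norm_def set_lebesgue_integral_def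
 by (simp add: indicator_def Bochner_Integration.integral_cong[where g="%_. 0"])

lemma L2_cong_AE: assumes "L2 D f" "AE x in lebesgue. x \<in> D --> f x = g x" shows "L2 D g" unfolding L2_def proof
 show "set_borel_measurable lebesgue D g" using assms set_borel_measurable_lebesgue_cong_AE unfolding L2_def by blast
 show "set_integrable lebesgue D (%x. (norm (g x))^2)" proof (rule set_integrable_lebesgue_cong_AE)
  show "set_integrable lebesgue D (%x. (norm (f x))^2)" using assms(1) by (simp add: L2_def)
 qed (use assms(2) in auto)
qed

lemma L2norm_cong_AE: assumes "AE x in lebesgue. x \<in> D --> norm (f x) = norm (g x)" shows "L2norm D f = L2norm D g" unfolding L2norm_def
 by (rule arg_cong[where f=sqrt], rule set_integral_lebesgue_cong_AE) (use assms in auto)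

lemma L2_cong_set_AE: assumes "L2 D f" "AE x in lebesgue. x \<in> D \<longleftrightarrow> x \<in> E" shows "L2 E f" proof -
 have "set_borel_measurable lebesgue E f" using assms(1) unfolding set_borel_measurable_def L2_def by (elim conjE borel_measurable_lebesgue_cong_AE)
    (use assms(2) in \<open>auto simp: indicator_def\<close>)
 then show ?thesis using assms(1) set_integrable_lebesgue_cong_set_AE[OF _ assms(2)] unfolding L2_def by blast
qed

lemma L2_bound:
 fixes f :: "'a::euclidean_space => 'b::euclidean_space" assumes f: "set_borel_measurable lebesgue D f" and g: "set_integrable lebesgue D g"
  and le: "AE x in lebesgue. x \<in> D --> (norm (f x))^2 \<le> (g x :: real)" shows "L2 D f" unfolding L2_iff proof
 show m: "(%x. indicator D x *R f x) \<in> borel_measurable lebesgue" using f by (simp add: set_borel_measurable_def)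
 show "integrable lebesgue (%x. (norm (indicator D x *R f x))^2)" proof (rule Bochner_Integration.integrable_bound)
  show "integrable lebesgue (%x. indicator D x *R g x)" using g by (simp add: set_integrable_def)
  show "(%x. (norm (indicator D x *R f x))^2) \<in> borel_measurable lebesgue" using m by measurable
  show "AE x in lebesgue. norm ((norm (indicator D x *R f x))^2) \<le> norm (indicator D x *R g x)"
   using le by eventually_elim (auto simp: indicator_def)
 qed
qed

lemma norm_add_sq_le: "(norm (a + b))^2 \<le> 2 * (norm a)^2 + 2 * (norm b :: real)^2" proof -
 have "(norm (a + b))^2 \<le> (norm a + norm b)^2" by (simp add: norm_triangle_ineq power_mono)
 also have "... \<le> 2 * (norm a)^2 + 2 * (norm b)^2" using sum_squares_bound[of "norm a" "norm b"] by (simp add: power2_sum)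
 finally show ?thesis .
qed

lemma L2_add: assumes "L2 D f" "L2 D g" shows "L2 D (%x. f x + g x)" proof (rule L2_bound)
 show "set_borel_measurable lebesgue D (%x. f x + g x)" using assms unfolding L2_def set_borel_measurable_def scaleR_add_right
  by (auto intro: borel_measurable_add)
 show "set_integrable lebesgue D (%x. 2 * (norm (f x))^2 + 2 * (norm (g x))^2)"
  using assms unfolding L2_def by (intro set_integral_add(1) set_integrable_mult_right) auto
qed (use norm_add_sq_le in auto)

lemma L2_bounded_mult:
 fixes c :: "'a::euclidean_space => real" assumes "L2 D f" "set_borel_measurable lebesgue D c"
  and b: "AE x in lebesgue. x \<in> D --> \<bar>c x\<bar> \<le> B" shows "L2 D (%x. c x *R f x)" proof (rule L2_bound)
 have m: "(%x. indicator D x *R c x) \<in> borel_measurable lebesgue"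
  "(%x. indicator D x *R f x) \<in> borel_measurable lebesgue" using assms unfolding L2_def set_borel_measurable_def by blast+
 have "(%x. (indicator D x *R c x) *R (indicator D x *R f x)) \<in> borel_measurable lebesgue" by (rule borel_measurable_scaleR[OF m])
 moreover have "(%x. (indicator D x *R c x) *R (indicator D x *R f x)) = (%x. indicator D x *R (c x *R f x))" by (auto simp: indicator_def)
 ultimately show "set_borel_measurable lebesgue D (%x. c x *R f x)" by (simp add: set_borel_measurable_def)
 show "set_integrable lebesgue D (%x. B^2 * (norm (f x))^2)" using assms(1) unfolding L2_def by (intro set_integrable_mult_right) auto
 show "AE x in lebesgue. x \<in> D --> (norm (c x *R f x))^2 \<le> B^2 * (norm (f x))^2" using b by eventually_elim
   (auto simp: power_mult_distrib intro!: mult_right_mono abs_le_square_iff[THEN iffD1] order_trans[OF _ abs_ge_self])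
qed

lemma L2_scale: "L2 D f ==> L2 D (%x. (c::real) *R f x)" proof -
 assume L: "L2 D f"
 have m: "(%x. indicator D x *R f x) \<in> borel_measurable lebesgue" using L unfolding L2_def set_borel_measurable_def by blast
 have "set_borel_measurable lebesgue D (%x. c *R f x)" using borel_measurable_scaleR[OF borel_measurable_const[of c] m]
  unfolding set_borel_measurable_def by (simp add: mult.commute)
 moreover have "set_integrable lebesgue D (%x. c^2 * (norm (f x))^2)" using L unfolding L2_def by (intro set_integrable_mult_right) auto
 ultimately show ?thesis by (rule L2_bound) (simp add: power_mult_distrib)
qed

lemma L2_diff: "L2 D f ==> L2 D g ==> L2 D (%x. f x - g x)" using L2_add[OF _ L2_scale[of D g "-1"]] by simp

lemma L2_zero [simp]: "L2 D (%x. 0)" by (simp add: L2_iff)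

lemma L2_subset: assumes "L2 D f" "E <= D" "E \<in> sets lebesgue" shows "L2 E f" proof (rule L2_bound)
 have m: "(%x. indicator D x *R f x) \<in> borel_measurable lebesgue" using assms unfolding L2_def set_borel_measurable_def by blast
 have "(%x. indicator E x *R (indicator D x *R f x)) \<in> borel_measurable lebesgue"
  by (rule borel_measurable_scaleR[OF borel_measurable_indicator m]) (rule assms)
 moreover have "(%x. indicator E x *R (indicator D x *R f x)) = (%x. indicator E x *R f x)" using assms(2) by (auto simp: indicator_def fun_eq_iff)
 ultimately show "set_borel_measurable lebesgue E f" by (simp add: set_borel_measurable_def)
 show "set_integrable lebesgue E (%x. (norm (f x))^2)" using assms set_integrable_subset unfolding L2_def by blast
qed auto

lemma L2_inner_integrable:
 fixes f g :: "'a::euclidean_space => 'b::euclidean_space" assumes "L2 D f" "L2 D g" shows "set_integrable lebesgue D (%x. f x \<bullet> g x)"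
 unfolding set_integrable_def proof (rule Bochner_Integration.integrable_bound)
 have "set_integrable lebesgue D (%x. (norm (f x))^2 + (norm (g x))^2)" using assms unfolding L2_def by (intro set_integral_add(1)) auto
 then show "integrable lebesgue (%x. indicator D x *R ((norm (f x))^2 + (norm (g x))^2))" by (simp add: set_integrable_def)
 have m: "(%x. indicator D x *R f x) \<in> borel_measurable lebesgue"
  "(%x. indicator D x *R g x) \<in> borel_measurable lebesgue" using assms unfolding L2_def set_borel_measurable_def by blast+
 have "(%x. (indicator D x *R f x) \<bullet> (indicator D x *R g x)) \<in> borel_measurable lebesgue" by (rule borel_measurable_inner[OF m])
 moreover have "(%x. (indicator D x *R f x) \<bullet> (indicator D x *R g x)) = (%x. indicator D x *R (f x \<bullet> g x))"
  by (auto simp: indicator_def)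
 ultimately show "(%x. indicator D x *R (f x \<bullet> g x)) \<in> borel_measurable lebesgue" by simp
 have "\<bar>a \<bullet> b\<bar> \<le> (norm a)^2 + (norm b)^2" for a b :: 'b
  using Cauchy_Schwarz_ineq2[of a b] sum_squares_bound[of "norm a" "norm b"]
   mult_nonneg_nonneg[OF norm_ge_zero[of a] norm_ge_zero[of b]] by linarith
 then show "AE x in lebesgue. norm (indicator D x *R (f x \<bullet> g x))
   \<le> norm (indicator D x *R ((norm (f x))^2 + (norm (g x))^2))" by (auto simp: indicator_def)
qed

lemma L2_mult_integrable:
 fixes f g :: "'a::euclidean_space => real" shows "L2 D f ==> L2 D g ==> set_integrable lebesgue D (%x. f x * g x)"
 using L2_inner_integrable[of D f g] by simp

lemma discriminant_bound:
 fixes a b c :: real assumes "!!t. 0 \<le> a * t^2 + 2 * b * t + c" "0 \<le> a" "0 \<le> c" shows "b^2 \<le> a * c" proof (cases "a = 0")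
 case True
 have "b = 0" proof (rule ccontr)
  assume "b ~= 0"
  then show False using assms(1)[of "- (c + 1) / (2 * b)"] True by (simp add: field_simps)
 qed
 then show ?thesis using True by simp
next
 case False
 then have a: "a > 0" using assms by simp
 have "0 \<le> a * (a * (-b/a)^2 + 2 * b * (-b/a) + c)" using assms(1)[of "-b/a"] a by simp
 also have "... = a * c - b^2" using a by (simp add: field_simps power2_eq_square)
 finally show ?thesis by simp
qed

lemma L2_Cauchy_Schwarz:
 fixes f g :: "'a::euclidean_space => 'b::euclidean_space" assumes "L2 D f" "L2 D g"
 shows "\<bar>LINT x:D. f x \<bullet> g x\<bar> \<le> L2norm D f * L2norm D g" proof -
 have i: "set_integrable lebesgue D (%x. f x \<bullet> g x)"
  "set_integrable lebesgue D (%x. (norm (f x))^2)" "set_integrable lebesgue D (%x. (norm (g x))^2)"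
  using assms L2_inner_integrable unfolding L2_def by auto
 have "0 \<le> (L2norm D f)^2 * t^2 + 2 * (LINT x:D. f x \<bullet> g x) * t + (L2norm D g)^2" for t proof -
  have "0 \<le> (LINT x:D. (norm (t *R f x + g x))^2)" using L2norm_sq_eq[of D "%x. t *R f x + g x"] by (metis zero_le_power2)
  also have "... = (LINT x:D. t^2 * (norm (f x))^2 + (2 * t) * (f x \<bullet> g x) + (norm (g x))^2)"
  proof (rule arg_cong[where f="set_lebesgue_integral lebesgue D"], rule ext)
   show "(norm (t *R f x + g x))^2 = t^2 * (norm (f x))^2 + (2 * t) * (f x \<bullet> g x) + (norm (g x))^2" for x unfolding power2_norm_eq_inner
    by (simp add: inner_simps inner_commute[of "g x" "f x"] power2_eq_square algebra_simps)
  qed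
  also have "... = t^2 * (L2norm D f)^2 + (2 * t) * (LINT x:D. f x \<bullet> g x) + (L2norm D g)^2"
   using i by (simp add: L2norm_sq_eq set_integral_add)
  finally show ?thesis by (simp add: algebra_simps)
 qed
 then have "(LINT x:D. f x \<bullet> g x)^2 \<le> (L2norm D f)^2 * (L2norm D g)^2" by (intro discriminant_bound) auto
 then have "(\<bar>LINT x:D. f x \<bullet> g x\<bar>)^2 \<le> (L2norm D f * L2norm D g)^2" by (simp add: power_mult_distrib)
 then show ?thesis by (rule power2_le_imp_le) simp
qed

lemma L2norm_sq_mono: assumes g: "L2 D g" and le: "AE x in lebesgue. x \<in> D --> norm (f x) \<le> c * norm (g x)"
 shows "(L2norm D f)^2 \<le> c^2 * (L2norm D g)^2" proof -
 have "(LINT x:D. (norm (f x))^2) \<le> (LINT x:D. c^2 * (norm (g x))^2)" unfolding set_lebesgue_integral_def proof (rule integral_mono_AE')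
  show "integrable lebesgue (%x. indicat_real D x *R (c^2 * (norm (g x))^2))"
   using g set_integrable_mult_right[of "c^2" lebesgue D "%x. (norm (g x))^2"] by (simp add: L2_def set_integrable_def)
  show "AE x in lebesgue. indicat_real D x *R (norm (f x))^2 \<le> indicat_real D x *R (c^2 * (norm (g x))^2)" using le proof eventually_elim
   case (elim x)
   then show ?case using power_mono[of "norm (f x)" "c * norm (g x)" 2] by (auto simp: indicator_def power_mult_distrib)
  qed
  show "AE x in lebesgue. 0 \<le> indicat_real D x *R (c^2 * (norm (g x))^2)" by (auto simp: indicator_def)
 qed
 then show ?thesis by (simp add: L2norm_sq_eq)
qed

lemma L2norm_sq_add_le: assumes "L2 D f" "L2 D g" shows "(L2norm D (%x. f x + g x))^2 \<le> 2 * (L2norm D f)^2 + 2 * (L2norm D g)^2" proof -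
 have i: "set_integrable lebesgue D (%x. (norm (f x))^2)" "set_integrable lebesgue D (%x. (norm (g x))^2)"
  "set_integrable lebesgue D (%x. (norm (f x + g x))^2)" using assms L2_add[OF assms] unfolding L2_def by auto
 have "(LINT x:D. (norm (f x + g x))^2) \<le> (LINT x:D. 2 * (norm (f x))^2 + 2 * (norm (g x))^2)"
  using i norm_add_sq_le by (intro set_integral_mono set_integral_add(1) set_integrable_mult_right) auto
 also have "... = 2 * (LINT x:D. (norm (f x))^2) + 2 * (LINT x:D. (norm (g x))^2)" using i by (simp add: set_integral_add)
 finally show ?thesis by (simp add: L2norm_sq_eq)
qed

lemma L2norm_sq_diff_le: assumes "L2 D f" "L2 D g" shows "(L2norm D (%x. f x - g x))^2 \<le> 2 * (L2norm D f)^2 + 2 * (L2norm D g)^2" proof -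
 have x: "AE x in lebesgue. x \<in> D --> norm (- g x) = norm (g x)" by (rule AE_I2) simp
 have "L2norm D (%x. - g x) = L2norm D g" by (rule L2norm_cong_AE[OF x])
 have n: "L2norm D (%x. - g x) = L2norm D g" by (rule L2norm_cong_AE) (rule AE_I2, simp)
 have "L2 D (%x. (-1) *R g x)" using assms(2) by (rule L2_scale)
 then have "L2 D (%x. - g x)" by simp
 from L2norm_sq_add_le[OF assms(1) this] show ?thesis by (simp only: n diff_conv_add_uminus)
qed

lemma set_integrable_continuous_bounded:
 fixes f :: "'a::euclidean_space => 'b::euclidean_space" assumes "continuous_on UNIV f" "bounded D" "D \<in> sets lebesgue"
 shows "set_integrable lebesgue D f" proof -
 obtain r where "D <= ball 0 r" using bounded_subset_ballD[OF assms(2), of 0] by auto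
 then have r: "D <= cball 0 r" using ball_subset_cball by (rule order_trans)
 have "set_integrable lborel (cball 0 r) f" unfolding set_integrable_def
  by (intro borel_integrable_compact compact_cball continuous_on_subset[OF assms(1)]) auto
 then have "set_integrable lebesgue (cball 0 r) f" unfolding set_integrable_def
  by (subst integrable_completion) (auto intro: borel_measurable_integrable)
 then show ?thesis by (rule set_integrable_subset) (use r assms in auto)
qed

lemma L2_continuous_bounded:
 fixes f :: "'a::euclidean_space => 'b::euclidean_space" assumes "continuous_on UNIV f" "bounded D" "D \<in> sets lebesgue" shows "L2 D f"
 unfolding L2_def proof
 have "integrable lebesgue (%x. indicator D x *R f x)" using set_integrable_continuous_bounded[OF assms] by (simp add: set_integrable_def)
 then show "set_borel_measurable lebesgue D f" by (simp add: set_borel_measurable_def borel_measurable_integrable)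
 show "set_integrable lebesgue D (%x. (norm (f x))^2)" using assms by (intro set_integrable_continuous_bounded continuous_intros) auto
qed

lemma L2norm_sq_le_measure: assumes D: "D \<in> lmeasurable" and le: "!!x. x \<in> D ==> norm (f x) \<le> S"
 shows "(L2norm D f)^2 \<le> S^2 * measure lebesgue D" proof -
 have "(LINT x:D. (norm (f x))^2) \<le> (LINT x:D. S^2)" unfolding set_lebesgue_integral_def proof (rule integral_mono_AE')
  show "integrable lebesgue (%x. indicat_real D x *R S^2)" using D by (auto simp: fmeasurable_def)
  show "AE x in lebesgue. indicat_real D x *R (norm (f x))^2 \<le> indicat_real D x *R S^2"
   using le power_mono[OF le, of _ 2] by (auto simp: indicator_def)
  show "AE x in lebesgue. 0 \<le> indicat_real D x *R S^2" by (auto simp: indicator_def)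
 qed
 also have "... = S^2 * measure lebesgue D" using D by (simp add: set_lebesgue_integral_def)
 finally show ?thesis by (simp add: L2norm_sq_eq)
qed

lemma measure_le_of_subset_cball2:
 fixes c :: pt assumes "D <= cball c r" "D \<in> sets lebesgue" "0 \<le> r" shows "measure lebesgue D \<le> 4 * r^2" proof -
 have sub: "D <= cbox (c - r *R One) (c + r *R One)" proof
  fix x assume "x \<in> D"
  then have "norm (x - c) \<le> r" using assms by (auto simp: dist_norm norm_minus_commute)
  then have "\<bar>(x - c) \<bullet> i\<bar> \<le> r" if "i \<in> Basis" for i using Basis_le_norm[OF that, of "x - c"] by linarith
  then show "x \<in> cbox (c - r *R One) (c + r *R One)" by (force simp: mem_box inner_simps abs_le_iff)
 qed
 have "measure lebesgue D \<le> measure lebesgue (cbox (c - r *R One) (c + r *R One))" by (rule measure_mono_fmeasurable[OF sub]) (use assms in auto)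
 also have "... = (\<Prod>b\<in>(Basis::pt set). 2 * r)" using assms(3) by (subst measure_completion, simp, subst content_cbox)
   (auto simp: inner_simps intro!: prod.cong)
 also have "... = 4 * r^2" by (simp add: power2_eq_square)
 finally show ?thesis .
qed

text \<open>Meshes cover the domain only up to null sets, hence a partition almost everywhere.\<close>

lemma set_integral_sum_partition:
 fixes f :: "'a::euclidean_space => 'b::euclidean_space" assumes fin: "finite I" and E: "!!i. i \<in> I ==> set_integrable lebesgue (E i) f"
  and part: "AE x in lebesgue. (\<Sum>i\<in>I. indicator (E i) x) = (indicator D x :: real)"
 shows "set_integrable lebesgue D f & (LINT x:D. f x) = (\<Sum>i\<in>I. LINT x:E i. f x)" proof -
 have s: "integrable lebesgue (%x. \<Sum>i\<in>I. indicator (E i) x *R f x)" using E by (auto simp: set_integrable_def)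
 have ae: "AE x in lebesgue. (\<Sum>i\<in>I. indicator (E i) x *R f x) = indicator D x *R f x"
  using part by eventually_elim (simp add: scaleR_sum_left[symmetric])
 have "integrable lebesgue (%x. indicator D x *R f x)" by (rule integrable_lebesgue_cong_AE[OF s ae])
 moreover have "integral\<^sup>L lebesgue (%x. indicator D x *R f x) = (\<Sum>i\<in>I. LINT x|lebesgue. indicator (E i) x *R f x)"
  using E by (subst integral_lebesgue_cong_AE[OF ae, symmetric])
   (simp add: set_integrable_def Bochner_Integration.integral_sum)
 ultimately show ?thesis by (simp add: set_integrable_def set_lebesgue_integral_def)
qed

section \<open>Continuously differentiable functions\<close>

lemma C1_D: "C1 phi dphi ==> (phi has_derivative (%h. dphi x \<bullet> h)) (at x)" by (simp add: C1_def)

lemma C1_continuous: "C1 phi dphi ==> continuous_on UNIV phi" unfolding C1_def by (meson continuous_at_imp_continuous_on has_derivative_continuous)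

lemma C1_continuous_grad: "C1 phi dphi ==> continuous_on UNIV dphi" by (simp add: C1_def)

lemma C1_const: "C1 (%x. c) (%x. 0)" by (simp add: C1_def)

lemma C1_inner: "C1 (%x. x \<bullet> a + c) (%x. a)" unfolding C1_def by (auto intro!: derivative_eq_intros simp: inner_commute)

lemma C1_add: "C1 f df ==> C1 g dg ==> C1 (%x. f x + g x) (%x. df x + dg x)"
 unfolding C1_def by (auto intro!: derivative_eq_intros continuous_intros simp: inner_add_left)

lemma C1_cmult: "C1 f df ==> C1 (%x. c * f x) (%x. c *R df x)" unfolding C1_def by (auto intro!: derivative_eq_intros continuous_intros)

lemma C1_mult: assumes "C1 f df" "C1 g dg" shows "C1 (%x. f x * g x) (%x. f x *R dg x + g x *R df x)" proof -
 have "continuous_on UNIV f" "continuous_on UNIV g" using assms C1_continuous by blast+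
 then show ?thesis using assms unfolding C1_def by (auto intro!: derivative_eq_intros continuous_intros simp: inner_add_left algebra_simps)
qed

lemma C1_compose_real: assumes "C1 f df" "!!t. (h has_real_derivative h' t) (at t)" "continuous_on UNIV h'"
 shows "C1 (%x. h (f x)) (%x. h' (f x) *R df x)" unfolding C1_def proof safe
 fix x
 have "(h has_derivative (%t. t * h' (f x))) (at (f x))" using assms(2)[of "f x"] by (simp add: has_field_derivative_def mult_commute_abs)
 from has_derivative_compose[OF C1_D[OF assms(1)] this]
 show "((%x. h (f x)) has_derivative (%ha. (h' (f x) *R df x) \<bullet> ha)) (at x)" by (simp add: mult.commute)
next
 have "continuous_on UNIV (%x. h' (f x))" by (rule continuous_on_compose2[OF assms(3) C1_continuous[OF assms(1)]]) auto
 then show "continuous_on UNIV (%x. h' (f x) *R df x)" using assms(1) by (intro continuous_intros) (auto simp: C1_def)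
qed

lemma C1_sum:
 "finite I ==> (!!i. i \<in> I ==> C1 (f i) (df i)) ==> C1 (%x. \<Sum>i\<in>I. f i x) (%x. \<Sum>i\<in>I. df i x)"
 by (induction I rule: finite_induct) (auto intro: C1_const C1_add)

lemma C1_real_iff:
 fixes f :: "real => real" shows "C1 f f' \<longleftrightarrow> (\<forall>x. (f has_real_derivative f' x) (at x)) & continuous_on UNIV f'"
 by (simp add: C1_def has_field_derivative_def mult_commute_abs inner_real_def)

lemma C1_unique: "C1 f d ==> C1 f d' ==> d = d'" proof
 fix x assume "C1 f d" "C1 f d'"
 then have "(%h. d x \<bullet> h) = (%h. d' x \<bullet> h)" using C1_D has_derivative_unique by blast
 then show "d x = d' x" by (metis inner_diff_left inner_eq_zero_iff right_minus_eq)
qed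

text \<open>Being \<open>C\<^sup>1\<close> on the whole space, a quadratic bump times a polynomial is a test
  function without any gluing of triangle-wise bubbles.\<close>

definition bump :: "'a::euclidean_space => real => 'a => real" where
 "bump c R x = (max 0 (1 - ((x - c) \<bullet> (x - c)) / R^2))^2"

definition dbump :: "'a::euclidean_space => real => 'a => 'a" where
 "dbump c R x = (- 4 / R^2 * max 0 (1 - ((x - c) \<bullet> (x - c)) / R^2)) *R (x - c)"

lemma pos_sq_deriv: "((%t::real. (max 0 t)^2) has_real_derivative 2 * max 0 t) (at t)" proof -
 consider "t > 0" | "t < 0" | "t = 0" by linarith
 then show ?thesis proof cases
  case 1
  have "((%t::real. t^2) has_real_derivative 2 * t) (at t)" by (auto intro!: derivative_eq_intros)
  then have "((%t::real. (max 0 t)^2) has_real_derivative 2 * t) (at t)" by (rule DERIV_cong_ev[THEN iffD1, rotated 3])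
    (use 1 eventually_nhds_in_open[of "{0<..}" t] in \<open>auto elim!: eventually_mono\<close>)
  then show ?thesis using 1 by simp
 next
  case 2
  have "((%t::real. 0) has_real_derivative 0) (at t)" by simp
  then have "((%t::real. (max 0 t)^2) has_real_derivative 0) (at t)" by (rule DERIV_cong_ev[THEN iffD1, rotated 3])
    (use 2 eventually_nhds_in_open[of "{..<0}" t] in \<open>auto elim!: eventually_mono\<close>)
  then show ?thesis using 2 by simp
 next
  case 3
  have "((%h. ((max 0 (0 + h))^2 - (max 0 0)^2) / h) \<longlongrightarrow> 0) (at (0::real))" proof (rule Lim_null_comparison)
   show "\<forall>\<^sub>F h in at (0::real). norm (((max 0 (0 + h))^2 - (max 0 0)^2) / h) \<le> \<bar>h\<bar>"
    by (auto simp: power2_eq_square max_def intro!: always_eventually)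
   show "((%h. \<bar>h\<bar>) \<longlongrightarrow> 0) (at (0::real))" using tendsto_rabs[OF tendsto_ident_at, of 0 UNIV] by simp
  qed
  then show ?thesis using 3 by (simp add: DERIV_def)
 qed
qed

lemma C1_bump: "R ~= 0 ==> C1 (bump c R) (dbump c R)" proof -
 assume R: "R ~= 0"
 have "C1 (%x. (x - c) \<bullet> (x - c)) (%x. 2 *R (x - c))" unfolding C1_def
  by (auto intro!: derivative_eq_intros continuous_intros simp: inner_commute)
 from C1_add[OF C1_const[of 1] C1_cmult[OF this, of "- 1 / R^2"]]
 have "C1 (%x. 1 - ((x - c) \<bullet> (x - c)) / R^2) (%x. (- 2 / R^2) *R (x - c))" by simp
 from C1_compose_real[OF this pos_sq_deriv]
 show ?thesis unfolding bump_def[abs_def] dbump_def[abs_def] by (simp add: continuous_intros mult_ac)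
qed

lemma bump_nonneg: "0 \<le> bump c R x" by (simp add: bump_def)

lemma bump_le_1: "bump c R x \<le> 1" by (auto simp: bump_def max_def power_le_one_iff power2_eq_square intro!: mult_le_one)

lemma bump_eq_0: "R > 0 ==> R \<le> dist x c ==> bump c R x = 0"
 by (auto simp: bump_def dist_norm power2_norm_eq_inner[symmetric] max_def divide_simps
   dest!: power_mono[of R _ 2])

lemma bump_pos: "R > 0 ==> dist x c < R ==> 0 < bump c R x" using power_strict_mono[of "dist x c" R 2]
 by (auto simp: bump_def dist_norm power2_norm_eq_inner[symmetric] max_def divide_simps)

lemma supp_subset_closed: "closed S ==> (!!x. x \<notin> S ==> f x = 0) ==> supp f <= S" unfolding supp_def by (rule closure_minimal) auto

lemma compact_supp: "compact S ==> (!!x. x \<notin> S ==> f x = 0) ==> compact (supp f)" using supp_subset_closed[of S f] compact_imp_closed[of S]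
 by (metis bounded_subset compact_eq_bounded_closed supp_def closed_closure)

lemma notin_supp: "x \<notin> supp f ==> f x = 0" using closure_subset[of "{x. f x ~= 0}"] unfolding supp_def by blast

lemma C1_grad_notin_supp: assumes "C1 f df" "x \<notin> supp f" shows "df x = 0" proof -
 have ev: "\<forall>\<^sub>F y in nhds x. f y = 0" proof -
  have "open (- supp f)" by (simp add: supp_def open_Compl)
  from eventually_nhds_in_open[OF this, of x] show ?thesis using assms(2) by (auto elim!: eventually_mono intro: notin_supp)
 qed
 have "(f has_derivative (%h. 0)) (at x)" by (rule has_derivative_transform_eventually[of "%_. 0"])
   (use ev eventually_nhds_x_imp_x[OF ev] in \<open>auto simp: eventually_at_filter elim!: eventually_mono\<close>)
 then have "(%h. df x \<bullet> h) = (%h. 0)" using C1_D[OF assms(1)] has_derivative_unique by blast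
 then show ?thesis by (metis inner_eq_zero_iff)
qed

lemma norm_dbump_le: assumes "R > 0" shows "norm (dbump c R x) \<le> 4 / R" proof (cases "dist x c < R")
 case True
 then have "norm (x - c) \<le> R" by (simp add: dist_norm)
 moreover have "\<bar>max 0 (1 - ((x - c) \<bullet> (x - c)) / R^2)\<bar> \<le> 1" by (auto simp: max_def)
 ultimately have "\<bar>max 0 (1 - ((x - c) \<bullet> (x - c)) / R^2)\<bar> * norm (x - c) \<le> 1 * R" by (intro mult_mono) auto
 then have "4 / R^2 * (\<bar>max 0 (1 - ((x - c) \<bullet> (x - c)) / R^2)\<bar> * norm (x - c)) \<le> 4 / R^2 * R"
  using assms by (intro mult_left_mono) auto
 then show ?thesis using assms by (simp add: dbump_def abs_mult power2_eq_square)
next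
 case False
 then have "R^2 \<le> (x - c) \<bullet> (x - c)" using assms power_mono[of R "dist x c" 2] by (simp add: dist_norm power2_norm_eq_inner)
 then have "dbump c R x = 0" using assms by (simp add: dbump_def max_def)
 then show ?thesis using assms by simp
qed

section \<open>The divergence theorem on a triangle\<close>

definition det2 :: "pt => pt => real" where
 "det2 a b = a$1 * b$2 - a$2 * b$1"

lemma Basis_pt: "(Basis :: pt set) = {axis 1 1, axis 2 1}" by (auto simp: Basis_vec_def UNIV_2)

lemma borel_measurable_pair_vec:
 "(%z::real\<times>real. vector [fst z, snd z] :: pt) \<in> borel_measurable borel" proof -
 have "(%z::real\<times>real. vector [fst z, snd z] :: pt) = (%z. \<chi> i. if i = 1 then fst z else snd z)" by (auto simp: vec_eq_iff forall_2)
 moreover have "continuous_on UNIV (%z::real\<times>real. if i = 1 then fst z else snd z)" for i :: 2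
  by (cases "i = 1") (auto intro!: continuous_intros)
 then have "continuous_on UNIV (%z::real\<times>real. (\<chi> i. if i = 1 then fst z else snd z) :: pt)" by (rule continuous_on_vec_lambda)
 ultimately show ?thesis by (simp add: borel_measurable_continuous_onI)
qed

lemma lborel_real2: "distr (lborel :: (real \<times> real) measure) borel (%z. vector [fst z, snd z]) = (lborel :: pt measure)"
proof (rule lborel_eqI[symmetric])
 have m: "(%z::real\<times>real. vector [fst z, snd z] :: pt) \<in> borel_measurable lborel" using borel_measurable_pair_vec by simp
 show "emeasure (distr lborel borel (%z. vector [fst z, snd z])) (box l u) = ennreal (\<Prod>b\<in>Basis. (u - l) \<bullet> b)"
  if le: "!!b. b \<in> Basis ==> l \<bullet> b \<le> u \<bullet> b" for l u :: pt proof -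
  have le': "l$1 \<le> u$1" "l$2 \<le> u$2" using le[of "axis 1 1"] le[of "axis 2 1"] by (auto simp: Basis_pt inner_axis)
  have "(%z::real\<times>real. vector [fst z, snd z] :: pt) -` box l u \<inter> space lborel = box (l$1, l$2) (u$1, u$2)"
   by (auto simp: mem_box Basis_pt inner_axis Basis_prod_def)
  moreover have "emeasure lborel (box (l$1, l$2) (u$1, u$2)) = ennreal ((u$1 - l$1) * (u$2 - l$2))"
   using le' by (subst emeasure_lborel_box) (auto simp: Basis_prod_def)
  ultimately show ?thesis using m by (subst emeasure_distr) (auto simp: Basis_pt inner_axis axis_eq_axis)
 qed
qed simp

lemma lborel_linear_image:
 fixes L :: "pt => pt" assumes L: "linear L" and d: "det (matrix L) ~= 0"
 shows "density (distr lborel borel L) (%_. ennreal \<bar>det (matrix L)\<bar>) = lborel" proof (rule lborel_eqI[symmetric])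
 have m: "L \<in> borel_measurable lborel" using L by (simp add: borel_measurable_continuous_onI linear_continuous_on linear_linear)
 have inj: "inj L" and surj: "surj L" using L d det_nz_iff_inj linear_injective_imp_surjective by blast+
 fix l u :: pt assume le: "!!b. b \<in> Basis ==> l \<bullet> b \<le> u \<bullet> b"
 obtain h where h: "linear h" "!!x. h (L x) = x" "!!x. L (h x) = x" using linear_injective_isomorphism[OF L inj] by blast
 have pre: "L -` box l u = h ` box l u" using h by (auto simp: image_iff) metis
 have pm: "L -` box l u \<in> lmeasurable" unfolding pre using h(1) by (intro measurable_linear_image) auto
 have "measure lebesgue (L ` (L -` box l u)) = \<bar>det (matrix L)\<bar> * measure lebesgue (L -` box l u)" by (rule measure_linear_image[OF L pm])
 moreover have "L ` (L -` box l u) = box l u" using surj by auto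
 ultimately have eq: "measure lebesgue (box l u) = \<bar>det (matrix L)\<bar> * measure lebesgue (L -` box l u)" by simp
 have bm: "L -` box l u \<in> sets borel" using measurable_sets[OF m, of "box l u"] by simp
 have e: "emeasure lborel (L -` box l u) = ennreal (measure lebesgue (L -` box l u))" proof -
  have "emeasure lebesgue (L -` box l u) = emeasure lborel (L -` box l u)" using bm by simp
  then show ?thesis using emeasure_eq_measure2[OF pm] by simp
 qed
 have "emeasure (density (distr lborel borel L) (%_. ennreal \<bar>det (matrix L)\<bar>)) (box l u)
   = ennreal \<bar>det (matrix L)\<bar> * emeasure lborel (L -` box l u)"
  using m by (subst emeasure_density) (auto simp: nn_integral_cmult_indicator emeasure_distr)
 also have "... = ennreal (measure lebesgue (box l u))" by (simp add: e eq ennreal_mult)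
 also have "... = ennreal (\<Prod>b\<in>Basis. (u - l) \<bullet> b)" using le by (simp add: measure_lborel_box_eq)
 finally show "emeasure (density (distr lborel borel L) (%_. ennreal \<bar>det (matrix L)\<bar>)) (box l u) = ennreal (\<Prod>b\<in>Basis. (u - l) \<bullet> b)" .
qed simp

text \<open>The change of variables to the coordinates given by two sides of a triangle.\<close>

lemma lborel_parallelogram:
 fixes g :: "pt => real" assumes d: "det2 a b ~= 0" and g: "g \<in> borel_measurable borel" shows "integral\<^sup>L lborel g
  = \<bar>det2 a b\<bar> * (LINT z|lborel. g (nu + fst z *R a + snd z *R b))" proof -
 define L :: "pt => pt" where "L = (%x. x$1 *R a + x$2 *R b)"
 have L: "linear L" by (auto simp: L_def linear_iff algebra_simps)
 have "det (matrix L) = det2 a b" by (simp add: det_2 matrix_def L_def det2_def axis_def)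
 with d have dL: "det (matrix L) ~= 0" "\<bar>det (matrix L)\<bar> = \<bar>det2 a b\<bar>" by auto
 have mL: "L \<in> borel_measurable borel" using L by (simp add: borel_measurable_continuous_onI linear_continuous_on linear_linear)
 note mI = borel_measurable_pair_vec
 have g': "(%x. g (nu + x)) \<in> borel_measurable borel" using measurable_compose[OF _ g, of "%x. nu + x" borel] by auto
 have g'': "(%x. g (nu + L x)) \<in> borel_measurable borel" using measurable_compose[OF mL g'] by simp
 have "integral\<^sup>L lborel g = integral\<^sup>L (distr lborel borel ((+) nu)) g" by (simp add: lborel_distr_plus)
 also have "... = (LINT x|lborel. g (nu + x))" using g by (subst integral_distr) auto
 also have "... = (LINT x|density (distr lborel borel L) (%_. ennreal \<bar>det2 a b\<bar>). g (nu + x))"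
  using lborel_linear_image[OF L dL(1)] dL(2) by simp
 also have "... = (LINT x|distr lborel borel L. \<bar>det2 a b\<bar> * g (nu + x))" using g' by (subst integral_density) auto
 also have "... = \<bar>det2 a b\<bar> * (LINT x|lborel. g (nu + L x))" using g' mL by (subst integral_distr) auto
 also have "(LINT x|lborel. g (nu + L x)) = (LINT x|distr (lborel :: (real \<times> real) measure) borel (%z. vector [fst z, snd z]). g (nu + L x))"
  by (simp add: lborel_real2)
 also have "... = (LINT z|lborel. g (nu + L (vector [fst z, snd z])))" using g'' mI by (subst integral_distr) auto
 finally show ?thesis by (simp add: L_def add.assoc)
qed

lemma det2_indep: assumes "det2 a b ~= 0" "s *R a + t *R b = s' *R a + t' *R b" shows "s = s' & t = t'" proof -
 have "(s - s') * det2 a b = det2 ((s *R a + t *R b) - (s' *R a + t' *R b)) b"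
  "(t - t') * det2 a b = det2 a ((s *R a + t *R b) - (s' *R a + t' *R b))" by (simp_all add: det2_def algebra_simps)
 then show ?thesis using assms by (simp add: det2_def)
qed

lemma triangle_directional_integral:
 fixes nu a b :: pt assumes d: "det2 a b ~= 0" and f: "C1 f df"
 defines "T \<equiv> {nu + s *R a + t *R b | s t. 0 \<le> s & 0 \<le> t & s + t \<le> 1}" shows "(LINT x:T. df x \<bullet> a)
   = \<bar>det2 a b\<bar> * (LINT t:{0..1}|lborel. f (nu + (1 - t) *R a + t *R b) - f (nu + t *R b))" proof -
 define R where "R = {z::real\<times>real. 0 \<le> fst z & 0 \<le> snd z & fst z + snd z \<le> 1}"
 define Phi where "Phi = (%z. nu + fst z *R a + snd z *R b)"
 have cR: "compact R" proof -
  have "closed R" unfolding R_def by (intro closed_Collect_conj closed_Collect_le continuous_intros)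
  moreover have "R <= cbox (0,0) (1,1)" by (auto simp: R_def mem_box Basis_prod_def)
  then have "bounded R" using bounded_cbox bounded_subset by blast
  ultimately show ?thesis by (simp add: compact_eq_bounded_closed)
 qed
 have T: "T = Phi ` R" by (force simp: T_def Phi_def R_def image_iff)
 have cPhi: "continuous_on UNIV Phi" unfolding Phi_def by (intro continuous_intros)
 have cT: "compact T" unfolding T using cR cPhi by (intro compact_continuous_image continuous_on_subset[OF cPhi]) auto
 have inR: "Phi z \<in> T \<longleftrightarrow> z \<in> R" for z using det2_indep[OF d] by (force simp: T Phi_def add.assoc prod_eq_iff)
 have cg: "continuous_on UNIV (%x. df x \<bullet> a)" using C1_continuous_grad[OF f] by (intro continuous_intros)
 define g where "g = (%x. indicator T x *R (df x \<bullet> a))"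
 have mg: "g \<in> borel_measurable borel" unfolding g_def
  using cT cg by (intro borel_measurable_scaleR borel_measurable_indicator borel_measurable_continuous_onI)
   (auto intro: borel_closed compact_imp_closed)
 define G where "G = (%z. indicator R z *R (df (Phi z) \<bullet> a))"
 have gG: "g (Phi z) = G z" for z by (simp add: g_def G_def inR indicator_def)
 have cG: "continuous_on UNIV (%z. df (Phi z) \<bullet> a)" by (rule continuous_on_compose2[OF cg cPhi]) auto
 have iG: "integrable (lborel \<Otimes>\<^sub>M lborel) (case_prod (%s t. G (s,t)))"
  unfolding lborel_prod G_def using borel_integrable_compact[OF cR continuous_on_subset[OF cG]] by (simp add: case_prod_unfold)
 have inner: "(LINT s|lborel. G (s,t)) = indicator {0..1} t *R (f (nu + (1 - t) *R a + t *R b) - f (nu + t *R b))" for t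
 proof (cases "t \<in> {0..1}")
  case True
  have "(LINT s|lborel. G (s,t)) = (LINT s|lborel. indicator {0..1-t} s *R (df (Phi (s,t)) \<bullet> a))"
   using True by (intro Bochner_Integration.integral_cong) (auto simp: G_def R_def indicator_def)
  also have "... = f (Phi (1 - t, t)) - f (Phi (0, t))" proof (rule integral_FTC_Icc)
   fix s assume "0 \<le> s" "s \<le> 1 - t"
   have "((%s. Phi (s,t)) has_derivative (%h. h *R a)) (at s within {0..1-t})" unfolding Phi_def by (auto intro!: derivative_eq_intros)
   from has_derivative_compose[OF this C1_D[OF f]]
   show "((%s. f (Phi (s,t))) has_vector_derivative df (Phi (s,t)) \<bullet> a) (at s within {0..1-t})" by (simp add: has_vector_derivative_def)
  next
   show "continuous_on {0..1-t} (%s. df (Phi (s,t)) \<bullet> a)"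
    by (rule continuous_on_compose2[OF cG, of _ "%s. (s,t)"]) (auto intro!: continuous_intros)
  qed (use True in auto)
  finally show ?thesis using True by (simp add: Phi_def)
 next
  case False
  then have "G (s,t) = 0" for s by (auto simp: G_def R_def indicator_def)
  then show ?thesis using False by simp
 qed
 have "(LINT x:T. df x \<bullet> a) = integral\<^sup>L lborel g"
  unfolding set_lebesgue_integral_def g_def[symmetric] using mg by (subst integral_completion) auto
 also have "... = \<bar>det2 a b\<bar> * (LINT z|lborel. g (Phi z))" unfolding Phi_def by (rule lborel_parallelogram[OF d mg])
 also have "(LINT z|lborel. g (Phi z)) = integral\<^sup>L (lborel \<Otimes>\<^sub>M lborel) (case_prod (%s t. G (s,t)))"
  by (simp add: gG lborel_prod case_prod_unfold)
 also have "... = (LINT t|lborel. LINT s|lborel. G (s,t))" using lborel_pair.integral_snd[OF iG] by simp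
 finally show ?thesis by (simp add: inner set_lebesgue_integral_def)
qed

lemma rot_simps: "rot v $ 1 = v $ 2" "rot v $ 2 = - v $ 1" by (simp_all add: rot_def)

lemma elen_swap [simp]: "elen (prod.swap e) = elen e" by (simp add: elen_def dist_commute)

lemma elen_nonneg: "0 \<le> elen e" by (simp add: elen_def)

lemma nrm_swap: "nrm (prod.swap e) = - nrm e" by (auto simp: nrm_def vec_eq_iff forall_2 rot_simps algebra_simps diff_divide_distrib)

lemma elen_nrm: "elen e * nrm e $ 1 = (snd e - fst e) $ 2" "elen e * nrm e $ 2 = - (snd e - fst e) $ 1" by (auto simp: nrm_def rot_simps elen_def)

lemma continuous_on_edge:
 fixes g :: "pt => 'b::real_normed_vector" assumes "continuous_on UNIV g" shows "continuous_on A (%t. g (x + t *R y))"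
 by (rule continuous_on_compose2[OF assms]) (auto intro!: continuous_intros)

lemma eint_eq: assumes g: "continuous_on UNIV g" shows "eint e g = elen e * (LINT t:{0..1}|lborel. g (fst e + t *R (snd e - fst e)))"
proof (cases "elen e = 0")
 case True
 then show ?thesis by (simp add: eint_def set_lebesgue_integral_def)
next
 case False
 define l where "l = elen e"
 have l: "l > 0" using False elen_nonneg[of e] by (simp add: l_def)
 define G where "G = (%s. g (fst e + (s / l) *R (snd e - fst e)))"
 have cG: "continuous_on UNIV G" unfolding G_def by (rule continuous_on_compose2[OF g]) (use l in \<open>auto intro!: continuous_intros\<close>)
 have "eint e g = (LINT s|lebesgue. indicator {0<..<l} s *R G s)" by (simp add: eint_def G_def l_def set_lebesgue_integral_def)
 also have "... = (LINT s|lborel. indicator {0<..<l} s *R G s)"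
  using borel_measurable_scaleR[OF borel_measurable_indicator borel_measurable_continuous_onI[OF cG], of "{0<..<l}"]
  by (intro integral_completion) simp
 also have "... = l * (LINT t|lborel. indicator {0<..<l} (0 + l * t) *R G (0 + l * t))"
  using l by (subst lborel_integral_real_affine[where c = l and t = 0]) auto
 also have "(LINT t|lborel. indicator {0<..<l} (0 + l * t) *R G (0 + l * t))
   = (LINT t:{0<..<1}|lborel. g (fst e + t *R (snd e - fst e)))" unfolding set_lebesgue_integral_def by (intro Bochner_Integration.integral_cong refl)
   (use l in \<open>auto simp: G_def indicator_def zero_less_mult_iff mult_less_cancel_left1\<close>)
 also have "... = (LINT t:{0..1}|lborel. g (fst e + t *R (snd e - fst e)))" proof (rule set_integral_cong_set)
  have m: "set_borel_measurable lborel S (%t. g (fst e + t *R (snd e - fst e)))" if "S \<in> sets borel" for S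
   using borel_measurable_scaleR[OF borel_measurable_indicator borel_measurable_continuous_onI[OF continuous_on_edge[OF g]]] that
   by (simp add: set_borel_measurable_def)
  show "set_borel_measurable lborel {0<..<1} (%t. g (fst e + t *R (snd e - fst e)))"
   "set_borel_measurable lborel {0..1} (%t. g (fst e + t *R (snd e - fst e)))" by (auto intro: m)
  show "AE t in lborel. (t \<in> {0..1}) = (t \<in> {0<..<1::real})" using AE_lborel_singleton[of "0::real"] AE_lborel_singleton[of "1::real"]
   by eventually_elim auto
 qed
 finally show ?thesis by (simp add: l_def)
qed

lemma set_integral_01_reflect:
 fixes g :: "real => real" shows "(LINT t:{0..1}|lborel. g (1 - t)) = (LINT t:{0..1}|lborel. g t)" proof -
 have "(LINT t:{0..1}|lborel. g t) = (LINT t|lborel. indicator {0..1} (1 + (-1) * t) *R g (1 + (-1) * t))" unfolding set_lebesgue_integral_def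
  by (subst lborel_integral_real_affine[where c = "-1" and t = 1]) auto
 also have "... = (LINT t:{0..1}|lborel. g (1 - t))" unfolding set_lebesgue_integral_def
  by (intro Bochner_Integration.integral_cong refl) (auto simp: indicator_def)
 finally show ?thesis by simp
qed

lemma eint_swap: assumes g: "continuous_on UNIV g" shows "eint (prod.swap e) g = eint e g" proof -
 have "(LINT t:{0..1}|lborel. g (snd e + t *R (fst e - snd e)))
   = (LINT t:{0..1}|lborel. g (fst e + (1 - t) *R (snd e - fst e)))"
  by (rule arg_cong[where f="set_lebesgue_integral lborel {0..1}"]) (auto simp: algebra_simps)
 also have "... = (LINT t:{0..1}|lborel. g (fst e + t *R (snd e - fst e)))" by (rule set_integral_01_reflect)
 finally show ?thesis by (simp add: eint_eq[OF g])
qed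

lemma eint_flux: assumes "continuous_on UNIV f1" "continuous_on UNIV f2" shows "eint e (%x. f1 x * nrm e $ 1 + f2 x * nrm e $ 2) =
  (LINT t:{0..1}|lborel. f1 (fst e + t *R (snd e - fst e)) * (snd e - fst e) $ 2
             - f2 (fst e + t *R (snd e - fst e)) * (snd e - fst e) $ 1)" proof -
 have "eint e (%x. f1 x * nrm e $ 1 + f2 x * nrm e $ 2) =
  (LINT t:{0..1}|lborel. elen e * (f1 (fst e + t *R (snd e - fst e)) * nrm e $ 1
             + f2 (fst e + t *R (snd e - fst e)) * nrm e $ 2))" using assms by (subst eint_eq) (auto intro!: continuous_intros)
 also have "... = (LINT t:{0..1}|lborel. f1 (fst e + t *R (snd e - fst e)) * (elen e * nrm e $ 1)
             + f2 (fst e + t *R (snd e - fst e)) * (elen e * nrm e $ 2))"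
  by (rule arg_cong[where f="set_lebesgue_integral lborel {0..1}"]) (auto simp: algebra_simps)
 finally show ?thesis unfolding elen_nrm mult_minus_right by (simp only: add_uminus_conv_diff)
qed

lemma tri_param: "tri (nu, a, b) = {nu + s *R (a - nu) + t *R (b - nu) | s t. 0 \<le> s & 0 \<le> t & s + t \<le> 1}"
 by (simp add: tri_def verts_def convex_hull_3_alt)

lemma ccw_det2: "ccw (nu, a, b) \<longleftrightarrow> 0 < det2 (a - nu) (b - nu)" by (simp add: ccw_def det2_def)

text \<open>In the coordinates \<open>s, t\<close> given by the two sides at \<open>nu\<close> the field has
  components \<open>det2 F (b - nu)\<close> and \<open>det2 (a - nu) F\<close>, up to the Jacobian,
  and the three boundary values produced by integrating along coordinate lines are the fluxes
  through the three edges.\<close>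

theorem divergence_triangle: assumes ccw: "ccw (nu, a, b)" and f: "C1 f1 d1" "C1 f2 d2" shows "(LINT x:tri (nu, a, b). d1 x $ 1 + d2 x $ 2) =
  (\<Sum>e\<in>{(nu, a), (a, b), (b, nu)}. eint e (%x. f1 x * nrm e $ 1 + f2 x * nrm e $ 2))" proof -
 define a' where "a' = a - nu"
 define b' where "b' = b - nu"
 define J where "J = det2 a' b'"
 have J: "J > 0" using ccw by (simp add: ccw_det2 J_def a'_def b'_def)
 have J': "det2 b' a' = - J" by (simp add: J_def det2_def)
 have T: "tri (nu, a, b) = {nu + s *R a' + t *R b' | s t. 0 \<le> s & 0 \<le> t & s + t \<le> 1}" by (simp add: tri_param a'_def b'_def)
 have T': "tri (nu, a, b) = {nu + s *R b' + t *R a' | s t. 0 \<le> s & 0 \<le> t & s + t \<le> 1}"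
  unfolding T by (auto simp: algebra_simps) (metis add.commute)+
 have cf: "continuous_on UNIV f1" "continuous_on UNIV f2" using f C1_continuous by blast+
 define alpha where "alpha = (%x. (b'$2 / J) * f1 x + (- b'$1 / J) * f2 x)"
 define beta where "beta = (%x. (- a'$2 / J) * f1 x + (a'$1 / J) * f2 x)"
 define dalpha where "dalpha = (%x. (b'$2 / J) *R d1 x + (- b'$1 / J) *R d2 x)"
 define dbeta where "dbeta = (%x. (- a'$2 / J) *R d1 x + (a'$1 / J) *R d2 x)"
 have Calpha: "C1 alpha dalpha" and Cbeta: "C1 beta dbeta" unfolding alpha_def dalpha_def beta_def dbeta_def by (intro C1_add C1_cmult f)+
 have c: "continuous_on UNIV alpha" "continuous_on UNIV beta" using Calpha Cbeta C1_continuous by blast+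
 have div: "d1 x $ 1 + d2 x $ 2 = dalpha x \<bullet> a' + dbeta x \<bullet> b'" for x proof -
  have "J * (dalpha x \<bullet> a' + dbeta x \<bullet> b') = J * (d1 x $ 1 + d2 x $ 2)"
   using J by (simp add: dalpha_def dbeta_def inner_vec_def sum_2 field_simps)
    (simp add: J_def det2_def algebra_simps)
  then show ?thesis using J by simp
 qed
 have bT: "bounded (tri (nu, a, b))" "tri (nu, a, b) \<in> sets lebesgue"
  by (auto simp: tri_def verts_def compact_imp_bounded finite_imp_compact_convex_hull lmeasurable_compact fmeasurableD)
 have int: "set_integrable lebesgue (tri (nu, a, b)) (%x. dalpha x \<bullet> a')" "set_integrable lebesgue (tri (nu, a, b)) (%x. dbeta x \<bullet> b')"
  by (intro set_integrable_continuous_bounded continuous_intros bT C1_continuous_grad[OF Calpha] C1_continuous_grad[OF Cbeta])+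
 have i01: "set_integrable lborel {0..1} (%t. h (x + t *R y))" if "continuous_on UNIV h" for h :: "pt => real" and x y
  using borel_integrable_atLeastAtMost'[OF continuous_on_edge[OF that, of "{0..1}" x y]] by simp
 have "(LINT x:tri (nu, a, b). d1 x $ 1 + d2 x $ 2)
   = (LINT x:tri (nu, a, b). dalpha x \<bullet> a') + (LINT x:tri (nu, a, b). dbeta x \<bullet> b')"
  unfolding div using int by (rule set_integral_add)
 also have "(LINT x:tri (nu, a, b). dalpha x \<bullet> a')
   = J * (LINT t:{0..1}|lborel. alpha (nu + (1 - t) *R a' + t *R b') - alpha (nu + t *R b'))"
  unfolding T using triangle_directional_integral[of a' b' alpha dalpha nu] Calpha J by (simp add: J_def)
 also have "(LINT x:tri (nu, a, b). dbeta x \<bullet> b')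
   = J * (LINT t:{0..1}|lborel. beta (nu + (1 - t) *R b' + t *R a') - beta (nu + t *R a'))"
  unfolding T' using triangle_directional_integral[of b' a' beta dbeta nu] Cbeta J by (simp add: J')
 also have "(LINT t:{0..1}|lborel. alpha (nu + (1 - t) *R a' + t *R b') - alpha (nu + t *R b'))
   = (LINT t:{0..1}|lborel. alpha (a + t *R (b - a)) - alpha (nu + t *R b'))"
  by (rule arg_cong[where f="set_lebesgue_integral lborel {0..1}"]) (auto simp: algebra_simps a'_def b'_def)
 also have "... = (LINT t:{0..1}|lborel. alpha (a + t *R (b - a))) - (LINT t:{0..1}|lborel. alpha (nu + t *R b'))"
  by (rule set_integral_diff(2)) (intro i01 c)+
 also have "(LINT t:{0..1}|lborel. beta (nu + (1 - t) *R b' + t *R a') - beta (nu + t *R a'))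
   = (LINT t:{0..1}|lborel. beta (b + t *R (a - b)) - beta (nu + t *R a'))"
  by (rule arg_cong[where f="set_lebesgue_integral lborel {0..1}"]) (auto simp: algebra_simps a'_def b'_def)
 also have "... = (LINT t:{0..1}|lborel. beta (b + t *R (a - b))) - (LINT t:{0..1}|lborel. beta (nu + t *R a'))"
  by (rule set_integral_diff(2)) (intro i01 c)+
 also have "(LINT t:{0..1}|lborel. beta (b + t *R (a - b))) = (LINT t:{0..1}|lborel. beta (a + t *R (b - a)))" proof -
  have "a + (1 - t) *R (b - a) = b + t *R (a - b)" for t :: real by (simp add: algebra_simps)
  then show ?thesis using set_integral_01_reflect[of "%t. beta (a + t *R (b - a))"] by (simp only:)
 qed
 also have "(LINT t:{0..1}|lborel. alpha (nu + t *R b')) = (LINT t:{0..1}|lborel. alpha (b + t *R (nu - b)))" proof -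
  have "b + (1 - t) *R (nu - b) = nu + t *R b'" for t :: real by (simp add: algebra_simps b'_def)
  then show ?thesis using set_integral_01_reflect[of "%t. alpha (b + t *R (nu - b))"] by (simp only:)
 qed
 finally have E: "(LINT x:tri (nu, a, b). d1 x $ 1 + d2 x $ 2) =
   J * ((LINT t:{0..1}|lborel. alpha (a + t *R (b - a))) + (LINT t:{0..1}|lborel. beta (a + t *R (b - a))))
   + J * (- (LINT t:{0..1}|lborel. alpha (b + t *R (nu - b))))
   + J * (- (LINT t:{0..1}|lborel. beta (nu + t *R a')))" by (simp add: algebra_simps)
 have 1: "J * ((LINT t:{0..1}|lborel. alpha (a + t *R (b - a))) + (LINT t:{0..1}|lborel. beta (a + t *R (b - a))))
   = eint (a, b) (%x. f1 x * nrm (a, b) $ 1 + f2 x * nrm (a, b) $ 2)"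
  apply (subst set_integral_add(2)[symmetric], (intro i01 c)+)
  apply (subst set_integral_mult_right[symmetric], subst eint_flux[OF cf])
  apply (rule arg_cong[where f="set_lebesgue_integral lborel {0..1}"]) using J by (auto simp: fun_eq_iff alpha_def beta_def a'_def b'_def field_simps)
 have 2: "J * (- (LINT t:{0..1}|lborel. alpha (b + t *R (nu - b))))
   = eint (b, nu) (%x. f1 x * nrm (b, nu) $ 1 + f2 x * nrm (b, nu) $ 2)"
  apply (subst mult_minus_right, subst mult_minus_left[symmetric], subst set_integral_mult_right[symmetric], subst eint_flux[OF cf])
  apply (rule arg_cong[where f="set_lebesgue_integral lborel {0..1}"]) using J by (auto simp: fun_eq_iff alpha_def a'_def b'_def field_simps)
 have 3: "J * (- (LINT t:{0..1}|lborel. beta (nu + t *R a')))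
   = eint (nu, a) (%x. f1 x * nrm (nu, a) $ 1 + f2 x * nrm (nu, a) $ 2)"
  apply (subst mult_minus_right, subst mult_minus_left[symmetric], subst set_integral_mult_right[symmetric], subst eint_flux[OF cf])
  apply (rule arg_cong[where f="set_lebesgue_integral lborel {0..1}"]) using J by (auto simp: fun_eq_iff beta_def a'_def b'_def field_simps)
 have ne: "nu ~= a" "a ~= b" "b ~= nu" using ccw by (auto simp: ccw_def mult.commute)
 then have dist: "(nu, a) \<notin> {(a, b), (b, nu)}" "(a, b) \<notin> {(b, nu)}" by auto
 then show ?thesis unfolding E 1 2 3 by simp
qed

section \<open>Polynomials in two variables\<close>

lemma poly2_monom: "i + j \<le> k ==> poly2 k (%x. a * ((x$1)^i * (x$2)^j))" proof -
 assume ij: "i + j \<le> k"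
 have "a * (x$1)^i * (x$2)^j = (\<Sum>i'\<le>k. \<Sum>j'\<le>k - i'. (if i' = i & j' = j then a else 0) * (x$1)^i' * (x$2)^j')" for x :: pt proof -
  have "(\<Sum>j'\<le>k - i'. (if i' = i & j' = j then a else 0) * (x$1)^i' * (x$2)^j') = (if i' = i then a * (x$1)^i * (x$2)^j else 0)"
   if "i' \<le> k" for i' proof (cases "i' = i")
   case True
   have "(\<Sum>j'\<le>k - i'. (if i' = i & j' = j then a else 0) * (x$1)^i' * (x$2)^j')
     = (\<Sum>j'\<le>k - i. if j' = j then a * (x$1)^i * (x$2)^j else 0)" using True by (intro sum.cong) auto
   also have "... = a * (x$1)^i * (x$2)^j" using ij by (subst sum.delta) auto
   finally show ?thesis using True by simp
  qed (simp add: sum.neutral)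
  then have "(\<Sum>i'\<le>k. \<Sum>j'\<le>k - i'. (if i' = i & j' = j then a else 0) * (x$1)^i' * (x$2)^j')
    = (\<Sum>i'\<le>k. if i' = i then a * (x$1)^i * (x$2)^j else 0)" by (intro sum.cong) auto
  also have "... = a * (x$1)^i * (x$2)^j" using ij by (subst sum.delta) auto
  finally show ?thesis by simp
 qed
 then show ?thesis unfolding poly2_def mult.assoc[symmetric] by (intro exI[of _ "%i' j'. if i' = i & j' = j then a else 0"]) blast
qed

lemma poly2_add: "poly2 k f ==> poly2 k g ==> poly2 k (%x. f x + g x)" proof -
 assume "poly2 k f" "poly2 k g"
 then obtain c d where "!!x. f x = (\<Sum>i\<le>k. \<Sum>j\<le>k - i. c i j * (x$1)^i * (x$2)^j)"
  "!!x. g x = (\<Sum>i\<le>k. \<Sum>j\<le>k - i. d i j * (x$1)^i * (x$2)^j)" unfolding poly2_def by blast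
 then show ?thesis unfolding poly2_def by (intro exI[of _ "%i j. c i j + d i j"]) (simp add: sum.distrib algebra_simps)
qed

lemma poly2_const: "poly2 k (%x. a)" using poly2_monom[of 0 0 k a] by simp

lemma poly2_sum: "finite I ==> (!!i. i \<in> I ==> poly2 k (f i)) ==> poly2 k (%x. \<Sum>i\<in>I. f i x)"
 by (induction I rule: finite_induct) (auto intro: poly2_const poly2_add)

lemma poly2_mult: assumes "poly2 n f" "poly2 m g" shows "poly2 (n + m) (%x. f x * g x)" proof -
 obtain c d where c: "!!x. f x = (\<Sum>i\<le>n. \<Sum>j\<le>n - i. c i j * (x$1)^i * (x$2)^j)"
  and d: "!!x. g x = (\<Sum>i\<le>m. \<Sum>j\<le>m - i. d i j * (x$1)^i * (x$2)^j)" using assms unfolding poly2_def by blast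
 have "f x * g x = (\<Sum>i\<le>n. \<Sum>i'\<le>m. \<Sum>j\<le>n - i. \<Sum>j'\<le>m - i'. (c i j * d i' j') * ((x$1)^(i + i') * (x$2)^(j + j')))" for x
  unfolding c d sum_product by (intro sum.cong refl) (simp add: power_add)
 moreover have "poly2 (n + m) (%x. \<Sum>i\<le>n. \<Sum>i'\<le>m. \<Sum>j\<le>n - i. \<Sum>j'\<le>m - i'. (c i j * d i' j') * ((x$1)^(i + i') * (x$2)^(j + j')))"
  by (intro poly2_sum poly2_monom) auto
 ultimately show ?thesis by presburger
qed

lemma poly2_cmult: "poly2 k f ==> poly2 k (%x. a * f x)" using poly2_mult[OF poly2_const[of 0 a], of k f] by simp

lemma poly2_diff: "poly2 k f ==> poly2 k g ==> poly2 k (%x. f x - g x)" using poly2_add[OF _ poly2_cmult[of k g "-1"]] by simp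

lemma poly2_power: "poly2 n f ==> poly2 (n * i) (%x. f x ^ i)" proof (induction i)
 case (Suc i)
 then show ?case using poly2_mult[of n f "n * i" "%x. f x ^ i"] by simp
qed (simp add: poly2_const)

lemma poly2_mono: "poly2 n f ==> n \<le> m ==> poly2 m f" using poly2_mult[OF poly2_const[of "m - n" 1], of n f] by simp

lemma poly2_coord: "poly2 1 (%x. x $ i)" using poly2_monom[of 1 0 1 1] poly2_monom[of 0 1 1 1] exhaust_2[of i] by auto

lemma poly2_affine: "poly2 1 (%x. x \<bullet> v + a)" by (simp add: inner_vec_def sum_2)
  (intro poly2_add poly2_const; subst mult.commute; intro poly2_cmult poly2_coord[simplified])

lemma poly2_poly: assumes "degree r \<le> k" "poly2 1 f" shows "poly2 k (%x. poly r (f x))" proof -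
 have "poly2 k (%x. coeff r i * f x ^ i)" if "i \<le> degree r" for i
  using poly2_mono[OF poly2_power[OF assms(2), of i], of k] that assms(1) by (intro poly2_cmult) simp
 then show ?thesis unfolding poly_altdef by (intro poly2_sum) auto
qed

lemma poly2_expand_comp: assumes "poly2 k q"
 obtains c where "!!x. q x = (\<Sum>i\<le>k. \<Sum>j\<le>k - i. c i j * ((x$1)^i * (x$2)^j))"
 using assms unfolding poly2_def by (auto simp: mult.assoc)

lemma poly2_rescale: assumes "poly2 k q" shows "poly2 k (%x. q (c + R *R x))" proof -
 obtain e where e: "!!x. q x = (\<Sum>i\<le>k. \<Sum>j\<le>k - i. e i j * ((x$1)^i * (x$2)^j))" using poly2_expand_comp[OF assms] by blast
 have 1: "poly2 1 (%x. c $ i + R * x $ i)" for i by (intro poly2_add poly2_const poly2_cmult poly2_coord)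
 have "poly2 k (%x. e i j * ((c$1 + R * x$1)^i * (c$2 + R * x$2)^j))" if "i \<le> k" "j \<le> k - i" for i j
  using poly2_mult[OF poly2_power[OF 1, of i 1] poly2_power[OF 1, of j 2]] that by (intro poly2_cmult) (auto elim: poly2_mono)
 then show ?thesis unfolding e by (intro poly2_sum) auto
qed

lemma poly2_line: assumes "poly2 k q"
 obtains r where "degree r \<le> k" "!!s. q (p + s *R t) = poly r s" proof -
 obtain e where e: "!!x. q x = (\<Sum>i\<le>k. \<Sum>j\<le>k - i. e i j * ((x$1)^i * (x$2)^j))" using poly2_expand_comp[OF assms] by blast
 define r where "r = (\<Sum>i\<le>k. \<Sum>j\<le>k - i. smult (e i j) ([:p$1, t$1:]^i * [:p$2, t$2:]^j))"
 have "degree (smult (e i j) ([:p$1, t$1:]^i * [:p$2, t$2:]^j)) \<le> k" if "i \<le> k" "j \<le> k - i" for i j proof -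
  have "degree ([:p$1, t$1:]^i * [:p$2, t$2:]^j) \<le> i + j" by (intro order_trans[OF degree_mult_le] add_mono order_trans[OF degree_power_le]) auto
  then show ?thesis using that degree_smult_le order_trans by (metis (no_types, lifting) le_diff_conv2 add.commute)
 qed
 then have "degree r \<le> k" unfolding r_def by (intro degree_sum_le) auto
 moreover have "q (p + s *R t) = poly r s" for s unfolding r_def e by (simp add: poly_sum mult.commute)
 ultimately show ?thesis using that by blast
qed

lemma C1_coord: "C1 (%x::pt. x $ i) (%x. axis i 1)" using C1_inner[of "axis i (1::real)" 0] by (simp add: inner_axis inner_real_def)

lemma C1_power: assumes "C1 f df" shows "C1 (%x. f x ^ n) (%x. (of_nat n * f x ^ (n - 1)) *R df x)"
 using C1_compose_real[OF assms DERIV_pow[of n]] by (simp add: continuous_intros)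

lemma C1_grad: assumes "C1 q d" shows "grad q = d" proof
 fix x :: pt
 have "deriv (%t. q (x + t *R axis i 1)) 0 = d x $ i" for i proof (rule DERIV_imp_deriv)
  have "((%t::real. x + t *R axis i 1) has_derivative (%h. h *R axis i 1)) (at 0)" by (auto intro!: derivative_eq_intros)
  from has_derivative_compose[OF this C1_D[OF assms]]
  show "((%t. q (x + t *R axis i 1)) has_real_derivative d x $ i) (at 0)" by (simp add: has_field_derivative_def inner_axis mult_commute_abs)
 qed
 then show "grad q x = d x" by (simp add: grad_def vec_eq_iff)
qed

lemma poly2_C1: assumes "poly2 k q" shows "C1 q (grad q)" "poly2 k (%x. grad q x $ i)" proof -
 obtain e where e: "!!x. q x = (\<Sum>i\<le>k. \<Sum>j\<le>k - i. e i j * ((x$1)^i * (x$2)^j))" using poly2_expand_comp[OF assms] by blast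
 define d where "d = (%x::pt. \<Sum>i\<le>k. \<Sum>j\<le>k - i. e i j *R
   ((x$1)^i *R ((of_nat j * (x$2)^(j-1)) *R axis 2 1) + (x$2)^j *R ((of_nat i * (x$1)^(i-1)) *R (axis 1 1 :: pt))))"
 have C: "C1 q d" unfolding e[abs_def] d_def by (intro C1_sum C1_cmult C1_mult C1_power C1_coord) auto
 then show "C1 q (grad q)" using C1_grad by metis
 have "d x $ i = (\<Sum>i'\<le>k. \<Sum>j\<le>k - i'. (e i' j * of_nat j * axis 2 1 $ i) * ((x$1)^i' * (x$2)^(j-1))
   + (e i' j * of_nat i' * axis 1 1 $ i) * ((x$1)^(i'-1) * (x$2)^j))" for x
  unfolding d_def sum_component by (intro sum.cong refl) (simp add: algebra_simps)
 moreover have "poly2 k (%x. \<Sum>i'\<le>k. \<Sum>j\<le>k - i'. (e i' j * of_nat j * axis 2 1 $ i) * ((x$1)^i' * (x$2)^(j-1))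
   + (e i' j * of_nat i' * axis 1 1 $ i) * ((x$1)^(i'-1) * (x$2)^j))" by (intro poly2_sum poly2_add poly2_monom) auto
 ultimately have "poly2 k (%x. d x $ i)" by presburger
 then show "poly2 k (%x. grad q x $ i)" using C1_grad[OF C] by simp
qed

lemma poly2_continuous: "poly2 k q ==> continuous_on UNIV q" using poly2_C1 C1_continuous by blast

lemma poly2_continuous_vec:
 fixes v :: "pt => pt" assumes "!!i. poly2 k (%x. v x $ i)" shows "continuous_on UNIV v" proof -
 have "continuous_on UNIV (%x. \<chi> i. v x $ i)" by (rule continuous_on_vec_lambda) (rule poly2_continuous[OF assms])
 then show ?thesis by simp
qed

lemma poly2_dvg: "(!!i. poly2 k (%x. v x $ i)) ==> poly2 k (dvg v)" unfolding dvg_def[abs_def] by (intro poly2_sum poly2_C1(2)) auto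

lemma poly2_inner:
 fixes v :: "pt => pt" shows "(!!i. poly2 k (%x. v x $ i)) ==> poly2 k (%x. v x \<bullet> n)" by (simp add: inner_vec_def sum_2)
  (intro poly2_add; subst mult.commute; intro poly2_cmult; simp)

section \<open>Equivalence of norms on polynomials\<close>

text \<open>The minimum on the unit sphere of coefficient vectors is attained and positive.\<close>

lemma positive_definite_form:
 fixes a :: "'i => 'i => real"
 assumes I: "finite I" and pos: "!!c. \<exists>i\<in>I. c i ~= 0 ==> 0 < (\<Sum>i\<in>I. \<Sum>j\<in>I. a i j * c i * c j)"
 shows "\<exists>mu>0. \<forall>c. mu * (\<Sum>i\<in>I. (c i)^2) \<le> (\<Sum>i\<in>I. \<Sum>j\<in>I. a i j * c i * c j)" proof (cases "I = {}")
 case True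
 then show ?thesis by (auto intro: exI[of _ 1])
next
 case False
 then obtain i0 where i0: "i0 \<in> I" by blast
 define Q where "Q = (%c. \<Sum>i\<in>I. \<Sum>j\<in>I. a i j * c i * c j)"
 define S where "S = PiE UNIV (%i. if i \<in> I then {-1..1::real} else {0}) \<inter> {c. (\<Sum>i\<in>I. (c i)^2) = 1}"
 have cc: "continuous_on A (%c :: 'i => real. c i)" for A i by (rule continuous_on_subset[OF continuous_on_product_coordinates]) simp
 have "compactin (product_topology (%_. euclidean) UNIV) (PiE UNIV (%i. if i \<in> I then {-1..1::real} else {0}))"
  by (subst compactin_PiE) (auto simp: compactin_euclidean_iff)
 then have "compact (PiE UNIV (%i. if i \<in> I then {-1..1::real} else {0}))" by (simp add: euclidean_product_topology compactin_euclidean_iff)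
 moreover have "closed {c :: 'i => real. (\<Sum>i\<in>I. (c i)^2) = 1}" by (intro closed_Collect_eq continuous_intros cc)
 ultimately have "compact S" unfolding S_def by (rule compact_Int_closed)
 moreover have "(%i. if i = i0 then 1 else 0) \<in> S" using i0 I by (auto simp: S_def if_distrib[of "%x. x^2"] sum.delta cong: if_cong)
 then have "S ~= {}" by blast
 moreover have "continuous_on S Q" unfolding Q_def by (intro continuous_intros cc)
 ultimately obtain c0 where c0: "c0 \<in> S" "!!c. c \<in> S ==> Q c0 \<le> Q c" using continuous_attains_inf by metis
 have "\<exists>i\<in>I. c0 i ~= 0" proof (rule ccontr)
  assume "\<not> (\<exists>i\<in>I. c0 i ~= 0)"
  then have "(\<Sum>i\<in>I. (c0 i)^2) = 0" by simp
  then show False using c0(1) by (simp add: S_def)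
 qed
 then have mu: "Q c0 > 0" unfolding Q_def by (rule pos)
 have "Q c0 * (\<Sum>i\<in>I. (c i)^2) \<le> Q c" for c proof (cases "(\<Sum>i\<in>I. (c i)^2) = 0")
  case True
  then have "c i = 0" if "i \<in> I" for i using that I by (simp add: sum_nonneg_eq_0_iff)
  then have "Q c = 0" unfolding Q_def by (intro sum.neutral ballI) simp
  then show ?thesis using True by simp
 next
  case False
  define N where "N = sqrt (\<Sum>i\<in>I. (c i)^2)"
  have N2: "N^2 = (\<Sum>i\<in>I. (c i)^2)" unfolding N_def by (simp add: sum_nonneg)
  then have N: "N ~= 0" using False by auto
  define d where "d = (%i. if i \<in> I then c i / N else 0)"
  have d1: "(\<Sum>i\<in>I. (d i)^2) = 1" proof -
   have "(\<Sum>i\<in>I. (d i)^2) = (\<Sum>i\<in>I. (c i)^2 / N^2)" by (intro sum.cong) (auto simp: d_def power_divide)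
   also have "... = 1" using N by (simp add: sum_divide_distrib[symmetric] N2[symmetric])
   finally show ?thesis .
  qed
  have "\<bar>d i\<bar> \<le> 1" if "i \<in> I" for i proof -
   have "(d i)^2 \<le> 1" using member_le_sum[OF that, of "%i. (d i)^2"] I d1 by simp
   then show ?thesis by (simp add: abs_square_le_1)
  qed
  then have "d i \<in> (if i \<in> I then {-1..1} else {0})" for i by (cases "i \<in> I") (auto simp: abs_le_iff minus_le_iff, auto simp: d_def)
  then have "d \<in> S" using d1 by (simp add: S_def PiE_iff)
  then have "Q c0 \<le> Q d" by (rule c0)
  also have "Q d = (\<Sum>i\<in>I. \<Sum>j\<in>I. (a i j * c i * c j) / N^2)"
   unfolding Q_def by (intro sum.cong refl) (simp add: d_def power2_eq_square)
  also have "... = Q c / N^2" by (simp add: Q_def sum_divide_distrib)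
  finally show ?thesis using N by (simp add: N2[symmetric] field_simps)
 qed
 then show ?thesis using mu unfolding Q_def by blast
qed

lemma continuous_nonneg_integral_pos:
 fixes g :: "'a::euclidean_space => real" assumes g: "continuous_on UNIV g" "!!x. 0 \<le> g x" and D: "bounded D" "D \<in> sets lebesgue"
  and O: "open O'" "O' <= D" "x0 \<in> O'" "g x0 > 0" shows "0 < (LINT x:D. g x)" proof -
 have i: "integrable lebesgue (%x. indicator D x *R g x)" using set_integrable_continuous_bounded[OF g(1) D] by (simp add: set_integrable_def)
 have n: "AE x in lebesgue. 0 \<le> indicat_real D x *R g x" using g(2) by simp
 have "0 \<le> (LINT x:D. g x)" unfolding set_lebesgue_integral_def by (rule integral_nonneg_AE[OF n])
 moreover have "(LINT x:D. g x) ~= 0" proof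
  assume "(LINT x:D. g x) = 0"
  then have "AE x in lebesgue. indicat_real D x *R g x = 0" unfolding set_lebesgue_integral_def using integral_nonneg_eq_0_iff_AE[OF i n] by blast
  then have "AE x\<in>O' in lebesgue. x \<in> {x. g x = 0}"
   by (rule eventually_mono) (use O(2) in \<open>auto simp: indicator_def split: if_splits\<close>)
  moreover have "closed {x. g x = 0}" using g(1) by (intro closed_Collect_eq continuous_intros) auto
  ultimately have "x0 \<in> {x. g x = 0}" using mem_closed_if_AE_lebesgue_open[OF O(1)] O(3) by blast
  then show False using O(4) by simp
 qed
 ultimately show ?thesis by simp
qed

text \<open>The weighted integral of the square is a positive definite quadratic form in the coefficients,
  while point values and gradients on a compact set are bounded by the coefficients.\<close>

lemma finite_dim_inverse_inequality:
 fixes b :: "'i => 'a::euclidean_space => real" assumes I: "finite I" and b: "!!i. i \<in> I ==> C1 (b i) (db i)" and K: "compact K"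
  and w: "continuous_on UNIV w" "!!x. 0 \<le> w x" and D: "bounded D" "D \<in> sets lebesgue" and O: "open O'" "O' <= D" "!!x. x \<in> O' ==> 0 < w x"
  and indep: "!!c. (!!x. x \<in> O' ==> (\<Sum>i\<in>I. c i * b i x) = 0) ==> \<forall>i\<in>I. c i = 0"
 shows "\<exists>C>0. \<forall>c. \<forall>x\<in>K. (\<Sum>i\<in>I. c i * b i x)^2 + (norm (\<Sum>i\<in>I. c i *R db i x))^2
   \<le> C * (LINT x:D. w x * (\<Sum>i\<in>I. c i * b i x)^2)" proof -
 have cb: "continuous_on UNIV (b i)" "continuous_on UNIV (db i)" if "i \<in> I" for i
  using C1_continuous[OF b[OF that]] C1_continuous_grad[OF b[OF that]] by auto
 define X where "X = (%c. LINT x:D. w x * (\<Sum>i\<in>I. c i * b i x)^2)"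
 define a where "a = (%i j. LINT x:D. w x * b i x * b j x)"
 have ia: "set_integrable lebesgue D (%x. w x * b i x * b j x)" if "i \<in> I" "j \<in> I" for i j
  using that by (intro set_integrable_continuous_bounded D continuous_intros w cb)
 have X: "X c = (\<Sum>i\<in>I. \<Sum>j\<in>I. a i j * c i * c j)" for c proof -
  have "X c = (LINT x:D. (\<Sum>i\<in>I. \<Sum>j\<in>I. (c i * c j) * (w x * b i x * b j x)))" unfolding X_def
   by (rule arg_cong[where f="set_lebesgue_integral lebesgue D"])
    (simp add: fun_eq_iff power2_eq_square sum_product sum_distrib_left mult_ac)
  also have "... = (LINT x|lebesgue. (\<Sum>i\<in>I. \<Sum>j\<in>I. (c i * c j) * (indicator D x *R (w x * b i x * b j x))))"
   unfolding set_lebesgue_integral_def by (rule Bochner_Integration.integral_cong[OF refl]) (simp add: sum_distrib_left mult_ac)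
  also have "... = (\<Sum>i\<in>I. \<Sum>j\<in>I. (c i * c j) * a i j)" unfolding a_def set_lebesgue_integral_def
   using ia unfolding set_integrable_def
   by (subst Bochner_Integration.integral_sum) (auto intro!: Bochner_Integration.integrable_sum integrable_mult_right sum.cong
     simp: Bochner_Integration.integral_sum)
  finally show ?thesis by (simp add: mult_ac)
 qed
 have Xpos: "0 < X c" if "\<exists>i\<in>I. c i ~= 0" for c proof -
  have "\<exists>x\<in>O'. (\<Sum>i\<in>I. c i * b i x) ~= 0" using indep[of c] that by meson
  then obtain x where x: "x \<in> O'" "(\<Sum>i\<in>I. c i * b i x) ~= 0" by blast
  show ?thesis unfolding X_def by (rule continuous_nonneg_integral_pos[OF _ _ D O(1,2) x(1)])
    (use w O(3)[OF x(1)] x(2) cb in \<open>auto intro!: continuous_intros\<close>)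
 qed
 have "\<exists>mu>0. \<forall>c. mu * (\<Sum>i\<in>I. (c i)^2) \<le> (\<Sum>i\<in>I. \<Sum>j\<in>I. a i j * c i * c j)"
  by (rule positive_definite_form[OF I]) (rule Xpos[unfolded X])
 then obtain mu where mu: "mu > 0" "!!c. mu * (\<Sum>i\<in>I. (c i)^2) \<le> X c" unfolding X by blast
 define B where "B = (%x. (\<Sum>i\<in>I. (b i x)^2) + (\<Sum>i\<in>I. norm (db i x))^2)"
 have "continuous_on K B" unfolding B_def using continuous_on_subset[OF cb(1)] continuous_on_subset[OF cb(2)] by (intro continuous_intros) auto
 then have "bounded (B ` K)" using K compact_continuous_image compact_imp_bounded by blast
 then obtain M where "\<forall>y\<in>B ` K. norm y \<le> M" unfolding bounded_iff by blast
 then have M: "!!x. x \<in> K ==> \<bar>B x\<bar> \<le> M" by simp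
 define C where "C = (\<bar>M\<bar> + 1) / mu"
 have "(\<Sum>i\<in>I. c i * b i x)^2 + (norm (\<Sum>i\<in>I. c i *R db i x))^2 \<le> C * X c" if x: "x \<in> K" for c x proof -
  define s where "s = (\<Sum>i\<in>I. (c i)^2)"
  have s0: "0 \<le> s" by (simp add: s_def sum_nonneg)
  have 1: "(\<Sum>i\<in>I. c i * b i x)^2 \<le> s * (\<Sum>i\<in>I. (b i x)^2)" unfolding s_def by (rule Cauchy_Schwarz_ineq_sum)
  have ci: "\<bar>c i\<bar> \<le> sqrt s" if "i \<in> I" for i
   using member_le_sum[OF that, of "%i. (c i)^2"] I by (intro real_le_rsqrt) (simp add: s_def)
  have "norm (\<Sum>i\<in>I. c i *R db i x) \<le> (\<Sum>i\<in>I. sqrt s * norm (db i x))"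
   using ci by (intro order_trans[OF norm_sum] sum_mono) (auto intro: mult_right_mono)
  then have "norm (\<Sum>i\<in>I. c i *R db i x) \<le> sqrt s * (\<Sum>i\<in>I. norm (db i x))" by (simp add: sum_distrib_left)
  from power_mono[OF this, of 2]
  have 2: "(norm (\<Sum>i\<in>I. c i *R db i x))^2 \<le> s * (\<Sum>i\<in>I. norm (db i x))^2" using s0 by (simp add: power_mult_distrib)
  have "(\<Sum>i\<in>I. c i * b i x)^2 + (norm (\<Sum>i\<in>I. c i *R db i x))^2 \<le> s * B x" using 1 2 by (simp add: B_def algebra_simps)
  also have "... \<le> s * (\<bar>M\<bar> + 1)" using M[OF x] s0 by (intro mult_left_mono) auto
  also have "... = C * (mu * s)" using mu(1) by (simp add: C_def)
  also have "... \<le> C * X c" using mu by (intro mult_left_mono) (auto simp: C_def s_def)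
  finally show ?thesis .
 qed
 moreover have "C > 0" using mu(1) by (simp add: C_def)
 ultimately show ?thesis unfolding X_def by blast
qed

lemma set_integral_scale_real:
 fixes g :: "real => real" assumes g: "continuous_on UNIV g" and l: "l > 0" shows "(LINT s:{0<..<l}. g s) = l * (LINT s:{0<..<1}. g (l * s))" proof -
 have cont: "continuous_on UNIV (%s. g (l * s))" by (rule continuous_on_compose2[OF g]) (auto intro!: continuous_intros)
 have leb: "(LINT s:{0<..<r}. h s) = (LINT s|lborel. indicator {0<..<r} s *R h s)"
  if "continuous_on UNIV h" for h :: "real => real" and r unfolding set_lebesgue_integral_def
  using borel_measurable_scaleR[OF borel_measurable_indicator borel_measurable_continuous_onI[OF that], of "{0<..<r}"]
  by (intro integral_completion) simp
 have "(LINT s|lborel. indicator {0<..<l} s *R g s) = l * (LINT t|lborel. indicator {0<..<l} (0 + l * t) *R g (0 + l * t))"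
  using l by (subst lborel_integral_real_affine[where c = l and t = 0]) auto
 also have "(LINT t|lborel. indicator {0<..<l} (0 + l * t) *R g (0 + l * t)) = (LINT t|lborel. indicator {0<..<1} t *R g (l * t))"
  by (intro Bochner_Integration.integral_cong refl)
   (use l in \<open>auto simp: indicator_def zero_less_mult_iff mult_less_cancel_left1\<close>)
 finally show ?thesis by (simp add: leb[OF g] leb[OF cont])
qed

lemma set_integral_scale_pt:
 fixes g :: "pt => real" assumes g: "continuous_on UNIV g" and R: "R > 0" shows "(LINT x:cball c R. g x) = R^2 * (LINT y:cball 0 1. g (c + R *R y))"
proof -
 have cont: "continuous_on UNIV (%y. g (c + R *R y))" by (rule continuous_on_compose2[OF g]) (auto intro!: continuous_intros)
 have bm: "(%x. indicator (cball a r) x *R h x) \<in> borel_measurable borel"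
  if "continuous_on UNIV h" for h :: "pt => real" and a r
  by (intro borel_measurable_scaleR borel_measurable_indicator borel_measurable_continuous_onI that) auto
 have leb: "(LINT x:cball a r. h x) = (LINT x|lborel. indicator (cball a r) x *R h x)"
  if "continuous_on UNIV h" for h :: "pt => real" and a r unfolding set_lebesgue_integral_def using bm[OF that] by (intro integral_completion) simp
 have ind: "indicator (cball c R) (c + R *R y) = (indicator (cball 0 1) y :: real)" for y using R by (auto simp: indicator_def dist_norm)
 have "(LINT x|lborel. indicator (cball c R) x *R g x) =
   (LINT x|density (distr lborel borel (%x. c + R *R x)) (%_. \<bar>R\<bar>^DIM(pt)). indicator (cball c R) x *R g x)"
  using lborel_affine[of R c] R by simp
 also have "... = (LINT x|distr lborel borel (%x. c + R *R x). R^2 * (indicator (cball c R) x *R g x))" using bm[OF g, of c R] R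
  by (subst integral_density) (auto simp: power_abs)
 also have "... = R^2 * (LINT y|lborel. indicator (cball c R) (c + R *R y) *R g (c + R *R y))" using bm[OF g, of c R] by (subst integral_distr) auto
 finally show ?thesis by (simp add: leb[OF g] leb[OF cont] ind)
qed

text \<open>Scaling to the unit interval. The weight may vanish near the end points, since a polynomial is
  determined by its values on any subinterval, and for the same reason the bound extends beyond the
  interval.\<close>

lemma poly_inverse_inequality:
 fixes w :: "real => real" assumes w: "continuous_on UNIV w" "!!x. 0 \<le> w x" and kappa: "kappa \<ge> 0"
  and w1: "a < b" "!!x. a < x ==> x < b ==> 0 < w x" "0 \<le> a" "b \<le> 1"
 shows "\<exists>C>0. \<forall>r l x. degree r \<le> k & l > 0 & \<bar>x\<bar> \<le> kappa * l -->
   (poly r x)^2 + l^2 * (poly (pderiv r) x)^2 \<le> C / l * (LINT s:{0<..<l}. w (s / l) * (poly r s)^2)" proof -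
 have C1p: "C1 (%x::real. x ^ i) (%x. of_nat i * x ^ (i - 1))" for i using C1_power[OF C1_inner[of "1::real" 0], of i] by (simp add: inner_real_def)
 have indep: "\<forall>i\<in>{..k}. c i = 0" if "!!x. x \<in> {a<..<b} ==> (\<Sum>i\<in>{..k}. c i * x ^ i) = 0" for c :: "nat => real"
 proof (rule ccontr)
  assume "\<not> (\<forall>i\<in>{..k}. c i = 0)"
  then have "finite {x. (\<Sum>i\<le>k. c i * x ^ i) = 0}" using polyfun_finite_roots[of c k] by auto
  then have "finite {a<..<b}" by (rule finite_subset[rotated]) (use that in auto)
  then show False using w1(1) infinite_Ioo by blast
 qed
 obtain C where C: "C > 0" "!!c x. x \<in> {-kappa..kappa} ==>
   (\<Sum>i\<in>{..k}. c i * x ^ i)^2 + (norm (\<Sum>i\<in>{..k}. c i *R (of_nat i * x ^ (i - 1))))^2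
   \<le> C * (LINT x:{0<..<1}. w x * (\<Sum>i\<in>{..k}. c i * x ^ i)^2)" proof -
  have "\<exists>C>0. \<forall>c. \<forall>x\<in>{-kappa..kappa}.
   (\<Sum>i\<in>{..k}. c i * x ^ i)^2 + (norm (\<Sum>i\<in>{..k}. c i *R (of_nat i * x ^ (i - 1))))^2
   \<le> C * (LINT x:{0<..<1}. w x * (\<Sum>i\<in>{..k}. c i * x ^ i)^2)" proof (rule finite_dim_inverse_inequality[where O' = "{a<..<b}"])
   show "{a<..<b} <= {0<..<1}" using w1 by auto
  qed (use C1p w w1 indep in auto)
  then show ?thesis using that by blast
 qed
 show ?thesis proof (intro exI[of _ C] conjI allI impI C(1); elim conjE)
  fix r :: "real poly" and l x :: real
  assume r: "degree r \<le> k" and l: "l > 0" and x: "\<bar>x\<bar> \<le> kappa * l"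
  define c where "c = (%i. coeff r i * l ^ i)"
  have p: "(\<Sum>i\<le>k. c i * y ^ i) = poly r (l * y)" for y proof -
   have "poly r (l * y) = (\<Sum>i\<le>k. coeff r i * (l * y) ^ i)"
    unfolding poly_altdef by (rule sum.mono_neutral_left) (use r in \<open>auto simp: coeff_eq_0\<close>)
   then show ?thesis by (simp add: c_def power_mult_distrib mult_ac)
  qed
  have dp: "(\<Sum>i\<le>k. c i * (of_nat i * y ^ (i - 1))) = l * poly (pderiv r) (l * y)" for y proof (rule DERIV_unique)
   show "((%y. \<Sum>i\<le>k. c i * y ^ i) has_real_derivative (\<Sum>i\<le>k. c i * (of_nat i * y ^ (i - 1)))) (at y)"
    by (auto intro!: derivative_eq_intros sum.cong simp: mult_ac)
   have "((%y. poly r (l * y)) has_real_derivative poly (pderiv r) (l * y) * l) (at y)"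
    by (rule DERIV_chain2[OF poly_DERIV]) (auto intro!: derivative_eq_intros)
   then show "((%y. \<Sum>i\<le>k. c i * y ^ i) has_real_derivative l * poly (pderiv r) (l * y)) (at y)" by (simp add: p mult.commute)
  qed
  have xl: "x / l \<in> {-kappa..kappa}" using x l by (auto simp: field_simps abs_le_iff)
  have cg: "continuous_on UNIV (%s. w (s / l) * (poly r s)^2)" using l by (intro continuous_intros continuous_on_compose2[OF w(1)]) auto
  have "(LINT s:{0<..<l}. w (s / l) * (poly r s)^2) = l * (LINT s:{0<..<1}. w s * (poly r (l * s))^2)"
   using set_integral_scale_real[OF cg l] l by simp
  then show "(poly r x)^2 + l^2 * (poly (pderiv r) x)^2 \<le> C / l * (LINT s:{0<..<l}. w (s / l) * (poly r s)^2)"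
   using C(2)[OF xl, of c, unfolded real_scaleR_def p dp] l by (simp add: power_mult_distrib)
 qed
qed

lemma poly2_coeffs_zero:
 fixes c :: "nat => nat => real"
 assumes "!!x y. \<bar>x\<bar> < 1/2 ==> \<bar>y\<bar> < 1/2 ==> (\<Sum>i\<le>k. \<Sum>j\<le>k - i. c i j * (x ^ i * y ^ j)) = 0"
  and "i \<le> k" "j \<le> k - i" shows "c i j = 0" proof -
 have zero: "d n = 0" if "!!x. \<bar>x\<bar> < 1/2 ==> (\<Sum>n\<le>N. d n * x ^ n) = 0" "n \<le> N" for d :: "nat => real" and N n
 proof (rule ccontr)
  assume "d n ~= 0"
  then have "finite {x. (\<Sum>i\<le>N. d i * x ^ i) = 0}" using polyfun_finite_roots[of d N] that(2) by auto
  then have "finite {0<..<1/2::real}" by (rule finite_subset[rotated]) (use that(1) in auto)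
  then show False using infinite_Ioo[of 0 "1/2::real"] by simp
 qed
 have "(\<Sum>j\<le>k - i. c i j * y ^ j) = 0" if y: "\<bar>y\<bar> < 1/2" for y
 proof (rule zero[where N = k and d = "%i. \<Sum>j\<le>k - i. c i j * y ^ j"])
  show "(\<Sum>n\<le>k. (\<Sum>j\<le>k - n. c n j * y ^ j) * x ^ n) = 0" if "\<bar>x\<bar> < 1/2" for x
   using assms(1)[OF that y] by (simp add: sum_distrib_right sum_distrib_left mult_ac)
 qed (rule assms)
 then show ?thesis by (rule zero[where N = "k - i" and d = "c i"]) (use assms in auto)
qed

text \<open>The same in a disc with a bump as weight; the larger disc will contain the whole triangle.\<close>

lemma poly2_inverse_inequality: assumes kappa: "kappa \<ge> 0"
 shows "\<exists>C>0. \<forall>q c R x. poly2 k q & R > 0 & x \<in> cball c (kappa * R) -->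
   (q x)^2 + R^2 * (norm (grad q x))^2 \<le> C / R^2 * (LINT x:cball c R. bump c R x * (q x)^2)" proof -
 define I where "I = Sigma {..k} (%i. {..k - i})"
 define b where "b = (%(i,j) (x::pt). (x$1)^i * (x$2)^j)"
 have b2: "poly2 k (b p)" if "p \<in> I" for p using poly2_monom[of "fst p" "snd p" k 1] that by (auto simp: b_def I_def split_beta)
 have b: "C1 (b p) (grad (b p))" if "p \<in> I" for p using poly2_C1(1)[OF b2[OF that]] .
 have sumI: "(\<Sum>p\<in>I. c p * b p x) = (\<Sum>i\<le>k. \<Sum>j\<le>k - i. c (i,j) * ((x$1)^i * (x$2)^j))" for c x
  by (simp add: I_def b_def sum.Sigma case_prod_unfold)
 have indep: "\<forall>p\<in>I. c p = 0" if z: "!!x. x \<in> ball 0 1 ==> (\<Sum>p\<in>I. c p * b p x) = 0" for c proof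
  fix p assume "p \<in> I"
  then obtain i j where p: "p = (i,j)" "i \<le> k" "j \<le> k - i" by (auto simp: I_def)
  have "(\<Sum>i\<le>k. \<Sum>j\<le>k - i. c (i,j) * (x ^ i * y ^ j)) = 0" if "\<bar>x\<bar> < 1/2" "\<bar>y\<bar> < 1/2" for x y proof -
   have "norm (vector [x, y] :: pt) \<le> \<bar>x\<bar> + \<bar>y\<bar>" using norm_le_l1_cart[of "vector [x, y] :: pt"] by (simp add: sum_2)
   then show ?thesis using z[of "vector [x, y]"] that by (simp add: sumI)
  qed
  from poly2_coeffs_zero[where k = k and c = "%i j. c (i,j)", OF this p(2,3)] show "c p = 0" by (simp add: p)
 qed
 have bump: "continuous_on UNIV (bump (0::pt) 1)" "!!x. 0 \<le> bump (0::pt) 1 x"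
  "!!x. x \<in> ball 0 1 ==> 0 < bump (0::pt) 1 x" using C1_continuous[OF C1_bump[of 1 "0::pt"]] by (auto simp: bump_nonneg intro!: bump_pos)
 have "finite I" by (simp add: I_def)
 obtain C where C: "C > 0" "!!c x. x \<in> cball 0 kappa ==>
   (\<Sum>p\<in>I. c p * b p x)^2 + (norm (\<Sum>p\<in>I. c p *R grad (b p) x))^2
   \<le> C * (LINT x:cball 0 1. bump 0 1 x * (\<Sum>p\<in>I. c p * b p x)^2)" proof -
  have "\<exists>C>0. \<forall>c. \<forall>x\<in>cball 0 kappa.
   (\<Sum>p\<in>I. c p * b p x)^2 + (norm (\<Sum>p\<in>I. c p *R grad (b p) x))^2
   \<le> C * (LINT x:cball 0 1. bump 0 1 x * (\<Sum>p\<in>I. c p * b p x)^2)" by (rule finite_dim_inverse_inequality[where O' = "ball 0 1"])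
    (use \<open>finite I\<close> b bump indep in \<open>auto simp: ball_subset_cball\<close>)
  then show ?thesis using that by blast
 qed
 show ?thesis proof (intro exI[of _ C] conjI allI impI C(1); elim conjE)
  fix q :: "pt => real" and c x :: pt and R :: real
  assume q: "poly2 k q" and R: "R > 0" and x: "x \<in> cball c (kappa * R)"
  obtain e where e: "!!x. q (c + R *R x) = (\<Sum>i\<le>k. \<Sum>j\<le>k - i. e i j * ((x$1)^i * (x$2)^j))"
   using poly2_expand_comp[OF poly2_rescale[OF q, of c R]] by blast
  have eq: "(\<Sum>p\<in>I. case_prod e p * b p x) = q (c + R *R x)" for x by (simp add: sumI e)
  have Cs: "C1 (%x. \<Sum>p\<in>I. case_prod e p * b p x) (%x. \<Sum>p\<in>I. case_prod e p *R grad (b p) x)"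
   by (intro C1_sum C1_cmult b) (auto simp: I_def)
  have "C1 (%x. q (c + R *R x)) (%x. R *R grad q (c + R *R x))" unfolding C1_def proof safe
   fix x
   have "((%x. c + R *R x) has_derivative (%h. R *R h)) (at x)" by (auto intro!: derivative_eq_intros)
   from has_derivative_compose[OF this C1_D[OF poly2_C1(1)[OF q]]]
   have "((%x. q (c + R *R x)) has_derivative (%h. grad q (c + R *R x) \<bullet> (R *R h))) (at x)" .
   moreover have "(\<bullet>) (R *R grad q (c + R *R x)) = (%h. grad q (c + R *R x) \<bullet> (R *R h))" by (rule ext) simp
   ultimately show "((%x. q (c + R *R x)) has_derivative (\<bullet>) (R *R grad q (c + R *R x))) (at x)" by simp
  next
   have "continuous_on UNIV (grad q)" using C1_continuous_grad[OF poly2_C1(1)[OF q]] .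
   then have "continuous_on UNIV (%x. grad q (c + R *R x))" by (rule continuous_on_compose2) (auto intro!: continuous_intros)
   then show "continuous_on UNIV (%x. R *R grad q (c + R *R x))" by (intro continuous_intros)
  qed
  from C1_unique[OF Cs[unfolded eq] this]
  have eqg: "(\<Sum>p\<in>I. case_prod e p *R grad (b p) x) = R *R grad q (c + R *R x)" for x by (simp add: fun_eq_iff)
  define y where "y = (1 / R) *R (x - c)"
  have y: "y \<in> cball 0 kappa" "c + R *R y = x" proof -
   have "norm (x - c) \<le> kappa * R" using x by (simp add: dist_norm norm_minus_commute)
   then show "y \<in> cball 0 kappa" using R by (simp add: y_def divide_le_eq)
   show "c + R *R y = x" using R by (simp add: y_def)
  qed
  have cq: "continuous_on UNIV q" using poly2_continuous[OF q] .
  have cg: "continuous_on UNIV (%x. bump c R x * (q x)^2)" using R by (intro continuous_intros cq C1_continuous[OF C1_bump]) auto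
  have bs: "bump c R (c + R *R x) = bump 0 1 x" for x using R by (simp add: bump_def power2_eq_square)
  have "(LINT x:cball c R. bump c R x * (q x)^2) = R^2 * (LINT x:cball 0 1. bump 0 1 x * (q (c + R *R x))^2)"
   using set_integral_scale_pt[OF cg R] by (simp add: bs)
  then show "(q x)^2 + R^2 * (norm (grad q x))^2 \<le> C / R^2 * (LINT x:cball c R. bump c R x * (q x)^2)"
   using C(2)[OF y(1), of "case_prod e"] R unfolding eq eqg y(2) by (simp add: power_mult_distrib)
 qed
qed

section \<open>The fundamental lemma of the calculus of variations\<close>

lemma box_Int_box_is_box:
 "box a b \<inter> box c d = box (\<Sum>i\<in>Basis. max (a\<bullet>i) (c\<bullet>i) *R i) (\<Sum>i\<in>Basis. min (b\<bullet>i) (d\<bullet>i) *R i :: 'a::euclidean_space)"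
 by (auto simp: mem_box)

lemma sigma_finite_lebesgue: "sigma_finite_measure (lebesgue :: 'a::euclidean_space measure)" proof
 obtain A :: "'a set set" where A: "countable A" "A <= sets lborel" "\<Union>A = space lborel" "\<forall>a\<in>A. emeasure lborel a ~= \<infinity>"
  using lborel.sigma_finite_countable by metis
 then show "\<exists>A. countable A & A <= sets lebesgue & \<Union>A = space (lebesgue :: 'a measure) & (\<forall>a\<in>A. emeasure lebesgue a ~= \<infinity>)"
  by (intro exI[of _ A]) auto
qed

text \<open>The boxes form an intersection-stable generator of the Borel sets.\<close>

lemma AE_zero_of_box_integrals:
 fixes g :: "'a::euclidean_space => real" assumes g: "set_integrable lebesgue (box a b) g"
  and z: "!!c d. box c d <= box a b ==> (LINT x:box c d. g x) = 0" shows "AE x in lebesgue. x \<in> box a b --> g x = 0" proof -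
 define h where "h = (%x. indicator (box a b) x *R g x)"
 have ih: "integrable lebesgue h" using g by (simp add: h_def set_integrable_def)
 have si: "set_integrable lebesgue A h" if "A \<in> sets lebesgue" for A using integrable_mult_indicator[OF that ih] by (simp add: set_integrable_def)
 have hA: "(LINT x:A. h x) = (LINT x:A \<inter> box a b. g x)" for A unfolding set_lebesgue_integral_def h_def
  by (intro Bochner_Integration.integral_cong refl) (auto simp: indicator_def)
 have box0: "(LINT x:box c d. h x) = 0" for c d unfolding hA box_Int_box_is_box by (rule z) (auto simp: box_Int_box_is_box[symmetric])
 have tot: "integral\<^sup>L lebesgue h = 0" proof -
  have "integral\<^sup>L lebesgue h = (LINT x:UNIV. h x)" by (simp add: set_lebesgue_integral_def)
  also have "... = (LINT x:box a b. g x)" unfolding hA by simp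
  finally show ?thesis using z by simp
 qed
 have bor: "(LINT x:A. h x) = 0" if "A \<in> sigma_sets UNIV (range (%(a, b). box a b))" for A proof (rule sigma_sets_induct_disjoint[OF _ _ that])
  show "Int_stable (range (%(a, b). box a b :: 'a set))" by (auto simp: Int_stable_def box_Int_box)
 next
  fix A :: "'a set" assume "A \<in> range (%(a, b). box a b)"
  then show "(LINT x:A. h x) = 0" using box0 by auto
 next
  fix A :: "'a set" assume A: "A \<in> sigma_sets UNIV (range (%(a, b). box a b))" and 0: "(LINT x:A. h x) = 0"
  have "A \<in> sets borel" using A by (simp add: borel_eq_box)
  then have Al: "A \<in> sets lebesgue" by simp
  have "(LINT x:UNIV - A. h x) = integral\<^sup>L lebesgue h - (LINT x:A. h x)" proof -
   have "(LINT x:UNIV - A. h x) = (LINT x|lebesgue. h x - indicator A x *R h x)" unfolding set_lebesgue_integral_def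
    by (intro Bochner_Integration.integral_cong refl) (auto simp: indicator_def)
   then show ?thesis using Bochner_Integration.integral_diff[OF ih si[OF Al, unfolded set_integrable_def]] by (simp add: set_lebesgue_integral_def)
  qed
  then show "(LINT x:UNIV - A. h x) = 0" using 0 tot by simp
 next
  fix A :: "nat => 'a set" assume d: "disjoint_family A"
   and A: "range A <= sigma_sets UNIV (range (%(a, b). box a b))" and 0: "!!i. (LINT x:A i. h x) = 0"
  have "A i \<in> sets borel" for i using A by (auto simp: borel_eq_box)
  then have Al: "A i \<in> sets lebesgue" for i by simp
  have "(LINT x:(\<Union>i. A i). h x) = (\<Sum>i. LINT x:A i. h x)"
   by (rule lebesgue_integral_countable_add) (use Al d si in \<open>auto simp: disjoint_family_on_def\<close>)
  then show "(LINT x:(\<Union>i. A i). h x) = 0" using 0 by simp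
 qed (auto simp: box0[of 0 0, simplified])
 have "AE x in lebesgue. h x = 0" proof (rule sigma_finite_measure.density_zero[OF sigma_finite_lebesgue ih])
  fix A :: "'a set" assume "A \<in> sets lebesgue"
  then obtain S N N' where A: "A = S \<union> N" "N <= N'" "N' \<in> null_sets lborel" "S \<in> sets lborel" by (rule sets_completionE) auto
  have "AE x in lebesgue. x \<notin> N'" using A(3) by (intro AE_not_in null_sets_completionI)
  then have "AE x in lebesgue. x \<in> A \<longleftrightarrow> x \<in> S" by (rule eventually_mono) (use A in auto)
  then have "(LINT x:A. h x) = (LINT x:S. h x)" by (rule set_integral_lebesgue_cong_set_AE)
  then show "(LINT x:A. h x) = 0" using bor[of S] A(4) by (simp add: borel_eq_box)
 qed
 then show ?thesis by eventually_elim (auto simp: h_def)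
qed

lemma AE_local:
 fixes D :: "'a::euclidean_space set" assumes "!!x. x \<in> D ==> \<exists>U. open U & x \<in> U & (AE y in lebesgue. y \<in> U --> P y)"
 shows "AE y in lebesgue. y \<in> D --> P y" proof -
 define \<F> where "\<F> = {U. open U & (AE y in lebesgue. y \<in> U --> P y)}"
 obtain \<F>' where F: "\<F>' <= \<F>" "countable \<F>'" "\<Union>\<F>' = \<Union>\<F>" by (rule Lindelof[of \<F>]) (auto simp: \<F>_def)
 have "AE y in lebesgue. \<forall>U\<in>\<F>'. y \<in> U --> P y" using F by (subst AE_ball_countable) (auto simp: \<F>_def)
 moreover have "D <= \<Union>\<F>'" using assms F(3) by (force simp: \<F>_def)
 ultimately show ?thesis by (auto elim!: eventually_mono)
qed

definition ramp :: "nat => real => real" where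
 "ramp n t = real n * (max 0 t)^2 / (1 + real n * (max 0 t)^2)"

lemma ramp_bounds: "0 \<le> ramp n t" "ramp n t \<le> 1" by (auto simp: ramp_def divide_simps add_pos_nonneg)

lemma ramp_zero: "t \<le> 0 ==> ramp n t = 0" by (simp add: ramp_def max_def)

lemma ramp_tendsto: "t > 0 ==> (%n. ramp n t) \<longlonglongrightarrow> 1" proof -
 assume t: "t > 0"
 have "filterlim (%n. real n * t^2) at_top sequentially"
  using t by (intro filterlim_at_top_mult_tendsto_pos[OF tendsto_const] filterlim_real_sequentially) auto
 then have "filterlim (%n. 1 + real n * t^2) at_top sequentially" by (intro filterlim_tendsto_add_at_top[OF tendsto_const])
 then have "(%n. 1 - inverse (1 + real n * t^2)) \<longlonglongrightarrow> 1 - 0" by (intro tendsto_diff tendsto_const tendsto_inverse_0_at_top)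
 moreover have "1 - inverse (1 + real n * t^2) = ramp n t" for n proof -
  have "1 + real n * t^2 > 0" using t by (simp add: add_pos_nonneg)
  then show ?thesis using t by (simp add: ramp_def max_def field_simps)
 qed
 ultimately show ?thesis by simp
qed

lemma C1_ramp: "C1 f df ==> \<exists>d. C1 (%x. ramp n (f x)) d" proof -
 assume f: "C1 f df"
 have pos: "1 + real n * (max 0 t)^2 ~= 0" for t :: real using add_pos_nonneg[of 1 "real n * (max 0 t)^2"] by force
 have D: "(ramp n has_real_derivative (real n * (2 * max 0 t) / (1 + real n * (max 0 t)^2)^2)) (at t)" for t unfolding ramp_def[abs_def]
  by (rule DERIV_cong, rule DERIV_divide[OF DERIV_cmult[OF pos_sq_deriv] DERIV_add[OF DERIV_const DERIV_cmult[OF pos_sq_deriv]] pos])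
   (use pos in \<open>simp add: field_simps power2_eq_square\<close>)
 have "continuous_on UNIV (%t. real n * (2 * max 0 t) / (1 + real n * (max 0 t)^2)^2)" using pos by (intro continuous_intros) auto
 from C1_compose_real[OF f D this] show ?thesis by blast
qed

lemma C1_prod_ex: assumes "finite I" "!!i. i \<in> I ==> \<exists>d. C1 (f i) d" shows "\<exists>d. C1 (%x. \<Prod>i\<in>I. f i x) d" using assms
proof (induction I rule: finite_induct)
 case empty
 then show ?case using C1_const[of 1] by auto
next
 case (insert i F)
 then obtain d1 d2 where "C1 (f i) d1" "C1 (%x. \<Prod>i\<in>F. f i x) d2" by blast
 from C1_mult[OF this] show ?case using insert(1,2) by auto
qed

text \<open>Products of one-dimensional ramps approximate the indicator of a box from inside.\<close>

lemma box_approximation: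
 fixes c d :: "'a::euclidean_space"
 obtains psi where "!!n::nat. \<exists>dpsi. C1 (psi n) dpsi" "!!n x. \<bar>psi n x\<bar> \<le> 1"
  "!!n x. x \<notin> cbox c d ==> psi n x = 0" "!!x. (%n. psi n x) \<longlonglongrightarrow> indicator (box c d) x" proof
 define psi where "psi = (%n x. \<Prod>i\<in>Basis. ramp n (x \<bullet> i + - (c \<bullet> i)) * ramp n (x \<bullet> (- i) + d \<bullet> i))"
 show "\<exists>dpsi. C1 (psi n) dpsi" for n unfolding psi_def proof (rule C1_prod_ex)
  fix i :: 'a
  obtain d1 d2 where "C1 (%x. ramp n (x \<bullet> i + - (c \<bullet> i))) d1" "C1 (%x. ramp n (x \<bullet> (- i) + d \<bullet> i)) d2"
   using C1_ramp[OF C1_inner] by metis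
  from C1_mult[OF this] show "\<exists>d'. C1 (%x. ramp n (x \<bullet> i + - (c \<bullet> i)) * ramp n (x \<bullet> (- i) + d \<bullet> i)) d'" by blast
 qed simp
 show "\<bar>psi n x\<bar> \<le> 1" for n x unfolding psi_def abs_prod by (rule prod_le_1) (auto simp: ramp_bounds abs_mult intro!: mult_le_one)
 show "psi n x = 0" if "x \<notin> cbox c d" for n x proof -
  have "\<exists>i\<in>Basis. \<not> (c \<bullet> i \<le> x \<bullet> i & x \<bullet> i \<le> d \<bullet> i)" using that unfolding mem_box by blast
  then obtain i where "i \<in> Basis" "x \<bullet> i < c \<bullet> i \<or> d \<bullet> i < x \<bullet> i" by force
  then show ?thesis unfolding psi_def by (intro prod_zero) (auto intro!: bexI[of _ i] simp: ramp_zero)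
 qed
 show "(%n. psi n x) \<longlonglongrightarrow> indicator (box c d) x" for x proof (cases "x \<in> box c d")
  case True
  have "(%n. ramp n (x \<bullet> i + - (c \<bullet> i)) * ramp n (x \<bullet> (- i) + d \<bullet> i)) \<longlonglongrightarrow> 1 * 1" if "i \<in> Basis" for i
   using True that by (intro tendsto_mult ramp_tendsto) (auto simp: mem_box)
  then have "(%n. psi n x) \<longlonglongrightarrow> (\<Prod>i\<in>(Basis::'a set). 1 * 1)" unfolding psi_def by (intro tendsto_prod)
  then show ?thesis using True by simp
 next
  case False
  have "\<exists>i\<in>Basis. \<not> (c \<bullet> i < x \<bullet> i & x \<bullet> i < d \<bullet> i)" using False unfolding mem_box by blast
  then obtain i where "i \<in> Basis" "x \<bullet> i \<le> c \<bullet> i \<or> d \<bullet> i \<le> x \<bullet> i" by force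
  then have "psi n x = 0" for n unfolding psi_def by (intro prod_zero) (auto intro!: bexI[of _ i] simp: ramp_zero)
  then show ?thesis using False by simp
 qed
qed

lemma ball_approximation:
 fixes c :: "'a::euclidean_space" assumes R: "R > 0"
 obtains psi where "!!n::nat. \<exists>dpsi. C1 (psi n) dpsi" "!!n x. \<bar>psi n x\<bar> \<le> 1"
  "!!n x. x \<notin> cball c R ==> psi n x = 0" "!!x. (%n. psi n x) \<longlonglongrightarrow> indicator (ball c R) x" proof
 define psi where "psi = (%n x. ramp n (R^2 + (- 1) * ((x - c) \<bullet> (x - c))))"
 have "C1 (%x. (x - c) \<bullet> (x - c)) (%x. 2 *R (x - c))"
  unfolding C1_def by (auto intro!: derivative_eq_intros continuous_intros simp: inner_commute)
 from C1_ramp[OF C1_add[OF C1_const C1_cmult[OF this]]]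
 show "\<exists>dpsi. C1 (psi n) dpsi" for n unfolding psi_def by blast
 show "\<bar>psi n x\<bar> \<le> 1" for n x by (simp add: psi_def ramp_bounds)
 have le: "R^2 \<le> (x - c) \<bullet> (x - c) \<longleftrightarrow> R \<le> dist c x" for x
  using R by (simp add: dist_norm power2_norm_eq_inner[symmetric] norm_minus_commute abs_le_square_iff[symmetric])
 show "psi n x = 0" if "x \<notin> cball c R" for n x using that le[of x] by (auto simp: psi_def intro!: ramp_zero)
 show "(%n. psi n x) \<longlonglongrightarrow> indicator (ball c R) x" for x proof (cases "x \<in> ball c R")
  case True
  then have "R^2 + (- 1) * ((x - c) \<bullet> (x - c)) > 0" using le[of x] by auto
  from ramp_tendsto[OF this] show ?thesis using True by (simp add: psi_def)
 next
  case False
  then have "psi n x = 0" for n using le[of x] by (auto simp: psi_def intro!: ramp_zero)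
  then show ?thesis using False by simp
 qed
qed

lemma set_integral_limit_indicator:
 fixes g :: "'a::euclidean_space => real" assumes g: "set_integrable lebesgue D g" and E: "E <= D" "E \<in> sets lebesgue"
  and psi: "!!n. set_borel_measurable lebesgue D (psi n)" "!!n x. x \<in> D ==> \<bar>psi n x\<bar> \<le> 1"
   "!!x. x \<in> D ==> (%n. psi n x) \<longlonglongrightarrow> indicator E x" and z: "!!n::nat. (LINT x:D. g x * psi n x) = 0"
 shows "(LINT x:E. g x) = 0" proof -
 have m: "(%x. indicator D x *R (g x * psi n x)) \<in> borel_measurable lebesgue" for n proof -
  have "(%x. (indicator D x *R g x) *R (indicator D x *R psi n x)) \<in> borel_measurable lebesgue"
   by (rule borel_measurable_scaleR[OF borel_measurable_integrable[OF g[unfolded set_integrable_def]]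
      psi(1)[unfolded set_borel_measurable_def]])
  moreover have "(%x. (indicator D x *R g x) *R (indicator D x *R psi n x)) = (%x. indicator D x *R (g x * psi n x))" by (auto simp: indicator_def)
  ultimately show ?thesis by simp
 qed
 have "(%n. LINT x|lebesgue. indicator D x *R (g x * psi n x)) \<longlonglongrightarrow> (LINT x|lebesgue. indicator E x *R g x)"
 proof (rule integral_dominated_convergence[where w = "%x. norm (indicator D x *R g x)"])
  have "set_integrable lebesgue E g" using g E set_integrable_subset by blast
  then show "(%x. indicator E x *R g x) \<in> borel_measurable lebesgue" by (simp add: set_integrable_def borel_measurable_integrable)
  show "integrable lebesgue (%x. norm (indicator D x *R g x))" using g unfolding set_integrable_def by (rule integrable_norm)
  show "AE x in lebesgue. (%n. indicator D x *R (g x * psi n x)) \<longlonglongrightarrow> indicator E x *R g x" proof (rule AE_I2)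
   fix x
   show "(%n. indicator D x *R (g x * psi n x)) \<longlonglongrightarrow> indicator E x *R g x" proof (cases "x \<in> D")
    case True
    have "(%n. g x * psi n x) \<longlonglongrightarrow> g x * indicator E x" by (intro tendsto_intros psi(3) True)
    then show ?thesis using True by (simp add: mult.commute)
   next
    case False
    then have "x \<notin> E" using E by blast
    then show ?thesis using False by simp
   qed
  qed
  show "AE x in lebesgue. norm (indicator D x *R (g x * psi n x)) \<le> norm (indicator D x *R g x)" for n
   using psi(2)[of _ n] by (auto simp: indicator_def abs_mult intro!: mult_left_le)
 qed (rule m)
 moreover have "(LINT x|lebesgue. indicator D x *R (g x * psi n x)) = 0" for n using z by (simp add: set_lebesgue_integral_def)
 ultimately have "(%n::nat. 0) \<longlonglongrightarrow> (LINT x|lebesgue. indicator E x *R g x)" by simp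
 then show ?thesis by (simp add: set_lebesgue_integral_def LIMSEQ_const_iff)
qed

lemma set_borel_measurable_continuous:
 fixes f :: "'a::euclidean_space => 'b::euclidean_space" assumes "continuous_on UNIV f" "D \<in> sets lebesgue"
 shows "set_borel_measurable lebesgue D f" unfolding set_borel_measurable_def using borel_measurable_continuous_onI[OF assms(1)] assms(2)
 by (intro borel_measurable_scaleR borel_measurable_indicator measurable_completion) auto

theorem fundamental_lemma:
 fixes g :: "'a::euclidean_space => real" assumes D: "open D" and g: "set_integrable lebesgue D g"
  and z: "!!phi dphi. C1 phi dphi ==> compact (supp phi) ==> supp phi <= D ==> (LINT x:D. g x * phi x) = 0"
 shows "AE x in lebesgue. x \<in> D --> g x = 0" proof (rule AE_local)
 fix x assume "x \<in> D"
 then obtain a b where ab: "cbox a b <= D" "x \<in> box a b" using open_contains_cbox[OF D] by metis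
 have "AE x in lebesgue. x \<in> box a b --> g x = 0" proof (rule AE_zero_of_box_integrals)
  show "set_integrable lebesgue (box a b) g" using g by (rule set_integrable_subset) (use ab box_subset_cbox[of a b] in auto)
  fix c d assume cd: "box c d <= box a b"
  show "(LINT x:box c d. g x) = 0" proof (cases "box c d = {}")
   case False
   then have cd': "cbox c d <= D" proof -
    have "closure (box c d) <= cbox a b" by (rule closure_minimal) (use cd box_subset_cbox[of a b] in auto)
    then show ?thesis using False ab(1) by (auto simp: closure_box)
   qed
   obtain psi where psi: "!!n::nat. \<exists>dpsi. C1 (psi n) dpsi" "!!n x. \<bar>psi n x\<bar> \<le> 1"
    "!!n x. x \<notin> cbox c d ==> psi n x = 0" "!!x. (%n. psi n x) \<longlonglongrightarrow> indicator (box c d) x"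
    using box_approximation[of c d] by metis
   show ?thesis proof (rule set_integral_limit_indicator[OF g])
    show "box c d <= D" using cd' box_subset_cbox by blast
    show "set_borel_measurable lebesgue D (psi n)" for n using psi(1)[of n] D by (auto intro!: set_borel_measurable_continuous dest: C1_continuous)
    show "(LINT x:D. g x * psi n x) = 0" for n proof -
     obtain dpsi where "C1 (psi n) dpsi" using psi(1) by blast
     then show ?thesis proof (rule z)
      show "compact (supp (psi n))" by (rule compact_supp[of "cbox c d"]) (auto simp: psi(3))
      have "supp (psi n) <= cbox c d" by (rule supp_subset_closed) (auto simp: psi(3))
      then show "supp (psi n) <= D" using cd' by blast
     qed
    qed
   qed (use psi in auto)
  qed (simp add: set_lebesgue_integral_def)
 qed
 then show "\<exists>U. open U & x \<in> U & (AE y in lebesgue. y \<in> U --> g y = 0)" using ab(2) open_box by blast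
qed

section \<open>Admissible test functions\<close>

lemma L2_continuous_compact:
 fixes f :: "'a::euclidean_space => 'b::euclidean_space" assumes K: "compact K" and f: "continuous_on K f" shows "L2 K f" unfolding L2_def proof
 have "(%x. indicator K x *R f x) \<in> borel_measurable lborel" using borel_integrable_compact[OF K f] by (rule borel_measurable_integrable)
 then show "set_borel_measurable lebesgue K f" unfolding set_borel_measurable_def by (rule measurable_completion)
 have c: "continuous_on K (%x. (norm (f x))^2)" using f by (intro continuous_intros)
 have "integrable lborel (%x. indicator K x *R (norm (f x))^2)" by (rule borel_integrable_compact[OF K c])
 then show "set_integrable lebesgue K (%x. (norm (f x))^2)"
  unfolding set_integrable_def by (subst integrable_completion) (auto intro: borel_measurable_integrable)
qed

lemma L2_Un_disjoint: assumes "L2 D f" "L2 E f" "D \<inter> E = {}" shows "L2 (D \<union> E) f" proof -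
 have i: "(%x. indicator (D \<union> E) x *R f x) = (%x. indicator D x *R f x + indicator E x *R f x)"
  "(%x. indicator (D \<union> E) x *R (norm (f x))^2) = (%x. indicator D x *R (norm (f x))^2 + indicator E x *R (norm (f x))^2)"
  using assms(3) by (auto simp: indicator_def fun_eq_iff)
 show ?thesis using assms(1,2) unfolding L2_def set_borel_measurable_def set_integrable_def i by (auto intro: borel_measurable_add)
qed

text \<open>The divergence theorem on a triangle so large that the function vanishes on its sides.\<close>

lemma integral_grad_compact_support:
 fixes f :: "pt => real" assumes f: "C1 f df" and K: "compact (supp f)" shows "(LINT x|lebesgue. df x) = 0" proof -
 obtain r where r0: "supp f <= ball 0 r" using bounded_subset_ballD[OF compact_imp_bounded[OF K], of 0] by auto
 define R where "R = max r 1"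
 have R: "R > 0" "supp f <= ball 0 R" using r0 by (auto simp: R_def)
 have out: "f x = 0" "df x = 0" if "R \<le> norm x" for x proof -
  have "x \<notin> supp f" using that R(2) by auto
  then show "f x = 0" "df x = 0" using notin_supp C1_grad_notin_supp[OF f] by blast+
 qed
 have big: "R \<le> norm x" if "R \<le> \<bar>x $ i\<bar>" for x :: pt and i using component_le_norm_cart[of x i] that by linarith
 define nu a b where "nu = (vector [-2 * R, -2 * R] :: pt)" and "a = (vector [6 * R, -2 * R] :: pt)" and "b = (vector [-2 * R, 6 * R] :: pt)"
 have ccw: "ccw (nu, a, b)" using R(1) by (simp add: ccw_def nu_def a_def b_def)
 have cov: "x \<in> tri (nu, a, b)" if "norm x < R" for x proof -
  have x: "\<bar>x$1\<bar> < R" "\<bar>x$2\<bar> < R" using component_le_norm_cart[of x 1] component_le_norm_cart[of x 2] that by linarith+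
  define s t where "s = (x$1 + 2 * R) / (8 * R)" and "t = (x$2 + 2 * R) / (8 * R)"
  have "x = nu + s *R (a - nu) + t *R (b - nu)" using R(1) by (simp add: vec_eq_iff forall_2 s_def t_def nu_def a_def b_def)
  moreover have "0 \<le> s" "0 \<le> t" "s + t \<le> 1" using x R(1) by (auto simp: s_def t_def divide_simps)
  ultimately show ?thesis unfolding tri_param by blast
 qed
 have edge: "f (fst e + t *R (snd e - fst e)) = 0" if et: "e \<in> {(nu, a), (a, b), (b, nu)}" "t \<in> {0..1}" for e t proof -
  let ?x = "fst e + t *R (snd e - fst e)"
  have "R \<le> norm ?x" proof -
   consider "e = (nu, a)" | "e = (a, b)" | "e = (b, nu)" using et by blast
   then show ?thesis proof cases
    case 1 then show ?thesis using R by (intro big[of _ 2]) (simp add: nu_def a_def)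
   next
    case 2
    have "?x $ 1 + ?x $ 2 = 4 * R" using 2 by (simp add: a_def b_def algebra_simps)
    then have "R \<le> \<bar>?x $ 1\<bar> \<or> R \<le> \<bar>?x $ 2\<bar>" using R(1) by linarith
    then show ?thesis using big by blast
   next
    case 3 then show ?thesis using R by (intro big[of _ 1]) (simp add: nu_def b_def)
   qed
  qed
  then show ?thesis by (rule out)
 qed
 have comp: "(LINT x|lebesgue. df x $ i) = 0" for i proof -
  define f1 f2 where "f1 = (%x. (if i = 1 then 1 else 0) * f x)" and "f2 = (%x. (if i = 2 then 1 else 0) * f x)"
  have C: "C1 f1 (%x. (if i = 1 then 1 else 0) *R df x)" "C1 f2 (%x. (if i = 2 then 1 else 0) *R df x)" unfolding f1_def f2_def by (intro C1_cmult f)+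
  have c: "continuous_on UNIV f1" "continuous_on UNIV f2" using C C1_continuous by blast+
  have "eint e (%x. f1 x * nrm e $ 1 + f2 x * nrm e $ 2) = 0" if "e \<in> {(nu, a), (a, b), (b, nu)}" for e
   unfolding eint_flux[OF c] set_lebesgue_integral_def
   by (intro integral_eq_zero_AE AE_I2) (use edge[OF that] in \<open>auto simp: f1_def f2_def indicator_def\<close>)
  then have "(\<Sum>e\<in>{(nu, a), (a, b), (b, nu)}. eint e (%x. f1 x * nrm e $ 1 + f2 x * nrm e $ 2)) = 0" by (intro sum.neutral ballI)
  then have "(LINT x:tri (nu, a, b). ((if i = 1 then 1 else 0) *R df x) $ 1 + ((if i = 2 then 1 else 0) *R df x) $ 2) = 0"
   using divergence_triangle[OF ccw C] by simp
  moreover have "(LINT x:tri (nu, a, b). ((if i = 1 then 1 else 0) *R df x) $ 1 + ((if i = 2 then 1 else 0) *R df x) $ 2)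
    = (LINT x|lebesgue. df x $ i)" unfolding set_lebesgue_integral_def proof (intro Bochner_Integration.integral_cong refl)
   fix x
   have "df x = 0" if "x \<notin> tri (nu, a, b)" using that cov[of x] out(2)[of x] by force
   then show "indicat_real (tri (nu, a, b)) x *R (((if i = 1 then 1 else 0) *R df x) $ 1 + ((if i = 2 then 1 else 0) *R df x) $ 2) = df x $ i"
    using exhaust_2[of i] by (auto simp: indicator_def)
  qed
  ultimately show ?thesis by simp
 qed
 have int: "integrable lebesgue df" proof -
  have "set_integrable lebesgue (ball 0 R) df" by (intro set_integrable_continuous_bounded C1_continuous_grad[OF f]) auto
  moreover have "(%x. indicator (ball 0 R) x *R df x) = df" using out(2) by (force simp: indicator_def fun_eq_iff)
  ultimately show ?thesis by (simp add: set_integrable_def)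
 qed
 have "(LINT x|lebesgue. df x) $ i = 0" for i using integral_bounded_linear[OF bounded_linear_vec_nth[of i] int] comp[of i] by simp
 then show ?thesis by (simp add: vec_eq_iff)
qed

lemma H1_C1:
 fixes phi :: "pt => real" assumes phi: "C1 phi dphi" and D: "open D" "bounded D"
  and q: "!!x. x \<in> D ==> q x = phi x" "!!x. x \<in> D ==> G x = dphi x" shows "H1 D q G" unfolding H1_def
proof (intro conjI allI impI; (elim conjE)?)
 have Dm: "D \<in> sets lebesgue" using D by auto
 have l: "L2 D phi" "L2 D dphi" using phi by (auto intro!: L2_continuous_bounded D Dm intro: C1_continuous C1_continuous_grad)
 show "L2 D q" by (rule L2_cong_AE[OF l(1)]) (simp add: q)
 show "L2 D G" by (rule L2_cong_AE[OF l(2)]) (simp add: q)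
 fix psi dpsi assume psi: "C1 psi dpsi" "compact (supp psi)" "supp psi <= D"
 have z: "(LINT x|lebesgue. phi x *R dpsi x + psi x *R dphi x) = 0" proof (rule integral_grad_compact_support[OF C1_mult[OF phi psi(1)]])
  show "compact (supp (%x. phi x * psi x))" by (rule compact_supp[OF psi(2)]) (simp add: notin_supp)
 qed
 have i: "set_integrable lebesgue D (%x. phi x *R dpsi x)" "set_integrable lebesgue D (%x. psi x *R dphi x)"
  using C1_continuous[OF phi] C1_continuous[OF psi(1)] C1_continuous_grad[OF phi] C1_continuous_grad[OF psi(1)]
  by (auto intro!: set_integrable_continuous_bounded D Dm continuous_intros)
 have "(LINT x:D. phi x *R dpsi x) + (LINT x:D. psi x *R dphi x) = (LINT x:D. phi x *R dpsi x + psi x *R dphi x)" using i by simp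
 also have "... = (LINT x|lebesgue. phi x *R dpsi x + psi x *R dphi x)" unfolding set_lebesgue_integral_def
 proof (intro Bochner_Integration.integral_cong refl)
  fix x
  have "psi x = 0 & dpsi x = 0" if "x \<notin> D" using that psi(3) notin_supp[of x psi] C1_grad_notin_supp[OF psi(1), of x] by blast
  then show "indicator D x *R (phi x *R dpsi x + psi x *R dphi x) = phi x *R dpsi x + psi x *R dphi x" by (cases "x \<in> D") auto
 qed
 finally have e: "(LINT x:D. phi x *R dpsi x) = - (LINT x:D. psi x *R dphi x)" using z by (simp add: eq_neg_iff_add_eq_0)
 have "(LINT x:D. q x *R dpsi x) = (LINT x:D. phi x *R dpsi x)"
  "(LINT x:D. psi x *R G x) = (LINT x:D. psi x *R dphi x)" by (rule set_integral_lebesgue_cong_AE; simp add: q)+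
 then show "(LINT x:D. q x *R dpsi x) = - (LINT x:D. psi x *R G x)" using e by simp
qed

lemma has_trace_C1: assumes "C1 phi dphi" "!!x. x \<in> D ==> q x = phi x" "!!x. x \<in> D ==> G x = dphi x"
  and "!!s. 0 < s ==> s < l ==> phi (c s) = g s" "L2 {0<..<l} g" shows "has_trace D q G c l g" unfolding has_trace_def
proof (intro conjI exI[of _ "%n. phi"] exI[of _ "%n. dphi"] allI)
 have "L2norm D (%x. phi x - q x) = 0" "L2norm D (%x. dphi x - G x) = 0" "L2norm {0<..<l} (%s. phi (c s) - g s) = 0"
  by (rule L2norm_zero; use assms in auto)+
 then show "(%n. L2norm D (%x. phi x - q x)) \<longlonglongrightarrow> 0" "(%n. L2norm D (%x. dphi x - G x)) \<longlonglongrightarrow> 0"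
  "(%n. L2norm {0<..<l} (%s. phi (c s) - g s)) \<longlonglongrightarrow> 0" by simp_all
qed (use assms in auto)

lemma polygonal_arc_local: assumes "polygonal_arc c l"
 obtains B where "finite B" "!!s. s \<in> {0..l} - B ==> 0 < s ==> s < l ==>
   \<exists>eps>0. \<exists>d. norm d = 1 & s - eps \<ge> 0 & s + eps \<le> l & (\<forall>x\<in>{s-eps..s+eps}. c x = c s + (x - s) *R d)"
  "continuous_on {0..l} c" proof -
 obtain B where B: "finite B" and lin: "!!s t. 0 \<le> s ==> s < t ==> t \<le> l ==> {s<..<t} \<inter> B = {} ==>
    \<exists>d. norm d = 1 & (\<forall>x\<in>{s..t}. c x = c s + (x - s) *R d)" using assms unfolding polygonal_arc_def by metis
 have l: "0 < l" using assms by (simp add: polygonal_arc_def)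
 have near: "\<exists>delta>0. \<forall>b\<in>B. b ~= s --> delta \<le> \<bar>b - s\<bar>" for s
  using finite_set_avoid[OF B, of s] by (auto simp: dist_real_def abs_minus_commute)
 have 1: "\<exists>eps>0. \<exists>d. norm d = 1 & s - eps \<ge> 0 & s + eps \<le> l & (\<forall>x\<in>{s-eps..s+eps}. c x = c s + (x - s) *R d)"
  if s: "s \<in> {0..l} - B" "0 < s" "s < l" for s proof -
  obtain delta where delta: "delta > 0" "!!b. b \<in> B ==> b ~= s ==> delta \<le> \<bar>b - s\<bar>" using near[of s] by blast
  define eps where "eps = min delta (min s (l - s))"
  have eps: "eps > 0" "eps \<le> s" "s + eps \<le> l" "eps \<le> delta" using delta s by (auto simp: eps_def)
  have "{s-eps<..<s+eps} \<inter> B = {}" proof (intro equals0I)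
   fix b assume b: "b \<in> {s-eps<..<s+eps} \<inter> B"
   then have "delta \<le> \<bar>b - s\<bar>" using delta(2)[of b] s(1) by auto
   then show False using b eps(4) by (auto simp: abs_if split: if_splits)
  qed
  from lin[OF _ _ _ this] eps
  have "\<exists>d. norm d = 1 & (\<forall>x\<in>{s-eps..s+eps}. c x = c (s-eps) + (x - (s-eps)) *R d)" by simp
  then obtain d where d: "norm d = 1" "\<forall>x\<in>{s-eps..s+eps}. c x = c (s-eps) + (x - (s-eps)) *R d" by blast
  have all: "\<forall>x\<in>{s-eps..s+eps}. c x = c s + (x - s) *R d" proof
   fix x assume x: "x \<in> {s-eps..s+eps}"
   have "c s = c (s-eps) + eps *R d" using bspec[OF d(2), of s] eps(1) by simp
   moreover have "c x = c (s-eps) + (x - (s-eps)) *R d" using d(2) x by blast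
   ultimately show "c x = c s + (x - s) *R d" by (simp add: algebra_simps)
  qed
  have "s - eps \<ge> 0" using eps by simp
  then show ?thesis using eps(1,3) d(1) all by blast
 qed
 have "continuous (at s within {0..l}) c" if s: "s \<in> {0..l}" for s proof -
  obtain delta where delta: "delta > 0" "!!b. b \<in> B ==> b ~= s ==> delta \<le> \<bar>b - s\<bar>" using near[of s] by blast
  have lip: "dist (c x) (c s) \<le> dist x s" if x: "x \<in> {0..l}" "dist x s < delta" for x proof -
   have gap: "{min x s<..<max x s} \<inter> B = {}" proof (intro equals0I)
    fix b assume b: "b \<in> {min x s<..<max x s} \<inter> B"
    then have "b ~= s" by (auto simp: min_def max_def split: if_splits)
    then have "delta \<le> \<bar>b - s\<bar>" using delta(2)[of b] b by blast
    then show False using b x by (auto simp: dist_real_def min_def max_def abs_if split: if_splits)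
   qed
   consider "x = s" | "x < s" | "s < x" by linarith
   then show ?thesis proof cases
    case 2
    then have "{x<..<s} \<inter> B = {}" using gap by (simp add: min_def max_def)
    from lin[OF _ _ _ this] 2 x s obtain d where d: "norm d = 1" "\<forall>y\<in>{x..s}. c y = c x + (y - x) *R d" by auto
    have "c s = c x + (s - x) *R d" using bspec[OF d(2), of s] 2 by simp
    then show ?thesis using d(1) by (simp add: dist_norm)
   next
    case 3
    then have "{s<..<x} \<inter> B = {}" using gap by (simp add: min_def max_def)
    from lin[OF _ _ _ this] 3 x s obtain d where d: "norm d = 1" "\<forall>y\<in>{s..x}. c y = c s + (y - s) *R d" by auto
    have "c x = c s + (x - s) *R d" using bspec[OF d(2), of x] 3 by simp
    then show ?thesis using d(1) by (simp add: dist_norm)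
   qed simp
  qed
  show ?thesis unfolding continuous_within_eps_delta proof (intro allI impI)
   fix e :: real assume "e > 0"
   then show "\<exists>d>0. \<forall>x'\<in>{0..l}. dist x' s < d --> dist (c x') (c s) < e"
    using lip delta(1) by (intro exI[of _ "min delta e"]) force
  qed
 qed
 then have "continuous_on {0..l} c" by (simp add: continuous_on_eq_continuous_within)
 with that[OF B 1] show ?thesis by blast
qed

section \<open>Coefficients\<close>

lemma mat_vec_mult: "(mat c :: real^2^2) *v x = c *R x" by (simp add: vec_eq_iff forall_2 matrix_vector_mult_def mat_def sum_2)

lemma mat_mult_mat: "(mat c :: real^2^2) ** mat d = mat (c * d)" by (simp add: vec_eq_iff forall_2 matrix_matrix_mult_def mat_def sum_2)

lemma matrix_inv_mat: "c ~= 0 ==> matrix_inv (mat c :: real^2^2) = mat (1 / c)" proof -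
 assume c: "c ~= 0"
 have i: "mat c ** (mat (1 / c) :: real^2^2) = mat 1" "mat (1 / c) ** (mat c :: real^2^2) = mat 1" using c by (simp_all add: mat_mult_mat)
 have inv: "mat c ** matrix_inv (mat c :: real^2^2) = mat 1 & matrix_inv (mat c) ** (mat c :: real^2^2) = mat 1"
  unfolding matrix_inv_def by (rule someI[where x = "mat (1 / c)"]) (simp add: i)
 have "matrix_inv (mat c :: real^2^2) = matrix_inv (mat c) ** (mat c ** mat (1 / c))" by (simp add: i)
 also have "... = (matrix_inv (mat c) ** mat c) ** mat (1 / c)" by (simp add: matrix_mul_assoc)
 also have "... = mat (1 / c)" using inv by simp
 finally show ?thesis .
qed

lemma mat_sqrt_mat: "c \<ge> 0 ==> mat_sqrt (mat c) = mat (sqrt c)" unfolding mat_sqrt_def proof (rule the_equality)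
 assume c: "c \<ge> 0"
 show "transpose (mat (sqrt c) :: real^2^2) = mat (sqrt c) & (\<forall>v. 0 \<le> v \<bullet> ((mat (sqrt c) :: real^2^2) *v v)) & mat (sqrt c) ** mat (sqrt c) = (mat c :: real^2^2)"
  using c by (simp add: transpose_mat mat_vec_mult mat_mult_mat)
 fix B :: "real^2^2" assume "transpose B = B & (\<forall>v. 0 \<le> v \<bullet> (B *v v)) & B ** B = mat c"
 then have t: "transpose B = B" and pos: "!!v. 0 \<le> v \<bullet> (B *v v)" and sq: "B ** B = mat c" by auto
 define p q r where "p = B$1$1" and "q = B$1$2" and "r = B$2$2"
 have "transpose B $ 2 $ 1 = B $ 1 $ 2" by (simp add: transpose_def)
 then have q': "B$2$1 = q" unfolding t q_def .
 have e: "p * p + q * q = c" "p * q + q * r = 0" "q * q + r * r = c"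
  using sq by (auto simp: vec_eq_iff forall_2 matrix_matrix_mult_def mat_def sum_2 q' p_def[symmetric] q_def[symmetric] r_def[symmetric])
 have Q: "0 \<le> x * (p * x + q * y) + y * (q * x + r * y)" for x y using pos[of "vector [x, y]"]
  by (simp add: inner_vec_def matrix_vector_mult_def sum_2 q' p_def[symmetric] q_def[symmetric] r_def[symmetric])
 have p: "p \<ge> 0" and r: "r \<ge> 0" using Q[of 1 0] Q[of 0 1] by auto
 have "q = 0" proof (rule ccontr)
  assume q: "q ~= 0"
  have "q * (p + r) = 0" using e(2) by (simp add: algebra_simps)
  then have "p = 0" "r = 0" using q p r by auto
  then show False using Q[of 1 1] Q[of 1 "-1"] q by simp
 qed
 then have "p = sqrt c" "r = sqrt c" using e p r real_sqrt_unique[of p c] real_sqrt_unique[of r c] by (simp_all add: power2_eq_square)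
 with \<open>q = 0\<close> show "B = mat (sqrt c)" by (simp add: vec_eq_iff forall_2 mat_def q' p_def[symmetric] q_def[symmetric] r_def[symmetric])
qed

lemma nonempty_open_AE_ex:
 fixes U :: "'a::euclidean_space set" assumes "open U" "x0 \<in> U" "AE x in lebesgue. x \<in> U --> P x" shows "\<exists>x\<in>U. P x"
proof (rule ccontr)
 assume n: "\<not> (\<exists>x\<in>U. P x)"
 have "AE x\<in>U in lebesgue. x \<in> {}" using assms(3) by (rule eventually_mono) (use n in auto)
 then show False using mem_closed_if_AE_lebesgue_open[OF assms(1), of "{}"] assms(2) by auto
qed

lemma set_borel_measurable_finite_open_partition:
 fixes f :: "'a::euclidean_space => real" assumes fin: "finite V" and op: "!!v. v \<in> V ==> open (U v)" "!!v. v \<in> V ==> U v <= D"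
  and val: "!!v x. v \<in> V ==> x \<in> U v ==> f x = c v"
  and dj: "disjoint_family_on U V" and ae: "AE x in lebesgue. x \<in> D --> x \<in> (\<Union>v\<in>V. U v)" shows "set_borel_measurable lebesgue D f"
 unfolding set_borel_measurable_def proof (rule borel_measurable_lebesgue_cong_AE)
 have "(%x. \<Sum>v\<in>V. c v * indicator (U v) x) \<in> borel_measurable lborel"
  using op by (intro borel_measurable_sum borel_measurable_times borel_measurable_const borel_measurable_indicator) auto
 then show "(%x. \<Sum>v\<in>V. c v * indicator (U v) x) \<in> borel_measurable lebesgue" by (rule measurable_completion)
 have one: "(\<Sum>v\<in>V. c v * indicator (U v) x) = c v" if "v \<in> V" "x \<in> U v" for v x proof -
  have "(\<Sum>v'\<in>V. c v' * indicator (U v') x) = (\<Sum>v'\<in>V. if v' = v then c v else 0)"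
   using dj that by (intro sum.cong) (auto simp: disjoint_family_on_def indicator_def)
  then show ?thesis using fin that by simp
 qed
 show "AE x in lebesgue. (\<Sum>v\<in>V. c v * indicator (U v) x) = indicator D x *R f x" using ae proof (rule eventually_mono)
  fix x assume x: "x \<in> D --> x \<in> (\<Union>v\<in>V. U v)"
  show "(\<Sum>v\<in>V. c v * indicator (U v) x) = indicator D x *R f x" proof (cases "x \<in> D")
   case True
   then obtain v where "v \<in> V" "x \<in> U v" using x by blast
   then show ?thesis using one val True by simp
  next
   case False
   then have "!!v. v \<in> V ==> x \<notin> U v" using op by blast
   then show ?thesis using False by (simp add: sum.neutral)
  qed
 qed
qed

lemma piecewise_const1_values: assumes "piecewise_const1 {0<..<L} c"
 obtains V B where "finite V" "finite B" "!!x. x \<in> {0<..<L} - B ==> c x \<in> V"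
  "!!v. open {x \<in> {0<..<L} - B. c x = v}" "set_borel_measurable lebesgue {0<..<L} c" proof -
 obtain B where B: "finite B" "!!I. connected I ==> I <= {0<..<L} - B ==> c constant_on I" using assms unfolding piecewise_const1_def by blast
 define V where "V = c ` ({0<..<L} - B)"
 have eq: "c x = c y" if "x \<in> {0<..<L} - B" "y \<in> {0<..<L} - B" "{b\<in>B. b < x} = {b\<in>B. b < y}" for x y proof -
  have "{min x y..max x y} <= {0<..<L} - B" proof
   fix z assume z: "z \<in> {min x y..max x y}"
   have "z \<notin> B" proof
    assume "z \<in> B"
    then have "z < x \<longleftrightarrow> z < y" using that(3) by blast
    then have "z = x \<or> z = y" using z by (auto simp: min_def max_def split: if_splits)
    then show False using that \<open>z \<in> B\<close> by blast
   qed
   then show "z \<in> {0<..<L} - B" using z that by (auto simp: min_def max_def split: if_splits)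
  qed
  then have "c constant_on {min x y..max x y}" by (intro B(2) connected_Icc)
  then show ?thesis unfolding constant_on_def by (auto simp: min_def max_def split: if_splits)
 qed
 have "finite V" proof -
  have "finite ((%x. {b\<in>B. b < x}) ` ({0<..<L} - B))" by (rule finite_subset[of _ "Pow B"]) (use B in auto)
  from finite_subset_image[OF this order_refl]
  obtain T where T: "T <= {0<..<L} - B" "finite T" "(%x. {b\<in>B. b < x}) ` ({0<..<L} - B) = (%x. {b\<in>B. b < x}) ` T" by (elim exE conjE)
  have "V <= c ` T" proof
   fix v assume "v \<in> V"
   then obtain x where x: "x \<in> {0<..<L} - B" "v = c x" by (auto simp: V_def)
   have "{b\<in>B. b < x} \<in> (%x. {b\<in>B. b < x}) ` T" using x(1) unfolding T(3)[symmetric] by (rule imageI)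
   then obtain t where "t \<in> T" "{b\<in>B. b < x} = {b\<in>B. b < t}" by (elim imageE)
   then show "v \<in> c ` T" using eq[of x t] x T(1) by blast
  qed
  then show ?thesis using T(2) finite_subset by blast
 qed
 moreover have opn: "open {x \<in> {0<..<L} - B. c x = v}" for v proof (rule Topological_Spaces.openI)
  fix x assume x: "x \<in> {x \<in> {0<..<L} - B. c x = v}"
  have "open ({0<..<L} - B)" using B(1) by (intro open_Diff finite_imp_closed) auto
  moreover have "x \<in> {0<..<L} - B" using x by blast
  ultimately obtain e where e: "e > 0" "ball x e <= {0<..<L} - B" by (rule openE)
  have "c constant_on ball x e" by (rule B(2)[OF connected_ball e(2)])
  then have "c y = v" if "y \<in> ball x e" for y using that x centre_in_ball[of x e] e(1) unfolding constant_on_def by force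
  then show "\<exists>T. open T & x \<in> T & T <= {x \<in> {0<..<L} - B. c x = v}" using e by (intro exI[of _ "ball x e"]) auto
 qed
 moreover have "set_borel_measurable lebesgue {0<..<L} c"
 proof (rule set_borel_measurable_finite_open_partition[of V "%v. {x \<in> {0<..<L} - B. c x = v}" _ _ "%v. v"])
  have "AE x in lebesgue. x \<notin> B" using B(1) by (intro AE_not_in null_sets_completionI finite_imp_null_set_lborel)
  then show "AE x in lebesgue. x \<in> {0<..<L} --> x \<in> (\<Union>v\<in>V. {x \<in> {0<..<L} - B. c x = v})"
   by (rule eventually_mono) (auto simp: V_def)
 qed (use \<open>finite V\<close> opn in \<open>auto simp: disjoint_family_on_def\<close>)
 ultimately show ?thesis using that[of V B] B(1) unfolding V_def by blast
qed

lemma AE_lebesgue_on_Gam: "(AE s in lebesgue_on (Gam P). Q s) \<longleftrightarrow> (AE s in lebesgue. s \<in> Gam P --> Q s)"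
 by (subst AE_restrict_space_iff) (auto simp: Gam_def)

lemma set_borel_measurable_divide_mult:
 fixes f g :: "'a::euclidean_space => real" assumes "set_borel_measurable lebesgue D f" "set_borel_measurable lebesgue D g"
 shows "set_borel_measurable lebesgue D (%x. f x / g x)" "set_borel_measurable lebesgue D (%x. f x * g x)" proof -
 have "(%x. (indicator D x *R f x) / (indicator D x *R g x)) \<in> borel_measurable lebesgue"
  "(%x. (indicator D x *R f x) * (indicator D x *R g x)) \<in> borel_measurable lebesgue" using assms unfolding set_borel_measurable_def
  by (rule borel_measurable_divide, rule borel_measurable_times)
 moreover have "(%x. (indicator D x *R f x) / (indicator D x *R g x)) = (%x. indicator D x *R (f x / g x))"
  "(%x. (indicator D x *R f x) * (indicator D x *R g x)) = (%x. indicator D x *R (f x * g x))" by (auto simp: indicator_def)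
 ultimately show "set_borel_measurable lebesgue D (%x. f x / g x)" "set_borel_measurable lebesgue D (%x. f x * g x)"
  by (simp_all add: set_borel_measurable_def)
qed

lemma set_borel_measurable_const: "D \<in> sets lebesgue ==> set_borel_measurable lebesgue D (%x. c :: real)"
 by (rule set_borel_measurable_continuous) auto

text \<open>The quantities on which the constants of the estimates may depend: the permeability is a scalar,
  and all coefficients are bounded away from zero and infinity.\<close>

locale fracture =
 fixes P :: problem and kappa :: "pt => real" and kmin kmax emin emax kG :: real assumes fp: "fracture_problem P"
  and kmin: "0 < kmin" and emin: "0 < emin" and kG: "0 < kG" and kappa_meas: "set_borel_measurable lebesgue (OmB P) kappa"
  and kappa_K: "x \<in> OmB P ==> Kb P x = mat (kappa x)" and kappa_bd: "AE x in lebesgue. x \<in> OmB P --> kmin \<le> kappa x & kappa x \<le> kmax"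
  and eta_meas: "set_borel_measurable lebesgue (Gam P) (etaG P)"
  and eta_bd: "AE s in lebesgue. s \<in> Gam P --> emin \<le> etaG P s & etaG P s \<le> emax"
  and KG_eq: "AE s in lebesgue. s \<in> Gam P --> KG P s = kG"

lemma fracture_exists: assumes fp: "fracture_problem P" and nj: "no_jump_KG P"
 shows "\<exists>kappa kmin kmax emin emax kG. fracture P kappa kmin kmax emin emax kG" proof -
 define kappa where "kappa = (%x. Kb P x $ 1 $ 1)"
 have Kx: "Kb P x = mat (kappa x) & 0 < kappa x" if x: "x \<in> OmB P" for x proof -
  obtain c where c: "Kb P x = mat c" and pos: "!!v. v ~= 0 ==> 0 < v \<bullet> (Kb P x *v v)" proof -
   have "\<forall>x\<in>OmB P. transpose (Kb P x) = Kb P x & (\<exists>c. Kb P x = mat c) & (\<forall>v. v ~= 0 --> 0 < v \<bullet> (Kb P x *v v))"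
    using fp unfolding fracture_problem_def by (elim conjE)
   then show ?thesis using that x by blast
  qed
  have "kappa x = c" by (simp add: kappa_def c mat_def)
  moreover have "0 < c" using pos[of "axis 1 1"] by (simp add: c mat_vec_mult inner_axis axis_eq_0_iff)
  ultimately show ?thesis using c by simp
 qed
 obtain \<D> where D: "finite \<D>" "disjoint \<D>" "!!X. X \<in> \<D> ==> open X & X <= OmB P & Kb P constant_on X"
  "negligible (OmB P - \<Union>\<D>)" proof -
  have "piecewise_const (OmB P) (Kb P)" using fp unfolding fracture_problem_def by (elim conjE)
  then show ?thesis using that unfolding piecewise_const_def by blast
 qed
 define V where "V = insert 1 (kappa ` \<Union>\<D>)"
 have "finite (kappa ` X)" if X: "X \<in> \<D>" for X proof -
  obtain A where "!!x. x \<in> X ==> Kb P x = A" using D(3)[OF X] unfolding constant_on_def by blast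
  then have "kappa ` X <= {A $ 1 $ 1}" by (auto simp: kappa_def)
  then show ?thesis using finite_subset by blast
 qed
 then have V: "finite V" using D(1) unfolding V_def by (auto simp: image_Union)
 have Vpos: "v > 0" if "v \<in> V" for v using that Kx D(3) by (auto simp: V_def)
 have kmin: "0 < Min V" using V Vpos by (subst Min_gr_iff) (auto simp: V_def)
 have ae: "AE x in lebesgue. x \<notin> OmB P - \<Union>\<D>" using D(4) by (intro AE_not_in) (simp add: negligible_iff_null_sets)
 have kb: "AE x in lebesgue. x \<in> OmB P --> Min V \<le> kappa x & kappa x \<le> Max V"
  using ae by (rule eventually_mono) (use V in \<open>auto simp: V_def intro!: Min_le Max_ge\<close>)
 have km: "set_borel_measurable lebesgue (OmB P) kappa"
 proof (rule set_borel_measurable_finite_open_partition[of \<D> "%X. X" _ _ "%X. kappa (SOME x. x \<in> X)"])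
  show "kappa x = kappa (SOME x. x \<in> X)" if "X \<in> \<D>" "x \<in> X" for X x
   using D(3)[OF that(1)] that(2) someI[of "%x. x \<in> X" x] unfolding constant_on_def kappa_def by metis
  show "AE x in lebesgue. x \<in> OmB P --> x \<in> (\<Union>X\<in>\<D>. X)" using ae by (rule eventually_mono) auto
  show "disjoint_family_on (%X. X) \<D>" using D(2) by (auto simp: disjoint_family_on_def disjoint_def)
 qed (use D in auto)
 have pc1: "piecewise_const1 {0<..<len P} (kapn P)" using fp unfolding fracture_problem_def Gam_def by (elim conjE)
 have pc2: "piecewise_const1 {0<..<len P} (ell P)" using fp unfolding fracture_problem_def Gam_def by (elim conjE)
 note pc = pc1 pc2
 obtain V2 B2 where 2: "finite V2" "finite B2" "!!x. x \<in> {0<..<len P} - B2 ==> ell P x \<in> V2"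
  "!!v. open {x \<in> {0<..<len P} - B2. ell P x = v}" "set_borel_measurable lebesgue {0<..<len P} (ell P)"
  using piecewise_const1_values[OF pc(2)] by blast
 obtain a b where ab: "0 < a" "0 < b" "AE s in lebesgue. s \<in> Gam P --> a \<le> kapn P s & kapn P s \<le> b"
  using fp unfolding fracture_problem_def AE_lebesgue_on_Gam by (elim conjE exE) blast
 obtain a' where ab': "0 < a'" "AE s in lebesgue. s \<in> Gam P --> a' \<le> kapt P s" proof -
  obtain a' b' where "0 < a'" "AE s in lebesgue. s \<in> Gam P --> a' \<le> kapt P s & kapt P s \<le> b'"
   using fp unfolding fracture_problem_def AE_lebesgue_on_Gam by (elim conjE exE)
  then show ?thesis using that[of a'] eventually_mono[of _ _ "%s. s \<in> Gam P --> a' \<le> kapt P s"] by blast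
 qed
 have ellpos: "AE s in lebesgue. s \<in> Gam P --> 0 < ell P s" using fp unfolding fracture_problem_def AE_lebesgue_on_Gam by (elim conjE)
 define W where "W = insert 1 (V2 \<inter> {0<..})"
 have W: "finite W" "!!v. v \<in> W ==> 0 < v" using 2(1) by (auto simp: W_def)
 have elw: "ell P x \<in> W" if x: "x \<in> {0<..<len P} - B2" for x proof -
  let ?O = "{y \<in> {0<..<len P} - B2. ell P y = ell P x}"
  have "AE s in lebesgue. s \<in> ?O --> 0 < ell P s" using ellpos by (rule eventually_mono) (auto simp: Gam_def)
  moreover have "x \<in> ?O" using x by simp
  ultimately have "\<exists>y\<in>?O. 0 < ell P y" by (intro nonempty_open_AE_ex[OF 2(4)])
  then obtain y where "y \<in> ?O" "0 < ell P y" by blast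
  then show ?thesis using 2(3)[OF x] by (auto simp: W_def)
 qed
 have B2: "AE x in lebesgue. x \<notin> B2" using 2(2) by (intro AE_not_in null_sets_completionI finite_imp_null_set_lborel)
 have em: "0 < Min W / b" using W ab(2) by (simp add: W_def)
 have eb: "AE s in lebesgue. s \<in> Gam P --> Min W / b \<le> etaG P s & etaG P s \<le> Max W / a" using B2 ab(3) proof eventually_elim
  case (elim s)
  show ?case proof
   assume s: "s \<in> Gam P"
   then have l: "ell P s \<in> W" using elim elw by (auto simp: Gam_def)
   have "Min W \<le> ell P s" "ell P s \<le> Max W" "0 < Min W" using l W by (auto simp: W_def)
   moreover have "a \<le> kapn P s" "kapn P s \<le> b" using elim s by auto
   ultimately show "Min W / b \<le> etaG P s & etaG P s \<le> Max W / a" unfolding etaG_def using ab(1,2) by (auto intro!: frac_le)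
  qed
 qed
 have etm: "set_borel_measurable lebesgue (Gam P) (etaG P)" unfolding etaG_def[abs_def] Gam_def
  by (rule set_borel_measurable_divide_mult(1)) (use 2(5) piecewise_const1_values[OF pc(1)] in blast)+
 obtain c where c: "AE s in lebesgue. s \<in> Gam P --> KG P s = c" using nj unfolding no_jump_KG_def AE_lebesgue_on_Gam by blast
 have "AE s in lebesgue. s \<in> Gam P --> 0 < c" using c ab'(2) ellpos by eventually_elim (use ab'(1) in \<open>auto simp: KG_def\<close>)
 moreover have "0 < len P" using fp by (simp add: fracture_problem_def polygonal_arc_def)
 ultimately have "0 < c" using nonempty_open_AE_ex[of "Gam P" "len P / 2" "%s. 0 < c"] by (auto simp: Gam_def)
 then have "fracture P kappa (Min V) (Max V) (Min W / b) (Max W / a) c" using fp kmin em km Kx kb etm eb c by unfold_locales auto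
 then show ?thesis by blast
qed

section \<open>Consequences of the weak formulation\<close>

context fracture
begin

lemma Om_facts: shows Om_open: "open (Om P)" and Om_bounded: "bounded (Om P)" and arc: "polygonal_arc (gam P) (len P)"
  and gam_Om: "gam P ` Gam P <= Om P" and gam_0: "gam P 0 \<in> frontier (Om P)" and gam_len: "gam P (len P) \<in> frontier (Om P)"
  and Om1_open: "open (Om1 P)" and Om2_open: "open (Om2 P)" and Om12: "Om1 P \<inter> Om2 P = {}"
  and OmB_Un: "OmB P = Om1 P \<union> Om2 P" and xi: "1 / 2 < xi P" "xi P \<le> 1"
 using fp unfolding fracture_problem_def by - (elim conjE, assumption)+

lemma len_pos: "0 < len P" and gam_inj: "inj_on (gam P) {0..len P}" using arc by (simp_all add: polygonal_arc_def)

lemma gam_continuous: "continuous_on {0..len P} (gam P)" using polygonal_arc_local[OF arc] by blast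

lemma OmB_sub: "OmB P <= Om P" by (auto simp: OmB_def)

lemma Om12_sub: "Om1 P <= OmB P" "Om2 P <= OmB P" using OmB_Un by auto

lemma OmB_open: "open (OmB P)" unfolding OmB_Un using Om1_open Om2_open by auto

lemma bounded_parts: "bounded (OmB P)" "bounded (Om1 P)" "bounded (Om2 P)" using Om_bounded OmB_sub Om12_sub bounded_subset by blast+

lemma gam_notin_OmB: "s \<in> {0..len P} ==> gam P s \<notin> OmB P" by (auto simp: OmB_def)

lemma Gam_sub: "Gam P <= {0..len P}" by (auto simp: Gam_def)

lemma frontier_inter_Om: assumes D: "D \<in> {Om1 P, Om2 P}" and x: "x \<in> frontier D" "x \<in> Om P" shows "x \<in> gam P ` Gam P" proof -
 have "x \<notin> Om1 P" "x \<notin> Om2 P"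
  using D x(1) Om1_open Om2_open Om12 open_Int_closure_eq_empty[of "Om1 P" "Om2 P"] open_Int_closure_eq_empty[of "Om2 P" "Om1 P"]
  by (auto simp: frontier_def interior_open)
 then have "x \<in> gam P ` {0..len P}" using x(2) OmB_Un unfolding OmB_def by blast
 then obtain s where s: "x = gam P s" "s \<in> {0..len P}" by blast
 have "gam P 0 \<notin> Om P" "gam P (len P) \<notin> Om P" using gam_0 gam_len Om_open by (auto simp: frontier_def interior_open)
 then have "s ~= 0" "s ~= len P" using s x(2) by auto
 then show ?thesis using s by (auto simp: Gam_def)
qed

lemma L2_trace: assumes "continuous_on UNIV phi" shows "L2 {0<..<len P} (%s. phi (gam P s) :: real)" proof (rule L2_subset)
 have "continuous_on {0..len P} (%s. phi (gam P s))" by (rule continuous_on_compose2[OF assms gam_continuous]) auto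
 then show "L2 {0..len P} (%s. phi (gam P s))" by (intro L2_continuous_compact) auto
qed auto

text \<open>Near the fracture a function of \<open>U\<close> may be prescribed independently on both sides;
  support in \<open>Om P\<close> takes care of the outer boundary.\<close>

lemma inU_C1: assumes 1: "C1 phi1 d1" "supp phi1 <= Om P" and 2: "C1 phi2 d2" "supp phi2 <= Om P"
 shows "inU P (%x. if x \<in> Om1 P then phi1 x else phi2 x) (%x. if x \<in> Om1 P then d1 x else d2 x)
   (%s. phi1 (gam P s)) (%s. phi2 (gam P s))" proof -
 have n: "x \<notin> Om1 P" if "x \<in> Om2 P" for x using that Om12 by blast
 have bd: "phi (a + s *R (b - a)) = 0"
  if D: "D \<in> {Om1 P, Om2 P}" and seg: "closed_segment a b <= frontier D - gam P ` {0..len P}"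
   and s: "0 < s" "s < 1" and phi: "supp phi <= Om P" for D a b s and phi :: "pt => real" proof -
  have "a + s *R (b - a) \<in> closed_segment a b" using s by (auto simp: closed_segment_def algebra_simps intro!: exI[of _ s])
  then have "a + s *R (b - a) \<notin> Om P" using seg frontier_inter_Om[OF D] Gam_sub by blast
  then show ?thesis using phi notin_supp by blast
 qed
 have t1: "has_trace (Om1 P) (%x. if x \<in> Om1 P then phi1 x else phi2 x) (%x. if x \<in> Om1 P then d1 x else d2 x) c l g"
  if "!!s. 0 < s ==> s < l ==> phi1 (c s) = g s" "L2 {0<..<l} g" for c l g by (rule has_trace_C1[OF 1(1)]) (use that in auto)
 have t2: "has_trace (Om2 P) (%x. if x \<in> Om1 P then phi1 x else phi2 x) (%x. if x \<in> Om1 P then d1 x else d2 x) c l g"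
  if "!!s. 0 < s ==> s < l ==> phi2 (c s) = g s" "L2 {0<..<l} g" for c l g by (rule has_trace_C1[OF 2(1)]) (use that n in auto)
 show ?thesis unfolding inU_def proof (intro conjI ballI allI impI)
  show "H1 (Om1 P) (%x. if x \<in> Om1 P then phi1 x else phi2 x) (%x. if x \<in> Om1 P then d1 x else d2 x)"
   by (rule H1_C1[OF 1(1) Om1_open bounded_parts(2)]) auto
  show "H1 (Om2 P) (%x. if x \<in> Om1 P then phi1 x else phi2 x) (%x. if x \<in> Om1 P then d1 x else d2 x)"
   by (rule H1_C1[OF 2(1) Om2_open bounded_parts(3)]) (use n in auto)
  show "has_trace (Om1 P) (%x. if x \<in> Om1 P then phi1 x else phi2 x) (%x. if x \<in> Om1 P then d1 x else d2 x)
    (gam P) (len P) (%s. phi1 (gam P s))" by (rule t1) (auto intro: L2_trace C1_continuous[OF 1(1)])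
  show "has_trace (Om2 P) (%x. if x \<in> Om1 P then phi1 x else phi2 x) (%x. if x \<in> Om1 P then d1 x else d2 x)
    (gam P) (len P) (%s. phi2 (gam P s))" by (rule t2) (auto intro: L2_trace C1_continuous[OF 2(1)])
  fix D a b assume D: "D \<in> {Om1 P, Om2 P}" and "a ~= b & closed_segment a b <= frontier D - gam P ` {0..len P}"
  then have seg: "closed_segment a b <= frontier D - gam P ` {0..len P}" by blast
  from D consider "D = Om1 P" | "D = Om2 P" by blast
  then show "has_trace D (%x. if x \<in> Om1 P then phi1 x else phi2 x) (%x. if x \<in> Om1 P then d1 x else d2 x)
    (%s. a + s *R (b - a)) 1 (%_. 0)" proof cases
   case 1
   show ?thesis unfolding 1 by (rule t1) (use bd[OF D seg _ _ assms(2)] in auto)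
  next
   case 2
   show ?thesis unfolding 2 by (rule t2) (use bd[OF D seg _ _ assms(4)] in auto)
  qed
 qed
qed

text \<open>Near a point where the arc is straight, a small ball cuts out an interval of the fracture, so bulk
  test functions separate functions on it.\<close>

lemma trace_fundamental_lemma: assumes g: "set_integrable lebesgue (Gam P) g"
  and z: "!!phi dphi. C1 phi dphi ==> compact (supp phi) ==> supp phi <= Om P ==>
    (LINT s:Gam P. g s * phi (gam P s)) = 0" shows "AE s in lebesgue. s \<in> Gam P --> g s = 0" proof -
 obtain B where B: "finite B" "!!s. s \<in> {0..len P} - B ==> 0 < s ==> s < len P ==>
   \<exists>eps>0. \<exists>d. norm d = 1 & s - eps \<ge> 0 & s + eps \<le> len P & (\<forall>x\<in>{s-eps..s+eps}. gam P x = gam P s + (x - s) *R d)"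
  by (rule polygonal_arc_local[OF arc]) blast
 have "AE s in lebesgue. s \<in> Gam P - B --> g s = 0" proof (rule AE_local)
  fix s0 assume s0: "s0 \<in> Gam P - B"
  then obtain eps d where eps: "eps > 0" "norm d = 1" "s0 - eps \<ge> 0" "s0 + eps \<le> len P"
   and lin: "\<forall>x\<in>{s0-eps..s0+eps}. gam P x = gam P s0 + (x - s0) *R d" using B(2)[of s0] by (auto simp: Gam_def)
  have "gam P s0 \<in> Om P" using s0 gam_Om by blast
  then obtain delta1 where delta1: "delta1 > 0" "ball (gam P s0) delta1 <= Om P" by (rule openE[OF Om_open])
  have "compact (gam P ` ({0..len P} - {s0-eps<..<s0+eps}))"
   by (intro compact_continuous_image continuous_on_subset[OF gam_continuous] compact_diff) auto
  then have opn: "open (- gam P ` ({0..len P} - {s0-eps<..<s0+eps}))" by (intro open_Compl compact_imp_closed)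
  have "gam P s0 \<in> - gam P ` ({0..len P} - {s0-eps<..<s0+eps})" using inj_onD[OF gam_inj, of s0] s0 eps(1) by (auto simp: Gam_def)
  then obtain delta2 where delta2: "delta2 > 0" "ball (gam P s0) delta2 <= - gam P ` ({0..len P} - {s0-eps<..<s0+eps})" by (rule openE[OF opn])
  define delta where "delta = min eps (min delta1 delta2) / 2"
  have delta: "delta > 0" "delta < eps" "delta < delta1" "delta < delta2" using eps(1) delta1(1) delta2(1) by (auto simp: delta_def)
  have "AE s in lebesgue. s \<in> box (s0 - delta) (s0 + delta) --> g s = 0" proof (rule AE_zero_of_box_integrals)
   have sub: "box (s0 - delta) (s0 + delta) <= Gam P" using eps delta by (auto simp: box_real Gam_def)
   show "set_integrable lebesgue (box (s0 - delta) (s0 + delta)) g" by (rule set_integrable_subset[OF g _ sub]) simp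
   fix a b :: real assume ab: "box a b <= box (s0 - delta) (s0 + delta)"
   show "(LINT x:box a b. g x) = 0" proof (cases "a < b")
    case True
    then have ab': "s0 - delta \<le> a" "b \<le> s0 + delta"
     using ab greaterThanLessThan_subseteq_greaterThanLessThan[of a b "s0 - delta" "s0 + delta"] by (auto simp: box_real)
    define mid R where "mid = (a + b) / 2" and "R = (b - a) / 2"
    have R: "R > 0" using True by (simp add: R_def)
    have midin: "mid \<in> {s0-eps..s0+eps}" using ab' delta True by (auto simp: mid_def)
    have dc: "dist (gam P mid) (gam P s0) + R \<le> delta" proof -
     have "gam P mid = gam P s0 + (mid - s0) *R d" using lin midin by blast
     then have "dist (gam P mid) (gam P s0) = \<bar>mid - s0\<bar>" using eps(2) by (simp add: dist_norm)
     then show ?thesis using ab' by (auto simp: mid_def R_def abs_if field_simps)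
    qed
    have incl: "dist (gam P s0) y \<le> delta" if "y \<in> cball (gam P mid) R" for y
     using dist_triangle[of "gam P s0" y "gam P mid"] that dc by (simp add: dist_commute)
    have cut: "gam P x \<in> ball (gam P mid) R \<longleftrightarrow> x \<in> box a b" if x: "x \<in> Gam P" for x proof -
     have loc: "gam P x \<in> ball (gam P mid) R \<longleftrightarrow> x \<in> box a b" if "x \<in> {s0-eps..s0+eps}" proof -
      have gx: "gam P x = gam P s0 + (x - s0) *R d" and gm: "gam P mid = gam P s0 + (mid - s0) *R d" using lin that midin by blast+
      have "gam P mid - gam P x = (mid - x) *R d" unfolding gx gm by (simp add: algebra_simps)
      then have "dist (gam P mid) (gam P x) = \<bar>mid - x\<bar>" using eps(2) by (simp add: dist_norm)
      then show ?thesis by (auto simp: box_real mid_def R_def abs_if field_simps split: if_splits)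
     qed
     show ?thesis proof (cases "x \<in> {s0-eps<..<s0+eps}")
      case True then show ?thesis using loc by auto
     next
      case False
      then have "gam P x \<in> gam P ` ({0..len P} - {s0-eps<..<s0+eps})" using x Gam_sub by blast
      then have "gam P x \<notin> ball (gam P s0) delta2" using delta2(2) by blast
      then have "gam P x \<notin> ball (gam P mid) R" using incl[of "gam P x"] delta(4) by auto
      moreover have "x \<notin> box a b" using False ab' delta(2) by (auto simp: box_real)
      ultimately show ?thesis by blast
     qed
    qed
    obtain psi where psi: "!!n::nat. \<exists>dpsi. C1 (psi n) dpsi" "!!n x. \<bar>psi n x\<bar> \<le> 1"
     "!!n x. x \<notin> cball (gam P mid) R ==> psi n x = 0" "!!x. (%n. psi n x) \<longlonglongrightarrow> indicator (ball (gam P mid) R) x"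
     using ball_approximation[OF R, of "gam P mid"] by metis
    show ?thesis proof (rule set_integral_limit_indicator[OF g, of _ "%n s. psi n (gam P s)"])
     show "box a b <= Gam P" using ab sub by blast
     show "set_borel_measurable lebesgue (Gam P) (%s. psi n (gam P s))" for n
      using psi(1)[of n] L2_trace[of "psi n"] C1_continuous unfolding L2_def Gam_def by blast
     show "(%n. psi n (gam P x)) \<longlonglongrightarrow> indicator (box a b) x" if "x \<in> Gam P" for x
      using psi(4)[of "gam P x"] cut[OF that] by (simp add: indicator_def)
     show "(LINT s:Gam P. g s * psi n (gam P s)) = 0" for n proof -
      obtain dpsi where "C1 (psi n) dpsi" using psi(1) by blast
      then show ?thesis proof (rule z)
       show "compact (supp (psi n))" by (rule compact_supp[of "cball (gam P mid) R"]) (auto simp: psi(3))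
       have "supp (psi n) <= cball (gam P mid) R" by (rule supp_subset_closed) (auto simp: psi(3))
       moreover have "cball (gam P mid) R <= ball (gam P s0) delta1" using incl delta(3) by force
       ultimately show "supp (psi n) <= Om P" using delta1(2) by blast
      qed
     qed
    qed (use psi(2) in auto)
   qed (auto simp: box_real set_lebesgue_integral_def)
  qed
  then show "\<exists>U. open U & s0 \<in> U & (AE y in lebesgue. y \<in> U --> g y = 0)"
   using delta(1) by (intro exI[of _ "box (s0 - delta) (s0 + delta)"]) (auto simp: box_real)
 qed
 moreover have "AE x in lebesgue. x \<notin> B" using B(1) by (intro AE_not_in null_sets_completionI finite_imp_null_set_lborel)
 ultimately show ?thesis by eventually_elim auto
qed

end

locale weak_setting = fracture +
 fixes f :: "pt => real" and fG :: "real => real" and u :: "pt => pt" and p :: "pt => real"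
  and Gp :: "pt => pt" and p1 p2 pG dpG un1 un2 :: "real => real" assumes f_L2: "L2 (OmB P) f" and fG_L2: "L2 (Gam P) fG"
  and ws: "weak_solution P f fG u p Gp p1 p2 pG dpG" and nt1: "has_normal_trace P (Om1 P) 1 u un1" and nt2: "has_normal_trace P (Om2 P) (- 1) u un2"
begin

lemma ws_facts: shows u_L2: "L2 (OmB P) u" and p_inU: "inU P p Gp p1 p2" and pG_H10: "H10 (Gam P) pG dpG" and weak_flux: "!!v. L2 (OmB P) v ==>
    (LINT x:OmB P. (matrix_inv (Kb P x) *v u x) \<bullet> v x)
    + (LINT x:OmB P. v x \<bullet> Gp x) = 0" and weak_pressure: "!!q Gq q1 q2. inU P q Gq q1 q2 ==>
    (LINT s:Gam P. (1 / alphaG P s) * ((p1 s + p2 s) / 2 - pG s) * ((q1 s + q2 s) / 2))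
    + (LINT s:Gam P. (1 / etaG P s) * (p1 s - p2 s) * (q1 s - q2 s))
    - (LINT x:OmB P. u x \<bullet> Gq x)
    = (LINT x:OmB P. f x * q x)" and weak_fracture: "!!qG dqG. H10 (Gam P) qG dqG ==>
    (LINT s:Gam P. KG P s * dpG s * dqG s)
    - (LINT s:Gam P. (1 / alphaG P s) * ((p1 s + p2 s) / 2 - pG s) * qG s)
    = (LINT s:Gam P. ell P s * fG s * qG s)" using ws unfolding weak_solution_def by blast+

lemma trace_L2: "L2 (Gam P) p1" "L2 (Gam P) p2" "L2 (Gam P) pG" "L2 (Gam P) dpG" "L2 (Gam P) un1" "L2 (Gam P) un2"
 using p_inU pG_H10 nt1 nt2 unfolding inU_def has_trace_def H10_def has_normal_trace_def Gam_def by blast+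

lemma Gp_L2: "L2 (OmB P) Gp" unfolding OmB_Un by (rule L2_Un_disjoint) (use p_inU Om12 in \<open>auto simp: inU_def H1_def\<close>)

definition xi' :: real where "xi' = xi P / 2 - 1 / 4"

lemma xi': "0 < xi'" "xi' \<le> 1 / 4" using xi by (auto simp: xi'_def)

lemma alpha_eq: "alphaG P s = etaG P s * xi'" by (simp add: alphaG_def xi'_def)

lemma inv_coeff_L2: assumes "L2 (Gam P) g" shows "L2 (Gam P) (%s. (1 / etaG P s) * g s)" "L2 (Gam P) (%s. (1 / alphaG P s) * g s)" proof -
 have Gm: "Gam P \<in> sets lebesgue" by (simp add: Gam_def)
 have m: "set_borel_measurable lebesgue (Gam P) (%s. 1 / etaG P s)"
  by (rule set_borel_measurable_divide_mult(1)[OF set_borel_measurable_const[OF Gm] eta_meas])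
 have "L2 (Gam P) (%s. (1 / etaG P s) *R g s)" proof (rule L2_bounded_mult[OF assms m])
  show "AE s in lebesgue. s \<in> Gam P --> \<bar>1 / etaG P s\<bar> \<le> 1 / emin" using eta_bd proof (rule eventually_mono, intro impI)
   fix s assume "s \<in> Gam P --> emin \<le> etaG P s & etaG P s \<le> emax" "s \<in> Gam P"
   then have "emin \<le> etaG P s" by blast
   then show "\<bar>1 / etaG P s\<bar> \<le> 1 / emin" using emin by (simp add: frac_le)
  qed
 qed
 then show 1: "L2 (Gam P) (%s. (1 / etaG P s) * g s)" by simp
 have "L2 (Gam P) (%s. (1 / xi') *R ((1 / etaG P s) * g s))" by (rule L2_scale[OF 1])
 then show "L2 (Gam P) (%s. (1 / alphaG P s) * g s)" by (simp add: alpha_eq mult_ac)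
qed

text \<open>The values of the flux jump and of the flux average that the interface conditions prescribe.\<close>

definition Aj :: "real => real" where "Aj s = (1 / alphaG P s) * ((p1 s + p2 s) / 2 - pG s)"
definition Bj :: "real => real" where "Bj s = (1 / etaG P s) * (p1 s - p2 s)"

lemma AB_L2: "L2 (Gam P) Aj" "L2 (Gam P) Bj" proof -
 have "L2 (Gam P) (%s. (1/2) *R (p1 s + p2 s) - pG s)" by (intro L2_diff L2_scale L2_add trace_L2)
 then have "L2 (Gam P) (%s. (p1 s + p2 s) / 2 - pG s)" by simp
 from inv_coeff_L2(2)[OF this] show "L2 (Gam P) Aj" by (simp add: Aj_def[abs_def])
 have "L2 (Gam P) (%s. p1 s - p2 s)" by (intro L2_diff trace_L2)
 from inv_coeff_L2(1)[OF this] show "L2 (Gam P) Bj" by (simp add: Bj_def[abs_def])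
qed

text \<open>The defect in Darcy's law is square-integrable, so it is an admissible test field for itself.\<close>

lemma flux_eq: "AE x in lebesgue. x \<in> OmB P --> u x = - (kappa x *R Gp x)" proof -
 define v where "v = (%x. (1 / kappa x) *R u x + Gp x)"
 have Om: "OmB P \<in> sets lebesgue" using OmB_open by simp
 have m: "set_borel_measurable lebesgue (OmB P) (%x. 1 / kappa x)"
  by (rule set_borel_measurable_divide_mult(1)[OF set_borel_measurable_const[OF Om] kappa_meas])
 have l: "L2 (OmB P) (%x. (1 / kappa x) *R u x)" proof (rule L2_bounded_mult[OF u_L2 m])
  show "AE x in lebesgue. x \<in> OmB P --> \<bar>1 / kappa x\<bar> \<le> 1 / kmin" using kappa_bd proof (rule eventually_mono, intro impI)
   fix x assume "x \<in> OmB P --> kmin \<le> kappa x & kappa x \<le> kmax" "x \<in> OmB P"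
   then have "kmin \<le> kappa x" by blast
   then show "\<bar>1 / kappa x\<bar> \<le> 1 / kmin" using kmin by (simp add: frac_le)
  qed
 qed
 have v: "L2 (OmB P) v" unfolding v_def by (rule L2_add[OF l Gp_L2])
 have "(LINT x:OmB P. (matrix_inv (Kb P x) *v u x) \<bullet> v x) = (LINT x:OmB P. ((1 / kappa x) *R u x) \<bullet> v x)"
 proof (rule set_integral_lebesgue_cong_AE)
  show "AE x in lebesgue. x \<in> OmB P --> (matrix_inv (Kb P x) *v u x) \<bullet> v x = ((1 / kappa x) *R u x) \<bullet> v x" using kappa_bd
  proof (rule eventually_mono, intro impI)
   fix x assume x: "x \<in> OmB P --> kmin \<le> kappa x & kappa x \<le> kmax" "x \<in> OmB P"
   then have "kappa x ~= 0" using kmin by auto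
   then show "(matrix_inv (Kb P x) *v u x) \<bullet> v x = ((1 / kappa x) *R u x) \<bullet> v x"
    by (simp add: kappa_K[OF x(2)] matrix_inv_mat mat_vec_mult)
  qed
 qed
 then have "(LINT x:OmB P. ((1 / kappa x) *R u x) \<bullet> v x) + (LINT x:OmB P. v x \<bullet> Gp x) = 0" using weak_flux[OF v] by simp
 moreover have "(LINT x:OmB P. (norm (v x))^2) = (LINT x:OmB P. ((1 / kappa x) *R u x) \<bullet> v x + v x \<bullet> Gp x)"
  by (rule arg_cong[where f="set_lebesgue_integral lebesgue (OmB P)"])
   (auto simp: power2_norm_eq_inner v_def inner_add_left inner_add_right inner_commute algebra_simps)
 moreover have "... = (LINT x:OmB P. ((1 / kappa x) *R u x) \<bullet> v x) + (LINT x:OmB P. v x \<bullet> Gp x)"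
  by (rule set_integral_add(2)) (rule L2_inner_integrable[OF l v], rule L2_inner_integrable[OF v Gp_L2])
 ultimately have z: "(LINT x|lebesgue. indicator (OmB P) x *R (norm (v x))^2) = 0" by (simp add: set_lebesgue_integral_def)
 have "integrable lebesgue (%x. indicator (OmB P) x *R (norm (v x))^2)" using v by (simp add: L2_def set_integrable_def)
 from integral_nonneg_eq_0_iff_AE[OF this] z
 have "AE x in lebesgue. indicat_real (OmB P) x *R (norm (v x))^2 = 0" by simp
 then show ?thesis using kappa_bd proof eventually_elim
  case (elim x)
  show ?case proof
   assume x: "x \<in> OmB P"
   then have "kappa x > 0" "v x = 0" using elim kmin by auto
   then have "kappa x *R v x = 0" "kappa x > 0" by auto
   then have "u x + kappa x *R Gp x = 0" by (simp add: v_def scaleR_add_right)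
   then show "u x = - (kappa x *R Gp x)" by (simp add: eq_neg_iff_add_eq_0)
  qed
 qed
qed

lemma weak_C1: assumes "C1 phi1 d1" "supp phi1 <= Om P" "C1 phi2 d2" "supp phi2 <= Om P"
 shows "(LINT s:Gam P. Aj s * ((phi1 (gam P s) + phi2 (gam P s)) / 2))
  + (LINT s:Gam P. Bj s * (phi1 (gam P s) - phi2 (gam P s)))
  - (LINT x:OmB P. u x \<bullet> (if x \<in> Om1 P then d1 x else d2 x))
  = (LINT x:OmB P. f x * (if x \<in> Om1 P then phi1 x else phi2 x))" using weak_pressure[OF inU_C1[OF assms]] by (simp add: Aj_def Bj_def)

lemma weak_div: assumes "C1 phi dphi" "supp phi <= OmB P" shows "- (LINT x:OmB P. u x \<bullet> dphi x) = (LINT x:OmB P. f x * phi x)" proof -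
 have "supp phi <= Om P" using assms(2) OmB_sub by blast
 note W = weak_C1[OF assms(1) this assms(1) this]
 have z: "phi (gam P s) = 0" if "s \<in> Gam P" for s using gam_notin_OmB[of s] that Gam_sub assms(2) notin_supp by blast
 have "(LINT s:Gam P. Aj s * ((phi (gam P s) + phi (gam P s)) / 2)) = (LINT s:Gam P. 0)" by (rule set_integral_lebesgue_cong_AE) (simp add: z)
 then show ?thesis using W by simp
qed

text \<open>The divergence that comes with the normal trace is the right-hand side, by the balance law in the
  interior.\<close>

lemma normal_trace_identity: assumes nt: "has_normal_trace P D sg u g" and D: "D \<in> {Om1 P, Om2 P}"
  and phi: "C1 phi dphi" "compact (supp phi)" "supp phi <= Om P" shows "(LINT x:D. u x \<bullet> dphi x) + (LINT x:D. f x * phi x)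
   = sg * (LINT s:Gam P. g s * phi (gam P s))" proof -
 obtain d where d: "L2 D d" and green: "!!phi dphi. C1 phi dphi ==> compact (supp phi) ==> supp phi \<inter> (frontier D - gam P ` Gam P) = {} ==>
     (LINT x:D. u x \<bullet> dphi x) + (LINT x:D. d x * phi x)
     = sg * (LINT s:Gam P. g s * phi (gam P s))" using nt unfolding has_normal_trace_def by blast
 have Do: "open D" "D <= OmB P" using D Om1_open Om2_open Om12_sub by auto
 have Dm: "D \<in> sets lebesgue" using Do by simp
 have fD: "L2 D f" by (rule L2_subset[OF f_L2 Do(2) Dm])
 have "AE x in lebesgue. x \<in> D --> d x - f x = 0"
 proof (rule fundamental_lemma[OF Do(1)])
  have bD: "bounded D" using D bounded_parts by auto
  have one: "L2 D (%x. 1::real)" using L2_continuous_bounded[of "%x. 1::real" D] bD Dm by simp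
  show "set_integrable lebesgue D (%x. d x - f x)" using L2_mult_integrable[OF L2_diff[OF d fD] one] by simp
  fix psi dpsi assume psi: "C1 psi dpsi" "compact (supp psi)" "supp psi <= D"
  have "supp psi \<inter> (frontier D - gam P ` Gam P) = {}" using psi(3) Do(1) by (auto simp: frontier_def interior_open)
  then have 1: "(LINT x:D. u x \<bullet> dpsi x) + (LINT x:D. d x * psi x) = sg * (LINT s:Gam P. g s * psi (gam P s))" by (rule green[OF psi(1,2)])
  have z: "psi (gam P s) = 0" if "s \<in> Gam P" for s using gam_notin_OmB[of s] that Gam_sub psi(3) Do(2) notin_supp by blast
  have "(LINT s:Gam P. g s * psi (gam P s)) = (LINT s:Gam P. 0)" by (rule set_integral_lebesgue_cong_AE) (simp add: z)
  then have 2: "(LINT x:D. u x \<bullet> dpsi x) + (LINT x:D. d x * psi x) = 0" using 1 by simp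
  have o: "psi x = 0" "dpsi x = 0" if "x \<notin> D" for x using that psi(3) notin_supp[of x psi] C1_grad_notin_supp[OF psi(1), of x] by blast+
  have "(LINT x:OmB P. u x \<bullet> dpsi x) = (LINT x:D. u x \<bullet> dpsi x)"
   "(LINT x:OmB P. f x * psi x) = (LINT x:D. f x * psi x)" unfolding set_lebesgue_integral_def using o Do(2)
   by (auto intro!: Bochner_Integration.integral_cong simp: indicator_def subset_iff)
  then have 3: "- (LINT x:D. u x \<bullet> dpsi x) = (LINT x:D. f x * psi x)" using weak_div[OF psi(1)] psi(3) Do(2) by auto
  have L: "L2 D psi" by (rule L2_continuous_bounded[OF C1_continuous[OF psi(1)] bD Dm])
  have "(LINT x:D. (d x - f x) * psi x) = (LINT x:D. d x * psi x) - (LINT x:D. f x * psi x)" unfolding left_diff_distrib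
   by (rule set_integral_diff(2)) (rule L2_mult_integrable[OF d L], rule L2_mult_integrable[OF fD L])
  then show "(LINT x:D. (d x - f x) * psi x) = 0" using 2 3 by simp
 qed
 then have "(LINT x:D. f x * phi x) = (LINT x:D. d x * phi x)" by (intro set_integral_lebesgue_cong_AE) (auto elim!: eventually_mono)
 moreover have "supp phi \<inter> (frontier D - gam P ` Gam P) = {}" using phi(3) frontier_inter_Om[OF D] by blast
 ultimately show ?thesis using green[OF phi(1,2)] by simp
qed

text \<open>The interface conditions are natural boundary conditions: they follow by testing with functions
  supported on one side of the fracture only.\<close>

lemma interface:
 "AE s in lebesgue. s \<in> Gam P --> un1 s - un2 s = Aj s & (un1 s + un2 s) / 2 = Bj s" proof -
 have gi: "set_integrable lebesgue (Gam P) g" if "L2 (Gam P) g" for g :: "real => real"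
  using L2_mult_integrable[OF that, of "%_. 1"] L2_continuous_bounded[of "%_. 1::real" "Gam P"] by (simp add: Gam_def)
 have split: "(LINT x:OmB P. g x) = (LINT x:D. h x)"
  if "!!x. x \<in> D ==> g x = h x" "!!x. x \<in> OmB P ==> x \<notin> D ==> g x = 0" "D <= OmB P"
  for D and g h :: "pt => real" unfolding set_lebesgue_integral_def
  by (rule Bochner_Integration.integral_cong[OF refl]) (use that in \<open>auto simp: indicator_def\<close>)
 have zero: "C1 (%x::pt. 0) (%x. 0)" "supp (%x::pt. 0) <= Om P" using C1_const[of 0] by (auto simp: supp_def)
 have e1: "AE s in lebesgue. s \<in> Gam P --> un1 s - ((1/2) *R Aj s + Bj s) = 0"
 proof (rule trace_fundamental_lemma)
  show "set_integrable lebesgue (Gam P) (%s. un1 s - ((1/2) *R Aj s + Bj s))" by (intro gi L2_diff L2_add L2_scale AB_L2 trace_L2)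
  fix phi dphi assume phi: "C1 phi dphi" "compact (supp phi)" "supp phi <= Om P"
  have T: "L2 (Gam P) (%s. phi (gam P s))" using L2_trace[OF C1_continuous[OF phi(1)]] by (simp add: Gam_def)
  have 1: "(LINT x:Om1 P. u x \<bullet> dphi x) + (LINT x:Om1 P. f x * phi x) = (LINT s:Gam P. un1 s * phi (gam P s))"
   using normal_trace_identity[OF nt1 _ phi] by simp
  have i: "(LINT x:OmB P. u x \<bullet> (if x \<in> Om1 P then dphi x else 0)) = (LINT x:Om1 P. u x \<bullet> dphi x)"
   "(LINT x:OmB P. f x * (if x \<in> Om1 P then phi x else 0)) = (LINT x:Om1 P. f x * phi x)" by (rule split; use Om12_sub in auto)+
  have 2: "(LINT s:Gam P. Aj s * ((phi (gam P s) + 0) / 2)) + (LINT s:Gam P. Bj s * (phi (gam P s) - 0))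
   = (LINT x:Om1 P. u x \<bullet> dphi x) + (LINT x:Om1 P. f x * phi x)" using weak_C1[OF phi(1,3) zero] unfolding i by linarith
  have "(LINT s:Gam P. (un1 s - ((1/2) *R Aj s + Bj s)) * phi (gam P s))
   = (LINT s:Gam P. un1 s * phi (gam P s) - (Aj s * ((phi (gam P s) + 0) / 2) + Bj s * (phi (gam P s) - 0)))"
   by (rule arg_cong[where f="set_lebesgue_integral lebesgue (Gam P)"]) (auto simp: algebra_simps)
  also have "... = (LINT s:Gam P. un1 s * phi (gam P s)) - ((LINT s:Gam P. Aj s * ((phi (gam P s) + 0) / 2)) + (LINT s:Gam P. Bj s * (phi (gam P s) - 0)))"
   using L2_mult_integrable[OF trace_L2(5) T] L2_mult_integrable[OF AB_L2(1) T] L2_mult_integrable[OF AB_L2(2) T]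
   by (subst set_integral_diff(2), simp, intro set_integral_add(1)) (simp_all add: set_integral_add)
  finally show "(LINT s:Gam P. (un1 s - ((1/2) *R Aj s + Bj s)) * phi (gam P s)) = 0" using 1 2 by simp
 qed
 have e2: "AE s in lebesgue. s \<in> Gam P --> un2 s + ((1/2) *R Aj s - Bj s) = 0"
 proof (rule trace_fundamental_lemma)
  show "set_integrable lebesgue (Gam P) (%s. un2 s + ((1/2) *R Aj s - Bj s))" by (intro gi L2_diff L2_add L2_scale AB_L2 trace_L2)
  fix phi dphi assume phi: "C1 phi dphi" "compact (supp phi)" "supp phi <= Om P"
  have T: "L2 (Gam P) (%s. phi (gam P s))" using L2_trace[OF C1_continuous[OF phi(1)]] by (simp add: Gam_def)
  have 1: "(LINT x:Om2 P. u x \<bullet> dphi x) + (LINT x:Om2 P. f x * phi x) = - (LINT s:Gam P. un2 s * phi (gam P s))"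
   using normal_trace_identity[OF nt2 _ phi] by simp
  have i: "(LINT x:OmB P. u x \<bullet> (if x \<in> Om1 P then 0 else dphi x)) = (LINT x:Om2 P. u x \<bullet> dphi x)"
   "(LINT x:OmB P. f x * (if x \<in> Om1 P then 0 else phi x)) = (LINT x:Om2 P. f x * phi x)" by (rule split; use Om12_sub Om12 OmB_Un in auto)+
  have 2: "(LINT s:Gam P. Aj s * ((0 + phi (gam P s)) / 2)) + (LINT s:Gam P. Bj s * (0 - phi (gam P s)))
   = (LINT x:Om2 P. u x \<bullet> dphi x) + (LINT x:Om2 P. f x * phi x)" using weak_C1[OF zero phi(1,3)] unfolding i by linarith
  have "(LINT s:Gam P. (un2 s + ((1/2) *R Aj s - Bj s)) * phi (gam P s))
   = (LINT s:Gam P. un2 s * phi (gam P s) + (Aj s * ((0 + phi (gam P s)) / 2) + Bj s * (0 - phi (gam P s))))"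
   by (rule arg_cong[where f="set_lebesgue_integral lebesgue (Gam P)"]) (auto simp: algebra_simps)
  also have "... = (LINT s:Gam P. un2 s * phi (gam P s)) + ((LINT s:Gam P. Aj s * ((0 + phi (gam P s)) / 2)) + (LINT s:Gam P. Bj s * (0 - phi (gam P s))))"
  proof -
   have i1: "set_integrable lebesgue (Gam P) (%s. un2 s * phi (gam P s))" by (rule L2_mult_integrable[OF trace_L2(6) T])
   have i2: "set_integrable lebesgue (Gam P) (%s. Aj s * ((0 + phi (gam P s)) / 2))" using L2_mult_integrable[OF AB_L2(1) T] by simp
   have i3: "set_integrable lebesgue (Gam P) (%s. Bj s * (0 - phi (gam P s)))" using L2_mult_integrable[OF AB_L2(2) L2_scale[OF T, of "-1"]] by simp
   show ?thesis using set_integral_add(2)[OF i1 set_integral_add(1)[OF i2 i3]] set_integral_add(2)[OF i2 i3] by simp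
  qed
  finally show "(LINT s:Gam P. (un2 s + ((1/2) *R Aj s - Bj s)) * phi (gam P s)) = 0" using 1 2 by simp
 qed
 show ?thesis using e1 e2 proof eventually_elim
  case (elim s)
  show ?case proof
   assume "s \<in> Gam P"
   then have "un1 s = (1/2) * Aj s + Bj s" "un2 s = Bj s - (1/2) * Aj s" using elim by auto
   then show "un1 s - un2 s = Aj s & (un1 s + un2 s) / 2 = Bj s" by (simp add: field_simps)
  qed
 qed
qed

text \<open>The interface condition for the flux jump lets that jump replace the coupling term.\<close>

lemma weak_tangential: assumes psi: "C1 psi dpsi" "compact (supp psi)" "supp psi <= Gam P"
 shows "kG * (LINT s:Gam P. dpG s * dpsi s) - (LINT s:Gam P. (un1 s - un2 s) * psi s)
   = (LINT s:Gam P. ell P s * fG s * psi s)" proof -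
 have Gm: "bounded (Gam P)" "Gam P \<in> sets lebesgue" by (auto simp: Gam_def)
 have H: "H10 (Gam P) psi dpsi" unfolding H10_def proof (intro conjI)
  show "L2 (Gam P) psi" "L2 (Gam P) dpsi"
   by (rule L2_continuous_bounded[OF C1_continuous[OF psi(1)] Gm], rule L2_continuous_bounded[OF C1_continuous_grad[OF psi(1)] Gm])
  have "L2norm (Gam P) (%x. psi x - psi x) = 0" "L2norm (Gam P) (%x. dpsi x - dpsi x) = 0" by (rule L2norm_zero; simp)+
  then show "\<exists>phi dphi. (\<forall>n::nat. C1 (phi n) (dphi n) & compact (supp (phi n)) & supp (phi n) <= Gam P) &
    (%n. L2norm (Gam P) (%x. phi n x - psi x)) \<longlonglongrightarrow> 0 &
    (%n. L2norm (Gam P) (%x. dphi n x - dpsi x)) \<longlonglongrightarrow> 0"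
   by - (rule exI[of _ "%n. psi"], rule exI[of _ "%n. dpsi"], simp add: psi)
 qed
 have "(LINT s:Gam P. KG P s * dpG s * dpsi s) = (LINT s:Gam P. kG * (dpG s * dpsi s))"
  by (rule set_integral_lebesgue_cong_AE, rule eventually_mono[OF KG_eq]) simp
 moreover have "(LINT s:Gam P. (1 / alphaG P s) * ((p1 s + p2 s) / 2 - pG s) * psi s) = (LINT s:Gam P. (un1 s - un2 s) * psi s)"
  by (rule set_integral_lebesgue_cong_AE, rule eventually_mono[OF interface]) (simp add: Aj_def)
 ultimately show ?thesis using weak_fracture[OF H] by simp
qed

end

section \<open>Triangles\<close>

definition orient :: "pt => pt => pt => real" where
 "orient p q x = det2 (q - p) (x - p)"

lemma orient_cyc: "orient q r p = orient p q r" "orient r p q = orient p q r" by (simp_all add: orient_def det2_def algebra_simps)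

lemma orient_flip: "orient q p x = - orient p q x" by (simp add: orient_def det2_def algebra_simps)

lemma orient_same [simp]: "orient p q p = 0" "orient p q q = 0" "orient p p x = 0" by (simp_all add: orient_def det2_def algebra_simps)

lemma orient_sum: "orient p q x + orient q r x + orient r p x = orient p q r" by (simp add: orient_def det2_def algebra_simps)

lemma orient_affine: "orient p q (x + t *R (y - x)) = (1 - t) * orient p q x + t * orient p q y" by (simp add: orient_def det2_def algebra_simps)

lemma det2_le: "\<bar>det2 u v\<bar> \<le> norm u * norm v" proof -
 have "(det2 u v)^2 + (u \<bullet> v)^2 = (norm u * norm v)^2" by (simp add: power_mult_distrib power2_norm_eq_inner)
   (simp add: inner_vec_def sum_2 det2_def power2_eq_square algebra_simps)
 then have "(det2 u v)^2 \<le> (norm u * norm v)^2" by (metis le_add_same_cancel1 zero_le_power2)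
 then show ?thesis using abs_le_square_iff[of "det2 u v" "norm u * norm v"] by simp
qed

lemma orient_lipschitz: "\<bar>orient p q x - orient p q y\<bar> \<le> dist p q * dist x y" proof -
 have "orient p q x - orient p q y = det2 (q - p) (x - y)" by (simp add: orient_def det2_def algebra_simps)
 then show ?thesis using det2_le[of "q - p" "x - y"] by (simp add: dist_norm norm_minus_commute)
qed

lemma continuous_orient: "continuous_on A (orient p q)" unfolding orient_def[abs_def] det2_def by (intro continuous_intros)

lemma ccw_orient: "ccw (p, q, r) \<longleftrightarrow> 0 < orient p q r" by (simp add: ccw_det2 orient_def)

lemma tri_iff: assumes "ccw (p, q, r)"
 shows "x \<in> tri (p, q, r) \<longleftrightarrow> 0 \<le> orient p q x & 0 \<le> orient q r x & 0 \<le> orient r p x" proof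
 let ?J = "orient p q r"
 have J: "?J > 0" using assms by (simp add: ccw_orient)
 {
  assume "x \<in> tri (p, q, r)"
  then obtain s t where st: "x = p + s *R (q - p) + t *R (r - p)" "0 \<le> s" "0 \<le> t" "s + t \<le> 1" unfolding tri_param by blast
  have "orient p q x = t * ?J" "orient r p x = s * ?J" "orient q r x = (1 - s - t) * ?J"
   unfolding st(1) by (simp_all add: orient_def det2_def algebra_simps)
  then show "0 \<le> orient p q x & 0 \<le> orient q r x & 0 \<le> orient r p x" using st J by simp
 }
 assume x: "0 \<le> orient p q x & 0 \<le> orient q r x & 0 \<le> orient r p x"
 define s t where "s = orient r p x / ?J" and "t = orient p q x / ?J"
 have "?J *R x = ?J *R p + orient r p x *R (q - p) + orient p q x *R (r - p)" by (simp add: vec_eq_iff forall_2 orient_def det2_def algebra_simps)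
 then have "(1 / ?J) *R (?J *R x) = (1 / ?J) *R (?J *R p + orient r p x *R (q - p) + orient p q x *R (r - p))" by simp
 then have "x = p + s *R (q - p) + t *R (r - p)" using J by (simp add: s_def t_def scaleR_add_right)
 moreover have "0 \<le> s" "0 \<le> t" "s + t \<le> 1" using x J orient_sum[of p q x r] by (auto simp: s_def t_def add_divide_distrib[symmetric])
 ultimately show "x \<in> tri (p, q, r)" unfolding tri_param by blast
qed

definition tri_int :: "elem => pt set" where
 "tri_int tau = {x. \<forall>e\<in>dedges tau. 0 < orient (fst e) (snd e) x}"

text \<open>Twice the area.\<close>

definition J :: "elem => real" where
 "J tau = (case tau of (p, q, r) => orient p q r)"

lemma finite_dedges [simp]: "finite (dedges tau)" by (cases tau) (simp add: dedges_def)

lemma open_tri_int: "open (tri_int tau)" proof -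
 have "tri_int tau = (\<Inter>e\<in>dedges tau. {x. 0 < orient (fst e) (snd e) x})" by (auto simp: tri_int_def)
 also have "open ..." by (intro open_INT ballI open_Collect_less continuous_intros continuous_orient) simp
 finally show ?thesis .
qed

lemma tri_int_subset: "ccw tau ==> tri_int tau <= tri tau" by (cases tau) (auto simp: tri_int_def tri_iff dedges_def)

lemma tri_props: "compact (tri tau)" "convex (tri tau)" "verts tau <= tri tau" "bounded (tri tau)" "closed (tri tau)"
 "tri tau \<in> sets lebesgue" proof -
 have f: "finite (verts tau)" by (cases tau) (simp add: verts_def)
 show c: "compact (tri tau)" unfolding tri_def using f by (rule finite_imp_compact_convex_hull)
 show "convex (tri tau)" "verts tau <= tri tau" unfolding tri_def by (auto intro: hull_inc)
 show "bounded (tri tau)" "closed (tri tau)" using c compact_imp_bounded compact_imp_closed by auto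
 then show "tri tau \<in> sets lebesgue" by simp
qed

lemma ccw_distinct: "ccw (p, q, r) ==> p ~= q & q ~= r & r ~= p" by (auto simp: ccw_orient)

text \<open>Centre and polygon vertices play the same role in the geometry of a triangle; any directed edge
  can be rotated to the front.\<close>

lemma dedge_rotate: assumes "ccw tau" "e \<in> dedges tau"
 obtains p q r where "e = (p, q)" "ccw (p, q, r)" "dedges tau = {(p, q), (q, r), (r, p)}" "verts tau = {p, q, r}"
  "tri tau = tri (p, q, r)" "J tau = orient p q r" proof -
 obtain x y z where tau: "tau = (x, y, z)" by (cases tau)
 have t: "tri (x, y, z) = tri (y, z, x)" "tri (x, y, z) = tri (z, x, y)" by (simp_all add: tri_def verts_def insert_commute)
 have c: "ccw (y, z, x)" "ccw (z, x, y)" using assms(1) orient_cyc[where p = x and q = y and r = z] by (simp_all add: tau ccw_orient)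
 from assms(2) consider "e = (x, y)" | "e = (y, z)" | "e = (z, x)" by (auto simp: tau dedges_def)
 then show ?thesis proof cases
  case 1
  show ?thesis by (rule that[OF 1, of z]) (use assms in \<open>auto simp: tau dedges_def verts_def J_def\<close>)
 next
  case 2
  show ?thesis by (rule that[OF 2, of x]) (use c t orient_cyc[where p = x and q = y and r = z] in \<open>auto simp: tau dedges_def verts_def J_def\<close>)
 next
  case 3
  show ?thesis by (rule that[OF 3, of y]) (use c t orient_cyc[where p = x and q = y and r = z] in \<open>auto simp: tau dedges_def verts_def J_def\<close>)
 qed
qed

lemma tri_int_iff:
 "dedges tau = {(p, q), (q, r), (r, p)} ==> x \<in> tri_int tau \<longleftrightarrow> 0 < orient p q x & 0 < orient q r x & 0 < orient r p x"
 by (simp add: tri_int_def)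

lemma dist_le_diameter_tri: "x \<in> tri tau ==> y \<in> tri tau ==> dist x y \<le> diameter (tri tau)"
 using diameter_bounded_bound[OF tri_props(4)] by blast

lemma J_le: "ccw tau ==> e \<in> dedges tau ==> J tau \<le> elen e * diameter (tri tau)" proof -
 assume "ccw tau" "e \<in> dedges tau"
 then obtain p q r where t: "e = (p, q)" "verts tau = {p, q, r}" "J tau = orient p q r" by (rule dedge_rotate)
 have "orient p q r \<le> dist p q * dist r p" using orient_lipschitz[of p q r p] by simp
 also have "... \<le> dist p q * diameter (tri tau)" using t(2) tri_props(3)[of tau] by (intro mult_left_mono dist_le_diameter_tri) auto
 finally show ?thesis by (simp add: t elen_def)
qed

lemma elen_le_diameter: "ccw tau ==> e \<in> dedges tau ==> elen e \<le> diameter (tri tau)" proof -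
 assume "ccw tau" "e \<in> dedges tau"
 then obtain p q r where "e = (p, q)" "verts tau = {p, q, r}" by (rule dedge_rotate)
 then show ?thesis using tri_props(3)[of tau] by (auto simp: elen_def intro!: dist_le_diameter_tri)
qed

lemma diameter_tri_pos: "ccw tau ==> 0 < diameter (tri tau)" proof -
 assume c: "ccw tau"
 obtain p q r where tau: "tau = (p, q, r)" by (cases tau)
 have "0 < dist p q" using c ccw_distinct by (auto simp: tau)
 also have "dist p q \<le> diameter (tri tau)" using tri_props(3)[of tau] by (intro dist_le_diameter_tri) (auto simp: tau verts_def)
 finally show ?thesis .
qed

lemma tri_boundary_null: assumes "ccw tau" shows "AE x in lebesgue. x \<in> tri tau --> x \<in> tri_int tau" proof -
 have "AE x in lebesgue. x \<notin> frontier (tri tau)"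
  using negligible_convex_frontier[OF tri_props(2)] by (intro AE_not_in) (simp add: negligible_iff_null_sets)
 moreover have "x \<in> tri_int tau" if x: "x \<in> tri tau" "x \<notin> frontier (tri tau)" for x proof -
  have "x \<in> interior (tri tau)" using x closure_subset by (auto simp: frontier_def)
  then obtain eps where eps: "eps > 0" "ball x eps <= tri tau" by (auto simp: mem_interior)
  have "0 < orient (fst e) (snd e) x" if e: "e \<in> dedges tau" for e proof -
   obtain p q r where t: "e = (p, q)" "ccw (p, q, r)" "tri tau = tri (p, q, r)" by (rule dedge_rotate[OF assms e])
   have Jp: "orient p q r > 0" using t(2) by (simp add: ccw_orient)
   define n where "n = norm (r - p)"
   have n: "n > 0" using ccw_distinct[OF t(2)] by (auto simp: n_def)
   define k where "k = eps / (2 * n)"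
   define y where "y = x + (- k) *R (r - p)"
   have "dist x y < eps" using eps(1) n by (simp add: y_def k_def dist_norm n_def[symmetric])
   then have "y \<in> tri tau" using eps(2) by auto
   then have "0 \<le> orient p q y" unfolding t(3) tri_iff[OF t(2)] by blast
   moreover have "orient p q y = orient p q x - k * orient p q r" by (simp add: y_def orient_def det2_def algebra_simps)
   moreover have "k * orient p q r > 0" using eps(1) n Jp by (simp add: k_def)
   ultimately show ?thesis by (simp add: t(1))
  qed
  then show ?thesis by (simp add: tri_int_def)
 qed
 ultimately show ?thesis by (auto elim!: eventually_mono)
qed

section \<open>Mesh geometry\<close>

locale mesh_setting = fracture +
 fixes M :: mesh and \<rho>S \<rho>E :: real assumes reg: "regular_mesh P \<rho>S \<rho>E M"
begin

lemmas reg0 = reg[unfolded regular_mesh_def]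
lemmas reg1 = reg0[THEN conjunct2]
lemmas reg2 = reg1[THEN conjunct2]
lemmas reg3 = reg2[THEN conjunct2]
lemmas reg4 = reg3[THEN conjunct2]
lemmas reg5 = reg4[THEN conjunct2]
lemmas reg6 = reg5[THEN conjunct2]
lemmas reg7 = reg6[THEN conjunct2]
lemmas reg8 = reg7[THEN conjunct2]
lemmas reg9 = reg8[THEN conjunct2]
lemmas reg10 = reg9[THEN conjunct2]
lemmas reg11 = reg10[THEN conjunct2]
lemmas reg12 = reg11[THEN conjunct2]
lemmas reg13 = reg12[THEN conjunct2]
lemmas reg14 = reg13[THEN conjunct2]
lemmas reg15 = reg14[THEN conjunct2]
lemmas reg16 = reg15[THEN conjunct2]
lemmas reg17 = reg16[THEN conjunct2]

lemma fin_Tu: "finite (Tu M)" by (rule reg0[THEN conjunct1])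

lemma Th_ccw: "tau \<in> Th M ==> ccw tau" using reg2[THEN conjunct1] by blast

lemma cover: "(\<Union>S\<in>Tu M. cell S) = closure (Om P)" by (rule reg3[THEN conjunct1])

lemma cells_disj: "S \<in> Tu M ==> S' \<in> Tu M ==> S ~= S' ==> interior (cell S) \<inter> interior (cell S') = {}"
 using reg4[THEN conjunct1] by blast

lemma conforming: "tau \<in> Th M ==> tau' \<in> Th M ==> tri tau \<inter> tri tau' = convex hull (verts tau \<inter> verts tau')"
 using reg5[THEN conjunct1] by blast

lemma cell_side: "S \<in> Tu M ==> interior (cell S) <= Om1 P \<or> interior (cell S) <= Om2 P" using reg6[THEN conjunct1] by blast

lemma pedge_cases: "e \<in> pedges M ==> on_bd P e \<or> open_segment (fst e) (snd e) <= Om P" using reg7[THEN conjunct1] by blast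

lemma FG_cover: "(\<Union>(s, t)\<in>FG P M. {s..t}) = {0..len P}" by (rule reg8[THEN conjunct1])

lemma FG_const: "(s, t) \<in> FG P M ==> kapt P constant_on {s<..<t} & kapn P constant_on {s<..<t} & ell P constant_on {s<..<t}"
 using bspec[OF reg9[THEN conjunct1], of "(s, t)"] by simp

lemma ori_one: "tau \<in> Th M ==> e \<in> dedges tau ==> e \<in> ori M \<longleftrightarrow> prod.swap e \<notin> ori M"
 using reg11[THEN conjunct1] by blast

lemma \<rho>S: "0 < \<rho>S" by (rule reg14[THEN conjunct1])

lemma \<rho>E: "0 < \<rho>E" by (rule reg15[THEN conjunct1])

lemma star: "S \<in> Tu M ==> \<exists>r \<ge> \<rho>S * diameter (cell S). ball (fst S) r <= cell S & (\<forall>y\<in>cell S. convex hull (insert y (ball (fst S) r)) <= cell S)"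
 by (rule bspec[OF reg16[THEN conjunct1]])

lemma edge_len: "S \<in> Tu M ==> (nu, a, b) \<in> tris_of S ==> elen (a, b) \<ge> \<rho>E * diameter (cell S)"
 using bspec[OF bspec[OF reg17], of S "(nu, a, b)"] by simp

lemma Th_iff: "tau \<in> Th M \<longleftrightarrow> (\<exists>S\<in>Tu M. tau \<in> tris_of S)" by (simp add: Th_def)

lemma finite_Th: "finite (Th M)" proof -
 have "tris_of S = (%i. (fst S, snd S ! i, snd S ! (Suc i mod length (snd S)))) ` {..<length (snd S)}" for S by (auto simp: tris_of_def)
 then have "finite (tris_of S)" for S by simp
 then show ?thesis unfolding Th_def using fin_Tu by blast
qed

lemma tris_of_centre: "(nu, a, b) \<in> tris_of S ==> nu = fst S" by (auto simp: tris_of_def)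

lemma tri_cell: "tau \<in> tris_of S ==> tri tau <= cell S" by (auto simp: cell_def)

lemma Union_tri: "(\<Union>tau\<in>Th M. tri tau) = closure (Om P)" unfolding cover[symmetric] Th_def cell_def by blast

lemma tri_int_interior: "S \<in> Tu M ==> tau \<in> tris_of S ==> tri_int tau <= interior (cell S)" proof (intro interior_maximal open_tri_int)
 assume "S \<in> Tu M" "tau \<in> tris_of S"
 then have "tri_int tau <= tri tau" "tri tau <= cell S" using tri_int_subset[OF Th_ccw, of tau] tri_cell unfolding Th_iff by blast+
 then show "tri_int tau <= cell S" by blast
qed

lemma tri_int_Om12: "tau \<in> Th M ==> tri_int tau <= Om1 P \<or> tri_int tau <= Om2 P" using tri_int_interior cell_side unfolding Th_iff by blast

lemma tri_int_OmB: "tau \<in> Th M ==> tri_int tau <= OmB P" using tri_int_Om12 OmB_Un by blast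

text \<open>By conformity a point of two triangles lies in their common face, so every vertex with a
  positive barycentric coordinate is shared.\<close>

lemma face: assumes tau: "tau \<in> Th M" "tau' \<in> Th M" and x: "x \<in> tri tau" "x \<in> tri tau'"
  and v: "verts tau = {p, q, r}" and pos: "0 < orient p q x" shows "r \<in> verts tau'" proof (rule ccontr)
 assume r: "r \<notin> verts tau'"
 have "verts tau \<inter> verts tau' <= {p, q}" using v r by blast
 then have "convex hull (verts tau \<inter> verts tau') <= {x. orient p q x \<le> 0}" proof (intro hull_minimal)
  have "orient p q x = (vector [- (q - p)$2, (q - p)$1] :: pt) \<bullet> x - (vector [- (q - p)$2, (q - p)$1] :: pt) \<bullet> p" for x
   by (simp add: orient_def det2_def inner_vec_def sum_2 algebra_simps)
  then have "{x. orient p q x \<le> 0} = {x. (vector [- (q - p)$2, (q - p)$1] :: pt) \<bullet> x \<le> (vector [- (q - p)$2, (q - p)$1] :: pt) \<bullet> p}" by auto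
  then show "convex {x. orient p q x \<le> 0}" by (simp add: convex_halfspace_le)
 qed auto
 then show False using conforming[OF tau] x pos by force
qed

lemma cell_bounded: "bounded (cell S)" proof -
 have "tris_of S = (%i. (fst S, snd S ! i, snd S ! (Suc i mod length (snd S)))) ` {..<length (snd S)}" by (auto simp: tris_of_def)
 then show ?thesis unfolding cell_def by (intro bounded_UN) (auto simp: tri_props)
qed

lemma diameter_tri_le_cell: "tau \<in> tris_of S ==> diameter (tri tau) \<le> diameter (cell S)" by (rule diameter_subset[OF tri_cell cell_bounded])

lemma centre_not_vertex: assumes tau: "(nu, a, b) \<in> Th M" "(nu', a', b') \<in> Th M" shows "nu' \<notin> {a, b}" proof
 assume in1: "nu' \<in> {a, b}"
 obtain S S' where S: "S \<in> Tu M" "(nu, a, b) \<in> tris_of S" and S': "S' \<in> Tu M" "(nu', a', b') \<in> tris_of S'"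
  using tau unfolding Th_iff by blast
 have c: "ccw (nu, a, b)" "ccw (nu', a', b')" using Th_ccw tau by auto
 have "nu ~= nu'" using in1 ccw_distinct[OF c(1)] by auto
 then have ne: "S ~= S'" using tris_of_centre[OF S(2)] tris_of_centre[OF S'(2)] by auto
 obtain r where r: "r \<ge> \<rho>S * diameter (cell S')" "ball nu' r <= cell S'" using star[OF S'(1)] tris_of_centre[OF S'(2)] by auto
 have "0 < diameter (cell S')" using diameter_tri_pos[OF c(2)] diameter_tri_le_cell[OF S'(2)] by linarith
 then have r0: "r > 0" using r(1) \<rho>S by (meson less_le_trans mult_pos_pos)
 define g where "g = (1/3) *R (nu + a + b)"
 have g: "orient nu a g = orient nu a b / 3" "orient a b g = orient nu a b / 3" "orient b nu g = orient nu a b / 3"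
  by (simp_all add: g_def orient_def det2_def field_simps)
 define eps where "eps = min 1 (r / (2 * (norm (g - nu') + 1)))"
 have eps: "0 < eps" "eps \<le> 1" using r0 by (auto simp: eps_def add_nonneg_pos)
 define x where "x = nu' + eps *R (g - nu')"
 have Jp: "0 < orient nu a b" using c(1) by (simp add: ccw_orient)
 have "0 \<le> orient nu a nu'" "0 \<le> orient a b nu'" "0 \<le> orient b nu nu'" using in1 Jp orient_cyc[where p = nu and q = a and r = b] by auto
 then have "0 < orient nu a x" "0 < orient a b x" "0 < orient b nu x"
  unfolding x_def orient_affine using eps g Jp by (auto intro!: add_nonneg_pos mult_nonneg_nonneg)
 then have "x \<in> tri_int (nu, a, b)" by (simp add: tri_int_def dedges_def)
 then have "x \<in> interior (cell S)" using tri_int_interior[OF S] by blast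
 moreover have "x \<in> interior (cell S')" proof -
  have "norm (g - nu') * eps \<le> norm (g - nu') * (r / (2 * (norm (g - nu') + 1)))" by (intro mult_left_mono) (auto simp: eps_def)
  also have "... = (r / 2) * (norm (g - nu') / (norm (g - nu') + 1))" by simp
  also have "... \<le> (r / 2) * 1" using r0 by (intro mult_left_mono) (auto simp: divide_le_eq add_nonneg_pos)
  finally have "dist nu' x < r" using r0 eps by (simp add: x_def dist_norm mult.commute)
  then have "x \<in> ball nu' r" by simp
  then show ?thesis using interior_maximal[OF r(2) open_ball] by blast
 qed
 ultimately show False using cells_disj[OF S(1) S'(1) ne] by blast
qed

lemma tri_int_unique: assumes tau: "tau \<in> Th M" "tau' \<in> Th M" and x: "x \<in> tri_int tau" "x \<in> tri tau'" shows "tau = tau'" proof -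
 obtain nu a b where t: "tau = (nu, a, b)" by (cases tau)
 obtain nu' a' b' where t': "tau' = (nu', a', b')" by (cases tau')
 have c: "ccw (nu, a, b)" "ccw (nu', a', b')" using Th_ccw tau t t' by auto
 have pos: "0 < orient nu a x" "0 < orient a b x" "0 < orient b nu x" using x(1) by (auto simp: t tri_int_def dedges_def)
 have xt: "x \<in> tri tau" using tri_int_subset[OF Th_ccw[OF tau(1)]] x(1) by blast
 have "b \<in> verts tau'" by (rule face[OF tau xt x(2) _ pos(1)]) (auto simp: t verts_def)
 moreover have "nu \<in> verts tau'" by (rule face[OF tau xt x(2) _ pos(2)]) (auto simp: t verts_def)
 moreover have "a \<in> verts tau'" by (rule face[OF tau xt x(2) _ pos(3)]) (auto simp: t verts_def)
 ultimately have "nu \<in> {nu', a', b'}" "a \<in> {nu', a', b'}" "b \<in> {nu', a', b'}" by (auto simp: t' verts_def)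
 moreover have "nu \<notin> {a', b'}" using centre_not_vertex[of nu' a' b' nu a b] tau t t' by blast
 moreover have d: "nu ~= a" "a ~= b" "b ~= nu" using ccw_distinct[OF c(1)] by auto
 ultimately have "nu = nu'" "(a = a' & b = b') \<or> (a = b' & b = a')" by auto
 moreover have "\<not> (a = b' & b = a')" if "nu = nu'" proof
  assume "a = b' & b = a'"
  then have "orient nu a b = - orient nu' a' b'" using that by (simp add: orient_def det2_def algebra_simps)
  then show False using c by (simp add: ccw_orient)
 qed
 ultimately show ?thesis by (auto simp: t t')
qed

lemma dedge_unique: assumes tau: "tau \<in> Th M" "tau' \<in> Th M" and e: "e \<in> dedges tau" "e \<in> dedges tau'" shows "tau = tau'" proof -
 obtain p q r where t: "e = (p, q)" "ccw (p, q, r)" "dedges tau = {(p, q), (q, r), (r, p)}" "tri tau = tri (p, q, r)"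
  by (rule dedge_rotate[OF Th_ccw[OF tau(1)] e(1)])
 obtain p' q' r' where t': "e = (p', q')" "ccw (p', q', r')" "tri tau' = tri (p', q', r')" by (rule dedge_rotate[OF Th_ccw[OF tau(2)] e(2)])
 have eq: "p' = p" "q' = q" using t t' by auto
 note c' = t'(2)[unfolded eq]
 define m where "m = (1/2) *R (p + q)"
 have J: "0 < orient p q r" "0 < orient p q r'" using t(2) c' by (auto simp: ccw_orient)
 have m: "orient p q m = 0" "orient q r m = orient p q r / 2" "orient r p m = orient p q r / 2"
  "orient q r' m = orient p q r' / 2" "orient r' p m = orient p q r' / 2" by (simp_all add: m_def orient_def det2_def field_simps)
 define K where "K = orient p q r' / 2 + \<bar>orient q r' r\<bar> + \<bar>orient r' p r\<bar>"
 define eps where "eps = (orient p q r' / 2) / (2 * K)"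
 have K: "K > 0" "orient p q r' / 2 \<le> K" using J by (auto simp: K_def)
 have eps: "0 < eps" "eps \<le> 1/2" using J K by (auto simp: eps_def divide_simps)
 define x where "x = m + eps *R (r - m)"
 have o: "orient u v x = (1 - eps) * orient u v m + eps * orient u v r" for u v unfolding x_def by (rule orient_affine)
 have "x \<in> tri_int tau" unfolding tri_int_iff[OF t(3)] o m using eps J by (simp add: add_nonneg_pos)
 moreover have "x \<in> tri tau'" proof -
  have b: "0 \<le> (1 - eps) * (orient p q r' / 2) + eps * y" if "\<bar>y\<bar> + orient p q r' / 2 \<le> K" for y proof -
   have "eps * (orient p q r' / 2 - y) \<le> eps * K" using eps that by (intro mult_left_mono) auto
   also have "... \<le> orient p q r' / 2" using K J by (simp add: eps_def field_simps)
   finally have "eps * (orient p q r' / 2) - eps * y \<le> orient p q r' / 2" by (simp only: right_diff_distrib)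
   then show ?thesis unfolding left_diff_distrib mult_1_left by linarith
  qed
  have b1: "0 \<le> (1 - eps) * (orient p q r' / 2) + eps * orient q r' r" and b2: "0 \<le> (1 - eps) * (orient p q r' / 2) + eps * orient r' p r"
   by (rule b, simp add: K_def)+
  show ?thesis unfolding t'(3) eq tri_iff[OF c'] o m using eps J b1 b2 by simp
 qed
 ultimately show ?thesis by (rule tri_int_unique[OF tau])
qed

lemma Lft_eq: "tau \<in> Th M ==> e \<in> dedges tau ==> Lft M e = tau" unfolding Lft_def by (rule the_equality) (auto intro: dedge_unique)

lemma open_segment_orient: assumes "x \<in> open_segment p q" "0 < orient p q r" shows "orient p q x = 0" "0 < orient q r x" "0 < orient r p x"
proof -
 obtain t where t: "0 < t" "t < 1" "x = p + t *R (q - p)" using assms(1) by (auto simp: in_segment algebra_simps)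
 show "orient p q x = 0" "0 < orient q r x" "0 < orient r p x"
  unfolding t(3) orient_affine using t assms(2) orient_cyc[where p = p and q = q and r = r] by simp_all
qed

lemma neighbour_exists: assumes tau: "tau \<in> Th M" "e \<in> dedges tau" and x0: "x0 \<in> open_segment (fst e) (snd e)" "x0 \<in> Om P"
 obtains tau' where "tau' \<in> Th M" "prod.swap e \<in> dedges tau'" proof -
 obtain p q r where t: "e = (p, q)" "ccw (p, q, r)" "verts tau = {p, q, r}" "tri tau = tri (p, q, r)"
  by (rule dedge_rotate[OF Th_ccw[OF tau(1)] tau(2)])
 have J: "0 < orient p q r" using t(2) by (simp add: ccw_orient)
 have x0': "x0 \<in> open_segment p q" using x0(1) t(1) by simp
 note o0 = open_segment_orient[OF x0' J]
 have x0t: "x0 \<in> tri tau" unfolding t(4) tri_iff[OF t(2)] using o0 by simp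
 have "closed (\<Union>tau'\<in>{tau'\<in>Th M. x0 \<notin> tri tau'}. tri tau')" using finite_Th tri_props(5) by (intro closed_UN) auto
 then have "open (Om P - (\<Union>tau'\<in>{tau'\<in>Th M. x0 \<notin> tri tau'}. tri tau'))" using Om_open by auto
 moreover have "x0 \<in> Om P - (\<Union>tau'\<in>{tau'\<in>Th M. x0 \<notin> tri tau'}. tri tau')" using x0(2) by auto
 ultimately obtain eps where eps: "eps > 0" "ball x0 eps <= Om P - (\<Union>tau'\<in>{tau'\<in>Th M. x0 \<notin> tri tau'}. tri tau')" by (rule openE)
 define n where "n = norm (r - x0)"
 have n: "n > 0" using o0(1) J by (auto simp: n_def)
 define x where "x = x0 + (- eps / (2 * n)) *R (r - x0)"
 have "dist x0 x < eps" using eps(1) n by (simp add: x_def dist_norm n_def[symmetric])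
 then have xb: "x \<in> ball x0 eps" by simp
 then have "x \<in> closure (Om P)" using eps(2) closure_subset by blast
 then obtain tau' where tau': "tau' \<in> Th M" "x \<in> tri tau'" unfolding Union_tri[symmetric] by blast
 then have x0t': "x0 \<in> tri tau'" using eps(2) xb by blast
 have neg: "orient p q x < 0" unfolding x_def orient_affine o0(1) using eps(1) n J by (simp add: divide_simps)
 have p: "p \<in> verts tau'" by (rule face[OF tau(1) tau'(1) x0t x0t' _ o0(2)]) (use t(3) in auto)
 have q: "q \<in> verts tau'" by (rule face[OF tau(1) tau'(1) x0t x0t' _ o0(3)]) (use t(3) in auto)
 have "p ~= q" using ccw_distinct[OF t(2)] by blast
 obtain u v w where u: "tau' = (u, v, w)" by (cases tau')
 have "(p, q) \<in> dedges tau' \<or> (q, p) \<in> dedges tau'" using p q \<open>p ~= q\<close> by (auto simp: u verts_def dedges_def)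
 moreover have "(p, q) \<notin> dedges tau'" proof
  assume pq: "(p, q) \<in> dedges tau'"
  obtain p' q' r' where "(p, q) = (p', q')" "ccw (p', q', r')" "tri tau' = tri (p', q', r')" by (rule dedge_rotate[OF Th_ccw[OF tau'(1)] pq])
  then show False using tau'(2) neg tri_iff[of p' q' r' x] by auto
 qed
 ultimately show ?thesis using that[OF tau'(1)] t(1) by simp
qed

end

lemma norm_rot: "norm (rot v) = norm v" by (simp add: norm_eq_sqrt_inner inner_vec_def sum_2 rot_simps add.commute)

context mesh_setting
begin

definition \<sigma> :: real where "\<sigma> = \<rho>S * \<rho>E"

lemma \<sigma>_pos: "0 < \<sigma>" using \<rho>S \<rho>E by (simp add: \<sigma>_def)

text \<open>If the line through a polygon edge came closer to the centre than the radius of the ball of star-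
  shapedness, then points beyond the midpoint of that edge would belong to the polygon, hence to a
  second triangle that overlaps the first one.\<close>

lemma shape_regular: assumes "tau \<in> Th M" shows "\<sigma> * (diameter (tri tau))^2 \<le> J tau" proof -
 obtain S where S: "S \<in> Tu M" "tau \<in> tris_of S" using assms unfolding Th_iff by blast
 obtain nu a b where t: "tau = (nu, a, b)" by (cases tau)
 have c: "ccw (nu, a, b)" using Th_ccw[OF assms] by (simp add: t)
 have nu: "nu = fst S" using tris_of_centre S(2) by (auto simp: t)
 define h where "h = diameter (cell S)"
 have dh: "diameter (tri tau) \<le> h" unfolding h_def by (rule diameter_tri_le_cell[OF S(2)])
 have h: "h > 0" using diameter_tri_pos[OF Th_ccw[OF assms]] dh by linarith
 obtain r where r: "r \<ge> \<rho>S * h" "ball nu r <= cell S" "!!y. y \<in> cell S ==> convex hull (insert y (ball nu r)) <= cell S"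
  using star[OF S(1)] unfolding nu h_def by blast
 have r0: "r > 0" using r(1) \<rho>S h by (meson less_le_trans mult_pos_pos)
 have ab: "a ~= b" using ccw_distinct[OF c] by blast
 define l where "l = norm (b - a)"
 have l: "l > 0" using ab by (simp add: l_def)
 have Jp: "0 < orient nu a b" using c by (simp add: ccw_orient)
 have "r * l \<le> orient nu a b" proof (rule ccontr)
  assume "\<not> r * l \<le> orient nu a b"
  then have lt: "orient nu a b < r * l" by simp
  define n where "n = (1 / l^2) *R rot (b - a)"
  define t0 where "t0 = ((nu - a) \<bullet> (b - a)) / l^2"
  define f where "f = a + t0 *R (b - a)"
  have l2: "l^2 = ((b - a)$1)^2 + ((b - a)$2)^2" unfolding l_def power2_norm_eq_inner by (simp add: inner_vec_def sum_2 power2_eq_square)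
  have "l^2 *R (f - nu) = orient nu a b *R rot (b - a)" proof -
   have "l^2 *R (f - nu) = l^2 *R (a - nu) + ((nu - a) \<bullet> (b - a)) *R (b - a)" proof -
    have t: "l^2 *R (t0 *R (b - a)) = ((nu - a) \<bullet> (b - a)) *R (b - a)" using l by (simp add: t0_def)
    have "l^2 *R (f - nu) = l^2 *R (a - nu) + l^2 *R (t0 *R (b - a))" by (simp only: f_def scaleR_add_right[symmetric]) (simp add: algebra_simps)
    then show ?thesis unfolding t .
   qed
   also have "... = orient nu a b *R rot (b - a)" unfolding l2
    by (simp add: vec_eq_iff forall_2 rot_simps inner_vec_def sum_2 orient_def det2_def power2_eq_square algebra_simps)
   finally show ?thesis .
  qed
  then have "norm (l^2 *R (f - nu)) = norm (orient nu a b *R rot (b - a))" by simp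
  moreover have "norm (rot (b - a)) = l" by (simp add: norm_rot l_def)
  ultimately have "l^2 * norm (f - nu) = orient nu a b * l" using Jp l by simp
  then have "l * norm (f - nu) = orient nu a b" using l by (simp add: power2_eq_square)
  then have fr: "norm (f - nu) < r" using lt l by (metis mult.commute mult_less_cancel_left_pos)
  have "\<exists>z\<in>{a, b}. \<exists>theta. 0 \<le> theta & theta < 1 & (1/2) *R (a + b) = (1 - theta) *R f + theta *R z"
  proof (cases "t0 \<le> 1/2")
   case True
   define theta where "theta = (1/2 - t0) / (1 - t0)"
   have e: "(1 - theta) * (1 - t0) = 1/2" "0 \<le> theta" "theta < 1" using True by (auto simp: theta_def field_simps)
   have "(1 - theta) *R f + theta *R b = b + ((1 - theta) * (1 - t0)) *R (a - b)" by (simp add: f_def algebra_simps)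
   also have "... = (1/2) *R (a + b)" unfolding e(1) by (simp add: vec_eq_iff forall_2 field_simps)
   finally show ?thesis using e by (intro bexI[of _ b] exI[of _ theta]) auto
  next
   case False
   define theta where "theta = 1 - 1 / (2 * t0)"
   have e: "(1 - theta) * t0 = 1/2" "0 \<le> theta" "theta < 1" using False by (auto simp: theta_def field_simps)
   have "(1 - theta) *R f + theta *R a = a + ((1 - theta) * t0) *R (b - a)" by (simp add: f_def algebra_simps)
   also have "... = (1/2) *R (a + b)" unfolding e(1) by (simp add: vec_eq_iff forall_2 field_simps)
   finally show ?thesis using e by (intro bexI[of _ a] exI[of _ theta]) auto
  qed
  then obtain z theta where z: "z \<in> {a, b}" "0 \<le> theta" "theta < 1" "(1/2) *R (a + b) = (1 - theta) *R f + theta *R z" by blast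
  define m where "m = (1/2) *R (a + b)"
  have mo: "orient nu a m = orient nu a b / 2" "orient a b m = 0" "orient b nu m = orient nu a b / 2"
   by (simp_all add: m_def orient_def det2_def field_simps)
  define g where "g = norm (m - nu)"
  define w where "w = m - nu"
  have wo: "orient a b (x + k *R w) = orient a b x - k * orient nu a b" for x k by (simp add: w_def m_def orient_def det2_def field_simps)
  define k where "k = min (1/2) ((r - norm (f - nu)) / (2 * (norm w + 1)))"
  have k1: "0 < k" using fr by (auto simp: k_def add_nonneg_pos)
  have k2: "k \<le> 1/2" unfolding k_def by (rule min.cobounded1)
  note k = k1 k2
  define f' where "f' = f + k *R w"
  have "norm (k *R w) < r - norm (f - nu)" proof -
   have "k * norm w \<le> (r - norm (f - nu)) / (2 * (norm w + 1)) * norm w" by (intro mult_right_mono) (auto simp: k_def)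
   also have "... = (r - norm (f - nu)) / 2 * (norm w / (norm w + 1))" by simp
   also have "... \<le> (r - norm (f - nu)) / 2 * 1" using fr by (intro mult_left_mono) (auto simp: divide_le_eq add_nonneg_pos)
   also have "... < r - norm (f - nu)" using fr by simp
   finally show ?thesis using k by simp
  qed
  then have "norm (f' - nu) < r" using norm_triangle_ineq[of "f - nu" "k *R w"] by (simp add: f'_def algebra_simps)
  then have f'b: "f' \<in> ball nu r" by (simp add: dist_norm norm_minus_commute)
  define m' where "m' = m + ((1 - theta) * k) *R w"
  have zc: "z \<in> cell S" using z(1) tri_cell[OF S(2)] tri_props(3)[of tau] by (auto simp: t verts_def)
  have "m' = (1 - theta) *R f' + theta *R z" unfolding m'_def m_def z(4) f'_def by (simp add: algebra_simps)
  moreover have "(1 - theta) *R f' + theta *R z \<in> convex hull (insert z (ball nu r))"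
   using z f'b by (intro convexD[OF convex_convex_hull]) (auto intro: hull_inc)
  ultimately have "m' \<in> cell S" using r(3)[OF zc] by auto
  then obtain tau' where tau': "tau' \<in> tris_of S" "m' \<in> tri tau'" by (auto simp: cell_def)
  have T': "tau' \<in> Th M" using tau'(1) S(1) Th_iff by blast
  have "fst tau' = nu" using tris_of_centre[of "fst tau'" "fst (snd tau')" "snd (snd tau')" S] tau'(1) nu by simp
  then have nu': "nu \<in> tri tau'" using tri_props(3)[of tau'] by (cases tau') (auto simp: verts_def)
  define k' where "k' = (1 - theta) * k"
  have "(1 - theta) * k \<le> 1 * k" by (intro mult_right_mono) (use k z in auto)
  then have k'2: "k' \<le> 1/2" unfolding k'_def using k2 by linarith
  have "0 < k'" using k1 z(3) by (simp add: k'_def)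
  note k' = this k'2
  define y where "y = nu + (1/2) *R (m' - nu)"
  have "y = (1/2) *R nu + (1/2) *R m'" by (simp add: y_def vec_eq_iff field_simps)
  then have "y \<in> tri tau'" using convexD[OF tri_props(2) nu' tau'(2), of "1/2" "1/2"] by simp
  moreover have "y \<in> tri_int tau" proof -
   have ym: "y = nu + ((1 + k') / 2) *R (m - nu)" proof -
    have "m' = m + k' *R w" by (simp add: m'_def k'_def)
    then have "m' - nu = (1 + k') *R (m - nu)" by (simp add: w_def algebra_simps)
    then show ?thesis by (simp add: y_def)
   qed
   have "0 < orient nu a y" "0 < orient a b y" "0 < orient b nu y"
    unfolding ym orient_affine mo using Jp k' mult_pos_pos[OF k'(1) Jp] orient_cyc[where p = nu and q = a and r = b]
    by (simp_all add: field_simps add_pos_pos)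
   then show ?thesis by (simp add: t tri_int_def dedges_def)
  qed
  ultimately have "tau = tau'" using tri_int_unique[OF assms T'] by blast
  then have "0 \<le> orient a b m'" using tau'(2) tri_iff[OF c] t by blast
  moreover have "orient a b m' < 0" unfolding m'_def wo mo using Jp k' by (simp add: k'_def[symmetric])
  ultimately show False by simp
 qed
 moreover have "\<rho>S * h * (\<rho>E * h) \<le> r * l" using r(1) edge_len[OF S(1), of nu a b] S(2) \<rho>S \<rho>E h
  using r0 by (intro mult_mono) (auto simp: t elen_def dist_norm l_def h_def norm_minus_commute)
 ultimately have "\<sigma> * h^2 \<le> J tau" by (simp add: \<sigma>_def t J_def power2_eq_square mult_ac)
 moreover have "(diameter (tri tau))^2 \<le> h^2" using dh diameter_tri_pos[OF Th_ccw[OF assms]] by (intro power_mono) auto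
 ultimately show ?thesis using mult_left_mono[of _ _ \<sigma>] \<sigma>_pos by (smt (verit))
qed

lemma elen_ge: "tau \<in> Th M ==> e \<in> dedges tau ==> \<sigma> * diameter (tri tau) \<le> elen e" proof -
 assume t: "tau \<in> Th M" "e \<in> dedges tau"
 have "\<sigma> * diameter (tri tau) * diameter (tri tau) \<le> elen e * diameter (tri tau)"
  using shape_regular[OF t(1)] J_le[OF Th_ccw[OF t(1)] t(2)] by (simp add: power2_eq_square mult.assoc)
 then show ?thesis using diameter_tri_pos[OF Th_ccw[OF t(1)]] by simp
qed

lemma \<sigma>_le_1: "tau \<in> Th M ==> \<sigma> \<le> 1" proof -
 assume t: "tau \<in> Th M"
 obtain e where e: "e \<in> dedges tau" by (cases tau) (auto simp: dedges_def)
 have "\<sigma> * diameter (tri tau) \<le> 1 * diameter (tri tau)" using elen_ge[OF t e] elen_le_diameter[OF Th_ccw[OF t] e] by simp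
 then show ?thesis using diameter_tri_pos[OF Th_ccw[OF t]] by (simp only: mult_le_cancel_right_pos)
qed

lemma elen_pos: "tau \<in> Th M ==> e \<in> dedges tau ==> 0 < elen e"
 using elen_ge \<sigma>_pos diameter_tri_pos[OF Th_ccw] by (meson less_le_trans mult_pos_pos)

definition centroid :: "elem => pt" where
 "centroid tau = (case tau of (p, q, r) => (1/3) *R (p + q + r))"

lemma centroid_ball: assumes "tau \<in> Th M"
 shows "cball (centroid tau) (\<sigma> * diameter (tri tau) / 6) <= tri_int tau" "centroid tau \<in> tri tau" proof -
 obtain p q r where t: "tau = (p, q, r)" by (cases tau)
 let ?g = "centroid tau"
 have Jp: "0 < J tau" using Th_ccw[OF assms] by (simp add: t J_def ccw_orient)
 have g: "orient p q ?g = J tau / 3" "orient q r ?g = J tau / 3" "orient r p ?g = J tau / 3"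
  by (simp_all add: t centroid_def J_def orient_def det2_def field_simps)
 then have go: "orient (fst e) (snd e) ?g = J tau / 3" if "e \<in> dedges tau" for e using that by (auto simp: t dedges_def)
 show sub: "cball ?g (\<sigma> * diameter (tri tau) / 6) <= tri_int tau" proof
  fix x assume x: "x \<in> cball ?g (\<sigma> * diameter (tri tau) / 6)"
  have "0 < orient (fst e) (snd e) x" if e: "e \<in> dedges tau" for e proof -
   have "\<bar>orient (fst e) (snd e) ?g - orient (fst e) (snd e) x\<bar> \<le> elen e * dist ?g x" unfolding elen_def by (rule orient_lipschitz)
   also have "... \<le> diameter (tri tau) * (\<sigma> * diameter (tri tau) / 6)" using x elen_le_diameter[OF Th_ccw[OF assms] e] elen_nonneg[of e]
    by (intro mult_mono) (auto intro: order_trans[OF zero_le_dist])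
   also have "... \<le> J tau / 6" using shape_regular[OF assms] by (simp add: power2_eq_square mult_ac)
   finally show ?thesis using go[OF e] Jp by linarith
  qed
  then show "x \<in> tri_int tau" by (simp add: tri_int_def)
 qed
 have "?g \<in> cball ?g (\<sigma> * diameter (tri tau) / 6)" using \<sigma>_pos diameter_tri_pos[OF Th_ccw[OF assms]] by simp
 then show "?g \<in> tri tau" using sub tri_int_subset[OF Th_ccw[OF assms]] by blast
qed

text \<open>Near its midpoint an edge sees only the half-plane that the triangle occupies.\<close>

lemma midpoint_ball: assumes t: "tau \<in> Th M" "e \<in> dedges tau" and x: "dist ((1/2) *R (fst e + snd e)) x \<le> \<sigma> * elen e / 4"
 shows "0 \<le> orient (fst e) (snd e) x ==> x \<in> tri tau" "0 < orient (fst e) (snd e) x ==> x \<in> tri_int tau"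
  "!!e'. e' \<in> dedges tau ==> e' ~= e ==> 0 < orient (fst e') (snd e') x" proof -
 obtain p q r where r: "e = (p, q)" "ccw (p, q, r)" "dedges tau = {(p, q), (q, r), (r, p)}" "verts tau = {p, q, r}"
  "tri tau = tri (p, q, r)" "J tau = orient p q r" by (rule dedge_rotate[OF Th_ccw[OF t(1)] t(2)])
 let ?m = "(1/2) *R (p + q)"
 have Jp: "0 < J tau" using r by (simp add: ccw_orient)
 have m: "orient q r ?m = J tau / 2" "orient r p ?m = J tau / 2" by (simp_all add: r(6) orient_def det2_def field_simps)
 have bd: "0 < orient u v x" if "orient u v ?m = J tau / 2" "(u, v) \<in> dedges tau" for u v proof -
  have "\<bar>orient u v ?m - orient u v x\<bar> \<le> elen (u, v) * dist ?m x" using orient_lipschitz[of u v ?m x] by (simp add: elen_def)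
  also have "... \<le> diameter (tri tau) * (\<sigma> * diameter (tri tau) / 4)" proof (rule mult_mono)
   have "\<sigma> * elen e \<le> \<sigma> * diameter (tri tau)"
    using elen_le_diameter[OF Th_ccw[OF t(1)] t(2)] \<sigma>_pos by (intro mult_left_mono) auto
   then show "dist ?m x \<le> \<sigma> * diameter (tri tau) / 4" using x by (simp add: r(1))
   show "elen (u, v) \<le> diameter (tri tau)" by (rule elen_le_diameter[OF Th_ccw[OF t(1)] that(2)])
  qed (use diameter_tri_pos[OF Th_ccw[OF t(1)]] in auto)
  also have "... \<le> J tau / 4" using shape_regular[OF t(1)] by (simp add: power2_eq_square mult_ac)
  finally show ?thesis using that(1) Jp by linarith
 qed
 have pos: "0 < orient q r x" "0 < orient r p x" by (rule bd[OF m(1)], simp add: r(3), rule bd[OF m(2)], simp add: r(3))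
 show "0 \<le> orient (fst e) (snd e) x ==> x \<in> tri tau" unfolding r(5) tri_iff[OF r(2)] using pos by (simp add: r(1))
 show "0 < orient (fst e) (snd e) x ==> x \<in> tri_int tau" unfolding tri_int_iff[OF r(3)] using pos by (simp add: r(1))
 show "!!e'. e' \<in> dedges tau ==> e' ~= e ==> 0 < orient (fst e') (snd e') x" using pos r(1,3) by auto
qed

lemma closed_segment_tri: "tau \<in> Th M ==> e \<in> dedges tau ==> closed_segment (fst e) (snd e) <= tri tau" proof -
 assume t: "tau \<in> Th M" "e \<in> dedges tau"
 obtain p q r where "e = (p, q)" "verts tau = {p, q, r}" by (rule dedge_rotate[OF Th_ccw[OF t(1)] t(2)])
 then show ?thesis using tri_props(3)[of tau] by (intro closed_segment_subset tri_props) auto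
qed

lemma same_edge: assumes t: "tau \<in> Th M" "tau' \<in> Th M" "e \<in> dedges tau" "e' \<in> dedges tau'"
  and z: "z \<in> open_segment (fst e) (snd e)" "z \<in> closed_segment (fst e') (snd e')" shows "e = e' \<or> e = prod.swap e'" proof -
 obtain p q r where r: "e = (p, q)" "ccw (p, q, r)" "verts tau = {p, q, r}" by (rule dedge_rotate[OF Th_ccw[OF t(1)] t(3)])
 obtain p' q' r' where r': "e' = (p', q')" "ccw (p', q', r')" "verts tau' = {p', q', r'}" "tri tau' = tri (p', q', r')"
  by (rule dedge_rotate[OF Th_ccw[OF t(2)] t(4)])
 have Jp: "0 < orient p q r" "0 < orient p' q' r'" using r r' by (auto simp: ccw_orient)
 have z': "z \<in> open_segment p q" "z \<in> closed_segment p' q'" using z r r' by auto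
 note o = open_segment_orient[OF z'(1) Jp(1)]
 have zt: "z \<in> tri tau" "z \<in> tri tau'" using subsetD[OF closed_segment_tri[OF t(1,3)] subsetD[OF segment_open_subset_closed z(1)]]
   subsetD[OF closed_segment_tri[OF t(2,4)] z(2)] by auto
 have p: "p \<in> verts tau'" by (rule face[OF t(1,2) zt _ o(2)]) (use r in auto)
 have q: "q \<in> verts tau'" by (rule face[OF t(1,2) zt _ o(3)]) (use r in auto)
 have z0: "orient p' q' z = 0" proof -
  obtain k where "z = p' + k *R (q' - p')" using z'(2) by (auto simp: closed_segment_def algebra_simps)
  then show ?thesis by (simp only: orient_affine) simp
 qed
 have nn: "0 \<le> orient p' q' y" if "y \<in> verts tau'" for y using that r' Jp by auto
 obtain k where k: "0 < k" "k < 1" "z = p + k *R (q - p)" using z'(1) by (auto simp: in_segment algebra_simps)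
 have "(1 - k) * orient p' q' p + k * orient p' q' q = 0" using z0 unfolding k(3) orient_affine .
 moreover have "0 \<le> (1 - k) * orient p' q' p" "0 \<le> k * orient p' q' q" using k nn[OF p] nn[OF q] by auto
 ultimately have "(1 - k) * orient p' q' p = 0" "k * orient p' q' q = 0" by linarith+
 then have "orient p' q' p = 0" "orient p' q' q = 0" using k by auto
 then have "p \<in> {p', q'}" "q \<in> {p', q'}" using p q r'(3) Jp(2) by auto
 moreover have "p ~= q" using ccw_distinct[OF r(2)] by blast
 ultimately show ?thesis using r r' by auto
qed

end

context mesh_setting
begin

section \<open>Edges of the mesh and of the fracture\<close>

lemma pedges_iff: "(a, b) \<in> pedges M \<longleftrightarrow> (\<exists>nu. (nu, a, b) \<in> Th M)" by (simp add: pedges_def)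

lemma pedge_tri: assumes "e \<in> pedges M" shows "Lft M e \<in> Th M" "e \<in> dedges (Lft M e)" "snd (Lft M e) = e" proof -
 obtain nu where t: "(nu, fst e, snd e) \<in> Th M" using assms by (cases e) (auto simp: pedges_iff)
 have e: "e \<in> dedges (nu, fst e, snd e)" by (cases e) (simp add: dedges_def)
 have "Lft M e = (nu, fst e, snd e)" by (rule Lft_eq[OF t e])
 then show "Lft M e \<in> Th M" "e \<in> dedges (Lft M e)" "snd (Lft M e) = e" using t e by simp_all
qed

lemma pedge_ne: "e \<in> pedges M ==> fst e ~= snd e" using elen_pos[OF pedge_tri(1,2)] by (auto simp: elen_def)

lemma on_bd_swap: "on_bd P (prod.swap e) = on_bd P e" by (simp add: on_bd_def open_segment_commute)
lemma on_frac_swap: "on_frac P (prod.swap e) = on_frac P e" by (simp add: on_frac_def closed_segment_commute)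

lemma midpoint_in_open_segment: "a ~= b ==> (1/2) *R (a + b) \<in> open_segment a (b :: pt)"
 using midpoint_in_open_segment[of a b] by (simp add: midpoint_def)

lemma pedge_open: "e \<in> pedges M ==> \<not> on_bd P e ==> open_segment (fst e) (snd e) <= Om P" using pedge_cases by blast

text \<open>Across an interior polygon edge there is another polygon, and the edge is not one of the
  new edges of that polygon, since centres are not polygon vertices.\<close>

lemma pedge_swap: assumes "e \<in> pedges M" "\<not> on_bd P e" shows "prod.swap e \<in> pedges M" proof -
 obtain x where x: "x \<in> open_segment (fst e) (snd e)" using midpoint_in_open_segment[OF pedge_ne[OF assms(1)]] by blast
 obtain tau' where t: "tau' \<in> Th M" "prod.swap e \<in> dedges tau'"
  using neighbour_exists[OF pedge_tri(1,2)[OF assms(1)] x] pedge_open[OF assms] x by blast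
 obtain nu' a' b' where t': "tau' = (nu', a', b')" by (cases tau')
 obtain nu where n: "(nu, fst e, snd e) \<in> Th M" using assms(1) by (cases e) (auto simp: pedges_iff)
 have "nu' \<notin> {fst e, snd e}" using centre_not_vertex[OF n] t(1) t' by blast
 then have "prod.swap e = (a', b')" using t(2) by (cases e) (auto simp: t' dedges_def)
 then show ?thesis using t(1) t' by (auto simp: pedges_iff)
qed

definition gedge :: "real \<times> real => pt \<times> pt" where
 "gedge i = map_prod (gam P) (gam P) i"

lemma FG_D: assumes "(s, t) \<in> FG P M"
 shows "0 \<le> s" "s < t" "t \<le> len P" "gedge (s, t) \<in> pedges M" "gam P ` {s..t} = closed_segment (gam P s) (gam P t)"
 using assms by (auto simp: FG_def gedge_def)

text \<open>The path has unit speed and is injective, so it runs through the segment without turning back.\<close>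

lemma FG_straight: assumes st: "(s, t) \<in> FG P M" and x: "x \<in> {s..t}"
 shows "gam P x = gam P s + ((x - s) / (t - s)) *R (gam P t - gam P s)" "elen (gedge (s, t)) = t - s" proof -
 note F = FG_D[OF st]
 define L where "L = norm (gam P t - gam P s)"
 have L: "L > 0" using pedge_ne[OF F(4)] by (simp add: L_def gedge_def)
 define d where "d = (1 / L) *R (gam P t - gam P s)"
 have nd: "norm d = 1" using L by (simp add: d_def L_def)
 have dd: "d \<bullet> d = 1" using nd by (simp add: power2_norm_eq_inner[symmetric])
 define h where "h = (%y. (gam P y - gam P s) \<bullet> d)"
 have gh: "gam P y = gam P s + h y *R d & 0 \<le> h y & h y \<le> L" if "y \<in> {s..t}" for y proof -
  have "gam P y \<in> closed_segment (gam P s) (gam P t)" using F(5) that by blast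
  then obtain k where k: "0 \<le> k" "k \<le> 1" "gam P y = gam P s + k *R (gam P t - gam P s)" by (auto simp: closed_segment_def algebra_simps)
  then have "gam P y = gam P s + (k * L) *R d" using L by (simp add: d_def)
  moreover from this have "h y = k * L" by (simp add: h_def dd)
  ultimately show ?thesis using k L by (simp add: mult_left_le_one_le)
 qed
 have hs: "h s = 0" by (simp add: h_def)
 have ht: "h t = L" proof -
  have "gam P t - gam P s = L *R d" using L by (simp add: d_def)
  then show ?thesis by (simp add: h_def dd)
 qed
 have sub: "{s..t} <= {0..len P}" using F by auto
 have ch: "continuous_on {s..t} h" unfolding h_def by (intro continuous_intros continuous_on_subset[OF gam_continuous sub])
 have inj: "inj_on h {s..t}" proof (rule inj_onI)
  fix y z assume y: "y \<in> {s..t}" and z: "z \<in> {s..t}" and e: "h y = h z"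
  have "gam P y = gam P s + h y *R d" "gam P z = gam P s + h z *R d" using gh[OF y] gh[OF z] by blast+
  then have "gam P y = gam P z" using e by metis
  then show "y = z" using inj_onD[OF gam_inj] y z sub by blast
 qed
 have mono: "h y < h z" if "s \<le> y" "y < z" "z \<le> t" for y z proof -
  have z0: "h y < h t" if "s \<le> y" "y < t" for y proof -
   have "h y ~= h t" using inj_on_eq_iff[OF inj, of y t] that F(2) by simp
   moreover have "h y \<le> L" using gh[of y] that by simp
   ultimately show ?thesis using ht by simp
  qed
  show ?thesis proof (cases "z = t")
   case True then show ?thesis using z0 that by simp
  next
   case False
   then have "(h y < h z & h z < h t) \<or> (h t < h z & h z < h y)"
    using that continuous_on_subset[OF ch, of "{y..t}"] inj_on_subset[OF inj, of "{y..t}"] by (intro continuous_inj_imp_mono) auto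
   then show ?thesis using z0[of z] z0[of y] that False by linarith
  qed
 qed
 obtain B where B: "finite B" "!!s. s \<in> {0..len P} - B ==> 0 < s ==> s < len P ==>
   \<exists>eps>0. \<exists>d. norm d = 1 & s - eps \<ge> 0 & s + eps \<le> len P & (\<forall>x\<in>{s-eps..s+eps}. gam P x = gam P s + (x - s) *R d)"
  by (rule polygonal_arc_local[OF arc]) blast
 have hx: "h y - y = - s" if y: "y \<in> {s..t}" for y
 proof (rule has_derivative_zero_unique_strong_interval[of "B \<union> {s, t}" s t "%y. h y - y" "- s" y])
  show "finite (B \<union> {s, t})" using B by simp
  show "continuous_on {s..t} (%y. h y - y)" by (intro continuous_intros ch)
  show "h s - s = - s" by (simp add: hs)
  fix z assume z: "z \<in> {s..t} - (B \<union> {s, t})"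
  then have z': "z \<in> {0..len P} - B" "0 < z" "z < len P" "s < z" "z < t" using F by auto
  obtain eps d' where e: "eps > 0" "norm d' = 1" "\<forall>x\<in>{z-eps..z+eps}. gam P x = gam P z + (x - z) *R d'" using B(2)[OF z'(1-3)] by blast
  define eps' where "eps' = min eps (min (z - s) (t - z))"
  have e': "eps' > 0" "eps' \<le> eps" "s \<le> z - eps'" "z + eps' \<le> t" using e(1) z' by (auto simp: eps'_def)
  have eq: "(y - z) *R d' = (h y - h z) *R d" if "y \<in> {z-eps'..z+eps'}" for y proof -
   have y1: "y \<in> {z-eps..z+eps}" "y \<in> {s..t}" "z \<in> {s..t}" using that e' z' by auto
   have "gam P y = gam P z + (y - z) *R d'" using e(3) y1(1) by blast
   moreover have "gam P y = gam P s + h y *R d" "gam P z = gam P s + h z *R d" using gh y1 by blast+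
   ultimately have "gam P s + h y *R d = gam P s + h z *R d + (y - z) *R d'" by simp
   then show ?thesis by (simp add: algebra_simps)
  qed
  have hd: "h y - h z = y - z" if y: "y \<in> {z-eps'..z+eps'}" for y proof -
   have "norm ((y - z) *R d') = norm ((h y - h z) *R d)" using eq[OF y] by simp
   then have a: "\<bar>h y - h z\<bar> = \<bar>y - z\<bar>" using e(2) nd by simp
   consider "y < z" | "y = z" | "y > z" by linarith
   then show ?thesis proof cases
    case 1 then show ?thesis using a mono[of y z] y e' z' by auto
   next
    case 3 then show ?thesis using a mono[of z y] y e' z' by auto
   qed simp
  qed
  have "((%y. h z - z) has_derivative (%h. 0)) (at z within {s..t})" by (rule has_derivative_const)
  then show "((%y. h y - y) has_derivative (%h. 0)) (at z within {s..t})" proof (rule has_derivative_transform_within[of _ _ _ _ eps'])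
   fix y assume "y \<in> {s..t}" "dist y z < eps'"
   then show "h z - z = h y - y" using hd[of y] by (auto simp: dist_real_def abs_if split: if_splits)
  qed (use z' e' in auto)
 qed (rule y)
 have Lt: "L = t - s" using hx[of t] ht F(2) by simp
 then show "elen (gedge (s, t)) = t - s" by (simp add: elen_def gedge_def L_def dist_norm norm_minus_commute)
 have "gam P x = gam P s + h x *R d" using gh[OF x] by blast
 then show "gam P x = gam P s + ((x - s) / (t - s)) *R (gam P t - gam P s)"
  using hx[OF x] by (simp add: d_def Lt[symmetric] divide_inverse mult.commute)
qed

lemma FG_open_segment: assumes "(s, t) \<in> FG P M" "s < x" "x < t" shows "gam P x \<in> open_segment (gam P s) (gam P t)" proof -
 have "gam P s ~= gam P t" using pedge_ne[OF FG_D(4)[OF assms(1)]] by (simp add: gedge_def)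
 moreover have "gam P x = (1 - (x - s) / (t - s)) *R gam P s + ((x - s) / (t - s)) *R gam P t"
  using FG_straight(1)[OF assms(1), of x] assms by (simp add: algebra_simps)
 moreover have "0 < (x - s) / (t - s)" "(x - s) / (t - s) < 1" using assms by simp_all
 ultimately show ?thesis by (auto simp: in_segment)
qed

lemma gedge_on_frac: "i \<in> FG P M ==> on_frac P (gedge i)" proof -
 assume i: "i \<in> FG P M"
 obtain s t where st: "i = (s, t)" by (cases i)
 note F = FG_D[OF i[unfolded st]]
 have "gam P ` {s..t} <= gam P ` {0..len P}" using F by (intro image_mono) auto
 then show ?thesis unfolding on_frac_def st using F(5) by (simp add: gedge_def)
qed

lemma gedge_not_bd: "i \<in> FG P M ==> \<not> on_bd P (gedge i)" proof
 assume i: "i \<in> FG P M" and bd: "on_bd P (gedge i)"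
 have "open_segment (fst (gedge i)) (snd (gedge i)) <= gam P ` {0..len P}"
  using gedge_on_frac[OF i] segment_open_subset_closed unfolding on_frac_def by blast
 moreover have "open_segment (fst (gedge i)) (snd (gedge i)) <= - gam P ` {0..len P}" using bd by (auto simp: on_bd_def bdOmB_def)
 moreover have "gedge i \<in> pedges M" using i FG_D(4) by (cases i) auto
 then have "open_segment (fst (gedge i)) (snd (gedge i)) ~= {}" using pedge_ne midpoint_in_open_segment by blast
 ultimately show False by blast
qed

text \<open>The fracture is covered by mesh edges, and by conformity two edges that meet in an interior point
  of one of them coincide.\<close>

lemma meets_fracture: assumes e: "e \<in> pedges M" and z: "z \<in> open_segment (fst e) (snd e)" "z \<in> gam P ` {0..len P}"
 obtains i where "i \<in> FG P M" "e = gedge i \<or> e = prod.swap (gedge i)" proof -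
 obtain x where x: "x \<in> {0..len P}" "z = gam P x" using z(2) by blast
 then obtain s t where st: "(s, t) \<in> FG P M" "x \<in> {s..t}" unfolding FG_cover[symmetric] by blast
 note F = FG_D[OF st(1)]
 have "z \<in> closed_segment (fst (gedge (s, t))) (snd (gedge (s, t)))" using F(5) st(2) x(2) by (auto simp: gedge_def)
 from same_edge[OF pedge_tri(1)[OF e] pedge_tri(1)[OF F(4)] pedge_tri(2)[OF e] pedge_tri(2)[OF F(4)] z(1) this]
 show ?thesis using that st(1) by blast
qed

lemma FG_disjoint: assumes "(s, t) \<in> FG P M" "(s', t') \<in> FG P M" "s < x" "x < t" "s' < x" "x < t'" shows "s = s' & t = t'" proof -
 note F = FG_D[OF assms(1)] and F' = FG_D[OF assms(2)]
 have z: "gam P x \<in> open_segment (fst (gedge (s, t))) (snd (gedge (s, t)))"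
  "gam P x \<in> closed_segment (fst (gedge (s', t'))) (snd (gedge (s', t')))"
  using FG_open_segment[OF assms(1,3,4)] FG_open_segment[OF assms(2,5,6)] segment_open_subset_closed by (auto simp: gedge_def)
 from same_edge[OF pedge_tri(1)[OF F(4)] pedge_tri(1)[OF F'(4)] pedge_tri(2)[OF F(4)] pedge_tri(2)[OF F'(4)] z]
 have "(gam P s = gam P s' & gam P t = gam P t') \<or> (gam P s = gam P t' & gam P t = gam P s')" by (auto simp: gedge_def)
 then have "(s = s' & t = t') \<or> (s = t' & t = s')" using inj_on_eq_iff[OF gam_inj] F F' by auto
 then show ?thesis using F(2) F'(2) by auto
qed

lemma fedge_eq: "(s, t) \<in> FG P M ==> s < x ==> x < t ==> fedge P M x = (s, t)" unfolding fedge_def by (rule the_equality) (auto dest: FG_disjoint)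

lemma inj_gedge: "inj_on gedge (FG P M)" proof (rule inj_onI)
 fix i j assume i: "i \<in> FG P M" and j: "j \<in> FG P M" and e: "gedge i = gedge j"
 obtain s t s' t' where d: "i = (s, t)" "j = (s', t')" by (cases i, cases j)
 show "i = j" using inj_on_eq_iff[OF gam_inj] FG_D[OF i[unfolded d]] FG_D[OF j[unfolded d]] e by (auto simp: d gedge_def)
qed

lemma finite_pedges: "finite (pedges M)" proof -
 have "pedges M = snd ` Th M" by (force simp: pedges_def)
 then show ?thesis using finite_Th by simp
qed

lemma finite_FG: "finite (FG P M)" proof (rule finite_imageD[OF _ inj_gedge])
 show "finite (gedge ` FG P M)" by (rule finite_subset[OF _ finite_pedges]) (auto dest: FG_D(4))
qed

lemma bij_Th_pedges: "bij_betw snd (Th M) (pedges M)" proof (rule bij_betwI')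
 fix tau tau' assume t: "tau \<in> Th M" "tau' \<in> Th M"
 have d1: "snd tau \<in> dedges tau" by (cases tau) (simp add: dedges_def)
 have d2: "snd tau' \<in> dedges tau'" by (cases tau') (simp add: dedges_def)
 note d = d1 d2
 show "snd tau = snd tau' \<longleftrightarrow> tau = tau'" using dedge_unique[OF t d(1)] d(2) by auto
next
 fix tau assume "tau \<in> Th M" then show "snd tau \<in> pedges M" by (cases tau) (auto simp: pedges_iff)
next
 fix e assume "e \<in> pedges M"
 then obtain nu where "(nu, e) \<in> Th M" by (cases e) (auto simp: pedges_iff)
 then show "\<exists>tau\<in>Th M. e = snd tau" by (rule bexI[rotated]) simp
qed

lemma Fu0_D: assumes "e \<in> Fu0 P M" shows "e \<in> pedges M" "prod.swap e \<in> pedges M" "\<not> on_bd P e" "\<not> on_frac P e" "e \<in> ori M"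
proof -
 show bd: "\<not> on_bd P e" and "\<not> on_frac P e" "e \<in> ori M" using assms by (auto simp: Fu0_def Fu_def)
 have "e \<in> pedges M \<or> prod.swap e \<in> pedges M" using assms by (auto simp: Fu0_def Fu_def)
 then show "e \<in> pedges M" "prod.swap e \<in> pedges M" using pedge_swap[of e] pedge_swap[of "prod.swap e"] bd on_bd_swap[of e] by auto
qed

text \<open>An interior polygon edge occurs with both orientations, once for each of its polygons.\<close>

lemma sum_pedges:
 fixes F :: "pt \<times> pt => real" assumes bd: "!!e. e \<in> pedges M ==> on_bd P e ==> F e = 0"
 shows "(\<Sum>e\<in>pedges M. F e) = (\<Sum>e\<in>Fu0 P M. F e + F (prod.swap e)) + (\<Sum>i\<in>FG P M. F (gedge i) + F (prod.swap (gedge i)))"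
proof -
 have injs: "inj_on prod.swap A" for A :: "(pt \<times> pt) set" by (auto simp: inj_on_def)
 let ?A = "Fu0 P M" and ?G = "gedge ` FG P M"
 have Gp: "gedge i \<in> pedges M" "prod.swap (gedge i) \<in> pedges M" if "i \<in> FG P M" for i proof -
  show g: "gedge i \<in> pedges M" using FG_D(4) that by (cases i) auto
  show "prod.swap (gedge i) \<in> pedges M" using pedge_swap[OF g] gedge_not_bd[OF that] by blast
 qed
 have un: "{e \<in> pedges M. \<not> on_bd P e} = (?A \<union> prod.swap ` ?A) \<union> (?G \<union> prod.swap ` ?G)" proof (intro equalityI subsetI)
  fix e assume e: "e \<in> {e \<in> pedges M. \<not> on_bd P e}"
  then have ep: "e \<in> pedges M" and nb: "\<not> on_bd P e" by auto
  show "e \<in> (?A \<union> prod.swap ` ?A) \<union> (?G \<union> prod.swap ` ?G)" proof (cases "on_frac P e")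
   case True
   have m: "(1/2) *R (fst e + snd e) \<in> open_segment (fst e) (snd e)" by (rule midpoint_in_open_segment[OF pedge_ne[OF ep]])
   then have "(1/2) *R (fst e + snd e) \<in> gam P ` {0..len P}" using True segment_open_subset_closed unfolding on_frac_def by blast
   then obtain i where "i \<in> FG P M" "e = gedge i \<or> e = prod.swap (gedge i)" by (rule meets_fracture[OF ep m])
   then show ?thesis by auto
  next
   case False
   have "e \<in> ori M \<longleftrightarrow> prod.swap e \<notin> ori M" by (rule ori_one[OF pedge_tri(1,2)[OF ep]])
   then have "e \<in> ?A \<or> prod.swap e \<in> ?A" using ep nb False on_bd_swap[of e] on_frac_swap[of e] by (auto simp: Fu0_def Fu_def)
   then show ?thesis using image_eqI[of e prod.swap "prod.swap e" ?A] by auto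
  qed
 next
  fix e assume "e \<in> (?A \<union> prod.swap ` ?A) \<union> (?G \<union> prod.swap ` ?G)"
  then consider "e \<in> ?A" | e' where "e' \<in> ?A" "e = prod.swap e'" | i where "i \<in> FG P M" "e = gedge i"
   | i where "i \<in> FG P M" "e = prod.swap (gedge i)" by blast
  then show "e \<in> {e \<in> pedges M. \<not> on_bd P e}" proof cases
   case 1 then show ?thesis using Fu0_D(1,3)[OF 1] by simp
  next
   case 2 then show ?thesis using Fu0_D(2,3)[OF 2(1)] on_bd_swap[of e'] by simp
  next
   case 3 then show ?thesis using Gp(1) gedge_not_bd by simp
  next
   case 4 then show ?thesis using Gp(2) gedge_not_bd by (simp add: on_bd_swap)
  qed
 qed
 have d1: "?A \<inter> prod.swap ` ?A = {}" proof (intro equals0I)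
  fix e assume "e \<in> ?A \<inter> prod.swap ` ?A"
  then have "e \<in> ?A" "prod.swap e \<in> ?A" by auto
  then show False using ori_one[OF pedge_tri(1,2)[OF Fu0_D(1)[of e]]] Fu0_D(5) by blast
 qed
 have d2: "?G \<inter> prod.swap ` ?G = {}" proof (intro equals0I)
  fix e assume "e \<in> ?G \<inter> prod.swap ` ?G"
  then obtain i j where ij: "i \<in> FG P M" "j \<in> FG P M" "gedge i = prod.swap (gedge j)" by auto
  obtain s t s' t' where d: "i = (s, t)" "j = (s', t')" by (cases i, cases j)
  show False using inj_on_eq_iff[OF gam_inj] FG_D[OF ij(1)[unfolded d]] FG_D[OF ij(2)[unfolded d]] ij(3) by (auto simp: d gedge_def)
 qed
 have d3: "(?A \<union> prod.swap ` ?A) \<inter> (?G \<union> prod.swap ` ?G) = {}" proof (intro equals0I)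
  fix e assume e: "e \<in> (?A \<union> prod.swap ` ?A) \<inter> (?G \<union> prod.swap ` ?G)"
  then consider "e \<in> ?A" | e' where "e' \<in> ?A" "e = prod.swap e'" by blast
  then have "\<not> on_frac P e" by cases (simp_all add: Fu0_D(4) on_frac_swap)
  moreover from e consider i where "i \<in> FG P M" "e = gedge i" | i where "i \<in> FG P M" "e = prod.swap (gedge i)" by blast
  then have "on_frac P e" by cases (simp_all add: gedge_on_frac on_frac_swap)
  ultimately show False by blast
 qed
 have "?A <= pedges M" using Fu0_D(1) by blast
 then have fin: "finite ?A" "finite ?G" using finite_subset[OF _ finite_pedges] finite_FG by auto
 have "(\<Sum>e\<in>pedges M. F e) = (\<Sum>e\<in>{e \<in> pedges M. \<not> on_bd P e}. F e)"
  by (rule sum.mono_neutral_right) (use finite_pedges bd in auto)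
 also have "... = (\<Sum>e\<in>?A. F e) + (\<Sum>e\<in>prod.swap ` ?A. F e) + ((\<Sum>e\<in>?G. F e) + (\<Sum>e\<in>prod.swap ` ?G. F e))"
  unfolding un using fin d1 d2 d3 by (simp add: sum.union_disjoint)
 also have "... = (\<Sum>e\<in>?A. F e + F (prod.swap e)) + (\<Sum>i\<in>FG P M. F (gedge i) + F (prod.swap (gedge i)))"
  by (simp add: sum.reindex[OF injs] sum.reindex[OF inj_gedge] sum.distrib)
 finally show ?thesis .
qed

lemma Fu0_open_OmB: assumes "e \<in> Fu0 P M" shows "open_segment (fst e) (snd e) <= OmB P" proof
 fix z assume z: "z \<in> open_segment (fst e) (snd e)"
 have "z \<notin> gam P ` {0..len P}" proof
  assume "z \<in> gam P ` {0..len P}"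
  then obtain i where "i \<in> FG P M" "e = gedge i \<or> e = prod.swap (gedge i)" by (rule meets_fracture[OF Fu0_D(1)[OF assms] z])
  then have "on_frac P e" using gedge_on_frac on_frac_swap by metis
  then show False using Fu0_D(4)[OF assms] by blast
 qed
 then show "z \<in> OmB P" using pedge_open[OF Fu0_D(1,3)[OF assms]] z by (auto simp: OmB_def)
qed

lemma AE_Gam_FG: "AE x in lebesgue. (\<Sum>i\<in>FG P M. indicator {fst i<..<snd i} x) = (indicator (Gam P) x :: real)" proof -
 define E where "E = fst ` FG P M \<union> snd ` FG P M"
 have "AE x in lebesgue. x \<notin> E" using finite_FG unfolding E_def by (intro AE_not_in null_sets_completionI finite_imp_null_set_lborel) auto
 then show ?thesis proof (rule eventually_mono)
  fix x assume x: "x \<notin> E"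
  show "(\<Sum>i\<in>FG P M. indicator {fst i<..<snd i} x) = (indicator (Gam P) x :: real)" proof (cases "x \<in> Gam P")
   case True
   then have "x \<in> {0..len P}" using Gam_sub by blast
   then obtain s t where st: "(s, t) \<in> FG P M" "x \<in> {s..t}" unfolding FG_cover[symmetric] by blast
   then have st': "s < x" "x < t" using x unfolding E_def by force+
   have "(\<Sum>i\<in>FG P M. indicator {fst i<..<snd i} x) = (\<Sum>i\<in>FG P M. if i = (s, t) then 1 else (0::real))" proof (intro sum.cong refl)
    fix i assume i: "i \<in> FG P M"
    have "i = (s, t)" if "x \<in> {fst i<..<snd i}" using FG_disjoint[OF st(1), of "fst i" "snd i" x] i st' that by (simp add: prod_eq_iff)
    note * = this
    show "indicator {fst i<..<snd i} x = (if i = (s, t) then 1 else (0::real))" proof (cases "i = (s, t)")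
     case True then show ?thesis using st' by simp
    next
     case False
     then have "x \<notin> {fst i<..<snd i}" using * by blast
     then show ?thesis using False by simp
    qed
   qed
   then show ?thesis using True finite_FG st(1) by simp
  next
   case False
   have "x \<notin> {fst i<..<snd i}" if "i \<in> FG P M" for i using False FG_D[of "fst i" "snd i"] that by (auto simp: Gam_def)
   then show ?thesis using False by (simp add: sum.neutral)
  qed
 qed
qed

end

context mesh_setting
begin

section \<open>Comparable triangles around a vertex\<close>

definition star_at :: "pt => elem set" where
 "star_at v = {tau \<in> Th M. v \<in> verts tau}"

definition adj_at :: "pt => (elem \<times> elem) set" where
 "adj_at v = {(tau, tau'). tau \<in> star_at v & tau' \<in> star_at v & (\<exists>y. y ~= v & y \<in> verts tau \<inter> verts tau')}"

lemma verts_edge: assumes "tau \<in> Th M" "v \<in> verts tau" "y \<in> verts tau" "y ~= v"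
 shows "\<sigma> * diameter (tri tau) \<le> dist v y" "dist v y \<le> diameter (tri tau)" proof -
 obtain p q r where t: "tau = (p, q, r)" by (cases tau)
 have "(v, y) \<in> dedges tau \<or> (y, v) \<in> dedges tau" using assms(2-4) by (auto simp: t verts_def dedges_def)
 then obtain e where e: "e \<in> dedges tau" "elen e = dist v y" by (auto simp: elen_def dist_commute)
 show "\<sigma> * diameter (tri tau) \<le> dist v y" "dist v y \<le> diameter (tri tau)"
  using elen_ge[OF assms(1) e(1)] elen_le_diameter[OF Th_ccw[OF assms(1)] e(1)] e(2) by simp_all
qed

lemma adj_at_comparable: assumes "(tau, tau') \<in> adj_at v" shows "diameter (tri tau') \<le> (1 / \<sigma>) * diameter (tri tau)" proof -
 obtain y where y: "tau \<in> Th M" "tau' \<in> Th M" "v \<in> verts tau" "v \<in> verts tau'" "y ~= v" "y \<in> verts tau" "y \<in> verts tau'"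
  using assms by (auto simp: adj_at_def star_at_def)
 have "\<sigma> * diameter (tri tau') \<le> diameter (tri tau)" using verts_edge(1)[OF y(2,4,7,5)] verts_edge(2)[OF y(1,3,6,5)] by simp
 then show ?thesis using \<sigma>_pos by (simp add: field_simps)
qed

text \<open>Scaling towards the vertex produces in each of the triangles a ball of the same radius,
  proportional to that of a disc around the vertex which contains all of them; the balls are
  disjoint.\<close>

lemma card_star: "real (card (star_at v)) \<le> 36 / \<sigma>^2" proof (cases "star_at v = {}")
 case False
 have fin: "finite (star_at v)" using finite_Th by (simp add: star_at_def)
 define eps where "eps = Min ((%tau. diameter (tri tau)) ` star_at v)"
 have eps: "eps > 0" "!!tau. tau \<in> star_at v ==> eps \<le> diameter (tri tau)"
  using fin False diameter_tri_pos[OF Th_ccw] by (auto simp: eps_def star_at_def)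
 define c where "c = (%tau. v + (eps / diameter (tri tau)) *R (centroid tau - v))"
 define rho where "rho = \<sigma> * eps / 6"
 have rho: "rho > 0" using eps(1) \<sigma>_pos by (simp add: rho_def)
 have inside: "ball (c tau) rho <= tri_int tau \<inter> cball v eps" if tau: "tau \<in> star_at v" for tau proof
  have T: "tau \<in> Th M" "v \<in> verts tau" using tau by (auto simp: star_at_def)
  define h where "h = diameter (tri tau)"
  have h: "h > 0" "eps \<le> h" using diameter_tri_pos[OF Th_ccw[OF T(1)]] eps(2)[OF tau] by (auto simp: h_def)
  define k where "k = eps / h"
  have k: "0 < k" "k \<le> 1" using h eps(1) by (auto simp: k_def)
  fix x assume x: "x \<in> ball (c tau) rho"
  define y where "y = v + (1 / k) *R (x - v)"
  have xy: "x = v + k *R (y - v)" using k by (simp add: y_def)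
  have "c tau - x = k *R (centroid tau - y)" unfolding c_def h_def[symmetric] k_def[symmetric] xy by (simp add: algebra_simps)
  then have "k * dist (centroid tau) y < rho" using x k by (simp add: dist_norm)
  moreover have "rho = k * (\<sigma> * h / 6)" using h by (simp add: rho_def k_def)
  ultimately have "dist (centroid tau) y < \<sigma> * h / 6" using k by simp
  then have yi: "y \<in> tri_int tau" using centroid_ball(1)[OF T(1)] by (auto simp: h_def)
  have "0 < orient (fst e) (snd e) x" if e: "e \<in> dedges tau" for e proof -
   obtain p q r where r: "e = (p, q)" "ccw (p, q, r)" "verts tau = {p, q, r}" by (rule dedge_rotate[OF Th_ccw[OF T(1)] e])
   have "0 \<le> orient p q v" using T(2) r by (auto simp: ccw_orient)
   moreover have "0 < orient p q y" using yi e r(1) by (auto simp: tri_int_def)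
   ultimately have "0 < (1 - k) * orient p q v + k * orient p q y" using k by (intro add_nonneg_pos mult_nonneg_nonneg mult_pos_pos) auto
   then show ?thesis unfolding xy orient_affine r(1) by simp
  qed
  then have "x \<in> tri_int tau" by (simp add: tri_int_def)
  moreover have "x \<in> cball v eps" proof -
   have "y \<in> tri tau" using yi tri_int_subset[OF Th_ccw[OF T(1)]] by blast
   moreover have "v \<in> tri tau" using T(2) tri_props(3) by blast
   ultimately have "dist v y \<le> h" unfolding h_def by (intro dist_le_diameter_tri)
   then have "k * norm (y - v) \<le> k * h" using k by (simp add: dist_norm norm_minus_commute)
   also have "k * h = eps" using h by (simp add: k_def)
   finally show ?thesis using k by (simp add: xy dist_norm)
  qed
  ultimately show "x \<in> tri_int tau \<inter> cball v eps" by blast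
 qed
 have dj: "disjoint_family_on (%tau. ball (c tau) rho) (star_at v)" unfolding disjoint_family_on_def proof (intro ballI impI equals0I)
  fix tau tau' x assume t: "tau \<in> star_at v" "tau' \<in> star_at v" "tau ~= tau'" and x: "x \<in> ball (c tau) rho \<inter> ball (c tau') rho"
  have "x \<in> tri_int tau" "x \<in> tri_int tau'" using inside[OF t(1)] inside[OF t(2)] x by blast+
  then show False using tri_int_unique[of tau tau' x] tri_int_subset[OF Th_ccw, of tau'] t by (auto simp: star_at_def)
 qed
 have mb: "measure lborel (ball (a::pt) r) = unit_ball_vol 2 * r^2" if "r \<ge> 0" for a r using content_ball[OF that, of a] by simp
 have "(\<Sum>tau\<in>star_at v. measure lebesgue (ball (c tau) rho)) = measure lebesgue (\<Union>tau\<in>star_at v. ball (c tau) rho)"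
 proof (rule measure_finite_Union[symmetric])
  show "emeasure lebesgue (ball (c tau) rho) ~= \<infinity>" for tau using emeasure_lborel_ball_finite[of "c tau" rho] by (simp add: less_top)
 qed (use fin dj in auto)
 also have "... \<le> measure lebesgue (cball v eps)" proof (rule measure_mono_fmeasurable)
  show "(\<Union>tau\<in>star_at v. ball (c tau) rho) <= cball v eps" using inside by blast
  have "open (\<Union>tau\<in>star_at v. ball (c tau) rho)" by blast
  then show "(\<Union>tau\<in>star_at v. ball (c tau) rho) \<in> sets lebesgue" by simp
 qed simp
 also have "... = unit_ball_vol 2 * eps^2" using content_cball[of eps v] eps(1) by simp
 finally have "unit_ball_vol 2 * (real (card (star_at v)) * rho^2) \<le> unit_ball_vol 2 * eps^2" using rho by (simp add: mb)
 moreover have "unit_ball_vol 2 > 0" by simp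
 ultimately have "real (card (star_at v)) * rho^2 \<le> eps^2" by (simp only: mult_le_cancel_left_pos)
 then have "real (card (star_at v)) * \<sigma>^2 * eps^2 \<le> 36 * eps^2" by (simp add: rho_def power_mult_distrib power_divide field_simps)
 then have "real (card (star_at v)) * \<sigma>^2 \<le> 36" using eps(1) by simp
 then show ?thesis using \<sigma>_pos by (simp add: field_simps)
qed (use \<sigma>_pos in simp)

text \<open>The triangles that can be reached from a given one through common edges fill a closed part of a
  punctured neighbourhood of the vertex, and so do the others; a punctured disc is connected.\<close>

lemma star_connected: assumes v: "v \<in> Om P" and t: "tau0 \<in> star_at v" "tau1 \<in> star_at v" shows "(tau0, tau1) \<in> (adj_at v)\<^sup>*"
proof (rule ccontr)
 assume n: "(tau0, tau1) \<notin> (adj_at v)\<^sup>*"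
 define A where "A = {tau \<in> star_at v. (tau0, tau) \<in> (adj_at v)\<^sup>*}"
 define B where "B = star_at v - A"
 have t0: "tau0 \<in> A" "tau1 \<in> B" using t n by (auto simp: A_def B_def)
 have fin: "finite A" "finite B" using finite_Th by (auto simp: A_def B_def star_at_def)
 have "closed (\<Union>tau\<in>{tau\<in>Th M. v \<notin> tri tau}. tri tau)" using finite_Th tri_props(5) by (intro closed_UN) auto
 then have "open (Om P - (\<Union>tau\<in>{tau\<in>Th M. v \<notin> tri tau}. tri tau))" using Om_open by auto
 moreover have "v \<in> Om P - (\<Union>tau\<in>{tau\<in>Th M. v \<notin> tri tau}. tri tau)" using v by auto
 ultimately obtain eps where eps: "eps > 0" "ball v eps <= Om P - (\<Union>tau\<in>{tau\<in>Th M. v \<notin> tri tau}. tri tau)" by (rule openE)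
 have vert: "tau \<in> star_at v" if tau: "tau \<in> Th M" "v \<in> tri tau" for tau proof -
  have T0: "tau0 \<in> Th M" "v \<in> verts tau0" using t(1) by (auto simp: star_at_def)
  obtain p q r where r: "tau0 = (p, q, r)" by (cases tau0)
  have o: "0 < orient p q r" using Th_ccw[OF T0(1)] by (simp only: r ccw_orient)
  have o2: "0 < orient q r p" using o by (subst orient_cyc(1))
  have o3: "0 < orient r p q" using o by (subst orient_cyc(2))
  obtain p' q' where pq: "verts tau0 = {p', q', v}" "0 < orient p' q' v" proof -
   consider "v = p" | "v = q" | "v = r" using T0(2) by (auto simp: r verts_def)
   then show thesis proof cases
    case 1 show thesis by (rule that[of q r]) (use o2 1 in \<open>auto simp: r verts_def\<close>)
   next
    case 2 show thesis by (rule that[of r p]) (use o3 2 in \<open>auto simp: r verts_def\<close>)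
   next
    case 3 show thesis by (rule that[of p q]) (use o 3 in \<open>auto simp: r verts_def\<close>)
   qed
  qed
  note pq
  moreover have "v \<in> tri tau0" using T0(2) tri_props(3) by blast
  ultimately have "v \<in> verts tau" using face[OF T0(1) tau(1) _ tau(2)] by blast
  then show ?thesis using tau(1) by (simp add: star_at_def)
 qed
 define S where "S = ball v eps - {v}"
 have "connected S" unfolding S_def by (rule connected_punctured_ball) simp
 moreover have "closed (\<Union>tau\<in>A. tri tau)" "closed (\<Union>tau\<in>B. tri tau)" using fin tri_props(5) by (auto intro!: closed_UN)
 moreover have "S <= (\<Union>tau\<in>A. tri tau) \<union> (\<Union>tau\<in>B. tri tau)" proof
  fix x assume x: "x \<in> S"
  then have "x \<in> closure (Om P)" using eps(2) closure_subset unfolding S_def by blast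
  then obtain tau where tau: "tau \<in> Th M" "x \<in> tri tau" unfolding Union_tri[symmetric] by blast
  then have "v \<in> tri tau" using eps(2) x unfolding S_def by blast
  then show "x \<in> (\<Union>tau\<in>A. tri tau) \<union> (\<Union>tau\<in>B. tri tau)" using vert[OF tau(1)] tau(2) by (auto simp: B_def)
 qed
 moreover have "(\<Union>tau\<in>A. tri tau) \<inter> (\<Union>tau\<in>B. tri tau) \<inter> S = {}" proof (intro equals0I)
  fix x assume "x \<in> (\<Union>tau\<in>A. tri tau) \<inter> (\<Union>tau\<in>B. tri tau) \<inter> S"
  then obtain tau tau' where x: "tau \<in> A" "tau' \<in> B" "x \<in> tri tau \<inter> tri tau'" "x ~= v" by (auto simp: S_def)
  have T: "tau \<in> star_at v" "tau' \<in> star_at v" using x by (auto simp: A_def B_def)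
  then have T': "tau \<in> Th M" "tau' \<in> Th M" "v \<in> verts tau \<inter> verts tau'" by (auto simp: star_at_def)
  have xc: "x \<in> convex hull (verts tau \<inter> verts tau')" using x(3) unfolding conforming[OF T'(1,2)] .
  have "verts tau \<inter> verts tau' ~= {v}" proof
   assume "verts tau \<inter> verts tau' = {v}"
   with xc have "x \<in> convex hull {v}" by (simp only:)
   then show False using x(4) by simp
  qed
  then obtain y where y: "y ~= v" "y \<in> verts tau \<inter> verts tau'" using T'(3) by blast
  then have "(tau, tau') \<in> adj_at v" using T unfolding adj_at_def by blast
  then have "(tau0, tau') \<in> (adj_at v)\<^sup>*" using x(1) unfolding A_def by (blast intro: rtrancl_into_rtrancl)
  then show False using x(2) T unfolding A_def B_def by blast
 qed
 ultimately have "(\<Union>tau\<in>A. tri tau) \<inter> S = {} \<or> (\<Union>tau\<in>B. tri tau) \<inter> S = {}" unfolding connected_closed by blast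
 moreover have ne: "tri tau \<inter> S ~= {}" if "tau \<in> star_at v" for tau proof -
  have T: "tau \<in> Th M" "v \<in> verts tau" using that by (auto simp: star_at_def)
  obtain p q r where r: "tau = (p, q, r)" by (cases tau)
  have "\<exists>y\<in>verts tau. y ~= v" using ccw_distinct[of p q r] Th_ccw[OF T(1)] by (auto simp: r verts_def)
  then obtain y where y: "y \<in> verts tau" "y ~= v" by blast
  have in': "v \<in> tri tau" "y \<in> tri tau" using T(2) y(1) tri_props(3) by blast+
  define n where "n = norm (y - v)"
  have n: "n > 0" using y(2) by (simp add: n_def)
  define k where "k = min 1 (eps / (2 * n))"
  have k: "0 < k" "k \<le> 1" "k * n < eps" proof -
   show "0 < k" "k \<le> 1" using n eps(1) by (auto simp: k_def)
   have "k * n \<le> eps / (2 * n) * n" using n by (intro mult_right_mono) (auto simp: k_def)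
   also have "... < eps" using n eps(1) by simp
   finally show "k * n < eps" .
  qed
  have "(1 - k) *R v + k *R y \<in> tri tau" using k in' by (intro convexD[OF tri_props(2)]) auto
  moreover have e: "(1 - k) *R v + k *R y = v + k *R (y - v)" by (simp add: algebra_simps)
  moreover have "v + k *R (y - v) \<in> S" using k n by (simp add: S_def dist_norm n_def[symmetric] y(2))
  ultimately show ?thesis by auto
 qed
 ultimately show False using t0 t ne by blast
qed

text \<open>An upper bound for the number of pairs of triangles at a vertex, hence for the length of a chain.\<close>

definition chain_len :: nat where "chain_len = nat \<lceil>(36 / \<sigma>^2)^2\<rceil>"

lemma star_comparable: assumes v: "v \<in> Om P" and t: "tau \<in> star_at v" "tau' \<in> star_at v"
 shows "diameter (tri tau') \<le> (1 / \<sigma>) ^ chain_len * diameter (tri tau)" proof -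
 have \<sigma>1: "1 \<le> 1 / \<sigma>" using \<sigma>_pos \<sigma>_le_1[of tau] t(1) by (simp add: star_at_def)
 have fin: "finite (star_at v)" using finite_Th by (simp add: star_at_def)
 have sub: "adj_at v <= star_at v \<times> star_at v" by (auto simp: adj_at_def)
 then have fadj: "finite (adj_at v)" using fin finite_subset by blast
 then obtain n where n: "n \<le> card (adj_at v)" "(tau, tau') \<in> adj_at v ^^ n"
  using star_connected[OF v t] rtrancl_finite_eq_relpow[OF fadj] by auto
 have step: "diameter (tri tau') \<le> (1 / \<sigma>) ^ n * diameter (tri tau)" if "(tau, tau') \<in> adj_at v ^^ n" for n tau' using that
 proof (induction n arbitrary: tau')
  case (Suc n)
  then obtain tau'' where u: "(tau, tau'') \<in> adj_at v ^^ n" "(tau'', tau') \<in> adj_at v" by auto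
  have "diameter (tri tau') \<le> (1 / \<sigma>) * diameter (tri tau'')" by (rule adj_at_comparable[OF u(2)])
  also have "... \<le> (1 / \<sigma>) * ((1 / \<sigma>) ^ n * diameter (tri tau))" using Suc.IH[OF u(1)] \<sigma>_pos by (intro mult_left_mono) auto
  finally show ?case by simp
 qed simp
 have "real (card (adj_at v)) \<le> (36 / \<sigma>^2)^2" proof -
  have "card (adj_at v) \<le> card (star_at v) * card (star_at v)" using card_mono[OF _ sub] fin by (simp add: card_cartesian_product)
  then have "real (card (adj_at v)) \<le> real (card (star_at v)) * real (card (star_at v))" by (metis of_nat_le_iff of_nat_mult)
  also have "... \<le> (36 / \<sigma>^2) * (36 / \<sigma>^2)" using card_star by (intro mult_mono) auto
  finally show ?thesis by (simp add: power2_eq_square)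
 qed
 then have "card (adj_at v) \<le> chain_len" unfolding chain_len_def by linarith
 then have "(1 / \<sigma>) ^ n \<le> (1 / \<sigma>) ^ chain_len" using n(1) \<sigma>1 by (intro power_increasing) auto
 then have "(1 / \<sigma>) ^ n * diameter (tri tau) \<le> (1 / \<sigma>) ^ chain_len * diameter (tri tau)"
  using diameter_tri_pos[OF Th_ccw, of tau] t(1) by (intro mult_right_mono) (auto simp: star_at_def)
 then show ?thesis using step[OF n(2)] by linarith
qed

definition kappav :: real where "kappav = (1 / \<sigma>) ^ chain_len / \<sigma>"

text \<open>Both edges belong to triangles at their common vertex.\<close>

lemma FG_neighbours: assumes "(r, z) \<in> FG P M" "(z, t) \<in> FG P M" shows "t - z \<le> kappav * (z - r)" "z - r \<le> kappav * (t - z)" proof -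
 note F1 = FG_D[OF assms(1)] and F2 = FG_D[OF assms(2)]
 define tau1 where "tau1 = Lft M (gedge (r, z))"
 define tau2 where "tau2 = Lft M (gedge (z, t))"
 note t1 = pedge_tri(1,2)[OF F1(4), folded tau1_def] and t2 = pedge_tri(1,2)[OF F2(4), folded tau2_def]
 have v: "gam P z \<in> Om P" using gam_Om F1 F2 by (auto simp: Gam_def)
 have "gam P z \<in> verts tau1" using t1(2) by (cases tau1) (auto simp: gedge_def dedges_def verts_def)
 then have s1: "tau1 \<in> star_at (gam P z)" using t1(1) by (simp add: star_at_def)
 have "gam P z \<in> verts tau2" using t2(2) by (cases tau2) (auto simp: gedge_def dedges_def verts_def)
 then have s2: "tau2 \<in> star_at (gam P z)" using t2(1) by (simp add: star_at_def)
 have l1: "elen (gedge (r, z)) = z - r" using FG_straight(2)[OF assms(1), of r] F1 by simp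
 have l2: "elen (gedge (z, t)) = t - z" using FG_straight(2)[OF assms(2), of z] F2 by simp
 have C: "0 \<le> (1 / \<sigma>) ^ chain_len" using \<sigma>_pos by simp
 have main: "b \<le> kappav * a" if "b \<le> d'" "d' \<le> (1 / \<sigma>) ^ chain_len * d" "\<sigma> * d \<le> a" for a b d d' proof -
  have "d \<le> a / \<sigma>" using that(3) \<sigma>_pos by (simp add: field_simps)
  then have "(1 / \<sigma>) ^ chain_len * d \<le> (1 / \<sigma>) ^ chain_len * (a / \<sigma>)" using C by (rule mult_left_mono)
  then show ?thesis using that by (simp add: kappav_def)
 qed
 show "t - z \<le> kappav * (z - r)" by (rule main[OF _ star_comparable[OF v s1 s2]])
   (use elen_le_diameter[OF Th_ccw[OF t2(1)] t2(2)] elen_ge[OF t1] l1 l2 in simp_all)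
 show "z - r \<le> kappav * (t - z)" by (rule main[OF _ star_comparable[OF v s2 s1]])
   (use elen_le_diameter[OF Th_ccw[OF t1(1)] t1(2)] elen_ge[OF t2] l1 l2 in simp_all)
qed

end

section \<open>Tools for the local estimates\<close>

text \<open>Estimates by Cauchy-Schwarz leave the unknown on the right with power one half; it can be
  absorbed.\<close>

lemma sqrt_absorb:
 fixes X a b c d :: real assumes X: "X \<le> sqrt (a * X) + sqrt (b * X) + sqrt (c * X) + sqrt (d * X)"
  and nn: "0 \<le> X" "0 \<le> a" "0 \<le> b" "0 \<le> c" "0 \<le> d" shows "X \<le> 4 * (a + b + c + d)" proof (cases "X = 0")
 case False
 then have pos: "0 < X" using nn by simp
 have sq: "(y1 + y2 + y3 + y4)^2 \<le> 4 * (y1^2 + y2^2 + y3^2 + y4^2)" for y1 y2 y3 y4 :: real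
  using zero_le_power2[of "y1 - y2"] zero_le_power2[of "y1 - y3"] zero_le_power2[of "y1 - y4"]
   zero_le_power2[of "y2 - y3"] zero_le_power2[of "y2 - y4"] zero_le_power2[of "y3 - y4"] by (simp add: power2_eq_square algebra_simps)
 have "X^2 \<le> (sqrt (a * X) + sqrt (b * X) + sqrt (c * X) + sqrt (d * X))^2" using X nn by (intro power_mono)
 also have "... \<le> 4 * ((sqrt (a * X))^2 + (sqrt (b * X))^2 + (sqrt (c * X))^2 + (sqrt (d * X))^2)" by (rule sq)
 also have "... = 4 * (a + b + c + d) * X" using nn by (simp add: algebra_simps)
 finally have "X * X \<le> 4 * (a + b + c + d) * X" by (simp add: power2_eq_square)
 then show ?thesis using pos by (simp only: mult_le_cancel_right_pos)
qed (use nn in simp)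

lemma set_integral_supp:
 fixes g :: "'a => 'b::{banach, second_countable_topology}" assumes "S <= A" "S <= B" "!!x. x \<notin> S ==> g x = 0"
 shows "(LINT x:A|N. g x) = (LINT x:B|N. g x)" unfolding set_lebesgue_integral_def proof (rule Bochner_Integration.integral_cong[OF refl])
 fix x
 show "indicator A x *R g x = indicator B x *R g x" proof (cases "x \<in> S")
  case True
  then have "x \<in> A" "x \<in> B" using assms by blast+
  then show ?thesis by simp
 qed (simp add: assms(3))
qed

lemma L2_CS_bound:
 fixes f g :: "'a::euclidean_space => 'b::euclidean_space" assumes "L2 D f" "L2 D g" "(L2norm D g)^2 \<le> B"
 shows "\<bar>LINT x:D. f x \<bullet> g x\<bar> \<le> sqrt ((L2norm D f)^2 * B)" proof -
 have "L2norm D f * L2norm D g = sqrt ((L2norm D f)^2 * (L2norm D g)^2)" by (simp add: real_sqrt_mult)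
 also have "... \<le> sqrt ((L2norm D f)^2 * B)" using assms(3) by (intro real_sqrt_le_mono mult_left_mono) auto
 finally show ?thesis using L2_Cauchy_Schwarz[OF assms(1,2)] by linarith
qed

lemma eint_cong: assumes "!!x. x \<in> closed_segment (fst e) (snd e) ==> g x = h x" shows "eint e g = eint e h"
 unfolding eint_def set_lebesgue_integral_def proof (rule Bochner_Integration.integral_cong[OF refl])
 fix s :: real
 show "indicator {0<..<elen e} s *R g (fst e + (s / elen e) *R (snd e - fst e))
   = indicator {0<..<elen e} s *R h (fst e + (s / elen e) *R (snd e - fst e))" proof (cases "s \<in> {0<..<elen e}")
  case True
  have "fst e + (s / elen e) *R (snd e - fst e) \<in> closed_segment (fst e) (snd e)" unfolding closed_segment_def
   using True by (intro CollectI exI[of _ "s / elen e"]) (auto simp: algebra_simps)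
  then show ?thesis using assms by simp
 qed simp
qed

lemma eint_zero: "(!!x. x \<in> closed_segment (fst e) (snd e) ==> g x = 0) ==> eint e g = 0" using eint_cong[of e g "%_. 0"] by (simp add: eint_def)

lemma edge_integrable: assumes "continuous_on UNIV g"
 shows "set_integrable lebesgue {0<..<elen e} (%s. g (fst e + (s / elen e) *R (snd e - fst e)) :: real)"
proof (rule set_integrable_continuous_bounded)
 show "continuous_on UNIV (%s. g (fst e + (s / elen e) *R (snd e - fst e)))"
  by (rule continuous_on_compose2[OF assms], cases "elen e = 0") (auto intro!: continuous_intros)
qed auto

lemma eint_add: assumes "continuous_on UNIV g" "continuous_on UNIV h"
 shows "eint e (%x. g x + h x) = eint e g + eint e h" "eint e (%x. g x - h x) = eint e g - eint e h"
 unfolding eint_def using edge_integrable[OF assms(1), of e] edge_integrable[OF assms(2), of e] by (simp_all add: set_integral_add set_integral_diff)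

lemma eint_cmult: "eint e (%x. c * g x) = c * eint e g" unfolding eint_def by (rule set_integral_mult_right)

text \<open>The divergence theorem for the field times the test function.\<close>

lemma green_triangle: assumes ccw: "ccw tau" and phi: "C1 phi dphi" and v: "!!i. poly2 k (%x. v x $ i)"
 shows "(LINT x:tri tau. v x \<bullet> dphi x) + (LINT x:tri tau. phi x * dvg v x)
  = (\<Sum>e\<in>dedges tau. eint e (%x. phi x * (v x \<bullet> nrm e)))" proof -
 obtain nu a b where t: "tau = (nu, a, b)" by (cases tau)
 let ?g = "%i. grad (%x. v x $ i)"
 have c1: "C1 (%x. phi x * v x $ i) (%x. phi x *R ?g i x + v x $ i *R dphi x)" for i by (rule C1_mult[OF phi poly2_C1(1)[OF v]])
 have "(LINT x:tri tau. (phi x *R ?g 1 x + v x $ 1 *R dphi x) $ 1 + (phi x *R ?g 2 x + v x $ 2 *R dphi x) $ 2)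
  = (\<Sum>e\<in>dedges tau. eint e (%x. phi x * v x $ 1 * nrm e $ 1 + phi x * v x $ 2 * nrm e $ 2))"
  using divergence_triangle[OF _ c1[of 1] c1[of 2], of nu a b] ccw unfolding t dedges_def by simp
 also have "... = (\<Sum>e\<in>dedges tau. eint e (%x. phi x * (v x \<bullet> nrm e)))" by (simp add: inner_vec_def sum_2 algebra_simps)
 finally have eq: "(LINT x:tri tau. (phi x *R ?g 1 x + v x $ 1 *R dphi x) $ 1 + (phi x *R ?g 2 x + v x $ 2 *R dphi x) $ 2)
  = (\<Sum>e\<in>dedges tau. eint e (%x. phi x * (v x \<bullet> nrm e)))" .
 have i1: "set_integrable lebesgue (tri tau) (%x. v x \<bullet> dphi x)"
  by (intro set_integrable_continuous_bounded tri_props continuous_on_inner poly2_continuous_vec[OF v] C1_continuous_grad[OF phi])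
 have i2: "set_integrable lebesgue (tri tau) (%x. phi x * dvg v x)"
  by (intro set_integrable_continuous_bounded tri_props continuous_on_mult C1_continuous[OF phi] poly2_continuous[OF poly2_dvg[OF v]])
 have "(LINT x:tri tau. v x \<bullet> dphi x) + (LINT x:tri tau. phi x * dvg v x)
  = (LINT x:tri tau. v x \<bullet> dphi x + phi x * dvg v x)" using set_integral_add(2)[OF i1 i2] by simp
 also have "(%x. v x \<bullet> dphi x + phi x * dvg v x)
  = (%x. (phi x *R ?g 1 x + v x $ 1 *R dphi x) $ 1 + (phi x *R ?g 2 x + v x $ 2 *R dphi x) $ 2)"
  by (rule ext) (simp add: inner_vec_def sum_2 dvg_def algebra_simps)
 finally show ?thesis using eq by simp
qed

text \<open>Keeping the constant a parameter of the local estimates shows that they hold uniformly in the mesh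
  and in the solution.\<close>

definition inverse_const2 :: "nat => real => real => bool" where
 "inverse_const2 n kappa C \<longleftrightarrow> 0 < C & (\<forall>q c R x. poly2 n q & R > 0 & x \<in> cball c (kappa * R) -->
   (q x)^2 + R^2 * (norm (grad q x))^2 \<le> C / R^2 * (LINT x:cball c R. bump c R x * (q x)^2))"

definition inverse_const1 :: "nat => (real => real) => real => real => bool" where
 "inverse_const1 n w kappa C \<longleftrightarrow> 0 < C & (\<forall>r l x. degree r \<le> n & l > 0 & \<bar>x\<bar> \<le> kappa * l -->
   (poly r x)^2 + l^2 * (poly (pderiv r) x)^2 \<le> C / l * (LINT s:{0<..<l}. w (s / l) * (poly r s)^2))"

lemma bump_test: assumes phi: "phi = (%x. bump c R x * g x)" and dphi: "dphi = (%x. bump c R x *R dg x + g x *R dbump c R x)"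
  and g: "C1 g dg" and R: "0 < R" shows "C1 phi dphi" "supp phi <= cball c R" "compact (supp phi)"
  "!!x. x \<notin> cball c R ==> phi x = 0" "!!x. x \<notin> cball c R ==> dphi x = 0" proof -
 show 1: "C1 phi dphi" unfolding phi dphi using R by (intro C1_mult C1_bump g) auto
 have 0: "phi x = 0" if "x \<notin> cball c R" for x using that bump_eq_0[OF R, of x c] by (simp add: phi dist_commute)
 then show "!!x. x \<notin> cball c R ==> phi x = 0" .
 show 2: "supp phi <= cball c R" by (rule supp_subset_closed) (use 0 in auto)
 show "compact (supp phi)" by (rule compact_supp[of "cball c R"]) (use 0 in auto)
 show "dphi x = 0" if "x \<notin> cball c R" for x by (rule C1_grad_notin_supp[OF 1]) (use 2 that in blast)
qed

text \<open>The gradient of the bump costs a factor of the inverse radius; only the measure of the support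
  enters.\<close>

lemma bump_test_bounds: assumes phi: "phi = (%x. bump c R x * g x)" and dphi: "dphi = (%x. bump c R x *R dg x + g x *R dbump c R x)"
  and g: "C1 g dg" and R: "0 < R" and D: "D \<in> sets lebesgue" and V: "measure lebesgue (cball c R) \<le> V"
  and b: "!!x. x \<in> cball c R ==> (g x)^2 \<le> S" "!!x. x \<in> cball c R ==> (norm (dg x))^2 \<le> G"
 shows "(L2norm D phi)^2 \<le> S * V" "(L2norm D dphi)^2 \<le> (2 * G + 32 / R^2 * S) * V" proof -
 note t = bump_test[OF phi dphi g R]
 have loc: "(L2norm D F)^2 \<le> B * V" if z: "!!x. x \<notin> cball c R ==> F x = 0" and le: "!!x. x \<in> cball c R ==> (norm (F x))^2 \<le> B"
  for F :: "'a => 'z::euclidean_space" and B proof -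
  have B: "0 \<le> B" using order_trans[OF zero_le_power2 le[of c]] R by simp
  have lm: "D \<inter> cball c R \<in> lmeasurable" using fmeasurable_Int_fmeasurable[of "cball c R" lebesgue D] D by (simp add: Int_commute)
  have "L2norm D F = L2norm (D \<inter> cball c R) F" unfolding L2norm_def set_lebesgue_integral_def
   by (intro arg_cong[where f = sqrt] Bochner_Integration.integral_cong refl) (use z in \<open>auto simp: indicator_def\<close>)
  moreover have "(L2norm (D \<inter> cball c R) F)^2 \<le> (sqrt B)^2 * measure lebesgue (D \<inter> cball c R)"
   by (rule L2norm_sq_le_measure[OF lm]) (use le in \<open>auto intro!: real_le_rsqrt\<close>)
  moreover have "measure lebesgue (D \<inter> cball c R) \<le> V"
   using measure_mono_fmeasurable[of "D \<inter> cball c R" "cball c R" lebesgue] D V by auto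
  then have "B * measure lebesgue (D \<inter> cball c R) \<le> B * V" using B by (rule mult_left_mono)
  ultimately show ?thesis using B by simp
 qed
 show "(L2norm D phi)^2 \<le> S * V" proof (rule loc[OF t(4)])
  fix x assume x: "x \<in> cball c R"
  have "\<bar>phi x\<bar> \<le> \<bar>g x\<bar>" using bump_nonneg[of c R x] bump_le_1[of c R x] by (simp add: phi abs_mult mult_left_le_one_le)
  then have "(norm (phi x))^2 \<le> (g x)^2" by (simp add: abs_le_square_iff)
  then show "(norm (phi x))^2 \<le> S" using b(1)[OF x] by linarith
 qed
 show "(L2norm D dphi)^2 \<le> (2 * G + 32 / R^2 * S) * V" proof (rule loc[OF t(5)])
  fix x assume x: "x \<in> cball c R"
  have "norm (bump c R x *R dg x) \<le> norm (dg x)" using bump_nonneg[of c R x] bump_le_1[of c R x] by (simp add: mult_left_le_one_le)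
  then have 1: "(norm (bump c R x *R dg x))^2 \<le> G" using b(2)[OF x] power_mono[of _ _ 2] norm_ge_zero order_trans by metis
  have "norm (g x *R dbump c R x) \<le> \<bar>g x\<bar> * (4 / R)" using mult_left_mono[OF norm_dbump_le[OF R, of c x] abs_ge_zero[of "g x"]] by simp
  then have "(norm (g x *R dbump c R x))^2 \<le> (\<bar>g x\<bar> * (4 / R))^2" by (intro power_mono) auto
  also have "... = 16 / R^2 * (g x)^2" by (simp add: power_mult_distrib power_divide)
  also have "... \<le> 16 / R^2 * S" using b(1)[OF x] by (intro mult_left_mono) auto
  finally have 2: "(norm (g x *R dbump c R x))^2 \<le> 16 / R^2 * S" .
  have "32 / R^2 * S = 2 * (16 / R^2 * S)" by simp
  then show "(norm (dphi x))^2 \<le> 2 * G + 32 / R^2 * S" unfolding dphi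
   using 1 2 norm_add_sq_le[of "bump c R x *R dg x" "g x *R dbump c R x"] by linarith
 qed
qed

locale discrete = weak_setting + mesh_setting +
 fixes k m :: nat and uh :: "elem => pt => pt" and ph :: "elem => pt => real" and pGh :: "real => real"
  and fh :: "elem => pt => real" and fGh :: "real => real"
 assumes sol: "sdg_solution P M k f fG uh ph pGh" and fh: "pw_poly M m fh" and fGh: "pw_polyG P M m fGh"
begin

lemma uh_Vh: "uh \<in> Vh M k" and ph_Sh: "ph \<in> Sh P M k" and pGh_Wh: "pGh \<in> Wh P M k"
 and scheme1: "!!v. v \<in> Vh M k ==> (\<Sum>tau\<in>Th M. LINT x:tri tau. (matrix_inv (Kb P x) *v uh tau x) \<bullet> v tau x)
    + bh_star P M ph v = 0"
 using sol unfolding sdg_solution_def by - (elim conjE, assumption, elim conjE, assumption, elim conjE, assumption, elim conjE, erule bspec, assumption)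

lemma uh_poly: "tau \<in> Th M ==> poly2 k (%x. uh tau x $ i)" using uh_Vh unfolding Vh_def by simp
lemma ph_poly: "tau \<in> Th M ==> poly2 k (ph tau)" using ph_Sh unfolding Sh_def by simp
lemma fh_poly: "tau \<in> Th M ==> poly2 m (fh tau)" using fh unfolding pw_poly_def by simp

lemma AE_tri_int: "tau \<in> Th M ==> AE x in lebesgue. x \<in> tri tau \<longleftrightarrow> x \<in> tri_int tau"
 by (rule eventually_mono[OF tri_boundary_null[OF Th_ccw]]) (use tri_int_subset[OF Th_ccw] in blast)+

lemma AE_tri: "tau \<in> Th M ==> AE x in lebesgue. x \<in> tri tau --> x \<in> OmB P"
 by (rule eventually_mono[OF tri_boundary_null[OF Th_ccw]]) (use tri_int_OmB in blast)+

lemma L2_tri: assumes "tau \<in> Th M" "L2 (OmB P) g" shows "L2 (tri tau) g" proof -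
 have "L2 (tri_int tau) g" using open_tri_int by (intro L2_subset[OF assms(2) tri_int_OmB[OF assms(1)]]) auto
 then show ?thesis using AE_tri_int[OF assms(1)] by (rule L2_cong_set_AE[OF _ eventually_mono]) auto
qed

lemma L2_tri_cont: "continuous_on UNIV g ==> L2 (tri tau) (g :: pt => 'b::euclidean_space)" by (intro L2_continuous_bounded tri_props)

lemma uh_cont: "tau \<in> Th M ==> continuous_on UNIV (uh tau)" by (rule poly2_continuous_vec[OF uh_poly])
lemma gph_cont: "tau \<in> Th M ==> continuous_on UNIV (grad (ph tau))" by (rule C1_continuous_grad[OF poly2_C1(1)[OF ph_poly]])

lemma OmB_sets: "OmB P \<in> sets lebesgue" using OmB_open by simp

lemma sqrt_kappa_meas: "set_borel_measurable lebesgue (OmB P) (%x. sqrt (kappa x))" proof -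
 have "(%x. sqrt (indicator (OmB P) x *R kappa x)) \<in> borel_measurable lebesgue"
  by (rule measurable_compose[OF kappa_meas[unfolded set_borel_measurable_def]])
   (intro borel_measurable_continuous_onI continuous_intros)
 moreover have "(%x. sqrt (indicator (OmB P) x *R kappa x)) = (%x. indicator (OmB P) x *R sqrt (kappa x))" proof
  fix x show "sqrt (indicator (OmB P) x *R kappa x) = indicator (OmB P) x *R sqrt (kappa x)" by (cases "x \<in> OmB P") auto
 qed
 ultimately show ?thesis by (simp add: set_borel_measurable_def)
qed

lemma inv_sqrt_kappa_meas: "set_borel_measurable lebesgue (OmB P) (%x. 1 / sqrt (kappa x))"
 by (rule set_borel_measurable_divide_mult(1)[OF set_borel_measurable_const[OF OmB_sets] sqrt_kappa_meas])

lemma AE_K: assumes "tau \<in> Th M" shows "AE x in lebesgue. x \<in> tri tau --> x \<in> OmB P & kmin \<le> kappa x & kappa x \<le> kmax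
  & (\<forall>v. matrix_inv (mat_sqrt (Kb P x)) *v v = (1 / sqrt (kappa x)) *R v)
  & (\<forall>v. mat_sqrt (Kb P x) *v v = sqrt (kappa x) *R v)
  & (\<forall>v. matrix_inv (Kb P x) *v v = (1 / kappa x) *R v)" using AE_tri[OF assms] kappa_bd proof eventually_elim
 case (elim x)
 show ?case proof
  assume x: "x \<in> tri tau"
  then have k: "x \<in> OmB P" "kmin \<le> kappa x" "kappa x \<le> kmax" "0 < kappa x" using elim kmin by auto
  show "x \<in> OmB P & kmin \<le> kappa x & kappa x \<le> kmax
   & (\<forall>v. matrix_inv (mat_sqrt (Kb P x)) *v v = (1 / sqrt (kappa x)) *R v)
   & (\<forall>v. mat_sqrt (Kb P x) *v v = sqrt (kappa x) *R v)
   & (\<forall>v. matrix_inv (Kb P x) *v v = (1 / kappa x) *R v)" unfolding kappa_K[OF k(1)] using k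
   by (simp add: mat_sqrt_mat matrix_inv_mat mat_vec_mult)
 qed
qed

lemma L2_inv_sqrt: assumes "tau \<in> Th M" "L2 (tri tau) g"
 shows "L2 (tri tau) (%x. matrix_inv (mat_sqrt (Kb P x)) *v g x)" "L2 (tri tau) (%x. mat_sqrt (Kb P x) *v g x)" proof -
 have g: "L2 (tri_int tau) g" using AE_tri_int[OF assms(1)] by (rule L2_cong_set_AE[OF assms(2)])
 have m: "set_borel_measurable lebesgue (tri_int tau) c" if "set_borel_measurable lebesgue (OmB P) c" for c :: "pt => real"
  using that open_tri_int[of tau] by (intro set_borel_measurable_subset[OF that] tri_int_OmB[OF assms(1)]) auto
 have sub: "tri_int tau <= tri tau" by (rule tri_int_subset[OF Th_ccw[OF assms(1)]])
 have 1: "L2 (tri_int tau) (%x. (1 / sqrt (kappa x)) *R g x)" proof (rule L2_bounded_mult[OF g m[OF inv_sqrt_kappa_meas]])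
  show "AE x in lebesgue. x \<in> tri_int tau --> \<bar>1 / sqrt (kappa x)\<bar> \<le> 1 / sqrt kmin" using AE_K[OF assms(1)] proof eventually_elim
   case (elim x) then show ?case using sub kmin by (auto simp: frac_le)
  qed
 qed
 have 2: "L2 (tri_int tau) (%x. sqrt (kappa x) *R g x)" proof (rule L2_bounded_mult[OF g m[OF sqrt_kappa_meas]])
  show "AE x in lebesgue. x \<in> tri_int tau --> \<bar>sqrt (kappa x)\<bar> \<le> sqrt kmax" using AE_K[OF assms(1)] proof eventually_elim
   case (elim x) then show ?case using sub kmin by auto
  qed
 qed
 have ae: "AE x in lebesgue. x \<in> tri_int tau \<longleftrightarrow> x \<in> tri tau" by (rule eventually_mono[OF AE_tri_int[OF assms(1)]]) auto
 have 1: "L2 (tri tau) (%x. (1 / sqrt (kappa x)) *R g x)" and 2: "L2 (tri tau) (%x. sqrt (kappa x) *R g x)"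
  using L2_cong_set_AE[OF 1 ae] L2_cong_set_AE[OF 2 ae] by auto
 show "L2 (tri tau) (%x. matrix_inv (mat_sqrt (Kb P x)) *v g x)" by (rule L2_cong_AE[OF 1], rule eventually_mono[OF AE_K[OF assms(1)]]) auto
 show "L2 (tri tau) (%x. mat_sqrt (Kb P x) *v g x)" by (rule L2_cong_AE[OF 2], rule eventually_mono[OF AE_K[OF assms(1)]]) auto
qed

text \<open>Squared errors and residuals on a triangle; all local estimates are for squares.\<close>

definition Eu :: "elem => real" where "Eu tau = (L2norm (tri tau) (%x. u x - uh tau x))^2"
definition eu :: "elem => real" where
 "eu tau = (L2norm (tri tau) (%x. matrix_inv (mat_sqrt (Kb P x)) *v (u x - uh tau x)))^2"
definition eg :: "elem => real" where
 "eg tau = (L2norm (tri tau) (%x. mat_sqrt (Kb P x) *v (Gp x - grad (ph tau) x)))^2"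
definition Of :: "elem => real" where "Of tau = (L2norm (tri tau) (%x. f x - fh tau x))^2"
definition Fr :: "elem => real" where "Fr tau = (L2norm (tri tau) (%x. f x - dvg (uh tau) x))^2"
definition Rf :: "elem => real" where
 "Rf tau = (L2norm (tri tau) (%x. matrix_inv (mat_sqrt (Kb P x)) *v uh tau x + mat_sqrt (Kb P x) *v grad (ph tau) x))^2"
definition KM :: real where "KM = max kmax 1"

lemma nonneg_tri [simp]: "0 \<le> Eu tau" "0 \<le> eu tau" "0 \<le> eg tau" "0 \<le> Of tau" "0 \<le> Fr tau" "0 \<le> Rf tau"
 by (simp_all add: Eu_def eu_def eg_def Of_def Fr_def Rf_def)

lemma KM_pos: "0 < KM" by (simp add: KM_def)

lemma u_diff_L2: "tau \<in> Th M ==> L2 (tri tau) (%x. u x - uh tau x)" by (intro L2_diff L2_tri u_L2 L2_tri_cont uh_cont)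
lemma G_diff_L2: "tau \<in> Th M ==> L2 (tri tau) (%x. Gp x - grad (ph tau) x)" by (intro L2_diff L2_tri Gp_L2 L2_tri_cont gph_cont)

lemma Eu_le: assumes "tau \<in> Th M" shows "Eu tau \<le> KM * eu tau" proof -
 have "Eu tau \<le> (sqrt KM)^2 * eu tau" unfolding Eu_def eu_def proof (rule L2norm_sq_mono[OF L2_inv_sqrt(1)[OF assms u_diff_L2[OF assms]]])
  show "AE x in lebesgue. x \<in> tri tau --> norm (u x - uh tau x)
    \<le> sqrt KM * norm (matrix_inv (mat_sqrt (Kb P x)) *v (u x - uh tau x))" using AE_K[OF assms] proof eventually_elim
   case (elim x)
   show ?case proof
    assume "x \<in> tri tau"
    then have k: "0 < kappa x" "kappa x \<le> KM"
     and e: "norm (matrix_inv (mat_sqrt (Kb P x)) *v (u x - uh tau x)) = norm (u x - uh tau x) / sqrt (kappa x)"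
     using elim kmin by (auto simp: KM_def)
    have "sqrt (kappa x) * (norm (u x - uh tau x) / sqrt (kappa x)) \<le> sqrt KM * (norm (u x - uh tau x) / sqrt (kappa x))"
     using k by (intro mult_right_mono) auto
    then show "norm (u x - uh tau x) \<le> sqrt KM * norm (matrix_inv (mat_sqrt (Kb P x)) *v (u x - uh tau x))" unfolding e using k by simp
   qed
  qed
 qed
 then show ?thesis using KM_pos by simp
qed

text \<open>The first residual vanishes for the exact solution, so it is the corresponding combination
  of the errors.\<close>

lemma Rf_le: assumes "tau \<in> Th M" shows "Rf tau \<le> 2 * eu tau + 2 * eg tau" proof -
 let ?a = "%x. matrix_inv (mat_sqrt (Kb P x)) *v (u x - uh tau x)"
 let ?b = "%x. mat_sqrt (Kb P x) *v (Gp x - grad (ph tau) x)"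
 have "Rf tau = (L2norm (tri tau) (%x. ?a x + ?b x))^2" unfolding Rf_def proof (rule arg_cong[where f = "%z. z^2"], rule L2norm_cong_AE)
  show "AE x in lebesgue. x \<in> tri tau -->
   norm (matrix_inv (mat_sqrt (Kb P x)) *v uh tau x + mat_sqrt (Kb P x) *v grad (ph tau) x) = norm (?a x + ?b x)" using AE_K[OF assms] flux_eq
  proof eventually_elim
   case (elim x)
   show ?case proof
    assume "x \<in> tri tau"
    then have k: "0 < kappa x" and ux: "u x = - (kappa x *R Gp x)" and e: "!!v. matrix_inv (mat_sqrt (Kb P x)) *v v = (1 / sqrt (kappa x)) *R v"
      "!!v. mat_sqrt (Kb P x) *v v = sqrt (kappa x) *R v" using elim kmin by auto
    have "(1 / sqrt (kappa x)) *R (kappa x *R Gp x) = sqrt (kappa x) *R Gp x" using k by (simp add: real_div_sqrt)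
    then have "?a x + ?b x = - (matrix_inv (mat_sqrt (Kb P x)) *v uh tau x + mat_sqrt (Kb P x) *v grad (ph tau) x)"
     unfolding e ux by (simp only: scaleR_diff_right scaleR_minus_right) simp
    then show "norm (matrix_inv (mat_sqrt (Kb P x)) *v uh tau x + mat_sqrt (Kb P x) *v grad (ph tau) x) = norm (?a x + ?b x)"
     by (simp only: norm_minus_cancel)
   qed
  qed
 qed
 also have "... \<le> 2 * eu tau + 2 * eg tau" unfolding eu_def eg_def
  by (intro L2norm_sq_add_le L2_inv_sqrt[OF assms] u_diff_L2[OF assms] G_diff_L2[OF assms])
 finally show ?thesis .
qed

text \<open>For test functions supported in one triangle, or in two neighbouring ones, the first two terms on
  the right add up to zero, so that only errors and jumps remain.\<close>

lemma local_residual: assumes tau: "tau \<in> Th M" and phi: "C1 phi dphi"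
 shows "(LINT x:tri tau. (f x - dvg (uh tau) x) * phi x) + (LINT x:tri tau. (u x - uh tau x) \<bullet> dphi x)
  = (LINT x:tri tau. f x * phi x) + (LINT x:tri tau. u x \<bullet> dphi x)
   - (\<Sum>e\<in>dedges tau. eint e (%x. phi x * (uh tau x \<bullet> nrm e)))" proof -
 note cont = C1_continuous[OF phi] C1_continuous_grad[OF phi] uh_cont[OF tau] poly2_continuous[OF poly2_dvg[OF uh_poly[OF tau]]]
 have i: "set_integrable lebesgue (tri tau) (%x. f x * phi x)" "set_integrable lebesgue (tri tau) (%x. phi x * dvg (uh tau) x)"
  "set_integrable lebesgue (tri tau) (%x. u x \<bullet> dphi x)" "set_integrable lebesgue (tri tau) (%x. uh tau x \<bullet> dphi x)"
  by (intro L2_mult_integrable L2_inner_integrable L2_tri[OF tau] L2_tri_cont f_L2 u_L2 cont)+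
 have "(%x. (f x - dvg (uh tau) x) * phi x) = (%x. f x * phi x - phi x * dvg (uh tau) x)" by (simp add: algebra_simps)
 then have 1: "(LINT x:tri tau. (f x - dvg (uh tau) x) * phi x)
   = (LINT x:tri tau. f x * phi x) - (LINT x:tri tau. phi x * dvg (uh tau) x)" using set_integral_diff(2)[OF i(1,2)] by (simp only:)
 have 2: "(LINT x:tri tau. (u x - uh tau x) \<bullet> dphi x)
   = (LINT x:tri tau. u x \<bullet> dphi x) - (LINT x:tri tau. uh tau x \<bullet> dphi x)"
  using set_integral_diff(2)[OF i(3,4)] by (simp only: inner_diff_left)
 show ?thesis using green_triangle[OF Th_ccw[OF tau] phi uh_poly[OF tau]] unfolding 1 2 by linarith
qed

definition c2 :: "real => real" where "c2 C = 2 + 2 * (144 * C / \<sigma>^2 * (544 * C * 36 / \<sigma>^2 + 16 * C))"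

text \<open>Tested with the polynomial part of the residual times a bump in an inscribed ball; no edge is
  seen.\<close>

lemma interior_residual: assumes tau: "tau \<in> Th M" and C: "inverse_const2 (max k m) (6 / \<sigma>) C"
 shows "(diameter (tri tau))^2 * Fr tau \<le> c2 C * (Eu tau + (diameter (tri tau))^2 * Of tau)" proof -
 define h where "h = diameter (tri tau)"
 define c where "c = centroid tau"
 \<comment> \<open>The ball of this radius around the centroid lies in the open triangle.\<close>
 define R where "R = \<sigma> * h / 6"
 define r where "r = (%x. fh tau x - dvg (uh tau) x)"
 have h: "h > 0" using diameter_tri_pos[OF Th_ccw[OF tau]] by (simp add: h_def)
 have R: "R > 0" using h \<sigma>_pos by (simp add: R_def)
 have C0: "0 < C" using C by (simp add: inverse_const2_def)
 have ball: "cball c R <= tri_int tau" and cT: "c \<in> tri tau" using centroid_ball[OF tau] by (simp_all add: c_def R_def h_def)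
 have ballT: "cball c R <= tri tau" using ball tri_int_subset[OF Th_ccw[OF tau]] by blast
 have Tball: "tri tau <= cball c h" using dist_le_diameter_tri[OF cT] by (auto simp: h_def)
 have rp: "poly2 (max k m) r" unfolding r_def by (intro poly2_diff poly2_mono[OF fh_poly[OF tau]] poly2_mono[OF poly2_dvg[OF uh_poly[OF tau]]]) auto
 define phi where "phi = (%x. bump c R x * r x)"
 define dphi where "dphi = (%x. bump c R x *R grad r x + r x *R dbump c R x)"
 note bt = bump_test[OF phi_def dphi_def poly2_C1(1)[OF rp] R]
 note phi = bt(1) and supp = bt(2) and phi0' = bt(4,5)
 define X where "X = (LINT x:cball c R. bump c R x * (r x)^2)"
 have X0: "0 \<le> X" unfolding X_def set_lebesgue_integral_def
  by (intro integral_nonneg_AE AE_I2) (auto simp: bump_nonneg intro!: mult_nonneg_nonneg)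
 have bd: "(r x)^2 + R^2 * (norm (grad r x))^2 \<le> C / R^2 * X" if "x \<in> tri tau" for x proof -
  have "x \<in> cball c (6 / \<sigma> * R)" using that Tball \<sigma>_pos by (auto simp: R_def)
  then show ?thesis using C rp R unfolding inverse_const2_def X_def by blast
 qed
 have b1: "(r x)^2 \<le> C / R^2 * X" if "x \<in> tri tau" for x
  using bd[OF that] zero_le_mult_iff[of "R^2" "(norm (grad r x))^2"] by (smt (verit) zero_le_power2)
 have b2: "(norm (grad r x))^2 \<le> C / R ^ 4 * X" if "x \<in> tri tau" for x proof -
  have "R^2 * (norm (grad r x))^2 \<le> C / R^2 * X" using bd[OF that] by (smt (verit) zero_le_power2)
  then show ?thesis using R by (simp add: field_simps power4_eq_xxxx power2_eq_square)
 qed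
 have mball: "measure lebesgue (cball c R) \<le> 4 * R^2" using R by (intro measure_le_of_subset_cball2) auto
 note bb = bump_test_bounds[OF phi_def dphi_def poly2_C1(1)[OF rp] R tri_props(6) mball b1[OF subsetD[OF ballT]] b2[OF subsetD[OF ballT]]]
 have mphi: "(L2norm (tri tau) phi)^2 \<le> 4 * C * X" using bb(1)[of tau] R by simp
 have "(2 * (C / R ^ 4 * X) + 32 / R^2 * (C / R^2 * X)) * (4 * R^2) = 136 * C / R^2 * X"
  using R by (simp add: field_simps power4_eq_xxxx power2_eq_square)
 then have md: "(L2norm (tri tau) dphi)^2 \<le> 136 * C / R^2 * X" using bb(2)[of tau] by (simp only:)
 note cont = C1_continuous[OF phi] C1_continuous_grad[OF phi]
 have Lphi: "L2 (tri tau) phi" "L2 (tri tau) dphi" using cont by (auto intro: L2_tri_cont)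
 have Lf: "L2 (tri tau) (%x. f x - fh tau x)" by (intro L2_diff L2_tri[OF tau f_L2] L2_tri_cont poly2_continuous[OF fh_poly[OF tau]])
 have Lfd: "L2 (tri tau) (%x. f x - dvg (uh tau) x)"
  by (intro L2_diff L2_tri[OF tau f_L2] L2_tri_cont poly2_continuous[OF poly2_dvg[OF uh_poly[OF tau]]])
 have bdry: "(\<Sum>e\<in>dedges tau. eint e (%x. phi x * (uh tau x \<bullet> nrm e))) = 0" proof (intro sum.neutral ballI eint_zero)
  fix e x assume e: "e \<in> dedges tau" and x: "x \<in> closed_segment (fst e) (snd e)"
  have "orient (fst e) (snd e) x = 0" proof -
   obtain t where "x = fst e + t *R (snd e - fst e)" using x unfolding closed_segment_def by (auto simp: algebra_simps)
   then show ?thesis by (simp add: orient_affine)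
  qed
  then have "x \<notin> tri_int tau" using e unfolding tri_int_def by force
  then have "x \<notin> cball c R" using ball by blast
  then show "phi x * (uh tau x \<bullet> nrm e) = 0" using phi0' by simp
 qed
 have loc: "(LINT x:OmB P. g x) = (LINT x:tri tau. g x)" if "!!x. x \<notin> cball c R ==> g x = 0" for g :: "pt => real"
  by (rule set_integral_supp[of "cball c R"]) (use ball ballT tri_int_OmB[OF tau] that in auto)
 have "(LINT x:tri tau. f x * phi x) + (LINT x:tri tau. u x \<bullet> dphi x) = 0" proof -
  have "supp phi <= OmB P" using supp ball tri_int_OmB[OF tau] by blast
  moreover have "(LINT x:OmB P. f x * phi x) = (LINT x:tri tau. f x * phi x)"
   "(LINT x:OmB P. u x \<bullet> dphi x) = (LINT x:tri tau. u x \<bullet> dphi x)" by (rule loc, simp add: phi0')+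
  ultimately show ?thesis using weak_div[OF phi] by linarith
 qed
 then have res: "(LINT x:tri tau. (f x - dvg (uh tau) x) * phi x) = - (LINT x:tri tau. (u x - uh tau x) \<bullet> dphi x)"
  using local_residual[OF tau phi] bdry by simp
 have "X = (LINT x:tri tau. r x * phi x)" proof -
  have "X = (LINT x:cball c R. r x * phi x)" by (simp add: X_def phi_def power2_eq_square mult_ac)
  also have "... = (LINT x:tri tau. r x * phi x)" by (rule set_integral_supp[of "cball c R"]) (use ballT phi0' in auto)
  finally show ?thesis .
 qed
 also have "... = (LINT x:tri tau. (f x - dvg (uh tau) x) * phi x - (f x - fh tau x) * phi x)" by (simp add: r_def algebra_simps)
 also have "... = (LINT x:tri tau. (f x - dvg (uh tau) x) * phi x) - (LINT x:tri tau. (f x - fh tau x) * phi x)"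
  by (intro set_integral_diff L2_mult_integrable Lphi Lf Lfd)
 finally have X: "X = - (LINT x:tri tau. (u x - uh tau x) \<bullet> dphi x) - (LINT x:tri tau. (f x - fh tau x) * phi x)" using res by simp
 have i1: "\<bar>LINT x:tri tau. (u x - uh tau x) \<bullet> dphi x\<bar> \<le> sqrt (Eu tau * (136 * C / R^2 * X))"
  unfolding Eu_def by (rule L2_CS_bound[OF u_diff_L2[OF tau] Lphi(2) md])
 have i2: "\<bar>LINT x:tri tau. (f x - fh tau x) * phi x\<bar> \<le> sqrt (Of tau * (4 * C * X))"
  unfolding Of_def using L2_CS_bound[OF Lf Lphi(1) mphi] by (simp only: inner_real_def)
 have "X \<le> 4 * (Eu tau * (136 * C / R^2) + Of tau * (4 * C) + 0 + 0)" proof (rule sqrt_absorb)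
  show "X \<le> sqrt (Eu tau * (136 * C / R^2) * X) + sqrt (Of tau * (4 * C) * X) + sqrt (0 * X) + sqrt (0 * X)"
   using X i1 i2 by (simp add: mult.assoc)
 qed (use X0 C0 in auto)
 then have Xb: "h^2 * X \<le> (544 * C * 36 / \<sigma>^2 + 16 * C) * (Eu tau + h^2 * Of tau)" proof -
  have "h^2 * X \<le> h^2 * (4 * (Eu tau * (136 * C / R^2) + Of tau * (4 * C) + 0 + 0))" using \<open>X \<le> _\<close> by (intro mult_left_mono) auto
  also have "... = 544 * C * 36 / \<sigma>^2 * Eu tau + 16 * C * (h^2 * Of tau)"
   using h \<sigma>_pos by (simp add: R_def field_simps power2_eq_square)
  also have "... \<le> (544 * C * 36 / \<sigma>^2 + 16 * C) * Eu tau + (544 * C * 36 / \<sigma>^2 + 16 * C) * (h^2 * Of tau)"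
   using C0 by (intro add_mono mult_right_mono) auto
  finally show ?thesis by (simp only: distrib_left)
 qed
 have "(L2norm (tri tau) r)^2 \<le> 144 * C / \<sigma>^2 * X" proof -
  have "(L2norm (tri tau) r)^2 \<le> (sqrt (C / R^2 * X))^2 * measure lebesgue (tri tau)" by (rule L2norm_sq_le_measure)
    (use tri_props b1 in \<open>auto intro!: real_le_rsqrt simp: lmeasurable_compact\<close>)
  also have "(sqrt (C / R^2 * X))^2 = C / R^2 * X" using C0 X0 by simp
  also have "C / R^2 * X * measure lebesgue (tri tau) \<le> C / R^2 * X * (4 * h^2)"
   using measure_le_of_subset_cball2[OF Tball tri_props(6)] h C0 X0 by (intro mult_left_mono) auto
  also have "... = 144 * C / \<sigma>^2 * X" using h \<sigma>_pos by (simp add: R_def field_simps power2_eq_square)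
  finally show ?thesis .
 qed
 then have "h^2 * (L2norm (tri tau) r)^2 \<le> h^2 * (144 * C / \<sigma>^2 * X)" by (intro mult_left_mono) auto
 also have "... = 144 * C / \<sigma>^2 * (h^2 * X)" by simp
 also have "... \<le> 144 * C / \<sigma>^2 * ((544 * C * 36 / \<sigma>^2 + 16 * C) * (Eu tau + h^2 * Of tau))"
  using C0 by (intro mult_left_mono Xb) auto
 finally have rb: "h^2 * (L2norm (tri tau) r)^2 \<le> 144 * C / \<sigma>^2 * (544 * C * 36 / \<sigma>^2 + 16 * C) * (Eu tau + h^2 * Of tau)" by simp
 have "Fr tau \<le> 2 * Of tau + 2 * (L2norm (tri tau) r)^2"
  using L2norm_sq_add_le[OF Lf L2_tri_cont[OF poly2_continuous[OF rp]]] by (simp add: Fr_def Of_def r_def)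
 then have "h^2 * Fr tau \<le> h^2 * (2 * Of tau + 2 * (L2norm (tri tau) r)^2)" by (intro mult_left_mono) auto
 then have "h^2 * Fr tau \<le> 2 * (h^2 * Of tau) + 2 * (h^2 * (L2norm (tri tau) r)^2)" by (simp add: algebra_simps)
 moreover have "2 * (h^2 * Of tau) \<le> 2 * (Eu tau + h^2 * Of tau)" by simp
 ultimately show ?thesis using rb unfolding c2_def h_def[symmetric] distrib_right by (simp only: mult.assoc)
qed

end

section \<open>The flux jump across polygon edges\<close>

definition tang :: "pt \<times> pt => pt" where "tang e = (1 / elen e) *R (snd e - fst e)"

lemma norm_tang: "0 < elen e ==> norm (tang e) = 1" by (simp add: tang_def elen_def dist_norm norm_minus_commute)

lemma tang_coord: "0 < elen e ==> (fst e + (s / elen e) *R (snd e - fst e) - fst e) \<bullet> tang e = s" proof -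
 assume "0 < elen e"
 then have "(snd e - fst e) \<bullet> (snd e - fst e) = elen e * elen e"
  by (simp add: elen_def dist_norm norm_minus_commute dot_square_norm power2_eq_square)
 then show ?thesis using \<open>0 < elen e\<close> by (simp add: tang_def)
qed

lemma segment_coord: assumes "0 < elen e" "x \<in> closed_segment (fst e) (snd e)"
 shows "x = fst e + (((x - fst e) \<bullet> tang e) / elen e) *R (snd e - fst e)" proof -
 obtain t where t: "x = fst e + t *R (snd e - fst e)" using assms(2) unfolding closed_segment_def by (auto simp: algebra_simps)
 then have "x = fst e + ((t * elen e) / elen e) *R (snd e - fst e)" using assms(1) by simp
 then show ?thesis using tang_coord[OF assms(1), of "t * elen e"] by simp
qed

text \<open>Constant in the normal direction, so that its size near the edge is controlled by the one-
  dimensional inverse inequality.\<close>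

lemma edge_extension: assumes e: "0 < elen e" and q: "poly2 n q"
 obtains r where "degree r \<le> n" "!!s. q (fst e + (s / elen e) *R (snd e - fst e)) = poly r s"
  "poly2 n (%x. poly r ((x - fst e) \<bullet> tang e))"
  "!!x. x \<in> closed_segment (fst e) (snd e) ==> q x = poly r ((x - fst e) \<bullet> tang e)"
  "C1 (%x. poly r ((x - fst e) \<bullet> tang e)) (%x. poly (pderiv r) ((x - fst e) \<bullet> tang e) *R tang e)" proof -
 obtain r where r: "degree r \<le> n" "!!s. q (fst e + s *R tang e) = poly r s" using poly2_line[OF q, where p = "fst e" and t = "tang e"] by blast
 have l: "q (fst e + (s / elen e) *R (snd e - fst e)) = poly r s" for s using r(2)[of s] by (simp add: tang_def)
 have a: "(%x. (x - fst e) \<bullet> tang e) = (%x. x \<bullet> tang e + - (fst e \<bullet> tang e))" by (simp add: inner_diff_left)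
 have p1: "poly2 1 (%x. (x - fst e) \<bullet> tang e)" unfolding a by (rule poly2_affine)
 have c1: "C1 (%x. (x - fst e) \<bullet> tang e) (%x. tang e)" unfolding a by (rule C1_inner)
 show thesis proof (rule that[OF r(1) l poly2_poly[OF r(1) p1]])
  fix x assume "x \<in> closed_segment (fst e) (snd e)"
  then show "q x = poly r ((x - fst e) \<bullet> tang e)" using segment_coord[OF e] l by metis
 next
  show "C1 (%x. poly r ((x - fst e) \<bullet> tang e)) (%x. poly (pderiv r) ((x - fst e) \<bullet> tang e) *R tang e)"
   by (rule C1_compose_real[OF c1]) (auto intro!: poly_DERIV continuous_intros)
 qed
qed

lemma barycentric: "orient p q r *R x = orient q r x *R p + orient r p x *R q + orient p q x *R r"
 by (simp add: vec_eq_iff forall_2 orient_def det2_def algebra_simps)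

lemma inverse_const1_mono:
 assumes "inverse_const1 n w kappa C" "degree r \<le> n" "0 < l" "\<bar>x\<bar> \<le> kappa * l" "(LINT s:{0<..<l}. w (s / l) * (poly r s)^2) \<le> X"
 shows "(poly r x)^2 \<le> C / l * X" "(poly (pderiv r) x)^2 \<le> C / l ^ 3 * X" proof -
 have C: "0 < C" and b: "(poly r x)^2 + l^2 * (poly (pderiv r) x)^2 \<le> C / l * (LINT s:{0<..<l}. w (s / l) * (poly r s)^2)"
  using assms(1-4) unfolding inverse_const1_def by blast+
 have "C / l * (LINT s:{0<..<l}. w (s / l) * (poly r s)^2) \<le> C / l * X" using C assms(3,5) by (intro mult_left_mono) auto
 then have b': "(poly r x)^2 + l^2 * (poly (pderiv r) x)^2 \<le> C / l * X" using b by linarith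
 moreover have "0 \<le> l^2 * (poly (pderiv r) x)^2" by simp
 ultimately show "(poly r x)^2 \<le> C / l * X" by linarith
 have "l^2 * (poly (pderiv r) x)^2 \<le> C / l * X" using b' zero_le_power2[of "poly r x"] by linarith
 then show "(poly (pderiv r) x)^2 \<le> C / l ^ 3 * X" using assms(3) by (simp add: field_simps power2_eq_square power3_eq_cube)
qed

context discrete
begin

text \<open>The bump around the midpoint of an edge, as a function on the edge scaled to unit length.\<close>

definition wgt :: "real => real" where "wgt = bump (1/2) (\<sigma> / 4)"

lemma edge_bump: assumes l: "0 < elen e"
 shows "bump ((1/2) *R (fst e + snd e)) (\<sigma> * elen e / 4) (fst e + (s / elen e) *R (snd e - fst e)) = wgt (s / elen e)" proof -
 have x: "fst e + (s / elen e) *R (snd e - fst e) - (1/2) *R (fst e + snd e) = (s / elen e - 1/2) *R (snd e - fst e)"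
  by (simp add: vec_eq_iff algebra_simps)
 have "(snd e - fst e) \<bullet> (snd e - fst e) = (elen e)^2" by (simp add: elen_def dist_norm norm_minus_commute dot_square_norm)
 then have "((s / elen e - 1/2) *R (snd e - fst e)) \<bullet> ((s / elen e - 1/2) *R (snd e - fst e)) / (\<sigma> * elen e / 4)^2
  = (s / elen e - 1/2)^2 * (elen e)^2 / (\<sigma> * elen e / 4)^2" by (simp add: power2_eq_square)
 also have "... = (s / elen e - 1/2)^2 / (\<sigma> / 4)^2" using l \<sigma>_pos by (simp add: power_mult_distrib power_divide)
 finally show ?thesis unfolding bump_def wgt_def x by (simp add: power2_eq_square)
qed

lemma orient_on_segment: assumes "x \<in> closed_segment a b" shows "orient a b x = 0" proof -
 obtain t where "x = a + t *R (b - a)" using assms unfolding closed_segment_def by (auto simp: algebra_simps)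
 then show ?thesis by (simp add: orient_affine)
qed

lemma midpoint_ball_on_edge: assumes t: "tau \<in> Th M" "e \<in> dedges tau" and x: "dist ((1/2) *R (fst e + snd e)) x \<le> \<sigma> * elen e / 4"
  and o: "orient (fst e) (snd e) x = 0" shows "x \<in> open_segment (fst e) (snd e)" proof -
 obtain p q r where r: "e = (p, q)" "ccw (p, q, r)" "dedges tau = {(p, q), (q, r), (r, p)}" by (rule dedge_rotate[OF Th_ccw[OF t(1)] t(2)])
 have d: "p ~= q" "q ~= r" "r ~= p" using ccw_distinct[OF r(2)] by auto
 have pos: "0 < orient q r x" "0 < orient r p x"
  using midpoint_ball(3)[OF t x, of "(q, r)"] midpoint_ball(3)[OF t x, of "(r, p)"] d by (auto simp: r(1,3))
 have o': "orient p q x = 0" using o by (simp add: r(1))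
 have s: "orient q r x + orient r p x = orient p q r" using orient_sum[of p q x r] o' by simp
 define theta where "theta = orient r p x / orient p q r"
 have J: "0 < orient p q r" using pos s by linarith
 have theta: "0 < theta" "theta < 1" "1 - theta = orient q r x / orient p q r" using pos s J by (auto simp: theta_def field_simps)
 have "x = (1 / orient p q r) *R (orient p q r *R x)" using J by simp
 also have "... = (1 - theta) *R p + theta *R q" unfolding barycentric[of p q r x] o' theta(3) by (simp add: theta_def scaleR_add_right)
 finally show ?thesis using theta(1,2) d(1) by (auto simp: in_segment r(1))
qed

definition c4 :: "real => real" where "c4 C = 16 * C * (C * (2 + 512 / \<sigma>^2) + C)"

text \<open>Tested with the extended jump times a bump around the midpoint of the edge.\<close>

lemma flux_jump_residual: assumes e: "e \<in> Fu0 P M" and C: "inverse_const1 (max k m) wgt (2 / \<sigma>) C"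
 shows "elen e * eint e (%x. (njump M e uh x)^2) \<le> c4 C *
  ((Eu (Lft M e) + (diameter (tri (Lft M e)))^2 * Fr (Lft M e)) + (Eu (Rgt M e) + (diameter (tri (Rgt M e)))^2 * Fr (Rgt M e)))" proof -
 let ?L = "Lft M e" and ?R = "Rgt M e"
 define l where "l = elen e"
 define mid where "mid = (1/2) *R (fst e + snd e)"
 \<comment> \<open>Within this distance of the midpoint no other edge of the two triangles is met.\<close>
 define R where "R = \<sigma> * l / 4"
 note L = pedge_tri(1,2)[OF Fu0_D(1)[OF e]]
 note R' = pedge_tri(1,2)[OF Fu0_D(2)[OF e], folded Rgt_def]
 have l: "0 < l" using elen_pos[OF L] by (simp add: l_def)
 have \<sigma>1: "\<sigma> \<le> 1" by (rule \<sigma>_le_1[OF L(1)])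
 have R: "0 < R" "R \<le> l / 4" using l \<sigma>_pos \<sigma>1 by (simp_all add: R_def)
 have C0: "0 < C" using C by (simp add: inverse_const1_def)
 have swap: "fst (prod.swap e) = snd e" "snd (prod.swap e) = fst e" "(1/2) *R (snd e + fst e) = mid" by (simp_all add: mid_def add.commute)
 have bL: "0 \<le> orient (fst e) (snd e) x ==> x \<in> tri ?L" "0 < orient (fst e) (snd e) x ==> x \<in> tri_int ?L"
  "!!e'. e' \<in> dedges ?L ==> e' ~= e ==> 0 < orient (fst e') (snd e') x" if "x \<in> cball mid R" for x
  using midpoint_ball[OF L, of x] that by (simp_all add: mid_def R_def l_def)
 have bR: "orient (fst e) (snd e) x \<le> 0 ==> x \<in> tri ?R" "orient (fst e) (snd e) x < 0 ==> x \<in> tri_int ?R"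
  "!!e'. e' \<in> dedges ?R ==> e' ~= prod.swap e ==> 0 < orient (fst e') (snd e') x" if "x \<in> cball mid R" for x
  using midpoint_ball[OF R', of x] that orient_flip[of "snd e" "fst e" x] unfolding swap by (simp_all add: R_def l_def)
 have LR: "?L ~= ?R" proof
  assume eq: "?L = ?R"
  have "centroid ?L \<in> tri_int ?L" using centroid_ball(1)[OF L(1)] \<sigma>_pos diameter_tri_pos[OF Th_ccw[OF L(1)]] by auto
  then have "0 < orient (fst e) (snd e) (centroid ?L)" "0 < orient (snd e) (fst e) (centroid ?L)"
   using L(2) R'(2) eq swap unfolding tri_int_def by force+
  then show False using orient_flip[of "snd e" "fst e"] by simp
 qed
 have cb_sub: "cball mid R <= tri ?L \<union> tri ?R" using bL(1) bR(1) by (meson UnI1 UnI2 linear subsetI)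
 have cb_OmB: "cball mid R <= OmB P" proof
  fix x assume x: "x \<in> cball mid R"
  consider "0 < orient (fst e) (snd e) x" | "orient (fst e) (snd e) x < 0" | "orient (fst e) (snd e) x = 0" by linarith
  then show "x \<in> OmB P" proof cases
   case 1 then show ?thesis using bL(2)[OF x] tri_int_OmB[OF L(1)] by blast
  next
   case 2 then show ?thesis using bR(2)[OF x] tri_int_OmB[OF R'(1)] by blast
  next
   case 3
   have "x \<in> open_segment (fst e) (snd e)" by (rule midpoint_ball_on_edge[OF L _ 3]) (use x in \<open>simp add: mid_def R_def l_def\<close>)
   then show ?thesis using Fu0_open_OmB[OF e] by blast
  qed
 qed
 define q where "q = (%x. uh ?L x \<bullet> nrm e - uh ?R x \<bullet> nrm e)"
 have q: "poly2 (max k m) q" unfolding q_def by (rule poly2_mono[of k]) (auto intro!: poly2_diff poly2_inner uh_poly L R')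
 obtain r where r: "degree r \<le> max k m" "!!s. q (fst e + (s / elen e) *R (snd e - fst e)) = poly r s"
  "poly2 (max k m) (%x. poly r ((x - fst e) \<bullet> tang e))"
  "!!x. x \<in> closed_segment (fst e) (snd e) ==> q x = poly r ((x - fst e) \<bullet> tang e)"
  "C1 (%x. poly r ((x - fst e) \<bullet> tang e)) (%x. poly (pderiv r) ((x - fst e) \<bullet> tang e) *R tang e)"
  using edge_extension[OF l[unfolded l_def] q] by blast
 define g where "g = (%x. poly r ((x - fst e) \<bullet> tang e))"
 define phi where "phi = (%x. bump mid R x * g x)"
 define dphi where "dphi = (%x. bump mid R x *R (poly (pderiv r) ((x - fst e) \<bullet> tang e) *R tang e) + g x *R dbump mid R x)"
 note bt = bump_test[OF phi_def dphi_def r(5)[folded g_def] R(1)]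
 note phi = bt(1) and supp = bt(2) and phi0' = bt(4,5)
 note cont = C1_continuous[OF phi] C1_continuous_grad[OF phi]
 define X where "X = eint e (%x. phi x * q x)"
 have X: "X = (LINT s:{0<..<l}. wgt (s / l) * (poly r s)^2)"
  unfolding X_def eint_def l_def phi_def g_def r(2) tang_coord[OF l[unfolded l_def]] mid_def R_def
   edge_bump[OF l[unfolded l_def]] by (simp add: power2_eq_square mult_ac)
 have X0: "0 \<le> X" unfolding X set_lebesgue_integral_def wgt_def
  by (intro integral_nonneg_AE AE_I2) (auto simp: bump_nonneg intro!: mult_nonneg_nonneg)
 have xb: "\<bar>(x - fst e) \<bullet> tang e\<bar> \<le> 2 / \<sigma> * l" if "x \<in> cball mid R" for x proof -
  have "\<bar>(x - fst e) \<bullet> tang e\<bar> \<le> norm (x - fst e)"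
   using Cauchy_Schwarz_ineq2[of "x - fst e" "tang e"] norm_tang[of e] l by (simp add: l_def)
  also have "... \<le> dist mid x + dist mid (fst e)" using dist_triangle2[of x "fst e" mid] by (simp add: dist_norm norm_minus_commute)
  also have "dist mid (fst e) = l / 2" proof -
   have "mid - fst e = (1/2) *R (snd e - fst e)" by (simp add: mid_def vec_eq_iff algebra_simps)
   then show ?thesis by (simp add: dist_norm l_def elen_def norm_minus_commute)
  qed
  also have "dist mid x \<le> l / 4" using that R by simp
  finally have "\<bar>(x - fst e) \<bullet> tang e\<bar> \<le> 2 * l" using l by simp
  also have "... \<le> 2 / \<sigma> * l" using \<sigma>1 \<sigma>_pos l by (simp add: field_simps)
  finally show ?thesis .
 qed
 have b1: "(g x)^2 \<le> C / l * X" if "x \<in> cball mid R" for x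
  unfolding g_def by (rule inverse_const1_mono(1)[OF C r(1) l xb[OF that]]) (simp add: X)
 have b2: "(norm (poly (pderiv r) ((x - fst e) \<bullet> tang e) *R tang e))^2 \<le> C / l ^ 3 * X" if "x \<in> cball mid R" for x
  using inverse_const1_mono(2)[OF C r(1) l xb[OF that], of X] norm_tang[of e] l by (simp add: X l_def)
 have mball: "measure lebesgue (cball mid R) \<le> l^2" proof -
  have "measure lebesgue (cball mid R) \<le> 4 * R^2" using R by (intro measure_le_of_subset_cball2) auto
  also have "R^2 \<le> (l / 4)^2" using R by (intro power_mono) auto
  also have "4 * (l / 4)^2 \<le> l^2" by (simp add: power2_eq_square)
  finally show ?thesis by simp
 qed
 define K where "K = 2 + 512 / \<sigma>^2"
 have K: "0 < K" using \<sigma>_pos by (simp add: K_def add_pos_nonneg)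
 note bb = bump_test_bounds[OF phi_def dphi_def r(5)[folded g_def] R(1) tri_props(6) mball b1 b2]
 have mphi: "(L2norm (tri T) phi)^2 \<le> l * C * X" for T using bb(1)[of T] l by (simp add: power2_eq_square mult_ac)
 have "(2 * (C / l ^ 3 * X) + 32 / R^2 * (C / l * X)) * l^2 = K * C / l * X"
  using l \<sigma>_pos by (simp add: K_def R_def field_simps power3_eq_cube power2_eq_square)
 then have md: "(L2norm (tri T) dphi)^2 \<le> K * C / l * X" for T using bb(2)[of T] by (simp only:)
 have Lfd: "L2 (tri tau) (%x. f x - dvg (uh tau) x)" if "tau \<in> Th M" for tau
  by (intro L2_diff L2_tri[OF that f_L2] L2_tri_cont poly2_continuous[OF poly2_dvg[OF uh_poly[OF that]]])
 have other: "eint e' (%x. phi x * (uh tau x \<bullet> nrm e')) = 0"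
  if "!!x. x \<in> cball mid R ==> 0 < orient (fst e') (snd e') x" for e' tau proof (rule eint_zero)
  fix x assume "x \<in> closed_segment (fst e') (snd e')"
  then have "x \<notin> cball mid R" using orient_on_segment that by force
  then show "phi x * (uh tau x \<bullet> nrm e') = 0" using phi0' by simp
 qed
 have bdL: "(\<Sum>e'\<in>dedges ?L. eint e' (%x. phi x * (uh ?L x \<bullet> nrm e'))) = eint e (%x. phi x * (uh ?L x \<bullet> nrm e))"
  using L(2) other bL(3) by (subst sum.remove[of _ e]) (auto intro!: sum.neutral)
 have bdR: "(\<Sum>e'\<in>dedges ?R. eint e' (%x. phi x * (uh ?R x \<bullet> nrm e'))) = - eint e (%x. phi x * (uh ?R x \<bullet> nrm e))" proof -
  have c: "continuous_on UNIV (%x. phi x * (uh ?R x \<bullet> nrm (prod.swap e)))"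
   by (intro continuous_on_mult cont continuous_on_inner uh_cont R' continuous_on_const)
  have "(\<Sum>e'\<in>dedges ?R. eint e' (%x. phi x * (uh ?R x \<bullet> nrm e')))
    = eint (prod.swap e) (%x. phi x * (uh ?R x \<bullet> nrm (prod.swap e)))"
   using R'(2) other bR(3) by (subst sum.remove[of _ "prod.swap e"]) (auto intro!: sum.neutral)
  also have "... = eint e (%x. phi x * (uh ?R x \<bullet> nrm (prod.swap e)))" by (rule eint_swap[OF c])
  also have "(%x. phi x * (uh ?R x \<bullet> nrm (prod.swap e))) = (%x. (-1) * (phi x * (uh ?R x \<bullet> nrm e)))" by (simp add: nrm_swap)
  also have "eint e ... = (-1) * eint e (%x. phi x * (uh ?R x \<bullet> nrm e))" by (rule eint_cmult)
  finally show ?thesis by simp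
 qed
 have XLR: "X = eint e (%x. phi x * (uh ?L x \<bullet> nrm e)) - eint e (%x. phi x * (uh ?R x \<bullet> nrm e))" proof -
  have "continuous_on UNIV (%x. phi x * (uh ?L x \<bullet> nrm e))" "continuous_on UNIV (%x. phi x * (uh ?R x \<bullet> nrm e))"
   by (intro continuous_on_mult cont continuous_on_inner uh_cont R' L continuous_on_const)+
  from eint_add(2)[OF this] show ?thesis unfolding X_def q_def by (simp only: right_diff_distrib)
 qed
 have split: "(LINT x:OmB P. G x) = (LINT x:tri ?L. G x) + (LINT x:tri ?R. G x)"
  if "!!x. x \<notin> cball mid R ==> G x = 0" "set_integrable lebesgue (tri ?L) G" "set_integrable lebesgue (tri ?R) G" for G :: "pt => real" proof -
  have "(LINT x:OmB P. G x) = (LINT x:tri ?L \<union> tri ?R. G x)" by (rule set_integral_supp[OF cb_OmB cb_sub that(1)])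
  also have "... = (\<Sum>tau\<in>{?L, ?R}. LINT x:tri tau. G x)" proof (rule conjunct2[OF set_integral_sum_partition])
   show "AE x in lebesgue. (\<Sum>i\<in>{?L, ?R}. indicator (tri i) x) = (indicator (tri ?L \<union> tri ?R) x :: real)" using AE_tri_int[OF L(1)]
   proof eventually_elim
    case (elim x)
    have "\<not> (x \<in> tri ?L & x \<in> tri ?R)" using elim tri_int_unique[OF L(1) R'(1)] LR by blast
    then show ?case using LR by (cases "x \<in> tri ?L"; cases "x \<in> tri ?R") simp_all
   qed
  qed (use that in auto)
  also have "... = (LINT x:tri ?L. G x) + (LINT x:tri ?R. G x)" using LR by simp
  finally show ?thesis .
 qed
 have int: "set_integrable lebesgue (tri tau) (%x. f x * phi x)" "set_integrable lebesgue (tri tau) (%x. u x \<bullet> dphi x)" if "tau \<in> Th M" for tau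
  by (intro L2_mult_integrable L2_inner_integrable L2_tri[OF that] L2_tri_cont f_L2 u_L2 cont)+
 have "supp phi <= OmB P" using supp cb_OmB by blast
 from weak_div[OF phi this]
 have "(LINT x:tri ?L. f x * phi x) + (LINT x:tri ?L. u x \<bullet> dphi x)
   + ((LINT x:tri ?R. f x * phi x) + (LINT x:tri ?R. u x \<bullet> dphi x)) = 0"
  using split[of "%x. f x * phi x", OF _ int(1)[OF L(1)] int(1)[OF R'(1)]]
   split[of "%x. u x \<bullet> dphi x", OF _ int(2)[OF L(1)] int(2)[OF R'(1)]] by (simp add: phi0')
 then have X_eq: "X = - ((LINT x:tri ?L. (f x - dvg (uh ?L) x) * phi x) + (LINT x:tri ?L. (u x - uh ?L x) \<bullet> dphi x))
   - ((LINT x:tri ?R. (f x - dvg (uh ?R) x) * phi x) + (LINT x:tri ?R. (u x - uh ?R x) \<bullet> dphi x))"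
  using local_residual[OF L(1) phi] local_residual[OF R'(1) phi] unfolding bdL bdR XLR by linarith
 have i1: "\<bar>LINT x:tri tau. (u x - uh tau x) \<bullet> dphi x\<bar> \<le> sqrt (Eu tau * (K * C / l) * X)" if "tau \<in> Th M" for tau
  unfolding Eu_def mult.assoc using L2_CS_bound[OF u_diff_L2[OF that] L2_tri_cont[OF cont(2)] md[unfolded mult.assoc]] by (simp add: mult.assoc)
 have i2: "\<bar>LINT x:tri tau. (f x - dvg (uh tau) x) * phi x\<bar> \<le> sqrt (Fr tau * (l * C) * X)" if "tau \<in> Th M" for tau
  unfolding Fr_def using L2_CS_bound[OF Lfd[OF that] L2_tri_cont[OF cont(1)] mphi] by (simp only: inner_real_def mult.assoc)
 have Xb: "X \<le> 4 * (Eu ?L * (K * C / l) + Fr ?L * (l * C) + Eu ?R * (K * C / l) + Fr ?R * (l * C))" proof (rule sqrt_absorb)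
  show "X \<le> sqrt (Eu ?L * (K * C / l) * X) + sqrt (Fr ?L * (l * C) * X) + sqrt (Eu ?R * (K * C / l) * X) + sqrt (Fr ?R * (l * C) * X)"
   using X_eq i1[OF L(1)] i2[OF L(1)] i1[OF R'(1)] i2[OF R'(1)] by linarith
 qed (use X0 C0 K l in auto)
 have hl: "l^2 * Fr tau \<le> (diameter (tri tau))^2 * Fr tau" if "l \<le> diameter (tri tau)" for tau
  using that l by (intro mult_right_mono power_mono) auto
 have lL: "l \<le> diameter (tri ?L)" using elen_le_diameter[OF Th_ccw[OF L(1)] L(2)] by (simp add: l_def)
 have lR: "l \<le> diameter (tri ?R)" using elen_le_diameter[OF Th_ccw[OF R'(1)] R'(2)] by (simp add: l_def)
 have seg: "eint e (%x. (njump M e uh x)^2) \<le> C * X" proof -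
  have "eint e (%x. (njump M e uh x)^2) = (LINT s:{0<..<l}. (poly r s)^2)" unfolding eint_def njump_def l_def q_def[symmetric]
   using r(2) unfolding q_def by simp
  also have "... \<le> (LINT s:{0<..<l}. C / l * X)" proof (rule set_integral_mono)
   show "set_integrable lebesgue {0<..<l} (%s. (poly r s)^2)" by (rule set_integrable_continuous_bounded) (auto intro!: continuous_intros)
   show "set_integrable lebesgue {0<..<l} (%s. C / l * X)" by (rule set_integrable_continuous_bounded) (auto intro!: continuous_intros)
   fix s assume s: "s \<in> {0<..<l}"
   have "l \<le> 2 / \<sigma> * l" using \<sigma>1 \<sigma>_pos l by (simp add: field_simps)
   then have "\<bar>s\<bar> \<le> 2 / \<sigma> * l" using s by simp
   then show "(poly r s)^2 \<le> C / l * X" by (intro inverse_const1_mono(1)[OF C r(1) l]) (simp_all add: X)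
  qed
  also have "... = C * X" using l by (simp add: set_lebesgue_integral_def)
  finally show ?thesis .
 qed
 let ?E = "Eu ?L + Eu ?R" and ?F = "l^2 * Fr ?L + l^2 * Fr ?R"
 have "elen e * eint e (%x. (njump M e uh x)^2) \<le> l * (C * X)" using seg l by (simp add: l_def)
 also have "... = C * (l * X)" by simp
 also have "... \<le> C * (l * (4 * (Eu ?L * (K * C / l) + Fr ?L * (l * C) + Eu ?R * (K * C / l) + Fr ?R * (l * C))))"
  using Xb C0 l by (intro mult_left_mono) auto
 also have "... = 4 * C * (C * K) * ?E + 4 * C * C * ?F" using l by (simp add: field_simps power2_eq_square)
 also have "... \<le> 16 * C * (C * K + C) * ?E + 16 * C * (C * K + C) * ?F" proof (intro add_mono mult_right_mono)
  have "0 \<le> C * (C * K)" "0 \<le> C * C" using C0 K by simp_all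
  then show "4 * C * (C * K) \<le> 16 * C * (C * K + C)" "4 * C * C \<le> 16 * C * (C * K + C)" by (simp_all add: distrib_left mult.assoc)
 qed auto
 also have "... = c4 C * (?E + ?F)" by (simp only: c4_def K_def distrib_left)
 also have "... \<le> c4 C * ((Eu ?L + (diameter (tri ?L))^2 * Fr ?L) + (Eu ?R + (diameter (tri ?R))^2 * Fr ?R))"
  using hl[OF lL] hl[OF lR] C0 K by (intro mult_left_mono) (auto simp: c4_def K_def[symmetric])
 finally show ?thesis .
qed

end

section \<open>Values on the fracture\<close>

lemma set_integral_shift_real:
 fixes g :: "real => real" assumes g: "continuous_on UNIV g" shows "(LINT x:{s<..<t}. g x) = (LINT y:{0<..<t - s}. g (s + y))" proof -
 have cont: "continuous_on UNIV (%y. g (s + y))" by (rule continuous_on_compose2[OF g]) (auto intro!: continuous_intros)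
 have leb: "(LINT s:{a<..<b}. h s) = (LINT s|lborel. indicator {a<..<b} s *R h s)"
  if "continuous_on UNIV h" for h :: "real => real" and a b unfolding set_lebesgue_integral_def
  using borel_measurable_scaleR[OF borel_measurable_indicator borel_measurable_continuous_onI[OF that], of "{a<..<b}"]
  by (intro integral_completion) simp
 have "(LINT x|lborel. indicator {s<..<t} x *R g x) = (LINT y|lborel. indicator {s<..<t} (s + 1 * y) *R g (s + 1 * y))"
  by (subst lborel_integral_real_affine[where c = 1 and t = s]) auto
 also have "... = (LINT y|lborel. indicator {0<..<t - s} y *R g (s + y))" by (intro Bochner_Integration.integral_cong refl) (auto simp: indicator_def)
 finally show ?thesis by (simp add: leb[OF g] leb[OF cont])
qed

lemma set_integral_cong': 
 fixes f g :: "'a => 'b::{banach, second_countable_topology}" assumes "!!x. x \<in> A ==> f x = g x" shows "(LINT x:A|N. f x) = (LINT x:A|N. g x)"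
 unfolding set_lebesgue_integral_def proof (rule Bochner_Integration.integral_cong[OF refl])
 fix x show "indicator A x *R f x = indicator A x *R g x" by (cases "x \<in> A") (simp_all add: assms)
qed

context mesh_setting
begin

lemma elen_gedge: "(s, t) \<in> FG P M ==> elen (gedge (s, t)) = t - s" using FG_straight(2)[of s t s] FG_D[of s t] by simp

lemma gam_FG: assumes "(s, t) \<in> FG P M" "x \<in> {s..t}"
 shows "gam P x = fst (gedge (s, t)) + ((x - s) / elen (gedge (s, t))) *R (snd (gedge (s, t)) - fst (gedge (s, t)))"
 using FG_straight(1)[OF assms] unfolding elen_gedge[OF assms(1)] by (simp add: gedge_def)

text \<open>The normal of the fracture agrees with that of the mesh edge as oriented by arc length.\<close>

lemma nG_FG: assumes st: "(s, t) \<in> FG P M" and x: "s < x" "x < t" shows "nG P x = nrm (gedge (s, t))" proof -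
 let ?d = "snd (gedge (s, t)) - fst (gedge (s, t))" and ?l = "elen (gedge (s, t))"
 have "((%x. fst (gedge (s, t)) + ((x - s) / ?l) *R ?d) has_vector_derivative (1 / ?l) *R ?d) (at x)"
  by (auto intro!: derivative_eq_intros simp: divide_inverse)
 then have "(gam P has_vector_derivative (1 / ?l) *R ?d) (at x)" by (rule has_vector_derivative_transform_within_open[where S = "{s<..<t}"])
   (use x gam_FG[OF st] in auto)
 then have "vector_derivative (gam P) (at x) = (1 / ?l) *R ?d" by (rule vector_derivative_at)
 moreover have "rot (c *R v) = c *R rot v" for c v by (simp add: rot_def vec_eq_iff forall_2)
 ultimately show ?thesis unfolding nG_def nrm_def by simp
qed

lemma side_FG: assumes "(s, t) \<in> FG P M" "s < x" "x < t"
 shows "side1 P M q x = q (Lft M (gedge (s, t))) (gam P x)" "side2 P M q x = q (Rgt M (gedge (s, t))) (gam P x)"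
 by (simp_all add: side1_def side2_def fedge_eq[OF assms] gedge_def)

lemma FG_eint: assumes st: "(s, t) \<in> FG P M" and g: "continuous_on UNIV g" shows "(LINT x:{s<..<t}. g (gam P x)) = eint (gedge (s, t)) g" proof -
 let ?e = "gedge (s, t)"
 let ?G = "%x. g (fst ?e + ((x - s) / elen ?e) *R (snd ?e - fst ?e))"
 have l: "elen ?e ~= 0" using elen_gedge[OF st] FG_D(2)[OF st] by simp
 have c: "continuous_on UNIV ?G" using l by (intro continuous_on_compose2[OF g]) (auto intro!: continuous_intros)
 have "(LINT x:{s<..<t}. g (gam P x)) = (LINT x:{s<..<t}. ?G x)" by (rule set_integral_cong') (use gam_FG[OF st] in auto)
 also have "... = (LINT y:{0<..<t - s}. ?G (s + y))" by (rule set_integral_shift_real[OF c])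
 finally show ?thesis by (simp add: eint_def elen_gedge[OF st])
qed

lemma gedge_swap_pedges: "i \<in> FG P M ==> gedge i \<in> pedges M" "i \<in> FG P M ==> prod.swap (gedge i) \<in> pedges M" proof -
 assume i: "i \<in> FG P M"
 show 1: "gedge i \<in> pedges M" using FG_D(4) i by (cases i) auto
 show "prod.swap (gedge i) \<in> pedges M" by (rule pedge_swap[OF 1 gedge_not_bd[OF i]])
qed

section \<open>The discrete bilinear form after integration by parts\<close>

text \<open>Integrating the divergence by parts on each triangle, the contributions of the polygon edges
  cancel against the edge terms of the form, because the discrete pressure is continuous
  across them; what is left are the edges inside the polygons.\<close>

lemma bh_star_eq: assumes q: "q \<in> Sh P M k" and v: "!!tau i. tau \<in> Th M ==> poly2 k (%x. v tau x $ i)"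
 shows "bh_star P M q v = (\<Sum>tau\<in>Th M. (LINT x:tri tau. v tau x \<bullet> grad (q tau) x)
   - (\<Sum>e\<in>dedges tau - {snd tau}. eint e (%x. q tau x * (v tau x \<bullet> nrm e))))" proof -
 have qp: "poly2 k (q tau)" if "tau \<in> Th M" for tau using q that by (simp add: Sh_def)
 have cont: "continuous_on UNIV (%x. q tau x * (v tau x \<bullet> n))" if "tau \<in> Th M" for tau n
  by (intro continuous_on_mult continuous_on_inner continuous_on_const poly2_continuous[OF qp] poly2_continuous_vec[OF v] that)
 define F where "F e = eint e (%x. q (Lft M e) x * (v (Lft M e) x \<bullet> nrm e))" for e
 have green: "(LINT x:tri tau. v tau x \<bullet> grad (q tau) x) - (\<Sum>e\<in>dedges tau - {snd tau}. eint e (%x. q tau x * (v tau x \<bullet> nrm e)))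
   = F (snd tau) - (LINT x:tri tau. q tau x * dvg (v tau) x)" if t: "tau \<in> Th M" for tau proof -
  have d: "snd tau \<in> dedges tau" by (cases tau) (simp add: dedges_def)
  show ?thesis
   using green_triangle[OF Th_ccw[OF t] poly2_C1(1)[OF qp[OF t]] v[OF t]] sum.remove[OF finite_dedges d, of "%e. eint e (%x. q tau x * (v tau x \<bullet> nrm e))"]
   by (simp add: F_def Lft_eq[OF t d])
 qed
 have Fswap: "F (prod.swap e) = - eint e (%x. q (Rgt M e) x * (v (Rgt M e) x \<bullet> nrm e))" if e: "prod.swap e \<in> pedges M" for e proof -
  have "F (prod.swap e) = eint e (%x. q (Rgt M e) x * (v (Rgt M e) x \<bullet> nrm (prod.swap e)))"
   unfolding F_def Rgt_def by (rule eint_swap[OF cont[OF pedge_tri(1)[OF e]]])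
  also have "... = eint e (%x. (-1) * (q (Rgt M e) x * (v (Rgt M e) x \<bullet> nrm e)))" by (simp add: nrm_swap)
  finally show ?thesis unfolding eint_cmult by simp
 qed
 have FF: "F e + F (prod.swap e) = eint e (%x. q (Lft M e) x * (v (Lft M e) x \<bullet> nrm e) - q (Rgt M e) x * (v (Rgt M e) x \<bullet> nrm e))"
  if e: "e \<in> pedges M" "prod.swap e \<in> pedges M" for e unfolding Fswap[OF e(2)]
  by (subst eint_add(2)[OF cont[OF pedge_tri(1)[OF e(1)]] cont[OF pedge_tri(1)[OF e(2)], folded Rgt_def]]) (simp add: F_def)
 have bd: "F e = 0" if e: "e \<in> pedges M" "on_bd P e" for e unfolding F_def proof (rule eint_zero)
  fix x assume x: "x \<in> closed_segment (fst e) (snd e)"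
  obtain nu a b where t: "Lft M e = (nu, a, b)" by (cases "Lft M e")
  have "(nu, a, b) \<in> Th M" "e = (a, b)" using pedge_tri(1,3)[OF e(1)] by (simp_all add: t)
  then have "q (nu, a, b) x = 0" using q e(2) x unfolding Sh_def by auto
  then show "q (Lft M e) x * (v (Lft M e) x \<bullet> nrm e) = 0" by (simp add: t)
 qed
 have Fu: "F e + F (prod.swap e) = eint e (%x. q (Lft M e) x * njump M e v x)" if e: "e \<in> Fu0 P M" for e unfolding FF[OF Fu0_D(1,2)[OF e]]
 proof (rule eint_cong)
  fix x assume "x \<in> closed_segment (fst e) (snd e)"
  then have "jump M e q x = 0" using q e unfolding Sh_def by blast
  then show "q (Lft M e) x * (v (Lft M e) x \<bullet> nrm e) - q (Rgt M e) x * (v (Rgt M e) x \<bullet> nrm e) = q (Lft M e) x * njump M e v x"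
   by (simp add: jump_def njump_def right_diff_distrib)
 qed
 have FGe: "F (gedge (s, t)) + F (prod.swap (gedge (s, t))) = (LINT x:{s<..<t}. jumpG P M q x * navgG P M v x)
   + (LINT x:{s<..<t}. avgG P M q x * njumpG P M v x)" if st: "(s, t) \<in> FG P M" for s t proof -
  let ?e = "gedge (s, t)"
  note p1 = pedge_tri(1)[OF gedge_swap_pedges(1)[OF st]] and p2 = pedge_tri(1)[OF gedge_swap_pedges(2)[OF st], folded Rgt_def]
  define A where "A x = (q (Lft M ?e) x - q (Rgt M ?e) x) * ((v (Lft M ?e) x \<bullet> nrm ?e + v (Rgt M ?e) x \<bullet> nrm ?e) / 2)" for x
  define B where "B x = (q (Lft M ?e) x + q (Rgt M ?e) x) / 2 * (v (Lft M ?e) x \<bullet> nrm ?e - v (Rgt M ?e) x \<bullet> nrm ?e)" for x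
  note c0 = poly2_continuous[OF qp[OF p1]] poly2_continuous[OF qp[OF p2]] poly2_continuous_vec[OF v[OF p1]] poly2_continuous_vec[OF v[OF p2]]
  have c: "continuous_on UNIV A" "continuous_on UNIV B" unfolding A_def B_def
   by (intro continuous_on_mult continuous_on_diff continuous_on_add continuous_on_divide continuous_on_inner continuous_on_const c0; simp)+
  have "(LINT x:{s<..<t}. jumpG P M q x * navgG P M v x) = (LINT x:{s<..<t}. A (gam P x))"
   by (rule set_integral_cong') (simp add: A_def jumpG_def navgG_def side_FG[OF st] nG_FG[OF st])
  moreover have "(LINT x:{s<..<t}. avgG P M q x * njumpG P M v x) = (LINT x:{s<..<t}. B (gam P x))"
   by (rule set_integral_cong') (simp add: B_def avgG_def njumpG_def side_FG[OF st] nG_FG[OF st])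
  moreover have "eint ?e (%x. A x + B x) = F ?e + F (prod.swap ?e)"
   unfolding FF[OF gedge_swap_pedges[OF st]] by (rule eint_cong) (simp add: A_def B_def field_simps)
  ultimately show ?thesis using eint_add(1)[OF c] by (simp add: FG_eint[OF st c(1)] FG_eint[OF st c(2)])
 qed
 have "(\<Sum>tau\<in>Th M. F (snd tau)) = (\<Sum>e\<in>pedges M. F e)" by (rule sum.reindex_bij_betw[OF bij_Th_pedges])
 also have "... = (\<Sum>e\<in>Fu0 P M. F e + F (prod.swap e)) + (\<Sum>i\<in>FG P M. F (gedge i) + F (prod.swap (gedge i)))"
  by (rule sum_pedges[OF bd])
 also have "(\<Sum>e\<in>Fu0 P M. F e + F (prod.swap e)) = (\<Sum>e\<in>Fu0 P M. eint e (%x. q (Lft M e) x * njump M e v x))"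
  by (rule sum.cong[OF refl Fu])
 also have "(\<Sum>i\<in>FG P M. F (gedge i) + F (prod.swap (gedge i)))
   = (\<Sum>(s, t)\<in>FG P M. (LINT x:{s<..<t}. jumpG P M q x * navgG P M v x)
     + (LINT x:{s<..<t}. avgG P M q x * njumpG P M v x))" by (rule sum.cong[OF refl]) (auto simp: FGe)
 also have "... = (\<Sum>(s, t)\<in>FG P M. LINT x:{s<..<t}. jumpG P M q x * navgG P M v x)
   + (\<Sum>(s, t)\<in>FG P M. LINT x:{s<..<t}. avgG P M q x * njumpG P M v x)" by (simp add: sum.distrib case_prod_unfold)
 finally show ?thesis by (simp add: bh_star_def green sum_subtractf)
qed

section \<open>Jumps of the discrete pressure inside the polygons\<close>

lemma Fp_D: assumes "e \<in> Fp M" shows "e \<in> ori M" "Lft M e \<in> Th M" "e \<in> dedges (Lft M e)" "e ~= snd (Lft M e)"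
  "Rgt M e \<in> Th M" "prod.swap e \<in> dedges (Rgt M e)" "prod.swap e ~= snd (Rgt M e)" proof -
 show "e \<in> ori M" using assms by (simp add: Fp_def)
 obtain nu a b where t: "(nu, a, b) \<in> Th M" and e: "e = (nu, a) \<or> e = (a, nu)" using assms by (auto simp: Fp_def)
 obtain c where t': "(nu, c, a) \<in> Th M" proof -
  obtain S where S: "S \<in> Tu M" "(nu, a, b) \<in> tris_of S" using t Th_iff by blast
  let ?n = "length (snd S)"
  obtain i where i: "i < ?n" "nu = fst S" "a = snd S ! i" using S(2) by (auto simp: tris_of_def)
  define j where "j = (if i = 0 then ?n - 1 else i - 1)"
  have j: "j < ?n" "Suc j mod ?n = i" using i(1) by (auto simp: j_def)
  have "(nu, snd S ! j, a) \<in> tris_of S" unfolding tris_of_def i(2,3) using j by blast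
  then show thesis using that S(1) Th_iff by blast
 qed
 have ne: "nu ~= a" using ccw_distinct[of nu a b] Th_ccw[OF t] by auto
 have n1: "nu ~= c" "nu ~= b" using ccw_distinct[of nu a b] Th_ccw[OF t] ccw_distinct[of nu c a] Th_ccw[OF t'] by auto
 have 1: "Lft M (nu, a) = (nu, a, b)" by (rule Lft_eq[OF t]) (simp add: dedges_def)
 have 2: "Lft M (a, nu) = (nu, c, a)" by (rule Lft_eq[OF t']) (simp add: dedges_def)
 show "Lft M e \<in> Th M" "e \<in> dedges (Lft M e)" "e ~= snd (Lft M e)"
  "Rgt M e \<in> Th M" "prod.swap e \<in> dedges (Rgt M e)" "prod.swap e ~= snd (Rgt M e)" using e t t' ne n1 by (auto simp: Rgt_def 1 2 dedges_def)
qed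

text \<open>A field parallel to one of the two edges at the centre, scaled by the flux through the other;
  shape regularity bounds its length.\<close>

lemma unit_flux_field: assumes t: "tau \<in> Th M" and e: "e \<in> dedges tau" "e ~= snd tau"
 obtains w where "w \<bullet> nrm e = 1" "!!e'. e' \<in> dedges tau ==> e' ~= e ==> e' ~= snd tau ==> w \<bullet> nrm e' = 0"
  "norm w \<le> 1 / \<sigma>" proof -
 obtain nu a b where n: "tau = (nu, a, b)" by (cases tau)
 have d: "nu ~= a" "a ~= b" "b ~= nu" using ccw_distinct[of nu a b] Th_ccw[OF t] by (auto simp: n)
 define D where "D = orient nu a b"
 have D: "0 < D" "D = J tau" using Th_ccw[OF t] by (simp_all add: D_def n ccw_orient J_def)
 have len: "0 < elen (nu, a)" "0 < elen (b, nu)" using d by (simp_all add: elen_def)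
 have le: "elen (nu, a) \<le> diameter (tri tau)" "elen (b, nu) \<le> diameter (tri tau)"
  by (rule elen_le_diameter[OF Th_ccw[OF t]], simp add: n dedges_def)+
 have nb: "norm w \<le> 1 / \<sigma>" if "norm w = elen (nu, a) * elen (b, nu) / D" for w :: pt proof -
  have "\<sigma> * (elen (nu, a) * elen (b, nu)) \<le> \<sigma> * (diameter (tri tau))^2"
   unfolding power2_eq_square using le len \<sigma>_pos by (intro mult_left_mono mult_mono) auto
  also have "... \<le> D" using shape_regular[OF t] D(2) by simp
  finally show ?thesis unfolding that using D \<sigma>_pos by (simp add: field_simps)
 qed
 have r1: "(b - nu) \<bullet> rot (a - nu) = - D" "(b - nu) \<bullet> rot (nu - b) = 0" "(a - nu) \<bullet> rot (nu - b) = - D" "(a - nu) \<bullet> rot (a - nu) = 0"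
  by (simp_all add: D_def orient_def det2_def inner_vec_def sum_2 rot_simps algebra_simps)
 consider "e = (nu, a)" | "e = (b, nu)" using e by (auto simp: n dedges_def)
 then show thesis proof cases
  case 1
  define w where "w = (- elen (nu, a) / D) *R (b - nu)"
  show thesis proof (rule that[of w])
   show "w \<bullet> nrm e = 1" using len D by (simp add: w_def 1 nrm_def r1)
   show "norm w \<le> 1 / \<sigma>" by (rule nb) (use D len in \<open>simp add: w_def elen_def dist_norm\<close>)
   fix e' assume "e' \<in> dedges tau" "e' ~= e" "e' ~= snd tau"
   then have "e' = (b, nu)" by (auto simp: n dedges_def 1)
   then show "w \<bullet> nrm e' = 0" by (simp add: w_def nrm_def r1)
  qed
 next
  case 2
  define w where "w = (- elen (b, nu) / D) *R (a - nu)"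
  show thesis proof (rule that[of w])
   show "w \<bullet> nrm e = 1" using len D by (simp add: w_def 2 nrm_def r1)
   show "norm w \<le> 1 / \<sigma>" by (rule nb) (use D len in \<open>simp add: w_def elen_def dist_norm norm_minus_commute\<close>)
   fix e' assume "e' \<in> dedges tau" "e' ~= e" "e' ~= snd tau"
   then have "e' = (nu, a)" by (auto simp: n dedges_def 2)
   then show "w \<bullet> nrm e' = 0" by (simp add: w_def nrm_def r1)
  qed
 qed
qed

end

context discrete
begin

definition c3 :: "real => real" where "c3 C = 16 * C / (\<sigma> ^ 4 * kmin)"

text \<open>The pressure jump across an edge inside a polygon: the first discrete equation, tested with a
  field on the two adjacent triangles whose flux through the edge is the jump.\<close>

lemma pressure_jump_residual: assumes e: "e \<in> Fp M" and C: "inverse_const1 (max k m) wgt (2 / \<sigma>) C"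
 shows "1 / elen e * eint e (%x. (jump M e ph x)^2) \<le> c3 C * (Rf (Lft M e) + Rf (Rgt M e))" proof -
 let ?L = "Lft M e" and ?R = "Rgt M e"
 note D = Fp_D[OF e]
 define l where "l = elen e"
 have l: "0 < l" using elen_pos[OF D(2,3)] by (simp add: l_def)
 have \<sigma>1: "\<sigma> \<le> 1" by (rule \<sigma>_le_1[OF D(2)])
 have C0: "0 < C" using C by (simp add: inverse_const1_def)
 have LR: "?L ~= ?R" proof
  assume eq: "?L = ?R"
  have "centroid ?L \<in> tri_int ?L" using centroid_ball(1)[OF D(2)] \<sigma>_pos diameter_tri_pos[OF Th_ccw[OF D(2)]] by auto
  then have "0 < orient (fst e) (snd e) (centroid ?L)" "0 < orient (snd e) (fst e) (centroid ?L)" using D(3,6) eq unfolding tri_int_def by force+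
  then show False using orient_flip[of "snd e" "fst e"] by simp
 qed
 define q where "q = (%x. ph ?L x - ph ?R x)"
 have q: "poly2 k q" unfolding q_def by (intro poly2_diff ph_poly D)
 obtain r where r: "degree r \<le> k" "!!s. q (fst e + (s / elen e) *R (snd e - fst e)) = poly r s"
  "poly2 k (%x. poly r ((x - fst e) \<bullet> tang e))"
  "!!x. x \<in> closed_segment (fst e) (snd e) ==> q x = poly r ((x - fst e) \<bullet> tang e)"
  "C1 (%x. poly r ((x - fst e) \<bullet> tang e)) (%x. poly (pderiv r) ((x - fst e) \<bullet> tang e) *R tang e)"
  using edge_extension[OF l[unfolded l_def] q] by blast
 have rd: "degree r \<le> max k m" using r(1) by simp
 define g where "g = (%x. poly r ((x - fst e) \<bullet> tang e))"
 have gc: "continuous_on UNIV g" unfolding g_def by (rule poly2_continuous[OF r(3)])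
 define Y where "Y = eint e (%x. (jump M e ph x)^2)"
 have Yr: "Y = (LINT s:{0<..<l}. (poly r s)^2)" unfolding Y_def jump_def eint_def l_def using r(2) by (simp add: q_def)
 have Y0: "0 \<le> Y" unfolding Yr set_lebesgue_integral_def by (intro integral_nonneg_AE AE_I2) auto
 have wY: "(LINT s:{0<..<l}. wgt (s / l) * (poly r s)^2) \<le> Y" unfolding Yr proof (rule set_integral_mono)
  have "continuous_on UNIV wgt" using C1_continuous[OF C1_bump, of "\<sigma> / 4" "1/2 :: real"] \<sigma>_pos by (simp add: wgt_def)
  then have "continuous_on UNIV (%s. wgt (s / l))" by (rule continuous_on_compose2) (use l in \<open>auto intro!: continuous_intros\<close>)
  then show "set_integrable lebesgue {0<..<l} (%s. wgt (s / l) * (poly r s)^2)" by (intro set_integrable_continuous_bounded continuous_intros) auto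
  show "set_integrable lebesgue {0<..<l} (%s. (poly r s)^2)" by (intro set_integrable_continuous_bounded continuous_intros) auto
  fix s show "wgt (s / l) * (poly r s)^2 \<le> (poly r s)^2"
   using mult_right_mono[OF bump_le_1[of "1/2" "\<sigma> / 4" "s / l"] zero_le_power2[of "poly r s"]] by (simp add: wgt_def)
 qed
 obtain wL where wL: "wL \<bullet> nrm e = 1" "!!e'. e' \<in> dedges ?L ==> e' ~= e ==> e' ~= snd ?L ==> wL \<bullet> nrm e' = 0" "norm wL \<le> 1 / \<sigma>"
  using unit_flux_field[OF D(2-4)] by blast
 obtain wR where wR: "wR \<bullet> nrm (prod.swap e) = 1"
  "!!e'. e' \<in> dedges ?R ==> e' ~= prod.swap e ==> e' ~= snd ?R ==> wR \<bullet> nrm e' = 0" "norm wR \<le> 1 / \<sigma>"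
  using unit_flux_field[OF D(5-7)] by blast
 \<comment> \<open>Opposite signs on the two sides: the flux through the edge is then continuous.\<close>
 define w where "w tau = (if tau = ?L then wL else if tau = ?R then - wR else 0)" for tau
 define v where "v tau x = g x *R w tau" for tau x
 have wv: "w ?L = wL" "w ?R = - wR" using LR by (simp_all add: w_def)
 have wn: "norm (w tau) \<le> 1 / \<sigma>" for tau using wL(3) wR(3) \<sigma>_pos by (simp add: w_def)
 have vp: "poly2 k (%x. v tau x $ i)" for tau i using poly2_cmult[OF r(3), of "w tau $ i"] by (simp add: v_def g_def mult.commute)
 have fl: "w tau \<bullet> nrm e' = (if e' = e then 1 else if e' = prod.swap e then - 1 else 0)"
  if t: "tau \<in> Th M" and e': "e' \<in> dedges tau" "e' ~= snd tau" for tau e' proof -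
  have "prod.swap e ~= e" using l by (cases e) (auto simp: l_def elen_def)
  consider "tau = ?L" | "tau = ?R" | "tau ~= ?L" "tau ~= ?R" by blast
  then show ?thesis proof cases
   case 1
   have "e' ~= prod.swap e" using dedge_unique[OF t D(5) e'(1)] D(6) 1 LR by auto
   then show ?thesis using wL(1,2) e' 1 wv by auto
  next
   case 2
   have "e' ~= e" using dedge_unique[OF t D(2) e'(1)] D(3) 2 LR by auto
   moreover have "wR \<bullet> nrm e' = (if e' = prod.swap e then 1 else 0)" using wR(1,2) e' 2 by auto
   ultimately show ?thesis using wv 2 by simp
  next
   case 3
   have "e' ~= e" using dedge_unique[OF t D(2) e'(1)] D(3) 3 by auto
   moreover have "e' ~= prod.swap e" using dedge_unique[OF t D(5) e'(1)] D(6) 3 by auto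
   ultimately show ?thesis using 3 by (simp add: w_def)
  qed
 qed
 have v: "v \<in> Vh M k" unfolding Vh_def proof (intro CollectI conjI ballI allI)
  fix e' x assume e': "e' \<in> Fp M"
  note D' = Fp_D[OF e']
  have "w (Lft M e') \<bullet> nrm e' + w (Rgt M e') \<bullet> nrm (prod.swap e') = 0" proof -
   have ne: "prod.swap e ~= e" using l by (cases e) (auto simp: l_def elen_def)
   have "prod.swap e' = e \<longleftrightarrow> e' = prod.swap e" "prod.swap e' = prod.swap e \<longleftrightarrow> e' = e" by (metis swap_swap)+
   then show ?thesis unfolding fl[OF D'(2-4)] fl[OF D'(5-7)] using ne by simp
  qed
  then have "w (Lft M e') \<bullet> nrm e' = w (Rgt M e') \<bullet> nrm e'" by (simp add: nrm_swap)
  then show "njump M e' v x = 0" by (simp add: njump_def v_def)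
 qed (use vp in auto)
 have inner: "(\<Sum>e'\<in>dedges tau - {snd tau}. eint e' (%x. ph tau x * (v tau x \<bullet> nrm e')))
   = (if tau = ?L then eint e (%x. ph ?L x * g x) else if tau = ?R then - eint e (%x. ph ?R x * g x) else 0)"
  if t: "tau \<in> Th M" for tau proof -
  have z: "eint e' (%x. ph tau x * (v tau x \<bullet> nrm e')) = (w tau \<bullet> nrm e') * eint e' (%x. ph tau x * g x)" for e'
   by (subst eint_cmult[symmetric]) (simp add: v_def mult_ac)
  have c: "continuous_on UNIV (%x. ph tau x * g x)" by (intro continuous_on_mult gc poly2_continuous[OF ph_poly[OF t]])
  consider "tau = ?L" | "tau = ?R" | "tau ~= ?L" "tau ~= ?R" by blast
  then show ?thesis proof cases
   case 1
   then show ?thesis unfolding z using D(3,4) wL(1,2) wv by (subst sum.remove[of _ e]) (auto intro!: sum.neutral)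
  next
   case 2
   have "wR \<bullet> nrm e' = 0" if "e' \<in> dedges tau - {snd tau} - {prod.swap e}" for e' using that wR(2) 2 by auto
   then have "(\<Sum>e'\<in>dedges tau - {snd tau} - {prod.swap e}. (w tau \<bullet> nrm e') * eint e' (%x. ph tau x * g x)) = 0"
    using 2 wv by (intro sum.neutral) auto
   then show ?thesis unfolding z using D(6,7) 2 wR(1) wv LR by (subst sum.remove[of _ "prod.swap e"]) (auto simp: eint_swap[OF c[unfolded 2]])
  qed (simp add: z w_def)
 qed
 define I where "I tau = (LINT x:tri tau. (matrix_inv (Kb P x) *v uh tau x) \<bullet> v tau x) + (LINT x:tri tau. v tau x \<bullet> grad (ph tau) x)" for tau
 have Iz: "I tau = 0" if "tau ~= ?L" "tau ~= ?R" for tau using that by (simp add: I_def v_def w_def set_lebesgue_integral_def)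
 have "(\<Sum>tau\<in>Th M. I tau - (\<Sum>e'\<in>dedges tau - {snd tau}. eint e' (%x. ph tau x * (v tau x \<bullet> nrm e')))) = 0"
  using scheme1[OF v] unfolding bh_star_eq[OF ph_Sh vp] I_def by (simp add: sum.distrib sum_subtractf algebra_simps)
 also have "(\<Sum>tau\<in>Th M. I tau - (\<Sum>e'\<in>dedges tau - {snd tau}. eint e' (%x. ph tau x * (v tau x \<bullet> nrm e'))))
   = (\<Sum>tau\<in>{?L, ?R}. I tau - (\<Sum>e'\<in>dedges tau - {snd tau}. eint e' (%x. ph tau x * (v tau x \<bullet> nrm e'))))"
  by (rule sum.mono_neutral_right) (use finite_Th D inner Iz in auto)
 finally have bal: "I ?L + I ?R = eint e (%x. ph ?L x * g x) - eint e (%x. ph ?R x * g x)" using LR by (simp add: inner[OF D(2)] inner[OF D(5)])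
 also have "... = eint e (%x. ph ?L x * g x - ph ?R x * g x)"
  by (rule eint_add(2)[symmetric]; intro continuous_on_mult gc poly2_continuous[OF ph_poly] D)
 also have "... = Y" unfolding Y_def by (rule eint_cong) (use r(4) in \<open>simp add: g_def jump_def q_def power2_eq_square algebra_simps\<close>)
 finally have Yb: "Y = I ?L + I ?R" by simp
 have vb: "(L2norm (tri tau) (v tau))^2 \<le> 4 * C * l / \<sigma> ^ 4 * Y" and Lv: "L2 (tri tau) (v tau)"
  if t: "tau \<in> Th M" and fe: "fst e \<in> tri tau" and hl: "\<sigma> * diameter (tri tau) \<le> l" for tau proof -
  define h where "h = diameter (tri tau)"
  have h: "0 < h" "h \<le> l / \<sigma>" using diameter_tri_pos[OF Th_ccw[OF t]] hl \<sigma>_pos by (simp_all add: h_def field_simps)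
  show "L2 (tri tau) (v tau)" unfolding v_def by (intro L2_tri_cont continuous_on_scaleR gc continuous_on_const)
  have pt: "norm (v tau x) \<le> sqrt (C / l * Y) * (1 / \<sigma>)" if x: "x \<in> tri tau" for x proof -
   have "\<bar>(x - fst e) \<bullet> tang e\<bar> \<le> norm (x - fst e)"
    using Cauchy_Schwarz_ineq2[of "x - fst e" "tang e"] norm_tang[of e] l by (simp add: l_def)
   also have "... \<le> h" using dist_le_diameter_tri[OF x fe] by (simp add: h_def dist_norm)
   also have "... \<le> 2 / \<sigma> * l" using h \<sigma>_pos l by (simp add: field_simps)
   finally have "(g x)^2 \<le> C / l * Y" unfolding g_def by (rule inverse_const1_mono(1)[OF C rd l _ wY])
   then have "\<bar>g x\<bar> \<le> sqrt (C / l * Y)" using real_le_rsqrt[of "\<bar>g x\<bar>"] by simp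
   then show ?thesis unfolding v_def using wn[of tau] C0 l Y0 by (simp only: norm_scaleR) (intro mult_mono, auto)
  qed
  have "(L2norm (tri tau) (v tau))^2 \<le> (sqrt (C / l * Y) * (1 / \<sigma>))^2 * measure lebesgue (tri tau)"
   by (rule L2norm_sq_le_measure) (use pt tri_props in \<open>auto simp: lmeasurable_compact\<close>)
  also have "(sqrt (C / l * Y) * (1 / \<sigma>))^2 = C / l * Y / \<sigma>^2" using C0 l Y0 by (simp add: power_mult_distrib power_divide)
  also have "C / l * Y / \<sigma>^2 * measure lebesgue (tri tau) \<le> C / l * Y / \<sigma>^2 * (4 * (l / \<sigma>)^2)" proof (rule mult_left_mono)
   have "tri tau <= cball (fst e) h" using dist_le_diameter_tri[OF fe] by (auto simp: h_def)
   then have "measure lebesgue (tri tau) \<le> 4 * h^2" using tri_props h by (intro measure_le_of_subset_cball2) auto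
   also have "... \<le> 4 * (l / \<sigma>)^2" using h by (intro mult_left_mono power_mono) auto
   finally show "measure lebesgue (tri tau) \<le> 4 * (l / \<sigma>)^2" .
  qed (use C0 l Y0 in auto)
  also have "... = 4 * C * l / \<sigma> ^ 4 * Y" using l \<sigma>_pos by (simp add: field_simps power2_eq_square power4_eq_xxxx)
  finally show "(L2norm (tri tau) (v tau))^2 \<le> 4 * C * l / \<sigma> ^ 4 * Y" .
 qed
 have Ib: "\<bar>I tau\<bar> \<le> sqrt (Rf tau / kmin * (4 * C * l / \<sigma> ^ 4) * Y)"
  if t: "tau \<in> Th M" and fe: "fst e \<in> tri tau" and hl: "\<sigma> * diameter (tri tau) \<le> l" for tau proof -
  let ?S = "%x. matrix_inv (mat_sqrt (Kb P x)) *v uh tau x + mat_sqrt (Kb P x) *v grad (ph tau) x"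
  let ?T = "%x. matrix_inv (Kb P x) *v uh tau x + grad (ph tau) x"
  have S: "L2 (tri tau) ?S" by (intro L2_add L2_inv_sqrt[OF t] L2_tri_cont uh_cont gph_cont t)
  have "L2 (tri tau) (%x. matrix_inv (mat_sqrt (Kb P x)) *v (matrix_inv (mat_sqrt (Kb P x)) *v uh tau x))"
   by (intro L2_inv_sqrt(1)[OF t] L2_tri_cont uh_cont t)
  then have U: "L2 (tri tau) (%x. matrix_inv (Kb P x) *v uh tau x)" proof (rule L2_cong_AE)
   show "AE x in lebesgue. x \<in> tri tau -->
    matrix_inv (mat_sqrt (Kb P x)) *v (matrix_inv (mat_sqrt (Kb P x)) *v uh tau x) = matrix_inv (Kb P x) *v uh tau x"
    using AE_K[OF t] by eventually_elim (use kmin in \<open>auto simp: real_sqrt_mult_self\<close>)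
  qed
  have T: "L2 (tri tau) ?T" by (intro L2_add U L2_tri_cont gph_cont t)
  have i: "set_integrable lebesgue (tri tau) (%x. (matrix_inv (Kb P x) *v uh tau x) \<bullet> v tau x)"
   "set_integrable lebesgue (tri tau) (%x. v tau x \<bullet> grad (ph tau) x)" by (intro L2_inner_integrable U Lv[OF t fe hl] L2_tri_cont gph_cont t)+
  have "I tau = (LINT x:tri tau. ?T x \<bullet> v tau x)"
   unfolding I_def set_integral_add(2)[OF i, symmetric] by (simp add: inner_add_left inner_add_right inner_commute)
  moreover have "\<bar>LINT x:tri tau. ?T x \<bullet> v tau x\<bar> \<le> sqrt ((L2norm (tri tau) ?T)^2 * (4 * C * l / \<sigma> ^ 4 * Y))"
   by (rule L2_CS_bound[OF T Lv[OF t fe hl] vb[OF t fe hl]])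
  moreover have "(L2norm (tri tau) ?T)^2 \<le> (1 / sqrt kmin)^2 * Rf tau" unfolding Rf_def proof (rule L2norm_sq_mono[OF S])
   show "AE x in lebesgue. x \<in> tri tau --> norm (?T x) \<le> 1 / sqrt kmin * norm (?S x)" using AE_K[OF t] proof eventually_elim
    case (elim x)
    show ?case proof
     assume "x \<in> tri tau"
     then have kx: "kmin \<le> kappa x" "0 < kappa x" and m: "!!v. matrix_inv (mat_sqrt (Kb P x)) *v v = (1 / sqrt (kappa x)) *R v"
      "!!v. mat_sqrt (Kb P x) *v v = sqrt (kappa x) *R v" "!!v. matrix_inv (Kb P x) *v v = (1 / kappa x) *R v" using elim kmin by auto
     have "?T x = (1 / sqrt (kappa x)) *R ?S x" unfolding m scaleR_add_right scaleR_scaleR using kx by (simp add: real_sqrt_mult_self)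
     moreover have "1 / sqrt (kappa x) \<le> 1 / sqrt kmin" using kx kmin by (simp add: frac_le)
     ultimately show "norm (?T x) \<le> 1 / sqrt kmin * norm (?S x)" using kx by (simp only: norm_scaleR) (intro mult_right_mono, auto)
    qed
   qed
  qed
  then have "(L2norm (tri tau) ?T)^2 * (4 * C * l / \<sigma> ^ 4 * Y) \<le> Rf tau / kmin * (4 * C * l / \<sigma> ^ 4 * Y)"
   using kmin C0 l Y0 \<sigma>_pos by (intro mult_right_mono) (auto simp: power_divide)
  ultimately show ?thesis by (smt (verit) real_sqrt_le_mono mult.assoc)
 qed
 have fe: "fst e \<in> tri ?L" "fst e \<in> tri ?R"
  using subsetD[OF closed_segment_tri[OF D(2,3)], of "fst e"] subsetD[OF closed_segment_tri[OF D(5,6)], of "fst e"] by simp_all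
 have "Y \<le> 4 * (Rf ?L / kmin * (4 * C * l / \<sigma> ^ 4) + Rf ?R / kmin * (4 * C * l / \<sigma> ^ 4) + 0 + 0)" proof (rule sqrt_absorb)
  have hR: "\<sigma> * diameter (tri ?R) \<le> l" using elen_ge[OF D(5,6)] by (simp add: l_def)
  show "Y \<le> sqrt (Rf ?L / kmin * (4 * C * l / \<sigma> ^ 4) * Y) + sqrt (Rf ?R / kmin * (4 * C * l / \<sigma> ^ 4) * Y) + sqrt (0 * Y) + sqrt (0 * Y)"
   using Yb Ib[OF D(2) fe(1) elen_ge[OF D(2,3), folded l_def]] Ib[OF D(5) fe(2) hR] by simp
 qed (use Y0 C0 kmin l \<sigma>_pos in auto)
 then have "1 / l * Y \<le> 1 / l * (4 * (Rf ?L / kmin * (4 * C * l / \<sigma> ^ 4) + Rf ?R / kmin * (4 * C * l / \<sigma> ^ 4) + 0 + 0))"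
  using l by (intro mult_left_mono) auto
 also have "... = c3 C * (Rf ?L + Rf ?R)" using l kmin \<sigma>_pos by (simp add: c3_def field_simps)
 finally show ?thesis by (simp add: Y_def l_def)
qed

end

section \<open>Residuals on the fracture\<close>

lemma FTC_open_interval: assumes "s \<le> t" "C1 F dF" shows "(LINT x:{s<..<t}. dF x :: real) = F t - F s" proof -
 have c: "continuous_on UNIV dF" by (rule C1_continuous_grad[OF assms(2)])
 have d: "(F has_real_derivative dF x) (at x)" for x using assms(2) unfolding C1_real_iff by blast
 have "(LINT x:{s<..<t}. dF x) = (LINT x:{s..t}. dF x)" proof (rule set_integral_lebesgue_cong_set_AE)
  have "AE x in lebesgue. x \<notin> {s, t}" by (intro AE_not_in null_sets_completionI finite_imp_null_set_lborel) auto
  then show "AE x in lebesgue. x \<in> {s<..<t} \<longleftrightarrow> x \<in> {s..t}" by (rule eventually_mono) auto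
 qed
 also have "... = (LINT x|lborel. indicator {s..t} x *R dF x)" unfolding set_lebesgue_integral_def
  using borel_measurable_scaleR[OF borel_measurable_indicator borel_measurable_continuous_onI[OF c], of "{s..t}"] by (intro integral_completion) simp
 also have "... = F t - F s" using integral_FTC_Icc_real[OF assms(1), of F dF] d c by (simp add: mult.commute continuous_on_eq_continuous_at)
 finally show ?thesis .
qed

lemma degree_shift: "degree (pcompose r [:s, 1:]) = degree (r :: real poly)" by (simp add: degree_pcompose)

context discrete
begin

abbreviation ej :: "real => real" where
 "ej x \<equiv> (un1 x - side1 P M uh x \<bullet> nG P x) - (un2 x - side2 P M uh x \<bullet> nG P x)"

abbreviation ev :: "real => real" where
 "ev x \<equiv> ((un1 x - side1 P M uh x \<bullet> nG P x) + (un2 x - side2 P M uh x \<bullet> nG P x)) / 2"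

lemma FG_sub_Gam: "(s, t) \<in> FG P M ==> {s<..<t} <= Gam P" using FG_D[of s t] by (auto simp: Gam_def)

lemma FG_sum_L2: assumes "!!s t. (s, t) \<in> FG P M ==> L2 {s<..<t} g"
 shows "(\<Sum>(s, t)\<in>FG P M. (L2norm {s<..<t} g)^2) = (L2norm (Gam P) (g :: real => real))^2" proof -
 have "(LINT x:Gam P. (norm (g x))^2) = (\<Sum>i\<in>FG P M. LINT x:{fst i<..<snd i}. (norm (g x))^2)"
  by (rule conjunct2[OF set_integral_sum_partition[OF finite_FG _ AE_Gam_FG]])
   (use assms in \<open>auto simp: L2_def\<close>)
 then show ?thesis by (simp add: L2norm_sq_eq case_prod_unfold)
qed

lemma FG_coeffs: assumes st: "(s, t) \<in> FG P M"
 obtains el ec where "!!x. x \<in> {s<..<t} ==> ell P x = el" "!!x. x \<in> {s<..<t} ==> etaG P x = ec"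
  "!!x. x \<in> {s<..<t} ==> KG P x = kG" "emin \<le> ec" proof -
 obtain a b c where k: "!!x. x \<in> {s<..<t} ==> kapt P x = a" "!!x. x \<in> {s<..<t} ==> kapn P x = b" "!!x. x \<in> {s<..<t} ==> ell P x = c"
  using FG_const[OF st] unfolding constant_on_def by auto
 have "AE x in lebesgue. x \<in> {s<..<t} --> KG P x = kG & emin \<le> etaG P x" using KG_eq eta_bd by eventually_elim (use FG_sub_Gam[OF st] in auto)
 then have "\<exists>y\<in>{s<..<t}. KG P y = kG & emin \<le> etaG P y"
  by (rule nonempty_open_AE_ex[of "{s<..<t}" "(s + t) / 2", rotated 2]) (use FG_D(2)[OF st] in auto)
 then obtain y where y: "y \<in> {s<..<t}" "KG P y = kG & emin \<le> etaG P y" by blast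
 show thesis proof (rule that[of c "c / b"])
  fix x assume x: "x \<in> {s<..<t}"
  show "ell P x = c" "etaG P x = c / b" using k x by (simp_all add: etaG_def)
  show "KG P x = kG" using y k x by (simp add: KG_def)
 next
  show "emin \<le> c / b" using y k by (simp add: etaG_def)
 qed
qed

lemma pGh_poly: assumes st: "(s, t) \<in> FG P M"
 obtains r where "degree r \<le> k" "!!x. x \<in> {s..t} ==> pGh x = poly r x"
  "!!x. x \<in> {s<..<t} ==> deriv pGh x = poly (pderiv r) x"
  "!!x. x \<in> {s<..<t} ==> deriv (%y. KG P y * deriv pGh y) x = kG * poly (pderiv (pderiv r)) x" proof -
 obtain r where r: "degree r \<le> k" "!!x. x \<in> {s..t} ==> pGh x = poly r x" using pGh_Wh st unfolding Wh_def by auto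
 have d: "deriv pGh x = poly (pderiv r) x" if "x \<in> {s<..<t}" for x
 proof (rule DERIV_imp_deriv, rule has_field_derivative_transform_within_open[OF poly_DERIV[of r]])
  show "x \<in> {s<..<t}" by (rule that)
  show "!!y. y \<in> {s<..<t} ==> poly r y = pGh y" using r(2) by auto
 qed auto
 have c: "KG P x = kG" if "x \<in> {s<..<t}" for x by (rule FG_coeffs[OF st]) (use that in blast)
 show thesis proof (rule that[OF r d])
  fix x assume x: "x \<in> {s<..<t}"
  show "deriv (%y. KG P y * deriv pGh y) x = kG * poly (pderiv (pderiv r)) x"
  proof (rule DERIV_imp_deriv, rule has_field_derivative_transform_within_open[OF DERIV_cmult[OF poly_DERIV[of "pderiv r"]]])
   show "x \<in> {s<..<t}" by (rule x)
   show "!!y. y \<in> {s<..<t} ==> kG * poly (pderiv r) y = KG P y * deriv pGh y" using c d by auto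
  qed auto
 qed auto
qed

lemma side_poly: assumes st: "(s, t) \<in> FG P M"
 shows "\<exists>r. degree r \<le> k & (\<forall>x\<in>{s<..<t}. side1 P M uh x \<bullet> nG P x = poly r (x - s))"
  "\<exists>r. degree r \<le> k & (\<forall>x\<in>{s<..<t}. side2 P M uh x \<bullet> nG P x = poly r (x - s))"
  "\<exists>r. degree r \<le> k & (\<forall>x\<in>{s<..<t}. side1 P M ph x = poly r (x - s))"
  "\<exists>r. degree r \<le> k & (\<forall>x\<in>{s<..<t}. side2 P M ph x = poly r (x - s))" proof -
 let ?e = "gedge (s, t)"
 have l: "0 < elen ?e" using elen_gedge[OF st] FG_D(2)[OF st] by simp
 note T = pedge_tri(1)[OF gedge_swap_pedges(1)[OF st]] pedge_tri(1)[OF gedge_swap_pedges(2)[OF st], folded Rgt_def]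
 have main: "\<exists>r. degree r \<le> k & (\<forall>x\<in>{s<..<t}. q (gam P x) = poly r (x - s))" if q: "poly2 k q" for q proof -
  obtain r where r: "degree r \<le> k" "!!y. q (fst ?e + y *R tang ?e) = poly r y"
   using poly2_line[OF q, where p = "fst ?e" and t = "tang ?e"] by blast
  have "q (gam P x) = poly r (x - s)" if "x \<in> {s<..<t}" for x using r(2)[of "x - s"] gam_FG[OF st, of x] that by (simp add: tang_def)
  then show ?thesis using r(1) by blast
 qed
 show "\<exists>r. degree r \<le> k & (\<forall>x\<in>{s<..<t}. side1 P M uh x \<bullet> nG P x = poly r (x - s))"
  using main[OF poly2_inner[OF uh_poly[OF T(1)]], of "nrm ?e"] by (simp add: side_FG[OF st] nG_FG[OF st])
 show "\<exists>r. degree r \<le> k & (\<forall>x\<in>{s<..<t}. side2 P M uh x \<bullet> nG P x = poly r (x - s))"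
  using main[OF poly2_inner[OF uh_poly[OF T(2)]], of "nrm ?e"] by (simp add: side_FG[OF st] nG_FG[OF st])
 show "\<exists>r. degree r \<le> k & (\<forall>x\<in>{s<..<t}. side1 P M ph x = poly r (x - s))"
  using main[OF ph_poly[OF T(1)]] by (simp add: side_FG[OF st])
 show "\<exists>r. degree r \<le> k & (\<forall>x\<in>{s<..<t}. side2 P M ph x = poly r (x - s))"
  using main[OF ph_poly[OF T(2)]] by (simp add: side_FG[OF st])
qed

lemma L2_interval_poly: "(!!x. x \<in> {s<..<t} ==> g x = poly r (x - c)) ==> L2 {s<..<t::real} (g :: real => real)"
 by (rule L2_cong_AE[of _ "%x. poly r (x - c)"])
  (auto intro!: L2_continuous_bounded continuous_intros AE_I2)

lemma L2_FG_Gam: "(s, t) \<in> FG P M ==> L2 (Gam P) g ==> L2 {s<..<t} (g :: real => real)" by (rule L2_subset[OF _ FG_sub_Gam]) auto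

lemma L2_FG: assumes st: "(s, t) \<in> FG P M"
 shows "L2 {s<..<t} (%x. side1 P M uh x \<bullet> nG P x)" "L2 {s<..<t} (%x. side2 P M uh x \<bullet> nG P x)"
  "L2 {s<..<t} (side1 P M ph)" "L2 {s<..<t} (side2 P M ph)" "L2 {s<..<t} pGh" "L2 {s<..<t} (deriv pGh)"
  "L2 {s<..<t} (deriv (%y. KG P y * deriv pGh y))" "L2 {s<..<t} (%x. ell P x * fG x)"
  "L2 {s<..<t} p1" "L2 {s<..<t} p2" "L2 {s<..<t} pG" "L2 {s<..<t} dpG" "L2 {s<..<t} un1" "L2 {s<..<t} un2" proof -
 show "L2 {s<..<t} (%x. side1 P M uh x \<bullet> nG P x)" "L2 {s<..<t} (%x. side2 P M uh x \<bullet> nG P x)"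
  "L2 {s<..<t} (side1 P M ph)" "L2 {s<..<t} (side2 P M ph)" using side_poly[OF st] by (auto intro: L2_interval_poly)
 show "L2 {s<..<t} p1" "L2 {s<..<t} p2" "L2 {s<..<t} pG" "L2 {s<..<t} dpG" "L2 {s<..<t} un1" "L2 {s<..<t} un2" using trace_L2 L2_FG_Gam[OF st] by auto
 obtain r where "degree r \<le> k" and r: "!!x. x \<in> {s..t} ==> pGh x = poly r x"
  "!!x. x \<in> {s<..<t} ==> deriv pGh x = poly (pderiv r) x"
  "!!x. x \<in> {s<..<t} ==> deriv (%y. KG P y * deriv pGh y) x = kG * poly (pderiv (pderiv r)) x" using pGh_poly[OF st] by blast
 show "L2 {s<..<t} pGh" by (rule L2_interval_poly[where r = r and c = 0]) (use r in auto)
 show "L2 {s<..<t} (deriv pGh)" by (rule L2_interval_poly[where r = "pderiv r" and c = 0]) (use r in auto)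
 show "L2 {s<..<t} (deriv (%y. KG P y * deriv pGh y))" by (rule L2_interval_poly[where r = "smult kG (pderiv (pderiv r))" and c = 0]) (use r in auto)
 obtain el ec where c: "!!x. x \<in> {s<..<t} ==> ell P x = el" "!!x. x \<in> {s<..<t} ==> etaG P x = ec"
  "!!x. x \<in> {s<..<t} ==> KG P x = kG" "emin \<le> ec" using FG_coeffs[OF st] by blast
 show "L2 {s<..<t} (%x. ell P x * fG x)" by (rule L2_cong_AE[OF L2_scale[OF L2_FG_Gam[OF st fG_L2], of el]]) (auto simp: c intro!: AE_I2)
qed

text \<open>Squared errors and residuals on a fracture edge.\<close>

definition Ep :: "real \<times> real => real" where
 "Ep i = (L2norm {fst i<..<snd i} (%x. dpG x - deriv pGh x))^2"
definition Ej :: "real \<times> real => real" where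
 "Ej i = (L2norm {fst i<..<snd i} (%x. ej x))^2"
definition Ev :: "real \<times> real => real" where
 "Ev i = (L2norm {fst i<..<snd i} (%x. ev x))^2"
definition Ea :: "real \<times> real => real" where
 "Ea i = (L2norm {fst i<..<snd i} (%x. (((p1 x - side1 P M ph x) + (p2 x - side2 P M ph x)) / 2 - (pG x - pGh x)) / sqrt (alphaG P x)))^2"
definition Eb :: "real \<times> real => real" where
 "Eb i = (L2norm {fst i<..<snd i} (%x. ((p1 x - side1 P M ph x) - (p2 x - side2 P M ph x)) / sqrt (etaG P x)))^2"
definition Og :: "real \<times> real => real" where
 "Og i = (L2norm {fst i<..<snd i} (%x. ell P x * (fGh x - fG x)))^2"
definition res :: "real => real" where
 "res x = ell P x * fG x + deriv (%y. KG P y * deriv pGh y) x + njumpG P M uh x"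
definition Fg :: "real \<times> real => real" where "Fg i = (L2norm {fst i<..<snd i} res)^2"

lemma nonneg_FG [simp]: "0 \<le> Ep i" "0 \<le> Ej i" "0 \<le> Ev i" "0 \<le> Ea i" "0 \<le> Eb i" "0 \<le> Og i" "0 \<le> Fg i"
 by (simp_all add: Ep_def Ej_def Ev_def Ea_def Eb_def Og_def Fg_def)

lemma res_L2: assumes st: "(s, t) \<in> FG P M" shows "L2 {s<..<t} res" unfolding res_def njumpG_def by (intro L2_add L2_diff L2_FG[OF st])

lemma err_L2: assumes st: "(s, t) \<in> FG P M" shows "L2 {s<..<t} (%x. dpG x - deriv pGh x)"
  "L2 {s<..<t} (%x. ej x)"
  "L2 {s<..<t} (%x. ev x)" proof -
 show "L2 {s<..<t} (%x. dpG x - deriv pGh x)"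
  "L2 {s<..<t} (%x. ej x)" by (intro L2_diff L2_FG[OF st])+
 have "L2 {s<..<t} (%x. (1/2) *R ((un1 x - side1 P M uh x \<bullet> nG P x) + (un2 x - side2 P M uh x \<bullet> nG P x)))"
  by (intro L2_scale L2_add L2_diff L2_FG[OF st])
 then show "L2 {s<..<t} (%x. ev x)" by simp
qed

text \<open>The terms that the tangential equation combines are kept apart, because that equation holds only
  after summation over the edges that meet the support.\<close>

lemma residual_by_parts: assumes st: "(s, t) \<in> FG P M" and psi: "C1 psi dpsi" and r: "!!x. x \<in> {s<..<t} ==> deriv pGh x = poly (pderiv r) x"
   "!!x. x \<in> {s<..<t} ==> deriv (%y. KG P y * deriv pGh y) x = kG * poly (pderiv (pderiv r)) x"
 shows "(LINT x:{s<..<t}. res x * psi x) = (LINT x:{s<..<t}. ell P x * fG x * psi x)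
   + (LINT x:{s<..<t}. (un1 x - un2 x) * psi x) - kG * (LINT x:{s<..<t}. dpG x * dpsi x)
   + kG * (LINT x:{s<..<t}. (dpG x - deriv pGh x) * dpsi x)
   - (LINT x:{s<..<t}. ej x * psi x)
   + kG * (poly (pderiv r) t * psi t - poly (pderiv r) s * psi s)" proof -
 note c = C1_continuous[OF psi] C1_continuous_grad[OF psi]
 have Lpsi: "L2 {s<..<t} psi" "L2 {s<..<t} dpsi" using c by (auto intro!: L2_continuous_bounded)
 have pc: "C1 (poly (pderiv r)) (poly (pderiv (pderiv r)))" unfolding C1_real_iff by (auto intro!: poly_DERIV continuous_intros)
 have 1: "(LINT x:{s<..<t}. poly (pderiv r) x * dpsi x + psi x * poly (pderiv (pderiv r)) x)
   = poly (pderiv r) t * psi t - poly (pderiv r) s * psi s" using FTC_open_interval[OF _ C1_mult[OF pc psi], of s t] FG_D(2)[OF st] by simp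
 have 2: "(LINT x:{s<..<t}. poly (pderiv r) x * dpsi x + psi x * poly (pderiv (pderiv r)) x)
   = (LINT x:{s<..<t}. deriv pGh x * dpsi x) + (LINT x:{s<..<t}. psi x * poly (pderiv (pderiv r)) x)" proof -
  have "(LINT x:{s<..<t}. poly (pderiv r) x * dpsi x + psi x * poly (pderiv (pderiv r)) x)
   = (LINT x:{s<..<t}. deriv pGh x * dpsi x + psi x * poly (pderiv (pderiv r)) x)" by (rule set_integral_cong') (simp add: r)
  then show ?thesis by (subst (asm) set_integral_add(2))
    (auto intro!: L2_mult_integrable L2_FG[OF st] Lpsi L2_continuous_bounded continuous_intros)
 qed
 have 3: "(LINT x:{s<..<t}. deriv (%y. KG P y * deriv pGh y) x * psi x)
   = kG * (LINT x:{s<..<t}. psi x * poly (pderiv (pderiv r)) x)"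
  unfolding set_integral_mult_right[symmetric] by (rule set_integral_cong') (simp add: r)
 have 4: "(LINT x:{s<..<t}. res x * psi x) = (LINT x:{s<..<t}. ell P x * fG x * psi x)
   + (LINT x:{s<..<t}. deriv (%y. KG P y * deriv pGh y) x * psi x) + (LINT x:{s<..<t}. njumpG P M uh x * psi x)"
  unfolding res_def distrib_right njumpG_def
  by (subst set_integral_add(2), (intro set_integral_add(1) L2_mult_integrable L2_FG[OF st] Lpsi L2_diff)+)+ simp
 have 5: "(LINT x:{s<..<t}. (dpG x - deriv pGh x) * dpsi x)
   = (LINT x:{s<..<t}. dpG x * dpsi x) - (LINT x:{s<..<t}. deriv pGh x * dpsi x)"
  unfolding left_diff_distrib by (intro set_integral_diff(2) L2_mult_integrable L2_FG[OF st] Lpsi)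
 have 6: "(LINT x:{s<..<t}. ej x * psi x)
   = (LINT x:{s<..<t}. (un1 x - un2 x) * psi x) - (LINT x:{s<..<t}. njumpG P M uh x * psi x)" proof -
  have "(LINT x:{s<..<t}. (un1 x - un2 x) * psi x - njumpG P M uh x * psi x)
   = (LINT x:{s<..<t}. (un1 x - un2 x) * psi x) - (LINT x:{s<..<t}. njumpG P M uh x * psi x)"
   unfolding njumpG_def by (intro set_integral_diff(2) L2_mult_integrable L2_diff L2_FG[OF st] Lpsi)
  then show ?thesis by (simp add: njumpG_def algebra_simps)
 qed
 have E: "(LINT x:{s<..<t}. psi x * poly (pderiv (pderiv r)) x)
  = (poly (pderiv r) t * psi t - poly (pderiv r) s * psi s) - (LINT x:{s<..<t}. deriv pGh x * dpsi x)" using 1 2 by linarith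
 show ?thesis unfolding 4 3 E 5 6 by (simp only: right_diff_distrib)
qed

definition c5 :: "real => real" where "c5 C = 2 + 32 * C * C * (kG^2 * (2 + 512 / \<sigma>^2) + (len P)^2 + 1)"

text \<open>Tested with the polynomial part of the residual times a bump inside the edge.\<close>

lemma fracture_residual: assumes st: "(s, t) \<in> FG P M" and C: "inverse_const1 (max k m) wgt (2 / \<sigma>) C"
 shows "(t - s)^2 * Fg (s, t) \<le> c5 C * (Ep (s, t) + Ej (s, t) + (t - s)^2 * Og (s, t))" proof -
 define l where "l = t - s"
 note F = FG_D[OF st]
 have l: "0 < l" "l \<le> len P" using F by (simp_all add: l_def)
 have \<sigma>1: "\<sigma> \<le> 1" by (rule \<sigma>_le_1[OF pedge_tri(1)[OF F(4)]])
 have C0: "0 < C" using C by (simp add: inverse_const1_def)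
 obtain rp where rp1: "degree rp \<le> k" "!!x. x \<in> {s..t} ==> pGh x = poly rp x"
  and rp: "!!x. x \<in> {s<..<t} ==> deriv pGh x = poly (pderiv rp) x"
   "!!x. x \<in> {s<..<t} ==> deriv (%y. KG P y * deriv pGh y) x = kG * poly (pderiv (pderiv rp)) x" using pGh_poly[OF st] by blast
 obtain r1 r2 where r12: "degree r1 \<le> k" "degree r2 \<le> k"
  "!!x. x \<in> {s<..<t} ==> side1 P M uh x \<bullet> nG P x = poly r1 (x - s)"
  "!!x. x \<in> {s<..<t} ==> side2 P M uh x \<bullet> nG P x = poly r2 (x - s)" using side_poly(1,2)[OF st] by auto
 obtain rf where rf: "degree rf \<le> m" "!!x. x \<in> {s<..<t} ==> fGh x = poly rf x" using fGh st unfolding pw_polyG_def by auto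
 obtain el ec where el: "!!x. x \<in> {s<..<t} ==> ell P x = el" "!!x. x \<in> {s<..<t} ==> etaG P x = ec"
  "!!x. x \<in> {s<..<t} ==> KG P x = kG" "emin \<le> ec" using FG_coeffs[OF st] by blast
 define r where "r = smult el (pcompose rf [:s, 1:]) + smult kG (pcompose (pderiv (pderiv rp)) [:s, 1:]) + (r1 - r2)"
 have dr: "degree r \<le> max k m" unfolding r_def using rp1(1) rf(1) r12(1,2) degree_shift[of rf s] degree_shift[of "pderiv (pderiv rp)" s]
  by (intro degree_add_le degree_diff_le order_trans[OF degree_smult_le]) (auto simp: degree_pderiv)
 have rr: "ell P x * (fGh x - fG x) + res x = poly r (x - s)" if "x \<in> {s<..<t}" for x
  using that by (simp add: res_def njumpG_def el rf r12 rp r_def poly_pcompose algebra_simps)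
 define c where "c = (s + t) / 2"
 \<comment> \<open>The support keeps away from the end points, which may be those of the fracture.\<close>
 define R where "R = \<sigma> * l / 4"
 have R: "0 < R" "R \<le> l / 4" using l \<sigma>_pos \<sigma>1 by (simp_all add: R_def)
 have bw: "bump c R x = wgt ((x - s) / l)" for x proof -
  have "x - c = ((x - s) / l - 1/2) * l" using l by (simp add: c_def l_def field_simps)
  then have "((x - c) \<bullet> (x - c)) / R^2 = (((x - s) / l - 1/2) \<bullet> ((x - s) / l - 1/2)) / (\<sigma> / 4)^2"
   using l by (simp add: R_def power2_eq_square)
  then show ?thesis by (simp only: bump_def wgt_def)
 qed
 define psi where "psi = (%x. bump c R x * poly r (x - s))"
 define dpsi where "dpsi = (%x. bump c R x *R poly (pderiv r) (x - s) + poly r (x - s) *R dbump c R x)"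
 have pc: "C1 (%x. poly r (x - s)) (%x. poly (pderiv r) (x - s))" proof -
  have "((%x. poly r (x - s)) has_real_derivative poly (pderiv r) (x - s) * 1) (at x)" for x
   by (rule DERIV_chain2[OF poly_DERIV]) (auto intro!: derivative_eq_intros)
  then show ?thesis unfolding C1_real_iff by (auto intro!: continuous_intros)
 qed
 note bt = bump_test[OF psi_def dpsi_def pc R(1)]
 note psi = bt(1) and supp = bt(2) and psi0' = bt(4,5)
 have cb: "cball c R <= {s<..<t}" using R l by (auto simp: c_def l_def dist_real_def abs_le_iff field_simps)
 define X where "X = (LINT x:{s<..<t}. poly r (x - s) * psi x)"
 have X: "X = (LINT y:{0<..<l}. wgt (y / l) * (poly r y)^2)" proof -
  have "X = (LINT y:{0<..<t - s}. poly r (s + y - s) * psi (s + y))" unfolding X_def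
   by (rule set_integral_shift_real) (intro continuous_on_mult continuous_intros C1_continuous[OF psi])
  then show ?thesis by (simp add: psi_def bw l_def power2_eq_square mult_ac)
 qed
 have X0: "0 \<le> X" unfolding X set_lebesgue_integral_def wgt_def
  by (intro integral_nonneg_AE AE_I2) (auto simp: bump_nonneg intro!: mult_nonneg_nonneg)
 define K where "K = 2 + 512 / \<sigma>^2"
 have K: "0 < K" using \<sigma>_pos by (simp add: K_def add_pos_nonneg)
 have xb: "\<bar>x - s\<bar> \<le> 2 / \<sigma> * l" if "x \<in> {s<..<t}" for x proof -
  have "\<bar>x - s\<bar> \<le> l" using that by (simp add: l_def)
  also have "l \<le> 2 / \<sigma> * l" using \<sigma>1 \<sigma>_pos l by (simp add: field_simps)
  finally show ?thesis .
 qed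
 have b1: "(poly r (x - s))^2 \<le> C / l * X" if "x \<in> {s<..<t}" for x by (rule inverse_const1_mono(1)[OF C dr l(1) xb[OF that]]) (simp add: X)
 have b2: "(norm (poly (pderiv r) (x - s)))^2 \<le> C / l ^ 3 * X" if "x \<in> {s<..<t}" for x
  using inverse_const1_mono(2)[OF C dr l(1) xb[OF that], of X] by (simp add: X)
 have ml: "measure lebesgue {s<..<t} = l" "{s<..<t} \<in> lmeasurable" using l by (simp_all add: l_def)
 have loc: "(L2norm {s<..<t} G)^2 \<le> S * l" if "0 \<le> S" "!!x. x \<in> {s<..<t} ==> (norm (G x))^2 \<le> S" for G :: "real => real" and S
  using L2norm_sq_le_measure[OF ml(2), of G "sqrt S"] that by (simp add: ml real_le_rsqrt)
 have "measure lebesgue (cball c R) \<le> l" using R l by (simp add: cball_eq_atLeastAtMost)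
 note bb = bump_test_bounds[OF psi_def dpsi_def pc R(1) _ this b1[OF subsetD[OF cb]] b2[OF subsetD[OF cb]], of "{s<..<t}"]
 have mpsi: "(L2norm {s<..<t} psi)^2 \<le> C * X" using bb(1) l by simp
 have "(2 * (C / l ^ 3 * X) + 32 / R^2 * (C / l * X)) * l = K * C / l^2 * X"
  using l \<sigma>_pos by (simp add: K_def R_def field_simps power3_eq_cube power2_eq_square)
 then have md: "(L2norm {s<..<t} dpsi)^2 \<le> K * C / l^2 * X" using bb(2) by simp
 note cont = C1_continuous[OF psi] C1_continuous_grad[OF psi]
 have Lpsi: "L2 {s<..<t} psi" "L2 {s<..<t} dpsi" using cont by (auto intro!: L2_continuous_bounded)
 have glob: "(LINT x:Gam P. G x) = (LINT x:{s<..<t}. G x)" if "!!x. x \<notin> cball c R ==> G x = 0" for G :: "real => real"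
  by (rule set_integral_supp[of "cball c R"]) (use cb FG_sub_Gam[OF st] that in auto)
 have "supp psi <= Gam P" using supp cb FG_sub_Gam[OF st] by blast
 then have "kG * (LINT x:{s<..<t}. dpG x * dpsi x) - (LINT x:{s<..<t}. (un1 x - un2 x) * psi x)
   = (LINT x:{s<..<t}. ell P x * fG x * psi x)"
  using weak_tangential[OF psi bt(3)] glob[of "%x. dpG x * dpsi x"] glob[of "%x. (un1 x - un2 x) * psi x"] glob[of "%x. ell P x * fG x * psi x"]
  by (simp add: psi0')
 moreover have "psi t = 0" "psi s = 0" by (rule psi0'(1), rule notI, drule subsetD[OF cb], simp)+
 ultimately have bp: "(LINT x:{s<..<t}. res x * psi x) = kG * (LINT x:{s<..<t}. (dpG x - deriv pGh x) * dpsi x)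
   - (LINT x:{s<..<t}. ej x * psi x)" using residual_by_parts[OF st psi rp] by simp
 have LO: "L2 {s<..<t} (%x. ell P x * (fGh x - fG x))" proof (rule L2_cong_AE)
  have "L2 {s<..<t} fGh" by (rule L2_interval_poly[where r = rf and c = 0]) (simp add: rf)
  then show "L2 {s<..<t} (%x. el *R (fGh x - fG x))" by (intro L2_scale L2_diff L2_FG_Gam[OF st fG_L2])
  show "AE x in lebesgue. x \<in> {s<..<t} --> el *R (fGh x - fG x) = ell P x * (fGh x - fG x)" by (auto simp: el intro!: AE_I2)
 qed
 have "X = (LINT x:{s<..<t}. ell P x * (fGh x - fG x) * psi x + res x * psi x)" unfolding X_def
  by (rule set_integral_cong') (simp add: rr[symmetric] distrib_right)
 also have "... = (LINT x:{s<..<t}. ell P x * (fGh x - fG x) * psi x) + (LINT x:{s<..<t}. res x * psi x)"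
  by (intro set_integral_add(2) L2_mult_integrable LO Lpsi res_L2[OF st])
 finally have X_eq: "X = (LINT x:{s<..<t}. ell P x * (fGh x - fG x) * psi x) + kG * (LINT x:{s<..<t}. (dpG x - deriv pGh x) * dpsi x)
   - (LINT x:{s<..<t}. ej x * psi x)" using bp by simp
 have i1: "\<bar>LINT x:{s<..<t}. ell P x * (fGh x - fG x) * psi x\<bar> \<le> sqrt (Og (s, t) * C * X)"
  using L2_CS_bound[OF LO Lpsi(1) mpsi] by (simp add: Og_def inner_real_def mult.assoc)
 have i2: "\<bar>kG * (LINT x:{s<..<t}. (dpG x - deriv pGh x) * dpsi x)\<bar> \<le> sqrt (Ep (s, t) * (kG^2 * (K * C / l^2)) * X)" proof -
  have "\<bar>LINT x:{s<..<t}. (dpG x - deriv pGh x) * dpsi x\<bar> \<le> sqrt (Ep (s, t) * (K * C / l^2 * X))"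
   using L2_CS_bound[OF err_L2(1)[OF st] Lpsi(2) md] by (simp add: Ep_def inner_real_def)
  then have "\<bar>kG * (LINT x:{s<..<t}. (dpG x - deriv pGh x) * dpsi x)\<bar> \<le> kG * sqrt (Ep (s, t) * (K * C / l^2 * X))"
   using kG by (simp add: abs_mult)
  also have "kG * sqrt Z = sqrt (kG^2 * Z)" for Z using kG by (simp add: real_sqrt_mult)
  finally show ?thesis by (simp add: mult_ac)
 qed
 have i3: "\<bar>LINT x:{s<..<t}. ej x * psi x\<bar> \<le> sqrt (Ej (s, t) * C * X)"
  using L2_CS_bound[OF err_L2(2)[OF st] Lpsi(1) mpsi] by (simp add: Ej_def inner_real_def mult.assoc)
 have Xb: "X \<le> 4 * (Og (s, t) * C + Ep (s, t) * (kG^2 * (K * C / l^2)) + Ej (s, t) * C + 0)" proof (rule sqrt_absorb)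
  show "X \<le> sqrt (Og (s, t) * C * X) + sqrt (Ep (s, t) * (kG^2 * (K * C / l^2)) * X) + sqrt (Ej (s, t) * C * X) + sqrt (0 * X)"
   using X_eq i1 i2 i3 by (simp only: mult_zero_left real_sqrt_zero)
 qed (use X0 C0 K l in auto)
 have rl: "(L2norm {s<..<t} (%x. poly r (x - s)))^2 \<le> C * X" using loc[of "C / l * X" "%x. poly r (x - s)"] b1 C0 l X0 by simp
 have "Fg (s, t) = (L2norm {s<..<t} (%x. poly r (x - s) - ell P x * (fGh x - fG x)))^2"
  unfolding Fg_def fst_conv snd_conv by (rule arg_cong[where f = "%z. z^2"], rule L2norm_cong_AE) (auto simp: rr[symmetric] intro!: AE_I2)
 also have "... \<le> 2 * (L2norm {s<..<t} (%x. poly r (x - s)))^2 + 2 * Og (s, t)" unfolding Og_def fst_conv snd_conv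
  by (intro L2norm_sq_diff_le LO L2_continuous_bounded continuous_intros) auto
 also have "... \<le> 2 * (C * X) + 2 * Og (s, t)" using rl by simp
 also have "... \<le> 2 * (C * (4 * (Og (s, t) * C + Ep (s, t) * (kG^2 * (K * C / l^2)) + Ej (s, t) * C + 0))) + 2 * Og (s, t)"
  using Xb C0 by (intro add_mono mult_left_mono) auto
 finally have "l^2 * Fg (s, t) \<le> l^2 * (2 * (C * (4 * (Og (s, t) * C + Ep (s, t) * (kG^2 * (K * C / l^2)) + Ej (s, t) * C + 0))) + 2 * Og (s, t))"
  by (rule mult_left_mono) simp
 also have "... = (2 + 8 * C * C) * (l^2 * Og (s, t)) + 8 * C * C * (kG^2 * K) * Ep (s, t) + 8 * C * C * (l^2 * Ej (s, t))"
  using l by (simp add: field_simps)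
 also have "... \<le> c5 C * (l^2 * Og (s, t)) + c5 C * Ep (s, t) + c5 C * Ej (s, t)" proof (intro add_mono mult_right_mono)
  have nn: "0 \<le> C * C * (kG^2 * K)" "0 \<le> C * C * (len P)^2" "0 \<le> C * C" using C0 K by simp_all
  have c5: "c5 C = 2 + 32 * (C * C * (kG^2 * K)) + 32 * (C * C * (len P)^2) + 32 * (C * C)"
   by (simp add: c5_def K_def[symmetric] distrib_left mult.assoc)
  show "2 + 8 * C * C \<le> c5 C" "8 * C * C * (kG^2 * K) \<le> c5 C" unfolding c5 using nn by linarith+
  have "l^2 * Ej (s, t) \<le> (len P)^2 * Ej (s, t)" using l by (intro mult_right_mono power_mono) auto
  then have "8 * C * C * (l^2 * Ej (s, t)) \<le> 8 * C * C * ((len P)^2 * Ej (s, t))" using C0 by (intro mult_left_mono) auto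
  also have "... = 8 * (C * C * (len P)^2) * Ej (s, t)" by simp
  also have "... \<le> c5 C * Ej (s, t)" unfolding c5 using nn by (intro mult_right_mono) (linarith, simp)
  finally show "8 * C * C * (l^2 * Ej (s, t)) \<le> c5 C * Ej (s, t)" .
 qed auto
 finally show ?thesis by (simp only: l_def distrib_left)
qed

end

section \<open>Flux jumps at fracture vertices and the coupling residuals\<close>

context discrete
begin

lemma hz_le: assumes "(r, z) \<in> FG P M" "(z, t) \<in> FG P M" shows "0 \<le> hz P M z" "hz P M z \<le> max (z - r) (t - z)" proof -
 have sub: "t' - s' \<in> {z - r, t - z}" if "(s', t') \<in> FG P M" "z = s' \<or> z = t'" for s' t' using that(2) proof
  assume z: "z = t'"
  define x where "x = (max s' r + z) / 2"
  have "s' < x" "x < t'" "r < x" "x < z" using FG_D(2)[OF that(1)] FG_D(2)[OF assms(1)] by (auto simp: x_def z)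
  then show ?thesis using FG_disjoint[OF that(1) assms(1)] z by auto
 next
  assume z: "z = s'"
  define x where "x = (min t' t + z) / 2"
  have "s' < x" "x < t'" "z < x" "x < t" using FG_D(2)[OF that(1)] FG_D(2)[OF assms(2)] by (auto simp: x_def z)
  then show ?thesis using FG_disjoint[OF that(1) assms(2)] z by auto
 qed
 let ?S = "{t - s | s t. (s, t) \<in> FG P M & (z = s \<or> z = t)}"
 have S: "?S <= {z - r, t - z}" using sub by blast
 have fin: "finite ?S" by (rule finite_subset[OF S]) simp
 have mem: "z - r \<in> ?S" using assms(1) by blast
 show "hz P M z \<le> max (z - r) (t - z)" unfolding hz_def proof (rule Max.boundedI[OF fin])
  show "?S ~= {}" using mem by blast
  fix x assume "x \<in> ?S"
  then have "x \<in> {z - r, t - z}" by (rule subsetD[OF S])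
  then show "x \<le> max (z - r) (t - z)" by auto
 qed
 have "z - r \<le> hz P M z" unfolding hz_def by (rule Max_ge[OF fin mem])
 then show "0 \<le> hz P M z" using FG_D(2)[OF assms(1)] by linarith
qed

definition c6 :: real where "c6 = 24 * max 1 kappav / kG * (2 + 32 * kG^2 + 2 * (len P)^2)"

text \<open>Tested with a bump around the vertex. The edges at the vertex have comparable lengths, so the bump
  is as wide as either of them.\<close>

lemma vertex_residual: assumes e1: "(r, z) \<in> FG P M" and e2: "(z, t) \<in> FG P M"
 shows "hz P M z * (Lim (at_left z) (%x. sqrt (KG P x) * deriv pGh x) - Lim (at_right z) (%x. sqrt (KG P x) * deriv pGh x))^2
  \<le> c6 * (((z - r)^2 * Fg (r, z) + Ep (r, z) + Ej (r, z)) + ((t - z)^2 * Fg (z, t) + Ep (z, t) + Ej (z, t)))" proof -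
 note F1 = FG_D[OF e1] and F2 = FG_D[OF e2]
 obtain q1 where q1: "degree q1 \<le> k" "!!x. x \<in> {r..z} ==> pGh x = poly q1 x"
  "!!x. x \<in> {r<..<z} ==> deriv pGh x = poly (pderiv q1) x"
  "!!x. x \<in> {r<..<z} ==> deriv (%y. KG P y * deriv pGh y) x = kG * poly (pderiv (pderiv q1)) x" using pGh_poly[OF e1] by blast
 obtain q2 where q2: "degree q2 \<le> k" "!!x. x \<in> {z..t} ==> pGh x = poly q2 x"
  "!!x. x \<in> {z<..<t} ==> deriv pGh x = poly (pderiv q2) x"
  "!!x. x \<in> {z<..<t} ==> deriv (%y. KG P y * deriv pGh y) x = kG * poly (pderiv (pderiv q2)) x" using pGh_poly[OF e2] by blast
 have KG1: "KG P x = kG" if "x \<in> {r<..<z}" for x using FG_coeffs[OF e1] that by metis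
 have KG2: "KG P x = kG" if "x \<in> {z<..<t}" for x using FG_coeffs[OF e2] that by metis
 have lim1: "Lim (at_left z) (%x. sqrt (KG P x) * deriv pGh x) = sqrt kG * poly (pderiv q1) z" proof (rule tendsto_Lim)
  have "((%x. sqrt kG * poly (pderiv q1) x) \<longlongrightarrow> sqrt kG * poly (pderiv q1) z) (at_left z)" by (intro tendsto_intros)
  moreover have "\<forall>\<^sub>F x in at_left z. sqrt kG * poly (pderiv q1) x = sqrt (KG P x) * deriv pGh x"
   unfolding eventually_at_left_field using F1(2) KG1 q1(3) by (intro exI[of _ r]) auto
  ultimately show "((%x. sqrt (KG P x) * deriv pGh x) \<longlongrightarrow> sqrt kG * poly (pderiv q1) z) (at_left z)"
   by (rule Lim_transform_eventually)
 qed simp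
 have lim2: "Lim (at_right z) (%x. sqrt (KG P x) * deriv pGh x) = sqrt kG * poly (pderiv q2) z" proof (rule tendsto_Lim)
  have "((%x. sqrt kG * poly (pderiv q2) x) \<longlongrightarrow> sqrt kG * poly (pderiv q2) z) (at_right z)" by (intro tendsto_intros)
  moreover have "\<forall>\<^sub>F x in at_right z. sqrt kG * poly (pderiv q2) x = sqrt (KG P x) * deriv pGh x"
   unfolding eventually_at_right_field using F2(2) KG2 q2(3) by (intro exI[of _ t]) auto
  ultimately show "((%x. sqrt (KG P x) * deriv pGh x) \<longlongrightarrow> sqrt kG * poly (pderiv q2) z) (at_right z)"
   by (rule Lim_transform_eventually)
 qed simp
 define J where "J = poly (pderiv q1) z - poly (pderiv q2) z"
 \<comment> \<open>The bump has to vanish at the far ends of both edges.\<close>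
 define a where "a = min (z - r) (t - z) / 2"
 have a: "0 < a" "a < z - r" "a < t - z" using F1(2) F2(2) by (auto simp: a_def)
 define psi where "psi = (%x. bump z a x * 1)"
 define dpsi where "dpsi = (%x. bump z a x *R 0 + 1 *R dbump z a x)"
 note bt = bump_test[OF psi_def dpsi_def C1_const a(1)]
 note psi = bt(1) and supp = bt(2) and psi0 = bt(4,5)
 have psiz: "psi z = 1" by (simp add: psi_def bump_def)
 have psirt: "psi r = 0" "psi t = 0" using psi0(1)[of r] psi0(1)[of t] a by (auto simp: dist_real_def)
 have cb: "cball z a <= {r<..<t}" using a by (auto simp: dist_real_def)
 have rt: "{r<..<t} <= Gam P" using F1 F2 by (auto simp: Gam_def)
 have split: "(LINT x:Gam P. G x) = (LINT x:{r<..<z}. G x) + (LINT x:{z<..<t}. G x)"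
  if "!!x. x \<notin> cball z a ==> G x = 0" "set_integrable lebesgue {r<..<z} G" "set_integrable lebesgue {z<..<t} G" for G :: "real => real" proof -
  have "(LINT x:Gam P. G x) = (LINT x:{r<..<t}. G x)" by (rule set_integral_supp[of "cball z a"]) (use cb rt that in auto)
  also have "... = (\<Sum>i\<in>{(r, z), (z, t)}. LINT x:{fst i<..<snd i}. G x)" proof (rule conjunct2[OF set_integral_sum_partition])
   have "AE x in lebesgue. x \<notin> {z}" by (intro AE_not_in null_sets_completionI finite_imp_null_set_lborel) auto
   then show "AE x in lebesgue. (\<Sum>i\<in>{(r, z), (z, t)}. indicator {fst i<..<snd i} x) = (indicator {r<..<t} x :: real)"
   proof (rule eventually_mono)
    fix x assume "x \<notin> {z}"
    then show "(\<Sum>i\<in>{(r, z), (z, t)}. indicator {fst i<..<snd i} x) = (indicator {r<..<t} x :: real)"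
     using F1(2) F2(2) by (cases "x < z") (auto simp: indicator_def)
   qed
  qed (use that in auto)
  also have "... = (LINT x:{r<..<z}. G x) + (LINT x:{z<..<t}. G x)" using F1(2) by simp
  finally show ?thesis .
 qed
 note cont = C1_continuous[OF psi] C1_continuous_grad[OF psi]
 have Lpsi: "L2 {x<..<y} psi" "L2 {x<..<y} dpsi" for x y using cont by (auto intro!: L2_continuous_bounded)
 have ints: "set_integrable lebesgue {x<..<y} (%x. dpG x * dpsi x)" "set_integrable lebesgue {x<..<y} (%x. (un1 x - un2 x) * psi x)"
  "set_integrable lebesgue {x<..<y} (%x. ell P x * fG x * psi x)" if "(x, y) \<in> FG P M" for x y
  by (intro L2_mult_integrable L2_diff L2_FG[OF that] Lpsi)+
 have "supp psi <= Gam P" using supp cb rt by blast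
 then have w: "kG * ((LINT x:{r<..<z}. dpG x * dpsi x) + (LINT x:{z<..<t}. dpG x * dpsi x))
   - ((LINT x:{r<..<z}. (un1 x - un2 x) * psi x) + (LINT x:{z<..<t}. (un1 x - un2 x) * psi x))
   = (LINT x:{r<..<z}. ell P x * fG x * psi x) + (LINT x:{z<..<t}. ell P x * fG x * psi x)"
  using weak_tangential[OF psi bt(3)] split[OF _ ints(1)[OF e1] ints(1)[OF e2]] split[OF _ ints(2)[OF e1] ints(2)[OF e2]]
   split[OF _ ints(3)[OF e1] ints(3)[OF e2]] by (simp add: psi0)
 let ?E = "%x. ej x"
 define A where "A i = (LINT x:{fst i<..<snd i}. res x * psi x)" for i
 define B where "B i = (LINT x:{fst i<..<snd i}. (dpG x - deriv pGh x) * dpsi x)" for i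
 define D where "D i = (LINT x:{fst i<..<snd i}. ?E x * psi x)" for i
 have w': "kG * (LINT x:{r<..<z}. dpG x * dpsi x) + kG * (LINT x:{z<..<t}. dpG x * dpsi x)
   - ((LINT x:{r<..<z}. (un1 x - un2 x) * psi x) + (LINT x:{z<..<t}. (un1 x - un2 x) * psi x))
   = (LINT x:{r<..<z}. ell P x * fG x * psi x) + (LINT x:{z<..<t}. ell P x * fG x * psi x)" using w unfolding distrib_left .
 have J_eq: "kG * J = (A (r, z) + A (z, t)) - kG * (B (r, z) + B (z, t)) + (D (r, z) + D (z, t))"
  using residual_by_parts[OF e1 psi q1(3,4)] residual_by_parts[OF e2 psi q2(3,4)] w' unfolding A_def B_def D_def J_def psirt psiz fst_conv snd_conv
  by (simp only: right_diff_distrib distrib_left mult_zero_right mult_1_right)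
 have "measure lebesgue (cball z a) \<le> 2 * a" using a by (simp add: cball_eq_atLeastAtMost)
 note bb = bump_test_bounds[OF psi_def dpsi_def C1_const a(1) _ this, of _ 1 0]
 have mpsi: "(L2norm {x<..<y} psi)^2 \<le> 2 * a" for x y using bb(1)[of "{x<..<y}"] by simp
 have md: "(L2norm {x<..<y} dpsi)^2 \<le> 64 / a" for x y using bb(2)[of "{x<..<y}"] a by (simp add: power2_eq_square)
 have i1: "(A i)^2 \<le> Fg i * (2 * a)" if "i \<in> {(r, z), (z, t)}" for i proof -
  have i: "(fst i, snd i) \<in> FG P M" using that e1 e2 by auto
  have "\<bar>A i\<bar> \<le> sqrt (Fg i * (2 * a))" using L2_CS_bound[OF res_L2[OF i] Lpsi(1) mpsi] by (simp add: Fg_def A_def inner_real_def)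
  then show ?thesis using a sqrt_ge_absD by blast
 qed
 have i2: "(B i)^2 \<le> Ep i * (64 / a)" if "i \<in> {(r, z), (z, t)}" for i proof -
  have i: "(fst i, snd i) \<in> FG P M" using that e1 e2 by auto
  have "\<bar>B i\<bar> \<le> sqrt (Ep i * (64 / a))" using L2_CS_bound[OF err_L2(1)[OF i] Lpsi(2) md] by (simp add: Ep_def B_def inner_real_def)
  then show ?thesis using a sqrt_ge_absD by blast
 qed
 have i3: "(D i)^2 \<le> Ej i * (2 * a)" if "i \<in> {(r, z), (z, t)}" for i proof -
  have i: "(fst i, snd i) \<in> FG P M" using that e1 e2 by auto
  have "\<bar>D i\<bar> \<le> sqrt (Ej i * (2 * a))" using L2_CS_bound[OF err_L2(2)[OF i] Lpsi(1) mpsi] by (simp add: Ej_def D_def inner_real_def)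
  then show ?thesis using a sqrt_ge_absD by blast
 qed
 have sq6: "(x1 + x2 - (x3 + x4) + (x5 + x6))^2 \<le> 6 * (x1^2 + x2^2 + x3^2 + x4^2 + x5^2 + x6^2)" for x1 x2 x3 x4 x5 x6 :: real proof -
  have s2: "(x + y)^2 \<le> 2 * x^2 + 2 * y^2" "(x - y)^2 \<le> 2 * x^2 + 2 * y^2" for x y :: real
   using zero_le_power2[of "x - y"] zero_le_power2[of "x + y"] by (simp_all add: power2_eq_square algebra_simps)
  have s3: "(x - y + w)^2 \<le> 3 * (x^2 + y^2 + w^2)" for x y w :: real
   using zero_le_power2[of "x + y"] zero_le_power2[of "x - w"] zero_le_power2[of "y + w"] by (simp add: power2_eq_square algebra_simps)
  show ?thesis using s3[of "x1 + x2" "x3 + x4" "x5 + x6"] s2(1)[of x1 x2] s2(1)[of x3 x4] s2(1)[of x5 x6] by argo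
 qed
 have "(kG * J)^2 \<le> 6 * ((A (r, z))^2 + (A (z, t))^2 + (kG * B (r, z))^2 + (kG * B (z, t))^2 + (D (r, z))^2 + (D (z, t))^2)"
  unfolding J_eq distrib_left[of kG] by (rule sq6)
 also have "... \<le> 6 * (Fg (r, z) * (2 * a) + Fg (z, t) * (2 * a) + kG^2 * (Ep (r, z) * (64 / a)) + kG^2 * (Ep (z, t) * (64 / a))
   + Ej (r, z) * (2 * a) + Ej (z, t) * (2 * a))" unfolding power_mult_distrib using i1 i2 i3 by (intro mult_left_mono add_mono) auto
 finally have JB: "(kG * J)^2 \<le> 6 * (Fg (r, z) * (2 * a) + Fg (z, t) * (2 * a) + kG^2 * (Ep (r, z) * (64 / a)) + kG^2 * (Ep (z, t) * (64 / a))
   + Ej (r, z) * (2 * a) + Ej (z, t) * (2 * a))" .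
 define mu where "mu = max 1 kappav"
 have mu: "1 \<le> mu" by (simp add: mu_def)
 have hb: "hz P M z \<le> 2 * mu * a" proof -
  have n: "t - z \<le> kappav * (z - r)" "z - r \<le> kappav * (t - z)" by (rule FG_neighbours[OF e1 e2])+
  have "kappav * (z - r) \<le> mu * (z - r)" "kappav * (t - z) \<le> mu * (t - z)" using F1(2) F2(2) by (auto simp: mu_def intro!: mult_right_mono)
  moreover have "z - r \<le> mu * (z - r)" "t - z \<le> mu * (t - z)" using mu F1(2) F2(2) by simp_all
  ultimately have "max (z - r) (t - z) \<le> mu * min (z - r) (t - z)" using n by (auto simp: min_def max_def)
  moreover have "2 * mu * a = mu * min (z - r) (t - z)" by (simp add: a_def)
  ultimately show ?thesis using hz_le(2)[OF e1 e2] by linarith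
 qed
 have "hz P M z * (sqrt kG * poly (pderiv q1) z - sqrt kG * poly (pderiv q2) z)^2 = hz P M z / kG * (kG * J)^2" proof -
  have "(sqrt kG * poly (pderiv q1) z - sqrt kG * poly (pderiv q2) z)^2 = kG * J^2"
   using kG by (simp add: J_def right_diff_distrib[symmetric] power_mult_distrib)
  then show ?thesis using kG by (simp add: power2_eq_square)
 qed
 also have "... \<le> 2 * mu * a / kG * (kG * J)^2" using hb kG by (intro mult_right_mono divide_right_mono) auto
 also have "... \<le> 2 * mu * a / kG * (6 * (Fg (r, z) * (2 * a) + Fg (z, t) * (2 * a) + kG^2 * (Ep (r, z) * (64 / a)) + kG^2 * (Ep (z, t) * (64 / a))
   + Ej (r, z) * (2 * a) + Ej (z, t) * (2 * a)))" using JB mu a kG by (intro mult_left_mono) auto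
 also have "... = 24 * mu / kG * ((a^2 * Fg (r, z) + 32 * kG^2 * Ep (r, z) + a^2 * Ej (r, z)) + (a^2 * Fg (z, t) + 32 * kG^2 * Ep (z, t) + a^2 * Ej (z, t)))"
  using a kG by (simp add: field_simps power2_eq_square)
 also have "... \<le> 24 * mu / kG * ((2 + 32 * kG^2 + 2 * (len P)^2) *
   (((z - r)^2 * Fg (r, z) + Ep (r, z) + Ej (r, z)) + ((t - z)^2 * Fg (z, t) + Ep (z, t) + Ej (z, t))))" proof (rule mult_left_mono)
  have one: "a^2 * Fg i + 32 * kG^2 * Ep i + a^2 * Ej i \<le> (2 + 32 * kG^2 + 2 * (len P)^2) * (y^2 * Fg i + Ep i + Ej i)"
   if "a \<le> y" "a \<le> len P" for i y proof -
   let ?Q = "2 + 32 * kG^2 + 2 * (len P)^2"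
   have sq: "a^2 \<le> y^2" "a^2 \<le> (len P)^2" "0 \<le> a^2" "0 \<le> kG^2" using that a by (simp_all add: power_mono)
   have "a^2 * Fg i \<le> y^2 * Fg i" by (rule mult_right_mono[OF sq(1)]) simp
   moreover have "a^2 * Ej i \<le> ?Q * Ej i" using sq by (intro mult_right_mono) (linarith, simp)
   moreover have "32 * kG^2 * Ep i \<le> ?Q * Ep i" using sq by (intro mult_right_mono) (linarith, simp)
   moreover have "1 * (y^2 * Fg i) \<le> ?Q * (y^2 * Fg i)" by (intro mult_right_mono) auto
   ultimately show ?thesis unfolding distrib_left[of ?Q] by linarith
  qed
  show "(a^2 * Fg (r, z) + 32 * kG^2 * Ep (r, z) + a^2 * Ej (r, z)) + (a^2 * Fg (z, t) + 32 * kG^2 * Ep (z, t) + a^2 * Ej (z, t))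
   \<le> (2 + 32 * kG^2 + 2 * (len P)^2) * (((z - r)^2 * Fg (r, z) + Ep (r, z) + Ej (r, z)) + ((t - z)^2 * Fg (z, t) + Ep (z, t) + Ej (z, t)))"
   unfolding distrib_left[of _ "(z - r)^2 * Fg (r, z) + Ep (r, z) + Ej (r, z)"] by (intro add_mono one) (use a F1 F2 in auto)
 qed (use mu kG in auto)
 finally show ?thesis unfolding lim1 lim2 c6_def mu_def by (simp only: mult.assoc)
qed

definition c7 :: real where "c7 = len P * (2 + 2 / (emin * xi') + 2 / emin)"

text \<open>The interface conditions, subtracted from the corresponding expressions in the discrete solution.\<close>

lemma coupling_residuals: assumes st: "(s, t) \<in> FG P M"
 shows "(t - s) * (L2norm {s<..<t} (%x. (1 / alphaG P x) * (avgG P M ph x - pGh x) - njumpG P M uh x))^2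
   \<le> c7 * (Ea (s, t) + Ej (s, t))"
  "(t - s) * (L2norm {s<..<t} (%x. navgG P M uh x - (1 / etaG P x) * jumpG P M ph x))^2 \<le> c7 * (Eb (s, t) + Ev (s, t))" proof -
 obtain el ec where c: "!!x. x \<in> {s<..<t} ==> ell P x = el" "!!x. x \<in> {s<..<t} ==> etaG P x = ec"
  "!!x. x \<in> {s<..<t} ==> KG P x = kG" "emin \<le> ec" using FG_coeffs[OF st] by blast
 have ec: "0 < ec" using c(4) emin by linarith
 define ac where "ac = ec * xi'"
 have ac: "0 < ac" "emin * xi' \<le> ac" using ec c(4) xi' by (simp_all add: ac_def)
 have al: "alphaG P x = ac" if "x \<in> {s<..<t}" for x using c(2)[OF that] by (simp add: alpha_eq ac_def)
 note F = FG_D[OF st]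
 let ?a = "%x. ((p1 x - side1 P M ph x) + (p2 x - side2 P M ph x)) / 2 - (pG x - pGh x)"
 let ?b = "%x. (p1 x - side1 P M ph x) - (p2 x - side2 P M ph x)"
 let ?j = "%x. ej x"
 let ?v = "%x. ev x"
 have La: "L2 {s<..<t} ?a" proof -
  have "L2 {s<..<t} (%x. (1/2) *R ((p1 x - side1 P M ph x) + (p2 x - side2 P M ph x)) - (pG x - pGh x))"
   by (intro L2_diff L2_scale L2_add L2_FG[OF st])
  then show ?thesis by simp
 qed
 have Lb: "L2 {s<..<t} ?b" by (intro L2_diff L2_FG[OF st])
 have scl: "(L2norm {s<..<t} (%x. (1 / d) *R g x))^2 \<le> 1 / d0 * (L2norm {s<..<t} (%x. g x / sqrt (w x)))^2"
  "L2 {s<..<t} (%x. (1 / d) *R g x)"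
  if g: "L2 {s<..<t} g" and d: "0 < d0" "d0 \<le> d" "!!x. x \<in> {s<..<t} ==> w x = d" for g w :: "real => real" and d d0 proof -
  show "L2 {s<..<t} (%x. (1 / d) *R g x)" by (rule L2_scale[OF g])
  have "L2 {s<..<t} (%x. g x / sqrt (w x))" by (rule L2_cong_AE[OF L2_scale[OF g, of "1 / sqrt d"]]) (auto simp: d(3) intro!: AE_I2)
  then have "(L2norm {s<..<t} (%x. (1 / d) *R g x))^2 \<le> (1 / sqrt d0)^2 * (L2norm {s<..<t} (%x. g x / sqrt (w x)))^2"
  proof (rule L2norm_sq_mono, intro AE_I2 impI)
   fix x assume x: "x \<in> {s<..<t}"
   have "1 / d * \<bar>g x\<bar> = 1 / sqrt d * (\<bar>g x\<bar> / sqrt d)" using d by simp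
   also have "... \<le> 1 / sqrt d0 * (\<bar>g x\<bar> / sqrt d)" using d by (intro mult_right_mono frac_le) auto
   finally show "norm ((1 / d) *R g x) \<le> 1 / sqrt d0 * norm (g x / sqrt (w x))" using d(1,2) by (simp add: d(3)[OF x])
  qed
  then show "(L2norm {s<..<t} (%x. (1 / d) *R g x))^2 \<le> 1 / d0 * (L2norm {s<..<t} (%x. g x / sqrt (w x)))^2"
   using d(1) by (simp add: power_divide)
 qed
 have ae: "AE x in lebesgue. x \<in> {s<..<t} --> un1 x - un2 x = Aj x & (un1 x + un2 x) / 2 = Bj x"
  by (rule eventually_mono[OF interface]) (use FG_sub_Gam[OF st] in auto)
 have tl: "0 \<le> t - s" "t - s \<le> len P" using F by simp_all
 have fin: "(t - s) * X \<le> c7 * (Y + Z)" if "X \<le> 2 * (1 / d * Y) + 2 * Z" "d = emin * xi' \<or> d = emin" "0 \<le> Y" "0 \<le> Z" for X Y Z d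
 proof -
  let ?q = "2 + 2 / (emin * xi') + 2 / emin"
  have p: "0 \<le> 2 / (emin * xi')" "0 \<le> 2 / emin" using emin xi' by simp_all
  have "2 * (1 / d) \<le> ?q" using that(2) p by auto
  then have "2 * (1 / d) * Y \<le> ?q * Y" using that(3) by (rule mult_right_mono)
  moreover have "2 * Z \<le> ?q * Z" using that(4) p by (intro mult_right_mono) auto
  ultimately have X: "X \<le> ?q * (Y + Z)" using that(1) unfolding distrib_left[of ?q] by linarith
  have "(t - s) * X \<le> (t - s) * (?q * (Y + Z))" using X tl by (intro mult_left_mono) auto
  also have "... \<le> len P * (?q * (Y + Z))" using tl that p by (intro mult_right_mono mult_nonneg_nonneg) auto
  finally show ?thesis by (simp only: c7_def mult.assoc)
 qed
 show "(t - s) * (L2norm {s<..<t} (%x. (1 / alphaG P x) * (avgG P M ph x - pGh x) - njumpG P M uh x))^2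
   \<le> c7 * (Ea (s, t) + Ej (s, t))" proof (rule fin[where d = "emin * xi'"])
  have "(L2norm {s<..<t} (%x. (1 / alphaG P x) * (avgG P M ph x - pGh x) - njumpG P M uh x))^2
    = (L2norm {s<..<t} (%x. (1 / ac) *R ?a x - ?j x))^2"
  proof (rule arg_cong[where f = "%z. z^2"], rule L2norm_cong_AE, rule eventually_mono[OF ae], intro impI)
   fix x assume "x \<in> {s<..<t} --> un1 x - un2 x = Aj x & (un1 x + un2 x) / 2 = Bj x" and x: "x \<in> {s<..<t}"
   then have u: "un1 x - un2 x = (1 / ac) * ((p1 x + p2 x) / 2 - pG x)" by (simp add: Aj_def al)
   have "(1 / alphaG P x) * (avgG P M ph x - pGh x) - njumpG P M uh x
    = (1 / ac) * ((p1 x + p2 x) / 2 - pG x) - (un1 x - un2 x) - ((1 / ac) *R ?a x - ?j x)"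
    using ac(1) by (simp add: al[OF x] avgG_def njumpG_def field_simps)
   also have "... = - ((1 / ac) *R ?a x - ?j x)" using u by simp
   finally show "norm ((1 / alphaG P x) * (avgG P M ph x - pGh x) - njumpG P M uh x) = norm ((1 / ac) *R ?a x - ?j x)"
    by (simp only: norm_minus_cancel)
  qed
  also have "... \<le> 2 * (L2norm {s<..<t} (%x. (1 / ac) *R ?a x))^2 + 2 * (L2norm {s<..<t} ?j)^2"
   by (rule L2norm_sq_diff_le[OF scl(2)[OF La _ ac(2) al] err_L2(2)[OF st]]) (use emin xi' in simp)
  also have "... \<le> 2 * (1 / (emin * xi') * Ea (s, t)) + 2 * Ej (s, t)" unfolding Ea_def Ej_def fst_conv snd_conv
   by (intro add_mono mult_left_mono scl(1)[OF La _ ac(2) al]) (use emin xi' in auto)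
  finally show "(L2norm {s<..<t} (%x. (1 / alphaG P x) * (avgG P M ph x - pGh x) - njumpG P M uh x))^2
   \<le> 2 * (1 / (emin * xi') * Ea (s, t)) + 2 * Ej (s, t)" .
 qed auto
 show "(t - s) * (L2norm {s<..<t} (%x. navgG P M uh x - (1 / etaG P x) * jumpG P M ph x))^2 \<le> c7 * (Eb (s, t) + Ev (s, t))"
 proof (rule fin[where d = emin])
  have "(L2norm {s<..<t} (%x. navgG P M uh x - (1 / etaG P x) * jumpG P M ph x))^2
    = (L2norm {s<..<t} (%x. (1 / ec) *R ?b x - ?v x))^2"
  proof (rule arg_cong[where f = "%z. z^2"], rule L2norm_cong_AE, rule eventually_mono[OF ae], intro impI)
   fix x assume "x \<in> {s<..<t} --> un1 x - un2 x = Aj x & (un1 x + un2 x) / 2 = Bj x" and x: "x \<in> {s<..<t}"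
   then have "(un1 x + un2 x) / 2 = Bj x" by blast
   also have "Bj x = (1 / ec) * (p1 x - p2 x)" by (simp only: Bj_def c(2)[OF x])
   finally have u: "(un1 x + un2 x) / 2 = (1 / ec) * (p1 x - p2 x)" .
   have "navgG P M uh x - (1 / etaG P x) * jumpG P M ph x
    = (un1 x + un2 x) / 2 - (1 / ec) * (p1 x - p2 x) + ((1 / ec) *R ?b x - ?v x)" using ec by (simp add: c(2)[OF x] navgG_def jumpG_def field_simps)
   also have "... = (1 / ec) *R ?b x - ?v x" unfolding u by simp
   finally show "norm (navgG P M uh x - (1 / etaG P x) * jumpG P M ph x) = norm ((1 / ec) *R ?b x - ?v x)" by (simp only:)
  qed
  also have "... \<le> 2 * (L2norm {s<..<t} (%x. (1 / ec) *R ?b x))^2 + 2 * (L2norm {s<..<t} ?v)^2"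
   by (rule L2norm_sq_diff_le[OF scl(2)[OF Lb emin c(4) c(2)] err_L2(3)[OF st]])
  also have "... \<le> 2 * (1 / emin * Eb (s, t)) + 2 * Ev (s, t)" unfolding Eb_def Ev_def fst_conv snd_conv
   by (intro add_mono mult_left_mono scl(1)[OF Lb emin c(4) c(2)]) auto
  finally show "(L2norm {s<..<t} (%x. navgG P M uh x - (1 / etaG P x) * jumpG P M ph x))^2
   \<le> 2 * (1 / emin * Eb (s, t)) + 2 * Ev (s, t)" .
 qed auto
qed

end

section \<open>Summation\<close>

context mesh_setting
begin

text \<open>A triangle has three edges.\<close>

lemma sum_adjacent:
 fixes G :: "elem => real"
 assumes F: "!!e. e \<in> F ==> e \<in> ori M & Lft M e \<in> Th M & e \<in> dedges (Lft M e) & Rgt M e \<in> Th M & prod.swap e \<in> dedges (Rgt M e)"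
  and G: "!!tau. 0 \<le> G tau" shows "(\<Sum>e\<in>F. G (Lft M e) + G (Rgt M e)) \<le> 3 * (\<Sum>tau\<in>Th M. G tau)" proof -
 let ?D = "Sigma (Th M) dedges"
 let ?a = "%e. (Lft M e, e)" and ?b = "%e. (Rgt M e, prod.swap e)"
 have finD: "finite ?D" using finite_Th by (intro finite_SigmaI) auto
 have sub: "?a ` F <= ?D" "?b ` F <= ?D" using F by auto
 have inj: "inj_on ?a F" "inj_on ?b F" by (auto intro!: inj_onI)
 have disj: "?a ` F \<inter> ?b ` F = {}" proof (rule equals0I)
  fix y assume "y \<in> ?a ` F \<inter> ?b ` F"
  then obtain e e' where e: "e \<in> F" "e' \<in> F" "e = prod.swap e'" by auto
  have "e \<in> ori M \<longleftrightarrow> prod.swap e \<notin> ori M" using ori_one[of "Lft M e" e] F[OF e(1)] by blast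
  then show False using F[OF e(1)] F[OF e(2)] e(3) by simp
 qed
 have fin: "finite (?a ` F)" "finite (?b ` F)" using finite_subset[OF _ finD] sub by blast+
 have "(\<Sum>e\<in>F. G (Lft M e) + G (Rgt M e)) = (\<Sum>y\<in>?a ` F. G (fst y)) + (\<Sum>y\<in>?b ` F. G (fst y))"
  by (simp add: sum.distrib sum.reindex[OF inj(1)] sum.reindex[OF inj(2)])
 also have "... = (\<Sum>y\<in>?a ` F \<union> ?b ` F. G (fst y))" by (rule sum.union_disjoint[symmetric, OF fin disj])
 also have "... \<le> (\<Sum>y\<in>?D. G (fst y))" by (rule sum_mono2[OF finD]) (use sub G in auto)
 also have "... = (\<Sum>tau\<in>Th M. \<Sum>e\<in>dedges tau. G tau)"
  using sum.Sigma[of "Th M" dedges "%tau e. G tau"] finite_Th by (simp add: case_prod_unfold)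
 also have "... \<le> (\<Sum>tau\<in>Th M. 3 * G tau)" proof (rule sum_mono)
  fix tau :: elem
  obtain nu a b where t: "tau = (nu, a, b)" by (cases tau)
  have "card (dedges tau) \<le> 3" using card_length[of "[(nu, a), (a, b), (b, nu)]"] by (simp add: t dedges_def)
  then show "(\<Sum>e\<in>dedges tau. G tau) \<le> 3 * G tau" using G[of tau] by (simp add: mult_right_mono)
 qed
 finally show ?thesis by (simp add: sum_distrib_left)
qed

lemma sum_vertices:
 fixes G :: "real \<times> real => real" assumes G: "!!i. 0 \<le> G i"
  and b: "!!r z t. (r, z) \<in> FG P M ==> (z, t) \<in> FG P M ==> T z \<le> C * (G (r, z) + G (z, t))" and C: "0 \<le> C"
 shows "(\<Sum>z\<in>NG P M. T z) \<le> C * (2 * (\<Sum>i\<in>FG P M. G i))" proof -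
 have "\<forall>z\<in>NG P M. \<exists>i. (fst i, z) \<in> FG P M & (z, snd i) \<in> FG P M" by (auto simp: NG_def)
 from bchoice[OF this] obtain w where w: "!!z. z \<in> NG P M ==> (fst (w z), z) \<in> FG P M & (z, snd (w z)) \<in> FG P M" by blast
 let ?a = "%z. (fst (w z), z)" and ?b = "%z. (z, snd (w z))"
 have one: "(\<Sum>z\<in>NG P M. G (h z)) \<le> (\<Sum>i\<in>FG P M. G i)" if "inj_on h (NG P M)" "h ` NG P M <= FG P M" for h proof -
  have "(\<Sum>z\<in>NG P M. G (h z)) = (\<Sum>i\<in>h ` NG P M. G i)" by (simp add: sum.reindex[OF that(1)])
  also have "... \<le> (\<Sum>i\<in>FG P M. G i)" by (rule sum_mono2[OF finite_FG that(2)]) (rule G)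
  finally show ?thesis .
 qed
 have "(\<Sum>z\<in>NG P M. T z) \<le> (\<Sum>z\<in>NG P M. C * (G (?a z) + G (?b z)))" by (rule sum_mono) (use b w in blast)
 also have "... = C * ((\<Sum>z\<in>NG P M. G (?a z)) + (\<Sum>z\<in>NG P M. G (?b z)))" by (simp add: sum_distrib_left[symmetric] sum.distrib)
 also have "... \<le> C * ((\<Sum>i\<in>FG P M. G i) + (\<Sum>i\<in>FG P M. G i))"
  by (intro mult_left_mono add_mono one C) (use w in \<open>auto intro!: inj_onI\<close>)
 finally show ?thesis by simp
qed

end

context discrete
begin

definition efficiency_const :: "real => real => real" where
 "efficiency_const Ca Cb = sqrt 2 + sqrt (c2 Cb * (KM + 1)) + sqrt (6 * c3 Ca) + sqrt (3 * c4 Ca * (KM + c2 Cb * (KM + 1)))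
   + sqrt (c5 Ca * (1 / kG + 2)) + sqrt (c6 * (2 * (c5 Ca * (1 / kG + 2) + (1 / kG + 1)))) + sqrt c7 + sqrt c7"

lemma efficiency: assumes Ca: "inverse_const1 (max k m) (bump (1/2) (\<rho>S * \<rho>E / 4)) (2 / (\<rho>S * \<rho>E)) Ca"
  and Cb: "inverse_const2 (max k m) (6 / (\<rho>S * \<rho>E)) Cb" shows "estimator P M f fG uh ph pGh \<le> efficiency_const Ca Cb * (sdg_norm P M
       (%tau x. u x - uh tau x)
       (%tau x. Gp x - grad (ph tau) x)
       (%s. p1 s - side1 P M ph s) (%s. p2 s - side2 P M ph s)
       (%s. pG s - pGh s) (%s. dpG s - deriv pGh s)
       (%s. un1 s - side1 P M uh s \<bullet> nG P s) (%s. un2 s - side2 P M uh s \<bullet> nG P s)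
      + osc P M f fG fh fGh)"
  (is "_ \<le> _ * (?N + ?O)") proof -
 have Ca: "inverse_const1 (max k m) wgt (2 / \<sigma>) Ca" using Ca by (simp add: wgt_def \<sigma>_def)
 have Cb: "inverse_const2 (max k m) (6 / \<sigma>) Cb" using Cb by (simp add: \<sigma>_def)
 have C0: "0 < Ca" "0 < Cb" using Ca Cb by (simp_all add: inverse_const1_def inverse_const2_def)
 define su where "su = (\<Sum>tau\<in>Th M. eu tau)"
 define sg where "sg = (\<Sum>tau\<in>Th M. eg tau)"
 define sa where "sa = (\<Sum>i\<in>FG P M. Ea i)"
 define sb where "sb = (\<Sum>i\<in>FG P M. Eb i)"
 define sp where "sp = (\<Sum>i\<in>FG P M. Ep i)"
 define sj where "sj = (\<Sum>i\<in>FG P M. Ej i)"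
 define sv where "sv = (\<Sum>i\<in>FG P M. Ev i)"
 define sf where "sf = (\<Sum>tau\<in>Th M. (diameter (tri tau))^2 * Of tau)"
 define so where "so = (\<Sum>i\<in>FG P M. (snd i - fst i)^2 * Og i)"
 \<comment> \<open>The square of the error norm plus the square of the oscillation.\<close>
 define T where "T = su + sa + sb + sg + kG * sp + sj + sv + so + sf"
 have nn: "0 \<le> su" "0 \<le> sg" "0 \<le> sa" "0 \<le> sb" "0 \<le> sp" "0 \<le> sj" "0 \<le> sv" "0 \<le> sf" "0 \<le> so"
  by (auto simp: su_def sg_def sa_def sb_def sp_def sj_def sv_def sf_def so_def intro!: sum_nonneg)
 have ksp: "0 \<le> kG * sp" using nn kG by simp
 have Gj: "(L2norm (Gam P) (%x. ej x))^2 = sj" unfolding sj_def Ej_def by (subst FG_sum_L2[symmetric, OF err_L2(2)]) (auto simp: case_prod_unfold)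
 have Gv: "(L2norm (Gam P) (%x. ev x))^2 = sv" unfolding sv_def Ev_def by (subst FG_sum_L2[symmetric, OF err_L2(3)]) (auto simp: case_prod_unfold)
 have Gk: "(L2norm (Gam P) (%x. sqrt (KG P x) * (dpG x - deriv pGh x)))^2 = kG * sp" proof -
  have "L2norm (Gam P) (%x. sqrt (KG P x) * (dpG x - deriv pGh x)) = L2norm (Gam P) (%x. sqrt kG * (dpG x - deriv pGh x))"
   by (rule L2norm_cong_AE, rule eventually_mono[OF KG_eq]) auto
  also have "(L2norm (Gam P) (%x. sqrt kG * (dpG x - deriv pGh x)))^2 = kG * (L2norm (Gam P) (%x. dpG x - deriv pGh x))^2"
   unfolding L2norm_sq_eq using kG by (simp add: power_mult_distrib abs_mult)
  also have "(L2norm (Gam P) (%x. dpG x - deriv pGh x))^2 = sp"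
   unfolding sp_def Ep_def by (subst FG_sum_L2[symmetric, OF err_L2(1)]) (auto simp: case_prod_unfold)
  finally show ?thesis .
 qed
 have N: "?N = sqrt (su + sa + sb + sg + kG * sp + sj + sv)" unfolding sdg_norm_def Gj Gv Gk su_def sa_def sb_def sg_def eu_def eg_def Ea_def Eb_def
  by (simp add: case_prod_unfold)
 have O: "?O = sqrt (so + sf)" unfolding osc_def so_def sf_def Og_def Of_def by (simp add: case_prod_unfold)
 have TNO: "sqrt T \<le> ?N + ?O" unfolding T_def N O add.assoc[of _ so sf] by (rule sqrt_add_le_add_sqrt) (use nn ksp in auto)
 have T0: "0 \<le> T" using nn ksp by (simp add: T_def)
 have le: "sqrt S \<le> sqrt c * (?N + ?O)" if "S \<le> c * T" "0 \<le> c" for S c proof -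
  have "sqrt S \<le> sqrt (c * T)" using that(1) by (rule real_sqrt_le_mono)
  also have "... = sqrt c * sqrt T" by (rule real_sqrt_mult)
  also have "... \<le> sqrt c * (?N + ?O)" using TNO that(2) by (intro mult_left_mono) auto
  finally show ?thesis .
 qed
 have k2: "0 \<le> c2 Cb" using C0 by (simp add: c2_def)
 have k3: "0 \<le> c3 Ca" using C0 kmin \<sigma>_pos by (simp add: c3_def)
 have k4: "0 \<le> c4 Ca" using C0 by (simp add: c4_def)
 have k5: "0 \<le> c5 Ca" using C0 by (simp add: c5_def)
 have k6: "0 \<le> c6" using kG by (simp add: c6_def)
 have k7: "0 \<le> c7" using emin xi' len_pos by (simp add: c7_def)
 have KM0: "0 < KM" by (rule KM_pos)
 have sR: "(\<Sum>tau\<in>Th M. Rf tau) \<le> 2 * T" proof -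
  have "(\<Sum>tau\<in>Th M. Rf tau) \<le> (\<Sum>tau\<in>Th M. 2 * eu tau + 2 * eg tau)" by (rule sum_mono[OF Rf_le])
  also have "... = 2 * su + 2 * sg" by (simp add: su_def sg_def sum.distrib sum_distrib_left)
  finally show ?thesis using nn ksp by (simp add: T_def)
 qed
 have sE: "(\<Sum>tau\<in>Th M. Eu tau) \<le> KM * T" proof -
  have "(\<Sum>tau\<in>Th M. Eu tau) \<le> (\<Sum>tau\<in>Th M. KM * eu tau)" by (rule sum_mono[OF Eu_le])
  also have "... = KM * su" by (simp add: su_def sum_distrib_left)
  also have "... \<le> KM * T" using nn ksp KM0 by (intro mult_left_mono) (auto simp: T_def)
  finally show ?thesis .
 qed
 have sF: "(\<Sum>tau\<in>Th M. (diameter (tri tau))^2 * Fr tau) \<le> c2 Cb * (KM + 1) * T" proof -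
  have "(\<Sum>tau\<in>Th M. (diameter (tri tau))^2 * Fr tau) \<le> (\<Sum>tau\<in>Th M. c2 Cb * (Eu tau + (diameter (tri tau))^2 * Of tau))"
   by (rule sum_mono[OF interior_residual[OF _ Cb]])
  also have "... = c2 Cb * ((\<Sum>tau\<in>Th M. Eu tau) + sf)" by (simp add: sf_def sum_distrib_left[symmetric] sum.distrib)
  also have "... \<le> c2 Cb * (KM * T + T)" using sE nn ksp k2 by (intro mult_left_mono add_mono) (auto simp: T_def)
  finally show ?thesis by (simp add: algebra_simps)
 qed
 have t3: "(\<Sum>e\<in>Fp M. 1 / elen e * eint e (%x. (jump M e ph x)^2)) \<le> 6 * c3 Ca * T" proof -
  have "(\<Sum>e\<in>Fp M. 1 / elen e * eint e (%x. (jump M e ph x)^2)) \<le> (\<Sum>e\<in>Fp M. c3 Ca * (Rf (Lft M e) + Rf (Rgt M e)))"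
   by (rule sum_mono[OF pressure_jump_residual[OF _ Ca]])
  also have "... = c3 Ca * (\<Sum>e\<in>Fp M. Rf (Lft M e) + Rf (Rgt M e))" by (simp add: sum_distrib_left)
  also have "... \<le> c3 Ca * (3 * (\<Sum>tau\<in>Th M. Rf tau))" by (intro mult_left_mono sum_adjacent k3) (use Fp_D in auto)
  also have "... \<le> c3 Ca * (3 * (2 * T))" by (intro mult_left_mono sR k3) auto
  finally show ?thesis by simp
 qed
 have t4: "(\<Sum>e\<in>Fu0 P M. elen e * eint e (%x. (njump M e uh x)^2)) \<le> 3 * c4 Ca * (KM + c2 Cb * (KM + 1)) * T" proof -
  let ?H = "%tau. Eu tau + (diameter (tri tau))^2 * Fr tau"
  have "(\<Sum>e\<in>Fu0 P M. elen e * eint e (%x. (njump M e uh x)^2)) \<le> (\<Sum>e\<in>Fu0 P M. c4 Ca * (?H (Lft M e) + ?H (Rgt M e)))"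
   by (rule sum_mono[OF flux_jump_residual[OF _ Ca]])
  also have "... = c4 Ca * (\<Sum>e\<in>Fu0 P M. ?H (Lft M e) + ?H (Rgt M e))" by (simp add: sum_distrib_left)
  also have "... \<le> c4 Ca * (3 * (\<Sum>tau\<in>Th M. ?H tau))" proof (intro mult_left_mono sum_adjacent k4)
   fix e assume e: "e \<in> Fu0 P M"
   show "e \<in> ori M & Lft M e \<in> Th M & e \<in> dedges (Lft M e) & Rgt M e \<in> Th M & prod.swap e \<in> dedges (Rgt M e)"
    using Fu0_D(5)[OF e] pedge_tri(1,2)[OF Fu0_D(1)[OF e]] pedge_tri(1,2)[OF Fu0_D(2)[OF e]] by (simp add: Rgt_def)
  qed auto
  also have "... \<le> c4 Ca * (3 * (KM * T + c2 Cb * (KM + 1) * T))" unfolding sum.distrib by (intro mult_left_mono add_mono sE sF k4) auto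
  finally show ?thesis by (simp add: algebra_simps)
 qed
 have spT: "sp \<le> 1 / kG * T" proof -
  have "kG * sp \<le> T" using nn by (simp add: T_def)
  then show ?thesis using kG by (simp add: field_simps)
 qed
 have jT: "sj \<le> T" "so \<le> T" using nn ksp by (simp_all add: T_def)
 have t5: "(\<Sum>i\<in>FG P M. (snd i - fst i)^2 * Fg i) \<le> c5 Ca * (1 / kG + 2) * T" proof -
  have "(\<Sum>i\<in>FG P M. (snd i - fst i)^2 * Fg i) \<le> (\<Sum>i\<in>FG P M. c5 Ca * (Ep i + Ej i + (snd i - fst i)^2 * Og i))"
   by (rule sum_mono) (use fracture_residual[OF _ Ca] in \<open>auto split: prod.split\<close>)
  also have "... = c5 Ca * (sp + sj + so)" by (simp add: sp_def sj_def so_def sum_distrib_left[symmetric] sum.distrib)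
  also have "... \<le> c5 Ca * (1 / kG * T + T + T)" by (intro mult_left_mono add_mono spT jT k5)
  finally show ?thesis by (simp add: algebra_simps)
 qed
 have t6: "(\<Sum>z\<in>NG P M. hz P M z * (Lim (at_left z) (%x. sqrt (KG P x) * deriv pGh x)
    - Lim (at_right z) (%x. sqrt (KG P x) * deriv pGh x))^2) \<le> c6 * (2 * (c5 Ca * (1 / kG + 2) + (1 / kG + 1))) * T" proof -
  let ?G = "%i. (snd i - fst i)^2 * Fg i + Ep i + Ej i"
  have "(\<Sum>z\<in>NG P M. hz P M z * (Lim (at_left z) (%x. sqrt (KG P x) * deriv pGh x)
    - Lim (at_right z) (%x. sqrt (KG P x) * deriv pGh x))^2) \<le> c6 * (2 * (\<Sum>i\<in>FG P M. ?G i))"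
   by (rule sum_vertices[OF _ _ k6]) (use vertex_residual in auto)
  also have "(\<Sum>i\<in>FG P M. ?G i) = (\<Sum>i\<in>FG P M. (snd i - fst i)^2 * Fg i) + sp + sj" by (simp add: sp_def sj_def sum.distrib)
  also have "c6 * (2 * ...) \<le> c6 * (2 * (c5 Ca * (1 / kG + 2) * T + 1 / kG * T + T))" by (intro mult_left_mono add_mono t5 spT jT k6) auto
  finally show ?thesis by (simp add: algebra_simps)
 qed
 have t7: "(\<Sum>(s, t)\<in>FG P M. (t - s) * (L2norm {s<..<t} (%x. (1 / alphaG P x) * (avgG P M ph x - pGh x) - njumpG P M uh x))^2) \<le> c7 * T"
 proof -
  have "(\<Sum>(s, t)\<in>FG P M. (t - s) * (L2norm {s<..<t} (%x. (1 / alphaG P x) * (avgG P M ph x - pGh x) - njumpG P M uh x))^2)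
   \<le> (\<Sum>i\<in>FG P M. c7 * (Ea i + Ej i))" unfolding case_prod_unfold by (rule sum_mono, rule order_trans[OF coupling_residuals(1)]) auto
  also have "... = c7 * (sa + sj)" by (simp add: sa_def sj_def sum_distrib_left[symmetric] sum.distrib)
  also have "... \<le> c7 * T" by (rule mult_left_mono[OF _ k7]) (use nn ksp in \<open>simp add: T_def\<close>)
  finally show ?thesis .
 qed
 have t8: "(\<Sum>(s, t)\<in>FG P M. (t - s) * (L2norm {s<..<t} (%x. navgG P M uh x - (1 / etaG P x) * jumpG P M ph x))^2) \<le> c7 * T" proof -
  have "(\<Sum>(s, t)\<in>FG P M. (t - s) * (L2norm {s<..<t} (%x. navgG P M uh x - (1 / etaG P x) * jumpG P M ph x))^2)
   \<le> (\<Sum>i\<in>FG P M. c7 * (Eb i + Ev i))" unfolding case_prod_unfold by (rule sum_mono, rule order_trans[OF coupling_residuals(2)]) auto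
  also have "... = c7 * (sb + sv)" by (simp add: sb_def sv_def sum_distrib_left[symmetric] sum.distrib)
  also have "... \<le> c7 * T" by (rule mult_left_mono[OF _ k7]) (use nn ksp in \<open>simp add: T_def\<close>)
  finally show ?thesis .
 qed
 have t5': "(\<Sum>(s, t)\<in>FG P M. (t - s)^2 * (L2norm {s<..<t} (%x. ell P x * fG x + deriv (%y. KG P y * deriv pGh y) x + njumpG P M uh x))^2)
   \<le> c5 Ca * (1 / kG + 2) * T" using t5 unfolding Fg_def res_def case_prod_unfold .
 have q: "0 \<le> 1 / kG" using kG by simp
 show ?thesis unfolding estimator_def efficiency_const_def distrib_right[of _ _ "?N + ?O"]
  by (intro add_mono le sR[unfolded Rf_def] sF[unfolded Fr_def] t3 t4 t5' t6 t7 t8)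
   (use k2 k3 k4 k5 k6 k7 KM0 q in simp_all)
qed

end

section \<open>The efficiency estimate\<close>

lemma inverse_const1_exists: assumes "0 < (\<sigma> :: real)" shows "\<exists>C. inverse_const1 n (bump (1/2) (\<sigma> / 4)) (2 / \<sigma>) C"
proof -
 let ?d = "min (\<sigma> / 4) (1 / 2)"
 have "continuous_on UNIV (bump (1/2 :: real) (\<sigma> / 4))" using C1_continuous[OF C1_bump, of "\<sigma> / 4"] assms by simp
 then have "\<exists>C>0. \<forall>r l x. degree r \<le> n & l > 0 & \<bar>x\<bar> \<le> 2 / \<sigma> * l -->
   (poly r x)^2 + l^2 * (poly (pderiv r) x)^2 \<le> C / l * (LINT s:{0<..<l}. bump (1/2) (\<sigma> / 4) (s / l) * (poly r s)^2)"
 proof (rule poly_inverse_inequality[where a = "1/2 - ?d" and b = "1/2 + ?d"])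
  fix x assume "1/2 - ?d < x" "x < 1/2 + ?d"
  moreover have "?d \<le> \<sigma> / 4" by simp
  ultimately have "dist x (1/2) < \<sigma> / 4" unfolding dist_real_def abs_less_iff by linarith
  then show "0 < bump (1/2) (\<sigma> / 4) x" using assms by (intro bump_pos) auto
 qed (use assms bump_nonneg in auto)
 then show ?thesis by (auto simp: inverse_const1_def)
qed

lemma inverse_const2_exists: "0 \<le> kappa ==> \<exists>C. inverse_const2 n kappa C"
 using poly2_inverse_inequality[of kappa n] by (auto simp: inverse_const2_def)

theorem theorem3p2:
  fixes P :: problem and k m :: nat and \<rho>S \<rho>E :: real
  assumes "fracture_problem P"
    and "0 < \<rho>S" and "0 < \<rho>E"
    and "no_jump_KG P"
  shows "\<exists>C>0. \<forall>M f fG u p Gp p1 p2 pG dpG un1 un2 uh ph pGh fh fGh.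
    regular_mesh P \<rho>S \<rho>E M \<and>
    L2 (OmB P) f \<and> L2 (Gam P) fG \<and>
    weak_solution P f fG u p Gp p1 p2 pG dpG \<and>
    has_normal_trace P (Om1 P) 1 u un1 \<and> has_normal_trace P (Om2 P) (- 1) u un2 \<and>
    sdg_solution P M k f fG uh ph pGh \<and>
    pw_poly M m fh \<and> pw_polyG P M m fGh \<longrightarrow>
    estimator P M f fG uh ph pGh \<le>
      C * (sdg_norm P M
             (\<lambda>\<tau> x. u x - uh \<tau> x)
             (\<lambda>\<tau> x. Gp x - grad (ph \<tau>) x)
             (\<lambda>s. p1 s - side1 P M ph s) (\<lambda>s. p2 s - side2 P M ph s)
             (\<lambda>s. pG s - pGh s) (\<lambda>s. dpG s - deriv pGh s)
             (\<lambda>s. un1 s - side1 P M uh s \<bullet> nG P s) (\<lambda>s. un2 s - side2 P M uh s \<bullet> nG P s)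
           + osc P M f fG fh fGh)"
proof -
 obtain kappa kmin kmax emin emax kG where fr: "fracture P kappa kmin kmax emin emax kG" using fracture_exists[OF assms(1,4)] by blast
 have s: "0 < \<rho>S * \<rho>E" using assms by simp
 obtain Ca where Ca: "inverse_const1 (max k m) (bump (1/2) (\<rho>S * \<rho>E / 4)) (2 / (\<rho>S * \<rho>E)) Ca"
  using inverse_const1_exists[OF s] by blast
 have "0 \<le> 6 / (\<rho>S * \<rho>E)" using s by simp
 then obtain Cb where Cb: "inverse_const2 (max k m) (6 / (\<rho>S * \<rho>E)) Cb" using inverse_const2_exists by blast
 define K where "K = discrete.efficiency_const P kmin kmax emin kG \<rho>S \<rho>E Ca Cb"
 \<comment> \<open>The maximum makes the constant positive.\<close>
 show ?thesis proof (rule exI[of _ "max 1 K"], intro conjI allI impI)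
  fix M f fG u p Gp p1 p2 pG dpG un1 un2 uh ph pGh fh fGh
  assume a: "regular_mesh P \<rho>S \<rho>E M &
   L2 (OmB P) f & L2 (Gam P) fG &
   weak_solution P f fG u p Gp p1 p2 pG dpG &
   has_normal_trace P (Om1 P) 1 u un1 & has_normal_trace P (Om2 P) (- 1) u un2 &
   sdg_solution P M k f fG uh ph pGh &
   pw_poly M m fh & pw_polyG P M m fGh"
  have d: "discrete P kappa kmin kmax emin emax kG f fG u p Gp p1 p2 pG dpG un1 un2 M \<rho>S \<rho>E k m uh ph pGh fh fGh"
   unfolding discrete_def weak_setting_def mesh_setting_def weak_setting_axioms_def mesh_setting_axioms_def discrete_axioms_def using fr a by simp
  let ?e = "sdg_norm P M (%tau x. u x - uh tau x) (%tau x. Gp x - grad (ph tau) x)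
   (%s. p1 s - side1 P M ph s) (%s. p2 s - side2 P M ph s) (%s. pG s - pGh s) (%s. dpG s - deriv pGh s)
   (%s. un1 s - side1 P M uh s \<bullet> nG P s) (%s. un2 s - side2 P M uh s \<bullet> nG P s) + osc P M f fG fh fGh"
  have "0 \<le> ?e" unfolding sdg_norm_def osc_def by (intro add_nonneg_nonneg real_sqrt_ge_zero sum_nonneg) (auto split: prod.split)
  then have "K * ?e \<le> max 1 K * ?e" by (intro mult_right_mono) auto
  then show "estimator P M f fG uh ph pGh \<le> max 1 K * ?e" using discrete.efficiency[OF d Ca Cb, folded K_def] by linarith
 qed simp
qed

end
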